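(* Let $n\geq 3$ and let $S_n$ be the symmetric group on $n$ letters. Then: (a) $\operatorname{covdim} S_n=\operatorname{edim} S_n+1$. (b) $\operatorname{covdim}(S_n\times\mathbb Z/d)=\operatorname{covdim} S_n$ for every integer $d\geq 2$. (c) $\operatorname{covdim} S_n\geq \lfloor \frac n2\rfloor+1$. (d) $\operatorname{covdim} S_{n+2}\geq\operatorname{covdim} S_n+1$.
   Context: The base field is $\mathbb C$; all $G$-modules are finite-dimensional over $\mathbb C$. A covariant of a finite group $G$ is a $G$-equivariant morphism (polynomial map) $\varphi\colon V\to W$ between $G$-modules; its dimension is $\dim\varphi:=\dim\overline{\varphi(V)}$. It is faithful if $G$ acts faithfully on the image $\varphi(V)$. The covariant dimension $\operatorname{covdim} G$ is the minimum of $\dim\varphi$ over all faithful covariants $\varphi$ of $G$. A rational covariant is a $G$-equivariant rational map $V\to W$ between $G$-modules, with dimension (of the closure of the image) and faithfulness defined in the same way; the essential dimension $\operatorname{edim} G$ is the minimum dimension of all faithful rational covariants of $G$. *)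

theory Defs
  imports
    "Jordan_Normal_Form.Matrix"
    "HOL-Algebra.Group_Action"
    "HOL-Algebra.Elementary_Groups"
    "HOL-Algebra.Sym_Groups"
    "HOL-Analysis.Abstract_Topology"
    "HOL-Library.Extended_Nat"
begin

section \<open>Polynomial functions and the Zariski topology on affine space\<close>

text \<open>
  Affine space \<open>\<complex>\<^sup>n\<close> is \<^term>\<open>carrier_vec n :: complex vec set\<close>.  A polynomial function on it
  is a finite sum of monomials; a monomial is given by its exponents \<open>a i\<close>, \<open>i < n\<close>.
  The values of \<open>f\<close> outside \<open>\<complex>\<^sup>n\<close> are irrelevant, here and throughout.
\<close>

definition polynomial_fun :: "nat \<Rightarrow> (complex vec \<Rightarrow> complex) \<Rightarrow> bool" where
  "polynomial_fun n f \<longleftrightarrow>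
     (\<exists>(M :: (nat \<Rightarrow> nat) set) (c :: (nat \<Rightarrow> nat) \<Rightarrow> complex). finite M \<and>
        (\<forall>v\<in>carrier_vec n. f v = (\<Sum>a\<in>M. c a * (\<Prod>i<n. (v $ i) ^ a i))))"

definition algebraic_set :: "nat \<Rightarrow> complex vec set \<Rightarrow> bool" where
  "algebraic_set n Z \<longleftrightarrow>
     (\<exists>P. (\<forall>p\<in>P. polynomial_fun n p) \<and> Z = {v \<in> carrier_vec n. \<forall>p\<in>P. p v = 0})"

definition zariski :: "nat \<Rightarrow> complex vec topology" where
  "zariski n = topology (\<lambda>U. U \<subseteq> carrier_vec n \<and> algebraic_set n (carrier_vec n - U))"

lemma polynomial_fun_mult:
  assumes "polynomial_fun n f" "polynomial_fun n g"
  shows "polynomial_fun n (\<lambda>v. f v * g v)"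
proof -
  obtain M c where M: "finite M"
    and f: "\<And>v. v \<in> carrier_vec n \<Longrightarrow> f v = (\<Sum>a\<in>M. c a * (\<Prod>i<n. (v $ i) ^ a i))"
    using assms(1) unfolding polynomial_fun_def by blast
  obtain N d where N: "finite N"
    and g: "\<And>v. v \<in> carrier_vec n \<Longrightarrow> g v = (\<Sum>b\<in>N. d b * (\<Prod>i<n. (v $ i) ^ b i))"
    using assms(2) unfolding polynomial_fun_def by blast
  define s :: "(nat \<Rightarrow> nat) \<times> (nat \<Rightarrow> nat) \<Rightarrow> nat \<Rightarrow> nat" where "s = (\<lambda>(a, b) i. a i + b i)"
  define e where "e = (\<lambda>x. \<Sum>(a, b)\<in>{y \<in> M \<times> N. s y = x}. c a * d b)"
  have "f v * g v = (\<Sum>x\<in>s ` (M \<times> N). e x * (\<Prod>i<n. (v $ i) ^ x i))"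
    if v: "v \<in> carrier_vec n" for v
  proof -
    have "f v * g v =
        (\<Sum>y\<in>M \<times> N. c (fst y) * d (snd y) * (\<Prod>i<n. (v $ i) ^ s y i))"
      unfolding f[OF v] g[OF v] sum_product sum.cartesian_product
      by (intro sum.cong) (auto simp: s_def power_add prod.distrib)
    also have "\<dots> = (\<Sum>x\<in>s ` (M \<times> N). \<Sum>y\<in>{y \<in> M \<times> N. s y = x}.
        c (fst y) * d (snd y) * (\<Prod>i<n. (v $ i) ^ s y i))"
      by (rule sum.image_gen) (use M N in auto)
    also have "\<dots> = (\<Sum>x\<in>s ` (M \<times> N). e x * (\<Prod>i<n. (v $ i) ^ x i))"
      unfolding e_def sum_distrib_right by (intro sum.cong) (auto simp: case_prod_beta)
    finally show ?thesis .
  qed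
  then show ?thesis
    unfolding polynomial_fun_def using M N by (intro exI[of _ "s ` (M \<times> N)"] exI[of _ e]) auto
qed

lemma istopology_zariski:
  "istopology (\<lambda>U. U \<subseteq> carrier_vec n \<and> algebraic_set n (carrier_vec n - U))"
  unfolding istopology_def
proof (intro conjI allI impI)
  fix S T
  assume S: "S \<subseteq> carrier_vec n \<and> algebraic_set n (carrier_vec n - S)"
    and T: "T \<subseteq> carrier_vec n \<and> algebraic_set n (carrier_vec n - T)"
  then show "S \<inter> T \<subseteq> carrier_vec n" by blast
  obtain P where P: "\<forall>p\<in>P. polynomial_fun n p"
      "carrier_vec n - S = {v \<in> carrier_vec n. \<forall>p\<in>P. p v = 0}"
    using S unfolding algebraic_set_def by blast
  obtain Q where Q: "\<forall>q\<in>Q. polynomial_fun n q"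
      "carrier_vec n - T = {v \<in> carrier_vec n. \<forall>q\<in>Q. q v = 0}"
    using T unfolding algebraic_set_def by blast
  let ?R = "(\<lambda>(p, q) v. p v * q v) ` (P \<times> Q)"
  have "\<forall>r\<in>?R. polynomial_fun n r"
    using P(1) Q(1) by (auto intro: polynomial_fun_mult)
  moreover have "carrier_vec n - S \<inter> T = {v \<in> carrier_vec n. \<forall>r\<in>?R. r v = 0}"
  proof -
    have "carrier_vec n - S \<inter> T = (carrier_vec n - S) \<union> (carrier_vec n - T)" by blast
    also have "\<dots> = {v \<in> carrier_vec n. (\<forall>p\<in>P. p v = 0) \<or> (\<forall>q\<in>Q. q v = 0)}"
      unfolding P(2) Q(2) by blast
    also have "\<dots> = {v \<in> carrier_vec n. \<forall>p\<in>P. \<forall>q\<in>Q. p v * q v = 0}"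
      unfolding mult_eq_0_iff by blast
    also have "\<dots> = {v \<in> carrier_vec n. \<forall>r\<in>?R. r v = 0}"
      by (simp add: split_beta)
    finally show ?thesis .
  qed
  ultimately show "algebraic_set n (carrier_vec n - S \<inter> T)"
    unfolding algebraic_set_def by (intro exI[of _ ?R] conjI)
next
  fix K :: "complex vec set set"
  assume K: "\<forall>U\<in>K. U \<subseteq> carrier_vec n \<and> algebraic_set n (carrier_vec n - U)"
  then show "\<Union>K \<subseteq> carrier_vec n" by blast
  have "\<forall>U\<in>K. \<exists>P. (\<forall>p\<in>P. polynomial_fun n p) \<and>
      carrier_vec n - U = {v \<in> carrier_vec n. \<forall>p\<in>P. p v = 0}"
    using K unfolding algebraic_set_def by blast
  from bchoice[OF this] obtain P where P: "\<forall>U\<in>K. (\<forall>p\<in>P U. polynomial_fun n p) \<and>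
      carrier_vec n - U = {v \<in> carrier_vec n. \<forall>p\<in>P U. p v = 0}" ..
  have "v \<notin> U \<longleftrightarrow> (\<forall>p\<in>P U. p v = 0)" if "U \<in> K" "v \<in> carrier_vec n" for U v
    using bspec[OF P that(1)] that(2) by blast
  then have "carrier_vec n - \<Union>K = {v \<in> carrier_vec n. \<forall>p\<in>\<Union>(P ` K). p v = 0}"
    by auto
  moreover have "\<forall>p\<in>\<Union>(P ` K). polynomial_fun n p"
    using P by simp
  ultimately show "algebraic_set n (carrier_vec n - \<Union>K)"
    unfolding algebraic_set_def by (intro exI[of _ "\<Union>(P ` K)"] conjI)
qed

lemma openin_zariski:
  "openin (zariski n) U \<longleftrightarrow> U \<subseteq> carrier_vec n \<and> algebraic_set n (carrier_vec n - U)"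
  unfolding zariski_def by (simp add: topology_inverse' istopology_zariski)

lemma topspace_zariski: "topspace (zariski n) = carrier_vec n"
proof -
  have "polynomial_fun n (\<lambda>_. 1)"
    unfolding polynomial_fun_def by (intro exI[of _ "{\<lambda>_. 0}"] exI[of _ "\<lambda>_. 1"]) simp
  then have "algebraic_set n {}"
    unfolding algebraic_set_def by (intro exI[of _ "{\<lambda>_. 1}"]) auto
  then have "openin (zariski n) (carrier_vec n)"
    by (simp add: openin_zariski)
  moreover have "topspace (zariski n) \<subseteq> carrier_vec n"
    using openin_zariski openin_topspace by blast
  ultimately show ?thesis
    using openin_subset by blast
qed

lemma closedin_zariski: "closedin (zariski n) Z \<longleftrightarrow> algebraic_set n Z"
proof -
  have "Z \<subseteq> carrier_vec n" if "algebraic_set n Z"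
    using that unfolding algebraic_set_def by blast
  then show ?thesis
    unfolding closedin_def topspace_zariski openin_zariski
    by (auto simp: double_diff)
qed


section \<open>Krull dimension of a topological space\<close>

definition irreducible_space :: "'a topology \<Rightarrow> bool" where
  "irreducible_space X \<longleftrightarrow> topspace X \<noteq> {} \<and>
     (\<forall>A B. closedin X A \<and> closedin X B \<and> A \<union> B = topspace X \<longrightarrow>
        A = topspace X \<or> B = topspace X)"

text \<open>
  The supremum of the lengths \<open>k\<close> of chains \<open>Z 0 \<subset> Z 1 \<subset> \<dots> \<subset> Z k\<close> of irreducible closed subsets.
\<close>

definition krull_dim :: "'a topology \<Rightarrow> enat" where
  "krull_dim X = Sup {enat k | k. \<exists>Z :: nat \<Rightarrow> 'a set.
     (\<forall>i\<le>k. closedin X (Z i) \<and> irreducible_space (subtopology X (Z i))) \<and>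
     (\<forall>i<k. Z i \<subset> Z (Suc i))}"

definition image_dim :: "nat \<Rightarrow> complex vec set \<Rightarrow> enat" where
  "image_dim m X = krull_dim (subtopology (zariski m) (zariski m closure_of X))"


section \<open>Modules and covariants\<close>

text \<open>
  A \<open>G\<close>-module of dimension \<open>n\<close> is taken in coordinates, as a homomorphism \<open>G \<rightarrow> GL\<^sub>n(\<complex>)\<close>;
  every finite-dimensional module is isomorphic to one of this form.
\<close>

abbreviation GL :: "nat \<Rightarrow> complex mat monoid" where
  "GL n \<equiv> units_of (ring_mat TYPE(complex) n ())"

definition covariant ::
  "('g, 'r) monoid_scheme \<Rightarrow> nat \<Rightarrow> ('g \<Rightarrow> complex mat) \<Rightarrow> nat \<Rightarrow> ('g \<Rightarrow> complex mat) \<Rightarrow>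
   (complex vec \<Rightarrow> complex vec) \<Rightarrow> bool" where
  "covariant G n \<rho> m \<sigma> \<phi> \<longleftrightarrow>
     \<rho> \<in> hom G (GL n) \<and> \<sigma> \<in> hom G (GL m) \<and>
     \<phi> \<in> carrier_vec n \<rightarrow> carrier_vec m \<and>
     (\<forall>i<m. polynomial_fun n (\<lambda>v. \<phi> v $ i)) \<and>
     (\<forall>g\<in>carrier G. \<forall>v\<in>carrier_vec n. \<phi> (\<rho> g *\<^sub>v v) = \<sigma> g *\<^sub>v \<phi> v)"

text \<open>
  A rational map is represented by its restriction \<open>\<phi>\<close> to a nonempty (hence dense) Zariski open
  subset \<open>U\<close> on which each coordinate is a quotient of polynomials.  If the map is equivariant, then
  \<open>U\<close> can be chosen \<open>G\<close>-stable (for example, the domain of definition); the closure of the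
  image and the elements of \<open>G\<close> fixing the image pointwise do not depend on \<open>U\<close>.
\<close>

definition rational_covariant ::
  "('g, 'r) monoid_scheme \<Rightarrow> nat \<Rightarrow> ('g \<Rightarrow> complex mat) \<Rightarrow> nat \<Rightarrow> ('g \<Rightarrow> complex mat) \<Rightarrow>
   complex vec set \<Rightarrow> (complex vec \<Rightarrow> complex vec) \<Rightarrow> bool" where
  "rational_covariant G n \<rho> m \<sigma> U \<phi> \<longleftrightarrow>
     \<rho> \<in> hom G (GL n) \<and> \<sigma> \<in> hom G (GL m) \<and>
     openin (zariski n) U \<and> U \<noteq> {} \<and>
     (\<forall>g\<in>carrier G. \<forall>v\<in>U. \<rho> g *\<^sub>v v \<in> U) \<and>
     \<phi> \<in> U \<rightarrow> carrier_vec m \<and>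
     (\<forall>i<m. \<exists>p q. polynomial_fun n p \<and> polynomial_fun n q \<and>
        (\<forall>v\<in>U. q v \<noteq> 0 \<and> \<phi> v $ i = p v / q v)) \<and>
     (\<forall>g\<in>carrier G. \<forall>v\<in>U. \<phi> (\<rho> g *\<^sub>v v) = \<sigma> g *\<^sub>v \<phi> v)"

definition acts_faithfully ::
  "('g, 'r) monoid_scheme \<Rightarrow> ('g \<Rightarrow> complex mat) \<Rightarrow> complex vec set \<Rightarrow> bool" where
  "acts_faithfully G \<sigma> X \<longleftrightarrow> faithful_action G X (\<lambda>g. \<lambda>w\<in>X. \<sigma> g *\<^sub>v w)"

text \<open>
  The infimum of a nonempty set of extended naturals is its minimum.
\<close>

definition covdim :: "('g, 'r) monoid_scheme \<Rightarrow> enat" where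
  "covdim G = Inf {image_dim m (\<phi> ` carrier_vec n) | n \<rho> m \<sigma> \<phi>.
     covariant G n \<rho> m \<sigma> \<phi> \<and> acts_faithfully G \<sigma> (\<phi> ` carrier_vec n)}"

definition edim :: "('g, 'r) monoid_scheme \<Rightarrow> enat" where
  "edim G = Inf {image_dim m (\<phi> ` U) | n \<rho> m \<sigma> U \<phi>.
     rational_covariant G n \<rho> m \<sigma> U \<phi> \<and> acts_faithfully G \<sigma> (\<phi> ` U)}"

end

theory Submission
  imports Defs "Jordan_Normal_Form.Determinant" "HOL-Library.Function_Algebras"
begin

text \<open>
  The dimension of the closure of the image of a (rational) map is the generic rank of its Jacobian
  matrix, and passing to leading forms does not increase this rank.

  A faithful (rational) covariant \<open>\<phi>\<close> of dimension \<open>d\<close> can be compressed to one between permutation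
  modules: choose vectors with trivial stabiliser in the source and in the image of \<open>\<phi>\<close> and compose
  \<open>\<phi>\<close> on both sides with equivariant polynomial maps interpolating the two orbits. The result is a map
  \<open>f / Q\<close> of \<open>\<complex>\<^sup>n\<close> with \<open>f\<close> equivariant for the symmetric group, which fixes \<open>(1, \<dots>, n)\<close>; the same works for a
  subgroup acting by permutations and signs. Subtracting the mean of the components of \<open>f\<close> and
  taking leading forms yields a nonzero homogeneous equivariant \<open>F\<close> with \<open>\<Sum> F\<^sub>i = 0\<close>; since \<open>n \<ge> 3\<close>, its
  components are pairwise not proportional.

  Multiplying by the denominator \<open>Q\<close> raises the rank by at most one, and \<open>F\<^sub>i\<^sup>n / \<Prod> F\<^sub>k\<close> has smaller rank than
  \<open>F\<close>, which gives (a). Multiplying \<open>F\<close> by a power of \<open>\<Sum> x\<^sub>l\<close> adjusts its degree modulo \<open>d\<close> without raising the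
  rank, which gives (b). For (d), compress a rational covariant of \<open>S\<^sub>n\<^sub>+\<^sub>2\<close> to \<open>S\<^sub>n \<times> S\<^sub>2\<close>, with \<open>S\<^sub>2\<close> acting by signs: now \<open>f / Q\<close>
  is odd, so that its leading form has nonzero degree and clearing the denominator does
  not raise the rank. For (c), compress a covariant of \<open>S\<^sub>n \<times> \<int>/2\<close> to an odd map and restrict it to a
  subspace of dimension \<open>\<lfloor>n/2\<rfloor> + 1\<close>, on which suitable combinations of the components are odd in
  exactly one variable each; their leading monomials have an exponent matrix of odd determinant.
\<close>

text \<open>Rank survives the passage to leading forms because it is lower semicontinuous: a
  weighted rescaling moves the normalised gradients towards those of the leading forms, and a minor
  that is nonzero in the limit is nonzero nearby. What can be lost is faithfulness, namely when all
  components share one leading term. Making the components sum to zero prevents this: double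
  transitivity and a third index turn proportional components into equal ones, which must then
  vanish; for n = 2 the pair F, -F escapes.

  How the rank reacts to a factor is decided by the radial direction. For a homogeneous map of
  nonzero degree, Euler's identity makes the derivative along the radial vector a nonzero multiple
  of the map, so a scalar factor adds no new direction; in degree zero the radial direction is lost.
  This is the gap of one in (a), and parity suffices in (d) because it excludes degree zero. The
  second half of (d) is (a) for n + 2 letters.

  In (c) the element -1 is supplied by (b) for d = 2. The subspace is cut out so that each single
  sign change of its coordinates comes from the group: from disjoint transpositions, and from -1
  times the reversal.\<close>

section \<open>Polynomial functions and degree bounds\<close>

text \<open>
  Points are functions \<open>nat \<Rightarrow> complex\<close>, of which only the coordinates below \<open>N\<close> matter; this
  avoids changes of type between spaces of different dimensions.
\<close>

inductive polyd :: "nat \<Rightarrow> nat \<Rightarrow> ((nat \<Rightarrow> complex) \<Rightarrow> complex) \<Rightarrow> bool" for N where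
  const: "polyd N D (\<lambda>_. c)"
| step: "polyd N D f \<Longrightarrow> polyd N (Suc D) g \<Longrightarrow> i < N \<Longrightarrow> polyd N (Suc D) (\<lambda>x. x i * f x + g x)"

text \<open>The degree is forgotten wherever only polynomiality matters; \<open>polyd\<close> stays
  for inductions in which differentiation or division by a coordinate lowers the degree.\<close>

definition polyf :: "nat \<Rightarrow> ((nat \<Rightarrow> complex) \<Rightarrow> complex) \<Rightarrow> bool" where
  "polyf N f \<longleftrightarrow> (\<exists>D. polyd N D f)"

lemma polyd_mono: "polyd N D f \<Longrightarrow> D \<le> E \<Longrightarrow> polyd N E f"
proof (induction arbitrary: E rule: polyd.induct)
  case (step D f g i)
  then obtain E' where "E = Suc E'" by (cases E) auto
  with step show ?case by (auto intro!: polyd.step)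
qed (rule polyd.const)

lemma polyd_add:
  assumes "polyd N D f" "polyd N D g"
  shows "polyd N D (\<lambda>x. f x + g x)"
  using assms
proof (induction rule: polyd.induct)
  case (const D c)
  then show ?case
  proof (induction rule: polyd.induct)
    case (step D f g i)
    have "polyd N (Suc D) (\<lambda>x. x i * f x + (c + g x))"
      using step by (intro polyd.step)
    then show ?case by (simp add: algebra_simps)
  qed (auto intro: polyd.const)
next
  case (step D f h i)
  have "polyd N (Suc D) (\<lambda>x. x i * f x + (h x + g x))"
    using step by (intro polyd.step)
  then show ?case by (simp add: algebra_simps)
qed

lemma polyd_cmult:
  assumes "polyd N D f"
  shows "polyd N D (\<lambda>x. c * f x)"
  using assms
proof (induction rule: polyd.induct)
  case (step D f h i)
  have "polyd N (Suc D) (\<lambda>x. x i * (c * f x) + c * h x)"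
    using step by (intro polyd.step)
  then show ?case by (simp add: algebra_simps)
qed (rule polyd.const)

lemma polyd_var_mult: "polyd N D f \<Longrightarrow> i < N \<Longrightarrow> polyd N (Suc D) (\<lambda>x. x i * f x)"
  using polyd.step[of N D f "\<lambda>_. 0" i] polyd.const by simp

lemma polyd_mult:
  assumes "polyd N D f" "polyd N E g"
  shows "polyd N (D + E) (\<lambda>x. f x * g x)"
  using assms
proof (induction rule: polyd.induct)
  case (const D c)
  then show ?case using polyd_mono[OF polyd_cmult] by simp
next
  case (step D f h i)
  have "polyd N (Suc (D + E)) (\<lambda>x. x i * (f x * g x) + h x * g x)"
    using step by (intro polyd.step) auto
  then show ?case by (simp add: algebra_simps)
qed

lemma polyf_const [simp, intro]: "polyf N (\<lambda>_. c)"
  unfolding polyf_def by (blast intro: polyd.const)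

lemma polyf_var [simp, intro]: "i < N \<Longrightarrow> polyf N (\<lambda>x. x i)"
  unfolding polyf_def using polyd_var_mult[OF polyd.const[of N 0 1]] by auto

lemma polyf_add [simp, intro]:
  assumes "polyf N f" "polyf N g" shows "polyf N (\<lambda>x. f x + g x)"
proof -
  obtain D E where "polyd N D f" "polyd N E g" using assms unfolding polyf_def by auto
  then have "polyd N (max D E) f" "polyd N (max D E) g" by (auto elim: polyd_mono)
  then show ?thesis unfolding polyf_def by (blast intro: polyd_add)
qed

lemma polyf_mult [simp, intro]: "polyf N f \<Longrightarrow> polyf N g \<Longrightarrow> polyf N (\<lambda>x. f x * g x)"
  unfolding polyf_def by (blast intro: polyd_mult)

lemma polyf_uminus [simp, intro]: "polyf N f \<Longrightarrow> polyf N (\<lambda>x. - f x)"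
  using polyf_mult[OF polyf_const[of N "-1"], of f] by simp

lemma polyf_diff [simp, intro]: "polyf N f \<Longrightarrow> polyf N g \<Longrightarrow> polyf N (\<lambda>x. f x - g x)"
  using polyf_add[OF _ polyf_uminus, of N f g] by simp

lemma polyf_sum [intro]: "(\<And>i. i \<in> I \<Longrightarrow> polyf N (f i)) \<Longrightarrow> polyf N (\<lambda>x. \<Sum>i\<in>I. f i x)"
  by (induction I rule: infinite_finite_induct) auto

lemma polyf_prod [intro]: "(\<And>i. i \<in> I \<Longrightarrow> polyf N (f i)) \<Longrightarrow> polyf N (\<lambda>x. \<Prod>i\<in>I. f i x)"
  by (induction I rule: infinite_finite_induct) auto

lemma polyf_power [simp, intro]: "polyf N f \<Longrightarrow> polyf N (\<lambda>x. f x ^ e)"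
  by (induction e) auto

lemma polyf_divide_const [simp, intro]: "polyf N f \<Longrightarrow> polyf N (\<lambda>x. f x / c)"
  using polyf_mult[OF polyf_const[of N "1/c"], of f] by simp

lemma polyf_induct [consumes 1, case_names const var add mult]:
  fixes P :: "((nat \<Rightarrow> complex) \<Rightarrow> complex) \<Rightarrow> bool"
  assumes "polyf N f"
    and "\<And>c. P (\<lambda>_. c)" "\<And>i. i < N \<Longrightarrow> P (\<lambda>x. x i)"
    and "\<And>f g. polyf N f \<Longrightarrow> polyf N g \<Longrightarrow> P f \<Longrightarrow> P g \<Longrightarrow> P (\<lambda>x. f x + g x)"
    and "\<And>f g. polyf N f \<Longrightarrow> polyf N g \<Longrightarrow> P f \<Longrightarrow> P g \<Longrightarrow> P (\<lambda>x. f x * g x)"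
  shows "P f"
proof -
  obtain D where "polyd N D f" using assms(1) unfolding polyf_def by auto
  then show ?thesis
  proof (induction rule: polyd.induct)
    case (step D f g i)
    have *: "polyf N f" "polyf N g" using step.hyps(1,2) unfolding polyf_def by blast+
    have x: "polyf N (\<lambda>x. x i)" "P (\<lambda>x. x i)"
      using step.hyps(3) by (rule polyf_var, rule assms(3))
    show ?case
      by (rule assms(4)[OF polyf_mult[OF x(1) *(1)] *(2) assms(5)[OF x(1) *(1) x(2) step.IH(1)] step.IH(2)])
  qed (rule assms(2))
qed

lemma polyf_cong:
  assumes "polyf N f" "\<And>i. i < N \<Longrightarrow> x i = y i"
  shows "f x = f y"
  using assms by (induction rule: polyf_induct) auto

lemma polyf_compose:
  assumes "polyf k F" "\<And>i. i < k \<Longrightarrow> polyf N (g i)"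
  shows "polyf N (\<lambda>x. F (\<lambda>i. g i x))"
  using assms by (induction rule: polyf_induct) auto

lemma polyf_mono: "polyf k F \<Longrightarrow> k \<le> N \<Longrightarrow> polyf N F"
  using polyf_compose[of k F N "\<lambda>i x. x i"] by auto

text \<open>Questions in several variables are reduced to one: along lines and weighted scalings the
  roots, derivatives and coefficients of univariate polynomials become available.\<close>

lemma polyf_curve:
  assumes "polyf N f"
  shows "\<exists>p. \<forall>t. poly p t = f (\<lambda>i. poly (c i) t)"
  using assms
proof (induction rule: polyf_induct)
  case (const c)
  show ?case by (intro exI[of _ "[:c:]"]) simp
next
  case (add f g)
  then obtain p q where "\<forall>t. poly p t = f (\<lambda>i. poly (c i) t)" "\<forall>t. poly q t = g (\<lambda>i. poly (c i) t)" by auto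
  then show ?case by (intro exI[of _ "p + q"]) simp
next
  case (mult f g)
  then obtain p q where "\<forall>t. poly p t = f (\<lambda>i. poly (c i) t)" "\<forall>t. poly q t = g (\<lambda>i. poly (c i) t)" by auto
  then show ?case by (intro exI[of _ "p * q"]) simp
qed auto

text \<open>Affine space is irreducible: on the line from \<open>x\<close> to \<open>y\<close> both
  restrictions are nonzero univariate polynomials, so their product has only finitely many
  roots.\<close>

lemma polyf_nonzero_common:
  assumes "polyf N f" "polyf N g" "f x \<noteq> 0" "g y \<noteq> 0"
  shows "\<exists>z. f z \<noteq> 0 \<and> g z \<noteq> 0"
proof -
  let ?c = "\<lambda>i. [:x i, y i - x i:]"
  obtain p q where p: "\<forall>t. poly p t = f (\<lambda>i. poly (?c i) t)"
    and q: "\<forall>t. poly q t = g (\<lambda>i. poly (?c i) t)"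
    using polyf_curve[OF assms(1), of ?c] polyf_curve[OF assms(2), of ?c] by auto
  have "poly p 0 \<noteq> 0" "poly q 1 \<noteq> 0" using assms(3,4) p q by auto
  then have "p * q \<noteq> 0" by auto
  then have "finite {t. poly (p * q) t = 0}" by (rule poly_roots_finite)
  then have "{t. poly (p * q) t = 0} \<noteq> UNIV" using infinite_UNIV_char_0 by metis
  then obtain t where "poly (p * q) t \<noteq> 0" by auto
  then show ?thesis using p q by auto
qed

lemma polyf_nonzero_common_finite:
  assumes "finite I" "\<And>i. i \<in> I \<Longrightarrow> polyf N (f i)" "\<And>i. i \<in> I \<Longrightarrow> \<exists>x. f i x \<noteq> 0"
  shows "\<exists>z. \<forall>i\<in>I. f i z \<noteq> 0"
  using assms
proof (induction I rule: finite_induct)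
  case (insert i I)
  then obtain z where "\<forall>i\<in>I. f i z \<noteq> 0" by blast
  then have "(\<Prod>i\<in>I. f i z) \<noteq> 0" using insert by simp
  moreover obtain y where "f i y \<noteq> 0" using insert by blast
  moreover have "polyf N (\<lambda>x. \<Prod>i\<in>I. f i x)" "polyf N (f i)" using insert by auto
  ultimately obtain w where "(\<Prod>i\<in>I. f i w) \<noteq> 0" "f i w \<noteq> 0"
    using polyf_nonzero_common by blast
  then show ?case using insert by (auto intro!: exI[of _ w])
qed auto

lemma polyf_zero_dense:
  assumes "polyf N f" "polyf N q" "q x0 \<noteq> 0" "\<And>x. q x \<noteq> 0 \<Longrightarrow> f x = 0"
  shows "f x = 0"
proof (rule ccontr)
  assume "f x \<noteq> 0"
  from polyf_nonzero_common[OF assms(1,2) this assms(3)] assms(4) show False by auto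
qed

text \<open>One affine linear factor for each point of \<open>T\<close>, in a coordinate separating
  it from \<open>a\<close>, normalised at \<open>a\<close>. Such functions single out one point of a
  finite orbit.\<close>

lemma polyf_interpolate:
  assumes "finite T" "\<And>y. y \<in> T \<Longrightarrow> \<exists>i<N. y i \<noteq> a i"
  shows "\<exists>s. polyf N s \<and> s a = 1 \<and> (\<forall>y\<in>T. s y = 0)"
proof -
  obtain j where j: "\<And>y. y \<in> T \<Longrightarrow> j y < N \<and> y (j y) \<noteq> a (j y)"
    using assms(2) by (metis (mono_tags))
  let ?s = "\<lambda>x. \<Prod>y\<in>T. (x (j y) - y (j y)) / (a (j y) - y (j y))"
  have "polyf N ?s"
    by (intro polyf_prod polyf_divide_const polyf_diff polyf_var polyf_const) (use j in blast)
  moreover have "?s a = 1" using j by (intro prod.neutral) (metis divide_self_if right_minus_eq)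
  moreover have "\<forall>y\<in>T. ?s y = 0" using assms(1) by auto
  ultimately show ?thesis by blast
qed

text \<open>Division by the coordinate \<open>x e\<close> with remainder. The quotient has smaller
  degree, which drives the induction in \<open>algindep_extend\<close>; for \<open>D = 0\<close> the
  bound \<open>D - 1\<close> is not smaller, so vanishing is stated separately.\<close>

lemma polyd_split_var:
  assumes "polyd N D f" "e < N"
  shows "\<exists>h. polyd N (D - 1) h \<and> (D = 0 \<longrightarrow> h = (\<lambda>_. 0)) \<and> (\<forall>x. f x = f (x(e := 0)) + x e * h x)"
  using assms(1)
proof (induction rule: polyd.induct)
  case (const D c)
  then show ?case by (intro exI[of _ "\<lambda>_. 0"]) (auto intro: polyd.const)
next
  case (step D f g i)
  obtain f1 where f1: "polyd N (D - 1) f1" "D = 0 \<longrightarrow> f1 = (\<lambda>_. 0)" "\<forall>x. f x = f (x(e := 0)) + x e * f1 x"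
    using step.IH(1) by blast
  obtain g1 where g1: "polyd N D g1" "\<forall>x. g x = g (x(e := 0)) + x e * g1 x"
    using step.IH(2) unfolding diff_Suc_1 by blast
  show ?case
  proof (cases "i = e")
    case True
    have 1: "polyd N D (\<lambda>x. f x + g1 x)" by (rule polyd_add[OF step.hyps(1) g1(1)])
    have "x i * f x + g x = (x(e := 0)) i * f (x(e := 0)) + g (x(e := 0)) + x e * (f x + g1 x)" for x
      unfolding g1(2)[THEN spec, of x] True by (simp add: algebra_simps)
    then have 2: "\<forall>x. x i * f x + g x = (x(e := 0)) i * f (x(e := 0)) + g (x(e := 0)) + x e * (f x + g1 x)" by blast
    show ?thesis
      by (rule exI[of _ "\<lambda>x. f x + g1 x"], intro conjI 2) (simp_all only: 1 diff_Suc_1 nat.distinct simp_thms)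
  next
    case False
    have "polyd N D (\<lambda>x. x i * f1 x)"
    proof (cases D)
      case 0 then show ?thesis using f1(2) by (auto intro: polyd.const)
    next
      case (Suc D') then show ?thesis using polyd_var_mult f1(1) step.hyps by auto
    qed
    then have 1: "polyd N D (\<lambda>x. x i * f1 x + g1 x)" by (rule polyd_add[OF _ g1(1)])
    have "x i * f x + g x = (x(e := 0)) i * f (x(e := 0)) + g (x(e := 0)) + x e * (x i * f1 x + g1 x)" for x
      by (subst g1(2)[THEN spec, of x], subst f1(3)[THEN spec, of x]) (use False in \<open>simp add: algebra_simps\<close>)
    then have 2: "\<forall>x. x i * f x + g x = (x(e := 0)) i * f (x(e := 0)) + g (x(e := 0)) + x e * (x i * f1 x + g1 x)" by blast
    show ?thesis
      by (rule exI[of _ "\<lambda>x. x i * f1 x + g1 x"], intro conjI 2) (simp_all only: 1 diff_Suc_1 nat.distinct simp_thms)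
  qed
qed

subsection \<open>Gradients\<close>

text \<open>
  \<open>G\<close> is a gradient if the chain rule holds along every curve through \<open>x\<close>; this needs no norm on the
  space of functions \<open>nat \<Rightarrow> complex\<close>.
\<close>

definition hasgrad :: "nat \<Rightarrow> ((nat \<Rightarrow> complex) \<Rightarrow> complex) \<Rightarrow> (nat \<Rightarrow> complex) \<Rightarrow> (nat \<Rightarrow> complex) \<Rightarrow> bool" where
  "hasgrad N f x G \<longleftrightarrow> (\<forall>c c' t. c t = x \<longrightarrow>
     (\<forall>i<N. ((\<lambda>s. c s i) has_field_derivative c' i) (at t)) \<longrightarrow>
     ((\<lambda>s. f (c s)) has_field_derivative (\<Sum>i<N. G i * c' i)) (at t))"

lemma hasgradD:
  assumes "hasgrad N f x G" "c t = x" "\<And>i. i < N \<Longrightarrow> ((\<lambda>s. c s i) has_field_derivative c' i) (at t)"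
  shows "((\<lambda>s. f (c s)) has_field_derivative (\<Sum>i<N. G i * c' i)) (at t)"
  using assms(1)[unfolded hasgrad_def, rule_format, of c t c'] assms(2,3) by blast

lemma hasgrad_const: "hasgrad N (\<lambda>_. a) x (\<lambda>_. 0)"
  unfolding hasgrad_def by simp

lemma hasgrad_var: "i < N \<Longrightarrow> hasgrad N (\<lambda>x. x i) x (\<lambda>l. if l = i then 1 else 0)"
proof -
  assume i: "i < N"
  have "(\<Sum>l<N. (if l = i then 1 else 0) * c' l) = c' i" for c' :: "nat \<Rightarrow> complex"
  proof -
    have "(\<Sum>l<N. (if l = i then 1 else 0) * c' l) = (\<Sum>l<N. if l = i then c' l else 0)"
      by (rule sum.cong) simp_all
    then show ?thesis using i by simp
  qed
  then show ?thesis unfolding hasgrad_def using i by simp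
qed

lemma hasgrad_add:
  assumes "hasgrad N f x G" "hasgrad N g x H"
  shows "hasgrad N (\<lambda>x. f x + g x) x (\<lambda>l. G l + H l)"
  unfolding hasgrad_def
proof (intro allI impI)
  fix c c' and t :: complex
  assume c: "c t = x" "\<forall>i<N. ((\<lambda>s. c s i) has_field_derivative c' i) (at t)"
  have 1: "((\<lambda>s. f (c s)) has_field_derivative (\<Sum>i<N. G i * c' i)) (at t)"
    by (rule hasgradD[OF assms(1), where c=c and t=t, OF c(1)]) (use c(2) in blast)
  have 2: "((\<lambda>s. g (c s)) has_field_derivative (\<Sum>i<N. H i * c' i)) (at t)"
    by (rule hasgradD[OF assms(2), where c=c and t=t, OF c(1)]) (use c(2) in blast)
  show "((\<lambda>s. f (c s) + g (c s)) has_field_derivative (\<Sum>i<N. (G i + H i) * c' i)) (at t)"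
    using DERIV_add[OF 1 2] by (simp add: distrib_right sum.distrib)
qed

lemma hasgrad_mult:
  assumes "hasgrad N f x G" "hasgrad N g x H"
  shows "hasgrad N (\<lambda>x. f x * g x) x (\<lambda>l. f x * H l + G l * g x)"
  unfolding hasgrad_def
proof (intro allI impI)
  fix c c' and t :: complex
  assume c: "c t = x" "\<forall>i<N. ((\<lambda>s. c s i) has_field_derivative c' i) (at t)"
  have 1: "((\<lambda>s. f (c s)) has_field_derivative (\<Sum>i<N. G i * c' i)) (at t)"
    by (rule hasgradD[OF assms(1), where c=c and t=t, OF c(1)]) (use c(2) in blast)
  have 2: "((\<lambda>s. g (c s)) has_field_derivative (\<Sum>i<N. H i * c' i)) (at t)"
    by (rule hasgradD[OF assms(2), where c=c and t=t, OF c(1)]) (use c(2) in blast)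
  show "((\<lambda>s. f (c s) * g (c s)) has_field_derivative (\<Sum>i<N. (f x * H i + G i * g x) * c' i)) (at t)"
    using DERIV_mult[OF 1 2]
    by (rule DERIV_cong) (simp add: c distrib_right sum.distrib sum_distrib_left sum_distrib_right algebra_simps)
qed

lemma hasgrad_divide:
  assumes "hasgrad N f x G" "hasgrad N g x H" "g x \<noteq> 0"
  shows "hasgrad N (\<lambda>x. f x / g x) x (\<lambda>l. (G l * g x - f x * H l) / (g x)^2)"
  unfolding hasgrad_def
proof (intro allI impI)
  fix c c' and t :: complex
  assume c: "c t = x" "\<forall>i<N. ((\<lambda>s. c s i) has_field_derivative c' i) (at t)"
  have 1: "((\<lambda>s. f (c s)) has_field_derivative (\<Sum>i<N. G i * c' i)) (at t)"
    by (rule hasgradD[OF assms(1), where c=c and t=t, OF c(1)]) (use c(2) in blast)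
  have 2: "((\<lambda>s. g (c s)) has_field_derivative (\<Sum>i<N. H i * c' i)) (at t)"
    by (rule hasgradD[OF assms(2), where c=c and t=t, OF c(1)]) (use c(2) in blast)
  have "g (c t) \<noteq> 0" using c assms by simp
  have "(\<Sum>i<N. (G i * g x - f x * H i) / (g x)^2 * c' i)
      = ((\<Sum>i<N. G i * c' i) * g x - f x * (\<Sum>i<N. H i * c' i)) / (g x * g x)"
    unfolding sum_distrib_left sum_distrib_right sum_subtractf[symmetric] sum_divide_distrib
    by (rule sum.cong) (simp_all add: power2_eq_square algebra_simps)
  then show "((\<lambda>s. f (c s) / g (c s)) has_field_derivative (\<Sum>i<N. (G i * g x - f x * H i) / (g x)^2 * c' i)) (at t)"
    using DERIV_divide[OF 1 2 \<open>g (c t) \<noteq> 0\<close>] c(1) by simp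
qed

lemma hasgrad_compose:
  assumes "hasgrad k F (\<lambda>i. g i x) H" "\<And>i. i < k \<Longrightarrow> hasgrad N (g i) x (G i)"
  shows "hasgrad N (\<lambda>x. F (\<lambda>i. g i x)) x (\<lambda>l. \<Sum>i<k. H i * G i l)"
  unfolding hasgrad_def
proof (intro allI impI)
  fix c c' and t :: complex
  assume c: "c t = x" "\<forall>i<N. ((\<lambda>s. c s i) has_field_derivative c' i) (at t)"
  have g: "((\<lambda>s. g i (c s)) has_field_derivative (\<Sum>l<N. G i l * c' l)) (at t)" if "i < k" for i
    by (rule hasgradD[OF assms(2)[OF that], where c=c and t=t, OF c(1)]) (use c(2) in blast)
  have "((\<lambda>s. F (\<lambda>i. g i (c s))) has_field_derivative (\<Sum>i<k. H i * (\<Sum>l<N. G i l * c' l))) (at t)"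
    by (rule hasgradD[OF assms(1), where c="\<lambda>s i. g i (c s)" and t=t]) (use c(1) g in auto)
  moreover have "(\<Sum>i<k. H i * (\<Sum>l<N. G i l * c' l)) = (\<Sum>l<N. (\<Sum>i<k. H i * G i l) * c' l)"
    unfolding sum_distrib_left sum_distrib_right mult.assoc by (rule sum.swap)
  ultimately show "((\<lambda>s. F (\<lambda>i. g i (c s))) has_field_derivative (\<Sum>l<N. (\<Sum>i<k. H i * G i l) * c' l)) (at t)"
    by simp
qed

text \<open>A description makes this total, so one notation serves polynomials and quotients; it is
  meaningful where the slice is differentiable.\<close>

definition pd :: "nat \<Rightarrow> ((nat \<Rightarrow> complex) \<Rightarrow> complex) \<Rightarrow> (nat \<Rightarrow> complex) \<Rightarrow> complex" where
  "pd l f x = (THE D. ((\<lambda>t. f (x(l := t))) has_field_derivative D) (at (x l)))"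

lemma pd_eqI: "((\<lambda>t. f (x(l := t))) has_field_derivative D) (at (x l)) \<Longrightarrow> pd l f x = D"
  unfolding pd_def by (rule the_equality) (simp_all add: DERIV_unique)

lemma hasgrad_pd:
  assumes "hasgrad N f x G" "l < N"
  shows "pd l f x = G l"
proof -
  have c: "((\<lambda>s. (x(l := s)) i) has_field_derivative (if i = l then 1 else 0)) (at (x l))" for i
    by (cases "i = l") simp_all
  have "(\<Sum>i<N. G i * (if i = l then 1 else 0)) = (\<Sum>i<N. if i = l then G i else 0)"
    by (rule sum.cong) simp_all
  also have "\<dots> = G l" using assms(2) by (simp only: sum.delta finite_lessThan lessThan_iff if_True)
  finally have eq: "(\<Sum>i<N. G i * (if i = l then 1 else 0)) = G l" .
  have "((\<lambda>t. f (x(l := t))) has_field_derivative (\<Sum>i<N. G i * (if i = l then 1 else 0))) (at (x l))"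
    by (rule hasgradD[OF assms(1), where c="\<lambda>t. x(l := t)" and t="x l", OF fun_upd_triv c])
  then show ?thesis unfolding eq by (rule pd_eqI)
qed

lemma hasgrad_cong: "hasgrad N f x G \<Longrightarrow> (\<And>l. l < N \<Longrightarrow> G l = H l) \<Longrightarrow> hasgrad N f x H"
  unfolding hasgrad_def by simp

text \<open>Partial derivatives lower the degree bound. In degree 0 the bound \<open>D - 1\<close>
  carries no information, hence the extra clause.\<close>

lemma polyd_grad:
  assumes "polyd N D f"
  shows "\<exists>G. (\<forall>l. polyd N (D - 1) (G l)) \<and> (D = 0 \<longrightarrow> (\<forall>l x. G l x = 0)) \<and> (\<forall>x. hasgrad N f x (\<lambda>l. G l x))"
  using assms
proof (induction rule: polyd.induct)
  case (const D c)
  show ?case by (intro exI[of _ "\<lambda>_ _. 0"]) (simp add: polyd.const hasgrad_const)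
next
  case (step D f g i)
  obtain F where F: "\<forall>l. polyd N (D - 1) (F l)" "D = 0 \<longrightarrow> (\<forall>l x. F l x = 0)" "\<forall>x. hasgrad N f x (\<lambda>l. F l x)"
    using step.IH(1) by blast
  obtain G where G: "\<forall>l. polyd N D (G l)" "\<forall>x. hasgrad N g x (\<lambda>l. G l x)"
    using step.IH(2) by auto
  let ?K = "\<lambda>l x. (x i * F l x + (if l = i then 1 else 0) * f x) + G l x"
  have "polyd N D (\<lambda>x. x i * F l x)" for l
  proof (cases D)
    case 0 then show ?thesis using F(2) by (auto intro: polyd.const)
  next
    case (Suc D') then show ?thesis using polyd_var_mult F(1) step.hyps by auto
  qed
  then have 1: "polyd N D (?K l)" for l
    by (intro polyd_add polyd_cmult) (use step.hyps G in blast)+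
  have 2: "hasgrad N (\<lambda>x. x i * f x + g x) x (\<lambda>l. ?K l x)" for x
    by (rule hasgrad_add[OF hasgrad_mult[OF hasgrad_var[OF step.hyps(3)] F(3)[rule_format]] G(2)[rule_format]])
  show ?case
    by (rule exI[of _ ?K]) (simp only: diff_Suc_1 1 2 nat.distinct simp_thms)
qed

lemma polyd_pd:
  assumes "polyd N D f" "l < N"
  shows "polyd N (D - 1) (pd l f)" "D = 0 \<Longrightarrow> pd l f x = 0"
proof -
  obtain G where G: "\<forall>l. polyd N (D - 1) (G l)" "D = 0 \<longrightarrow> (\<forall>l x. G l x = 0)" "\<forall>x. hasgrad N f x (\<lambda>l. G l x)"
    using polyd_grad[OF assms(1)] by blast
  have "pd l f = G l" by (rule ext, rule hasgrad_pd[OF G(3)[rule_format] assms(2)])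
  then show "polyd N (D - 1) (pd l f)" "D = 0 \<Longrightarrow> pd l f x = 0" using G(1,2) by simp_all
qed

lemma hasgrad_polyf: "polyf N f \<Longrightarrow> hasgrad N f x (\<lambda>l. pd l f x)"
proof -
  assume "polyf N f"
  then obtain D where "polyd N D f" unfolding polyf_def by auto
  from polyd_grad[OF this] obtain G where G: "\<forall>x. hasgrad N f x (\<lambda>l. G l x)" by blast
  show ?thesis
    by (rule hasgrad_cong[OF G[rule_format]]) (simp add: hasgrad_pd[OF G[rule_format]])
qed

lemma polyf_pd [simp, intro]: "polyf N f \<Longrightarrow> polyf N (pd l f)"
proof (cases "l < N")
  case True
  assume "polyf N f"
  then obtain D where "polyd N D f" unfolding polyf_def by auto
  from polyd_pd(1)[OF this True] show ?thesis unfolding polyf_def by (rule exI)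
next
  case False
  assume "polyf N f"
  have f: "f (x(l := t)) = f x" for x t
    by (rule polyf_cong[OF \<open>polyf N f\<close>]) (use False in auto)
  have "pd l f x = 0" for x by (rule pd_eqI) (unfold f, rule DERIV_const)
  then have "pd l f = (\<lambda>_. 0)" by (rule ext)
  then show ?thesis by simp
qed

subsection \<open>Homogeneous components\<close>

text \<open>The restriction of \<open>f\<close> to the orbit of \<open>x\<close> under weighted
  scaling. Reading homogeneous components off its coefficients avoids expanding \<open>f\<close>
  into monomials. Weights are general because both the total degree and the degree in a single
  coordinate are needed.\<close>

definition scaling_poly :: "(nat \<Rightarrow> nat) \<Rightarrow> ((nat \<Rightarrow> complex) \<Rightarrow> complex) \<Rightarrow> (nat \<Rightarrow> complex) \<Rightarrow> complex poly" where
  "scaling_poly w f x = (THE p. \<forall>t. poly p t = f (\<lambda>i. t ^ w i * x i))"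

text \<open>\<open>hc w k f\<close> is the component of \<open>f\<close> of degree \<open>k\<close> if the coordinate \<open>x\<^sub>i\<close> has weight \<open>w i\<close>.\<close>

definition hc :: "(nat \<Rightarrow> nat) \<Rightarrow> nat \<Rightarrow> ((nat \<Rightarrow> complex) \<Rightarrow> complex) \<Rightarrow> (nat \<Rightarrow> complex) \<Rightarrow> complex" where
  "hc w k f x = coeff (scaling_poly w f x) k"

lemma scaling_poly_eqI:
  assumes "\<And>t. poly p t = f (\<lambda>i. t ^ w i * x i)"
  shows "scaling_poly w f x = p"
  unfolding scaling_poly_def
proof (rule the_equality)
  show "\<forall>t. poly p t = f (\<lambda>i. t ^ w i * x i)" using assms by blast
  fix q assume "\<forall>t. poly q t = f (\<lambda>i. t ^ w i * x i)"
  then have "poly q = poly p" using assms by (intro ext) simp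
  then show "q = p" by (simp add: poly_eq_poly_eq_iff)
qed

lemma poly_scaling_poly:
  assumes "polyf N f"
  shows "poly (scaling_poly w f x) t = f (\<lambda>i. t ^ w i * x i)"
proof -
  obtain p where p: "\<forall>t. poly p t = f (\<lambda>i. poly (monom (x i) (w i)) t)"
    using polyf_curve[OF assms, of "\<lambda>i. monom (x i) (w i)"] by blast
  then have "scaling_poly w f x = p" by (intro scaling_poly_eqI) (simp add: poly_monom mult.commute)
  then show ?thesis using p by (simp add: poly_monom mult.commute)
qed

lemma hc_cong:
  assumes "\<And>t. f (\<lambda>i. t ^ w i * x i) = g (\<lambda>i. t ^ w i * y i)"
  shows "hc w k f x = hc w k g y"
  unfolding hc_def scaling_poly_def assms ..

lemma hc_const: "hc w k (\<lambda>_. c) x = (if k = 0 then c else 0)"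
proof -
  have "scaling_poly w (\<lambda>_. c) x = [:c:]" by (rule scaling_poly_eqI) simp
  then show ?thesis unfolding hc_def by (simp add: coeff_pCons split: nat.split)
qed

lemma hc_add:
  assumes "polyf N f" "polyf N g"
  shows "hc w k (\<lambda>x. f x + g x) x = hc w k f x + hc w k g x"
proof -
  have "scaling_poly w (\<lambda>x. f x + g x) x = scaling_poly w f x + scaling_poly w g x"
    by (rule scaling_poly_eqI) (simp add: poly_scaling_poly[OF assms(1)] poly_scaling_poly[OF assms(2)])
  then show ?thesis unfolding hc_def by simp
qed

lemma hc_cmult:
  assumes "polyf N f"
  shows "hc w k (\<lambda>x. c * f x) x = c * hc w k f x"
proof -
  have "scaling_poly w (\<lambda>x. c * f x) x = smult c (scaling_poly w f x)"
    by (rule scaling_poly_eqI) (simp add: poly_scaling_poly[OF assms])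
  then show ?thesis unfolding hc_def by simp
qed

lemma hc_sum:
  assumes "finite I" "\<And>i. i \<in> I \<Longrightarrow> polyf N (f i)"
  shows "hc w k (\<lambda>x. \<Sum>i\<in>I. f i x) x = (\<Sum>i\<in>I. hc w k (f i) x)"
  using assms
proof (induction I rule: finite_induct)
  case empty
  then show ?case by (simp add: hc_const)
next
  case (insert i I)
  have "hc w k (\<lambda>x. f i x + (\<Sum>i\<in>I. f i x)) x = hc w k (f i) x + hc w k (\<lambda>x. \<Sum>i\<in>I. f i x) x"
    by (rule hc_add[of N]) (use insert in auto)
  then show ?case using insert by simp
qed

lemma hc_var_mult:
  assumes "polyf N f"
  shows "hc w k (\<lambda>x. x i * f x) x = (if w i \<le> k then x i * hc w (k - w i) f x else 0)"
proof -
  have "scaling_poly w (\<lambda>x. x i * f x) x = monom (x i) (w i) * scaling_poly w f x"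
    by (rule scaling_poly_eqI) (simp add: poly_monom poly_scaling_poly[OF assms] mult.commute)
  then show ?thesis unfolding hc_def by (simp add: coeff_monom_mult)
qed

lemma polyf_hc_bounded:
  assumes "polyf N f"
  shows "(\<forall>k. polyf N (hc w k f)) \<and> (\<exists>K. \<forall>k>K. \<forall>x. hc w k f x = 0)"
proof -
  obtain D where "polyd N D f" using assms unfolding polyf_def by auto
  then show ?thesis
  proof (induction rule: polyd.induct)
    case (const D c)
    have "polyf N (hc w k (\<lambda>_. c))" for k
    proof -
      have "hc w k (\<lambda>_. c) = (\<lambda>_. if k = 0 then c else 0)" by (rule ext) (rule hc_const)
      then show ?thesis by simp
    qed
    moreover have "\<forall>k>0. \<forall>x. hc w k (\<lambda>_. c) x = 0" by (simp add: hc_const)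
    ultimately show ?case by blast
  next
    case (step D f g i)
    have f: "polyf N f" and g: "polyf N g" using step.hyps unfolding polyf_def by blast+
    have eq: "hc w k (\<lambda>x. x i * f x + g x) x = (if w i \<le> k then x i * hc w (k - w i) f x else 0) + hc w k g x" for k x
      using hc_add[OF polyf_mult[OF polyf_var[OF step.hyps(3)] f] g] hc_var_mult[OF f] by simp
    have "polyf N (hc w k (\<lambda>x. x i * f x + g x))" for k
      using step.IH step.hyps(3) by (cases "w i \<le> k") (simp_all add: eq[abs_def])
    moreover obtain K L where KL: "\<forall>k>K. \<forall>x. hc w k f x = 0" "\<forall>k>L. \<forall>x. hc w k g x = 0"
      using step.IH by blast
    have "hc w k (\<lambda>x. x i * f x + g x) x = 0" if "k > K + L + w i" for k x
      unfolding eq using KL that by auto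
    ultimately show ?case by blast
  qed
qed

lemma polyf_hc [simp, intro]: "polyf N f \<Longrightarrow> polyf N (hc w k f)"
  using polyf_hc_bounded by blast

lemma hc_expand:
  assumes "polyf N f" "\<And>k. k > K \<Longrightarrow> hc w k f x = 0"
  shows "f (\<lambda>i. t ^ w i * x i) = (\<Sum>k\<le>K. t ^ k * hc w k f x)"
proof -
  have "degree (scaling_poly w f x) \<le> K"
    using assms(2) unfolding hc_def by (intro degree_le) auto
  then have "poly (scaling_poly w f x) t = (\<Sum>k\<le>K. coeff (scaling_poly w f x) k * t ^ k)"
    unfolding poly_altdef by (intro sum.mono_neutral_left) (auto simp: coeff_eq_0)
  then show ?thesis
    unfolding hc_def by (simp add: poly_scaling_poly[OF assms(1)] mult.commute)
qed

lemma hc_homogeneous: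
  assumes "polyf N f"
  shows "hc w k f (\<lambda>i. s ^ w i * x i) = s ^ k * hc w k f x"
proof -
  have "scaling_poly w f (\<lambda>i. s ^ w i * x i) = pcompose (scaling_poly w f x) [:0, s:]"
    by (rule scaling_poly_eqI)
      (simp add: poly_pcompose poly_scaling_poly[OF assms] power_mult_distrib mult.assoc)
  then show ?thesis unfolding hc_def by (simp add: coeff_pcompose_linear)
qed

lemma hc_nonzero:
  assumes "polyf N f" "f x \<noteq> 0"
  shows "\<exists>k. hc w k f x \<noteq> 0"
proof (rule ccontr)
  assume "\<not> ?thesis"
  then have "scaling_poly w f x = 0" unfolding hc_def by (intro poly_eqI) simp
  with poly_scaling_poly[OF assms(1), of w x 1] assms(2) show False by simp
qed

text \<open>With t = 1/s the components of degree below \<open>a\<close> acquire positive powers of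
  s, so only the one of degree \<open>a\<close> is left in the limit.\<close>

lemma hc_tendsto:
  assumes "polyf N f" "\<And>k. k > a \<Longrightarrow> hc w k f x = 0"
  shows "((\<lambda>s. s ^ a * f (\<lambda>i. (1 / s) ^ w i * x i)) \<longlongrightarrow> hc w a f x) (at 0)"
proof -
  have eq: "s ^ a * f (\<lambda>i. (1 / s) ^ w i * x i) = (\<Sum>k\<le>a. s ^ (a - k) * hc w k f x)" if "s \<noteq> 0" for s
  proof -
    have "s ^ a * ((1 / s) ^ k * hc w k f x) = s ^ (a - k) * hc w k f x" if "k \<le> a" for k
      using \<open>s \<noteq> 0\<close> that by (simp add: power_diff power_one_over field_simps)
    moreover have "f (\<lambda>i. (1 / s) ^ w i * x i) = (\<Sum>k\<le>a. (1 / s) ^ k * hc w k f x)"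
      by (rule hc_expand[OF assms])
    ultimately show ?thesis unfolding sum_distrib_left by (auto simp: sum_distrib_left intro!: sum.cong)
  qed
  have "((\<lambda>s. \<Sum>k\<le>a. s ^ (a - k) * hc w k f x) \<longlongrightarrow> (\<Sum>k\<le>a. 0 ^ (a - k) * hc w k f x)) (at 0)"
    by (intro tendsto_intros)
  moreover have "(\<Sum>k\<le>a. 0 ^ (a - k) * hc w k f x) = (\<Sum>k\<le>a. if k = a then hc w k f x else 0)"
    by (intro sum.cong) (auto simp: zero_power)
  ultimately have "((\<lambda>s. \<Sum>k\<le>a. s ^ (a - k) * hc w k f x) \<longlongrightarrow> hc w a f x) (at 0)" by simp
  then show ?thesis
    by (rule Lim_transform_eventually) (auto simp: eventually_at_filter eq)
qed

subsection \<open>Regular functions on a principal open set\<close>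

text \<open>The coordinate ring localised at \<open>q\<close>, as functions whose values matter only
  off the zeros of \<open>q\<close>. Allowing all powers of one fixed \<open>q\<close> makes the
  class closed under sums, products and partial derivatives.\<close>

definition reg :: "nat \<Rightarrow> ((nat \<Rightarrow> complex) \<Rightarrow> complex) \<Rightarrow> ((nat \<Rightarrow> complex) \<Rightarrow> complex) \<Rightarrow> bool" where
  "reg N q f \<longleftrightarrow> (\<exists>e p. polyf N p \<and> (\<forall>x. q x \<noteq> 0 \<longrightarrow> f x = p x / q x ^ e))"

lemma reg_polyf: "polyf N f \<Longrightarrow> reg N q f"
  unfolding reg_def by (intro exI[of _ 0] exI[of _ f]) simp

lemma reg_divide:
  assumes "polyf N f"
  shows "reg N q (\<lambda>x. f x / q x)"
  unfolding reg_def using assms by (intro exI[of _ 1] exI[of _ f]) simp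

lemma reg_cong: "reg N q f \<Longrightarrow> (\<And>x. q x \<noteq> 0 \<Longrightarrow> f x = g x) \<Longrightarrow> reg N q g"
  unfolding reg_def by metis

lemma reg_add:
  assumes "polyf N q" "reg N q f" "reg N q g"
  shows "reg N q (\<lambda>x. f x + g x)"
proof -
  obtain e p where f: "polyf N p" "\<And>x. q x \<noteq> 0 \<Longrightarrow> f x = p x / q x ^ e"
    using assms(2) unfolding reg_def by blast
  obtain d r where g: "polyf N r" "\<And>x. q x \<noteq> 0 \<Longrightarrow> g x = r x / q x ^ d"
    using assms(3) unfolding reg_def by blast
  have "polyf N (\<lambda>x. p x * q x ^ d + r x * q x ^ e)" using f(1) g(1) assms(1) by simp
  moreover have "f x + g x = (p x * q x ^ d + r x * q x ^ e) / q x ^ (e + d)" if "q x \<noteq> 0" for x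
    using f(2)[OF that] g(2)[OF that] that by (simp add: power_add field_simps)
  ultimately show ?thesis unfolding reg_def by blast
qed

lemma reg_mult:
  assumes "reg N q f" "reg N q g"
  shows "reg N q (\<lambda>x. f x * g x)"
proof -
  obtain e p where f: "polyf N p" "\<And>x. q x \<noteq> 0 \<Longrightarrow> f x = p x / q x ^ e"
    using assms(1) unfolding reg_def by blast
  obtain d r where g: "polyf N r" "\<And>x. q x \<noteq> 0 \<Longrightarrow> g x = r x / q x ^ d"
    using assms(2) unfolding reg_def by blast
  have "polyf N (\<lambda>x. p x * r x)" using f(1) g(1) by simp
  moreover have "f x * g x = (p x * r x) / q x ^ (e + d)" if "q x \<noteq> 0" for x
    using f(2)[OF that] g(2)[OF that] by (simp add: power_add)
  ultimately show ?thesis unfolding reg_def by blast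
qed

lemma reg_const: "reg N q (\<lambda>_. c)" by (rule reg_polyf) simp

lemma reg_sum:
  assumes "polyf N q" "\<And>i. i \<in> I \<Longrightarrow> reg N q (f i)"
  shows "reg N q (\<lambda>x. \<Sum>i\<in>I. f i x)"
  using assms(2)
proof (induction I rule: infinite_finite_induct)
  case (insert i I)
  then have "reg N q (\<lambda>x. f i x + (\<Sum>i\<in>I. f i x))" by (intro reg_add assms(1)) simp_all
  then show ?case using insert by simp
qed (simp_all add: reg_const)

lemma reg_prod:
  assumes "\<And>i. i \<in> I \<Longrightarrow> reg N q (f i)"
  shows "reg N q (\<lambda>x. \<Prod>i\<in>I. f i x)"
  using assms
proof (induction I rule: infinite_finite_induct)
  case (insert i I)
  then have "reg N q (\<lambda>x. f i x * (\<Prod>i\<in>I. f i x))" by (intro reg_mult) simp_all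
  then show ?case using insert by simp
qed (simp_all add: reg_const)

lemma reg_compose:
  assumes "polyf k F" "polyf N q" "\<And>i. i < k \<Longrightarrow> reg N q (g i)"
  shows "reg N q (\<lambda>x. F (\<lambda>i. g i x))"
  using assms(1)
proof (induction rule: polyf_induct)
  case (const c) show ?case by (rule reg_const)
next
  case (var i) then show ?case by (rule assms(3))
next
  case (add f g) then show ?case by (intro reg_add assms(2))
next
  case (mult f g) then show ?case by (intro reg_mult)
qed

lemma reg_cleared:
  assumes "reg N q f"
  shows "\<exists>p. polyf N p \<and> (\<forall>x. q x \<noteq> 0 \<longrightarrow> (f x = 0 \<longleftrightarrow> p x = 0))"
proof -
  obtain e p where f: "polyf N p" "\<And>x. q x \<noteq> 0 \<Longrightarrow> f x = p x / q x ^ e"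
    using assms unfolding reg_def by blast
  then show ?thesis by (intro exI[of _ p]) simp
qed

lemma reg_nonzero_common_finite:
  assumes "polyf N q" "q a \<noteq> 0" "finite I" "\<And>i. i \<in> I \<Longrightarrow> reg N q (f i)"
    "\<And>i. i \<in> I \<Longrightarrow> \<exists>x. q x \<noteq> 0 \<and> f i x \<noteq> 0"
  shows "\<exists>z. q z \<noteq> 0 \<and> (\<forall>i\<in>I. f i z \<noteq> 0)"
proof -
  have "\<forall>i\<in>I. \<exists>p. polyf N p \<and> (\<forall>x. q x \<noteq> 0 \<longrightarrow> (f i x = 0 \<longleftrightarrow> p x = 0))"
    using reg_cleared assms(4) by blast
  then obtain p where p: "\<forall>i\<in>I. polyf N (p i) \<and> (\<forall>x. q x \<noteq> 0 \<longrightarrow> (f i x = 0 \<longleftrightarrow> p i x = 0))"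
    by (rule bchoice[THEN exE])
  have 1: "polyf N (\<lambda>x. \<Prod>i\<in>I. p i x)" using p by (intro polyf_prod) blast
  obtain y where "\<forall>i\<in>I. p i y \<noteq> 0"
    using polyf_nonzero_common_finite[OF assms(3), of N p] p assms(5) by blast
  then have "(\<Prod>i\<in>I. p i y) \<noteq> 0" using assms(3) by simp
  from polyf_nonzero_common[OF 1 assms(1) this assms(2)]
  obtain z where z: "(\<Prod>i\<in>I. p i z) \<noteq> 0" "q z \<noteq> 0" by blast
  then have "\<forall>i\<in>I. p i z \<noteq> 0" using assms(3) by auto
  then show ?thesis using p z(2) by blast
qed

text \<open>The ring of regular functions has no zero divisors, because the principal open set is
  irreducible.\<close>

lemma reg_prod_zero:
  assumes "polyf N q" "reg N q f" "reg N q g" "\<And>x. q x \<noteq> 0 \<Longrightarrow> f x * g x = 0" "q a \<noteq> 0" "q b \<noteq> 0" "f a \<noteq> 0"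
  shows "g b = 0"
proof (rule ccontr)
  assume "g b \<noteq> 0"
  have "\<exists>z. q z \<noteq> 0 \<and> (\<forall>i\<in>{True, False}. (if i then f else g) z \<noteq> 0)"
    by (rule reg_nonzero_common_finite[OF assms(1,5)]) (use assms \<open>g b \<noteq> 0\<close> in auto)
  then show False using assms(4) by auto
qed

text \<open>Along a differentiable curve \<open>q\<close> is continuous, so it stays nonzero near
  the parameter in question and the two functions agree there.\<close>

lemma hasgrad_transform:
  assumes "hasgrad N h x G" "polyf N q" "q x \<noteq> 0" "\<And>y. q y \<noteq> 0 \<Longrightarrow> f y = h y"
  shows "hasgrad N f x G"
  unfolding hasgrad_def
proof (intro allI impI)
  fix c c' and t :: complex
  assume c: "c t = x" "\<forall>i<N. ((\<lambda>s. c s i) has_field_derivative c' i) (at t)"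
  have h: "((\<lambda>s. h (c s)) has_field_derivative (\<Sum>i<N. G i * c' i)) (at t)"
    by (rule hasgradD[OF assms(1), where c=c and t=t, OF c(1)]) (use c(2) in blast)
  have "((\<lambda>s. q (c s)) has_field_derivative (\<Sum>i<N. pd i q x * c' i)) (at t)"
    by (rule hasgradD[OF hasgrad_polyf[OF assms(2)], where c=c and t=t, OF c(1)]) (use c(2) in blast)
  then have "isCont (\<lambda>s. q (c s)) t" by (rule DERIV_isCont)
  then have "((\<lambda>s. q (c s)) \<longlongrightarrow> q (c t)) (nhds t)"
    using tendsto_at_iff_tendsto_nhds[of "\<lambda>s. q (c s)" t] unfolding isCont_def by blast
  then have "((\<lambda>s. q (c s)) \<longlongrightarrow> q x) (nhds t)" unfolding c(1) .
  then have "eventually (\<lambda>s. q (c s) \<noteq> 0) (nhds t)" using assms(3) by (rule tendsto_imp_eventually_ne)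
  then have "eventually (\<lambda>s. f (c s) = h (c s)) (nhds t)"
    by (rule eventually_mono) (rule assms(4))
  then show "((\<lambda>s. f (c s)) has_field_derivative (\<Sum>i<N. G i * c' i)) (at t)"
    using h by (rule iffD2[OF DERIV_cong_ev[OF refl _ refl]])
qed

text \<open>The last claim makes a gradient a function on all of \<open>nat\<close> with support
  below \<open>N\<close>, so the linear algebra of functions applies to it directly.\<close>

lemma reg_gradient:
  assumes "polyf N q" "reg N q f"
  shows "reg N q (pd l f)"
    and "q x \<noteq> 0 \<Longrightarrow> hasgrad N f x (\<lambda>l. pd l f x)"
    and "q x \<noteq> 0 \<Longrightarrow> l \<ge> N \<Longrightarrow> pd l f x = 0"
proof -
  obtain e p where f: "polyf N p" "\<And>x. q x \<noteq> 0 \<Longrightarrow> f x = p x / q x ^ e"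
    using assms(2) unfolding reg_def by blast
  have Q: "polyf N (\<lambda>x. q x ^ e)" using assms(1) by simp
  let ?G = "\<lambda>l x. (pd l p x * q x ^ e - p x * pd l (\<lambda>x. q x ^ e) x) / (q x ^ e)^2"
  have G: "hasgrad N f x (\<lambda>l. ?G l x)" if "q x \<noteq> 0" for x
    by (rule hasgrad_transform[OF hasgrad_divide[OF hasgrad_polyf[OF f(1)] hasgrad_polyf[OF Q]] assms(1) that f(2)])
      (use that in simp_all)
  show *: "hasgrad N f x (\<lambda>l. pd l f x)" if "q x \<noteq> 0" for x
    by (rule hasgrad_cong[OF G[OF that]]) (simp add: hasgrad_pd[OF G[OF that]])
  have z: "pd l f x = 0" if x: "q x \<noteq> 0" and l: "l \<ge> N" for l x
  proof (rule pd_eqI)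
    have "x i = (x(l := t)) i" if "i < N" for i t using l that by auto
    then have "p (x(l := t)) = p x" "q (x(l := t)) = q x" for t
      using polyf_cong[OF f(1), of x "x(l := t)"] polyf_cong[OF assms(1), of x "x(l := t)"] by auto
    then have "f (x(l := t)) = f x" for t using f(2)[OF x] f(2)[of "x(l := t)"] x by metis
    then have "(\<lambda>t. f (x(l := t))) = (\<lambda>_. f x)" by (intro ext)
    then show "((\<lambda>t. f (x(l := t))) has_field_derivative 0) (at (x l))" by simp
  qed
  then show "q x \<noteq> 0 \<Longrightarrow> l \<ge> N \<Longrightarrow> pd l f x = 0" .
  show "reg N q (pd l f)"
  proof (cases "l < N")
    case True
    have "polyf N (\<lambda>x. pd l p x * q x ^ e - p x * pd l (\<lambda>x. q x ^ e) x)"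
      using f(1) assms(1) Q by (intro polyf_diff polyf_mult polyf_pd)
    then have "reg N q (?G l)"
      unfolding reg_def power_mult[symmetric] by (intro exI[of _ "e * 2"]) blast
    then show ?thesis
      by (rule reg_cong) (simp add: hasgrad_pd[OF G True])
  next
    case False
    show ?thesis by (rule reg_cong[OF reg_const[of N q 0]]) (use z False in simp)
  qed
qed

subsection \<open>Linear independence of complex-valued functions\<close>

interpretation fs: vector_space "\<lambda>(c::complex) (v::'a \<Rightarrow> complex) x. c * v x"
  by unfold_locales (auto simp: algebra_simps)

interpretation fsp: vector_space_pair "\<lambda>(c::complex) (v::'a \<Rightarrow> complex) x. c * v x" "(*) :: complex \<Rightarrow> complex \<Rightarrow> complex"
  by unfold_locales (auto simp: algebra_simps)

lemma sum_apply: "(\<Sum>i\<in>I. f i) x = (\<Sum>i\<in>I. f i x)" for f :: "'b \<Rightarrow> 'a \<Rightarrow> complex"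
  by (induction I rule: infinite_finite_induct) auto

text \<open>Stated for indexed families and not for sets, so that coinciding vectors count as
  dependent.\<close>

definition indep :: "nat \<Rightarrow> (nat \<Rightarrow> 'a \<Rightarrow> complex) \<Rightarrow> bool" where
  "indep k v \<longleftrightarrow> (\<forall>c. (\<forall>x. (\<Sum>i<k. c i * v i x) = 0) \<longrightarrow> (\<forall>i<k. c i = 0))"

lemma indepI:
  assumes "\<And>c i. (\<And>x. (\<Sum>i<k. c i * v i x) = 0) \<Longrightarrow> i < k \<Longrightarrow> c i = 0"
  shows "indep k v"
  unfolding indep_def using assms by blast

lemma indepD: "indep k v \<Longrightarrow> (\<And>x. (\<Sum>i<k. c i * v i x) = 0) \<Longrightarrow> i < k \<Longrightarrow> c i = 0"
  unfolding indep_def by blast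

lemma indep_mono:
  assumes "indep K v" "k \<le> K"
  shows "indep k v"
proof (rule indepI)
  fix c i assume c: "\<And>x. (\<Sum>i<k. c i * v i x) = 0" and i: "i < k"
  have "(\<Sum>i<K. (if i < k then c i else 0) * v i x) = 0" for x
  proof -
    have "(\<Sum>i<K. (if i < k then c i else 0) * v i x) = (\<Sum>i<k. (if i < k then c i else 0) * v i x)"
      using assms(2) by (intro sum.mono_neutral_right) auto
    then show ?thesis using c by simp
  qed
  from indepD[OF assms(1) this, of i] i assms(2) show "c i = 0" by simp
qed

lemma indep_image:
  assumes "indep k v"
  shows "inj_on v {..<k}" and "fs.independent (v ` {..<k})"
proof -
  show inj: "inj_on v {..<k}"
  proof (rule inj_onI, rule ccontr)
    fix i j assume ij: "i \<in> {..<k}" "j \<in> {..<k}" "v i = v j" "i \<noteq> j"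
    let ?c = "\<lambda>l. (if l = i then 1 else 0) - (if l = j then 1 else 0) :: complex"
    have "(\<Sum>l<k. ?c l * v l x) = 0" for x
    proof -
      have "(\<Sum>l<k. ?c l * v l x) = (\<Sum>l<k. if l = i then v l x else 0) - (\<Sum>l<k. if l = j then v l x else 0)"
        unfolding sum_subtractf[symmetric] by (intro sum.cong) auto
      then show ?thesis using ij by simp
    qed
    from indepD[OF assms this, of i] ij show False by simp
  qed
  show "fs.independent (v ` {..<k})"
  proof (rule fs.independent_if_scalars_zero)
    fix f w assume s: "(\<Sum>w\<in>v ` {..<k}. (\<lambda>x. f w * w x)) = 0" and w: "w \<in> v ` {..<k}"
    have "(\<Sum>i<k. f (v i) * v i x) = 0" for x
      using fun_cong[OF s, of x] by (simp add: sum_apply sum.reindex[OF inj])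
    from indepD[OF assms this] w show "f w = 0" by auto
  qed simp
qed

lemma indep_span_le:
  assumes "indep k v" "finite B" "\<And>i. i < k \<Longrightarrow> v i \<in> fs.span B"
  shows "k \<le> card B"
proof -
  have "card (v ` {..<k}) \<le> card B"
    using fs.independent_span_bound[OF assms(2) indep_image(2)[OF assms(1)]] assms(3) by auto
  then show ?thesis using card_image[OF indep_image(1)[OF assms(1)]] by simp
qed

text \<open>Only upper bounds on ranks are compared, and a small spanning set is the convenient
  certificate for them.\<close>

definition rank_le :: "nat \<Rightarrow> ('a \<Rightarrow> complex) set \<Rightarrow> bool" where
  "rank_le d V \<longleftrightarrow> (\<exists>B. finite B \<and> card B \<le> d \<and> V \<subseteq> fs.span B)"

lemma rank_leI: "finite B \<Longrightarrow> card B \<le> d \<Longrightarrow> V \<subseteq> fs.span B \<Longrightarrow> rank_le d V"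
  unfolding rank_le_def by blast

text \<open>A maximal independent subset spans, so it has more than \<open>d\<close> elements;
  \<open>h\<close> selects indices for \<open>Suc d\<close> of them.\<close>

lemma not_rank_le_indep:
  fixes v :: "nat \<Rightarrow> 'a \<Rightarrow> complex"
  assumes "\<not> rank_le d (v ` {..<m})"
  shows "\<exists>h. (\<forall>i\<le>d. h i < m) \<and> indep (Suc d) (\<lambda>i. v (h i))"
proof -
  obtain B where B: "B \<subseteq> v ` {..<m}" "fs.independent B" "v ` {..<m} \<subseteq> fs.span B"
    using fs.maximal_independent_subset .
  have fin: "finite B" using B(1) by (rule finite_subset) simp
  have "Suc d \<le> card B"
  proof (rule ccontr)
    assume "\<not> Suc d \<le> card B"
    then have "rank_le d (v ` {..<m})" using fin B(3) by (intro rank_leI[of B]) simp_all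
    with assms show False by (rule notE)
  qed
  then obtain S where S: "S \<subseteq> B" "card S = Suc d" "finite S" using obtain_subset_with_card_n by blast
  obtain g where g: "bij_betw g {..<Suc d} S"
    using ex_bij_betw_nat_finite[OF S(3)] S(2) by (auto simp: atLeast0LessThan)
  have gS: "\<forall>i\<in>{..<Suc d}. g i \<in> S" using g by (auto simp: bij_betw_def)
  have "\<forall>i\<in>{..<Suc d}. \<exists>j. j < m \<and> v j = g i"
  proof
    fix i assume "i \<in> {..<Suc d}"
    then have "g i \<in> v ` {..<m}" using gS S(1) B(1) by blast
    then show "\<exists>j. j < m \<and> v j = g i" by auto
  qed
  then obtain h where h: "\<forall>i\<in>{..<Suc d}. h i < m \<and> v (h i) = g i" by (rule bchoice[THEN exE])
  have "indep (Suc d) (\<lambda>i. v (h i))"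
  proof (rule indepI)
    fix c i assume c: "\<And>x. (\<Sum>i<Suc d. c i * v (h i) x) = 0" and i: "i < Suc d"
    let ?u = "\<lambda>w. c (the_inv_into {..<Suc d} g w)"
    have u: "?u (g j) = c j" if "j < Suc d" for j
      using the_inv_into_f_f[of g "{..<Suc d}" j] g that by (simp add: bij_betw_def)
    have "(\<Sum>w\<in>S. ?u w * w x) = (\<Sum>j<Suc d. c j * v (h j) x)" for x
    proof -
      have "(\<Sum>w\<in>S. ?u w * w x) = (\<Sum>j<Suc d. ?u (g j) * g j x)"
        by (rule sum.reindex_bij_betw[OF g, symmetric])
      also have "\<dots> = (\<Sum>j<Suc d. c j * v (h j) x)"
      proof (rule sum.cong[OF refl])
        fix j assume "j \<in> {..<Suc d}"
        then have "?u (g j) = c j" "v (h j) = g j" using u h by blast+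
        then show "?u (g j) * g j x = c j * v (h j) x" by (simp only:)
      qed
      finally show ?thesis .
    qed
    then have "(\<Sum>w\<in>S. (\<lambda>x. ?u w * w x)) = 0"
      by (intro ext) (simp only: sum_apply c zero_fun_apply)
    from fs.independentD[OF B(2) S(3,1) this, of "g i"] gS i have "?u (g i) = 0" by blast
    then show "c i = 0" unfolding u[OF i] .
  qed
  then show ?thesis using h by (intro exI[of _ h]) auto
qed

lemma rank_le_mono: "rank_le d V \<Longrightarrow> W \<subseteq> fs.span V \<Longrightarrow> rank_le d W"
proof -
  assume "rank_le d V" and W: "W \<subseteq> fs.span V"
  then obtain B where B: "finite B" "card B \<le> d" "V \<subseteq> fs.span B" unfolding rank_le_def by blast
  have "fs.span V \<subseteq> fs.span B" by (rule fs.span_minimal[OF B(3) fs.subspace_span])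
  then show ?thesis using B W by (intro rank_leI[of B]) auto
qed

lemma rank_le_insert: "rank_le d V \<Longrightarrow> rank_le (Suc d) (insert a V)"
proof -
  assume "rank_le d V"
  then obtain B where B: "finite B" "card B \<le> d" "V \<subseteq> fs.span B" unfolding rank_le_def by blast
  have "insert a V \<subseteq> fs.span (insert a B)"
    using B(3) fs.span_mono[of B "insert a B"] by (auto intro: fs.span_base)
  moreover have "card (insert a B) \<le> Suc d" using B card_insert_le_m1[of "Suc d" B a] by simp
  ultimately show ?thesis using B(1) unfolding rank_le_def by blast
qed

text \<open>The linear functional given by \<open>b\<close> vanishes on \<open>W\<close> but not at
  \<open>v\<close>, so \<open>v\<close> enlarges any basis of the span of \<open>W\<close> inside
  the span of \<open>V\<close>.\<close>

lemma rank_le_hyperplane: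
  assumes "rank_le d V" "W \<subseteq> fs.span V" "v \<in> fs.span V"
    and L: "\<And>w. w \<in> W \<Longrightarrow> (\<Sum>l\<in>I. w l * b l) = 0" "(\<Sum>l\<in>I. v l * b l) \<noteq> 0"
  shows "d > 0 \<and> rank_le (d - 1) W"
proof -
  obtain B where B: "finite B" "card B \<le> d" "V \<subseteq> fs.span B" using assms(1) unfolding rank_le_def by blast
  obtain C where C: "C \<subseteq> W" "fs.independent C" "W \<subseteq> fs.span C"
    using fs.maximal_independent_subset .
  have sp: "fs.span V \<subseteq> fs.span B" by (rule fs.span_minimal[OF B(3) fs.subspace_span])
  have LC: "(\<Sum>l\<in>I. w l * b l) = 0" if "w \<in> fs.span C" for w
    using that
  proof (induction rule: fs.span_induct_alt)
    case (step c x y)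
    have 1: "(\<Sum>l\<in>I. x l * b l) = 0" using step.hyps C(1) by (intro L(1)) blast
    have "(\<Sum>l\<in>I. ((\<lambda>m. c * x m) + y) l * b l) = (\<Sum>l\<in>I. c * (x l * b l) + y l * b l)"
      by (intro sum.cong refl) (simp add: distrib_right)
    also have "\<dots> = c * (\<Sum>l\<in>I. x l * b l) + (\<Sum>l\<in>I. y l * b l)"
      by (simp only: sum.distrib sum_distrib_left)
    also have "\<dots> = 0" unfolding 1 step.IH by simp
    finally show ?case .
  qed simp
  have v: "v \<notin> fs.span C"
  proof
    assume "v \<in> fs.span C"
    from LC[OF this] L(2) show False by (rule notE[rotated])
  qed
  have "fs.independent (insert v C)" by (rule fs.independent_insertI[OF v C(2)])
  moreover have "insert v C \<subseteq> fs.span B" using assms(2,3) C(1) sp by blast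
  ultimately have "finite (insert v C) \<and> card (insert v C) \<le> card B"
    by (rule fs.independent_span_bound[OF B(1)])
  then have *: "finite (insert v C)" "card (insert v C) \<le> card B" by (rule conjunct1, rule conjunct2)
  have "v \<notin> C" using v fs.span_base by blast
  then have "Suc (card C) \<le> d" using * B(2) by simp
  moreover have "finite C" using *(1) by simp
  ultimately show ?thesis using C(3) by (intro conjI rank_leI[of C]) simp_all
qed

text \<open>The determinant of the pairings of the vectors \<open>a i\<close> with test vectors
  \<open>b j\<close>. The Leibniz sum shows at once that it is regular, and continuous, in the
  entries of \<open>a\<close>.\<close>

definition gram :: "nat \<Rightarrow> nat \<Rightarrow> (nat \<Rightarrow> nat \<Rightarrow> complex) \<Rightarrow> (nat \<Rightarrow> nat \<Rightarrow> complex) \<Rightarrow> complex" where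
  "gram k N a b = (\<Sum>p | p permutes {0..<k}. signof p * (\<Prod>i=0..<k. \<Sum>l<N. a i l * b (p i) l))"

lemma gram_det: "gram k N a b = det (mat k k (\<lambda>(i, j). \<Sum>l<N. a i l * b j l))"
proof -
  have "(\<Prod>i=0..<k. mat k k (\<lambda>(i, j). \<Sum>l<N. a i l * b j l) $$ (i, p i)) = (\<Prod>i=0..<k. \<Sum>l<N. a i l * b (p i) l)"
    if "p permutes {0..<k}" for p
    by (rule prod.cong) (use permutes_in_image[OF that] in auto)
  then show ?thesis unfolding gram_def
    by (subst det_def'[of _ k]) (auto intro!: sum.cong)
qed

text \<open>A linear relation among the \<open>a i\<close> is a kernel vector of the transposed
  matrix of pairings.\<close>

lemma gram_nonzero_indep:
  assumes "gram k N a b \<noteq> 0"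
  shows "indep k a"
proof (rule indepI)
  fix c i assume c: "\<And>x. (\<Sum>i<k. c i * a i x) = 0" and i: "i < k"
  let ?M = "mat k k (\<lambda>(i, j). \<Sum>l<N. a i l * b j l)"
  have M: "?M\<^sup>T \<in> carrier_mat k k" by simp
  have "det ?M\<^sup>T = det ?M" by (rule det_transpose[of _ k]) simp
  then have det: "det ?M\<^sup>T \<noteq> 0" using assms unfolding gram_det by (simp only: not_False_eq_True)
  have zero: "?M\<^sup>T *\<^sub>v vec k c = 0\<^sub>v k"
  proof (rule eq_vecI)
    fix j assume "j < dim_vec (0\<^sub>v k :: complex vec)"
    then have j: "j < k" by simp
    have "(?M\<^sup>T *\<^sub>v vec k c) $ j = (\<Sum>i<k. (\<Sum>l<N. a i l * b j l) * c i)"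
      using j by (simp add: scalar_prod_def atLeast0LessThan)
    also have "\<dots> = (\<Sum>l<N. (\<Sum>i<k. c i * a i l) * b j l)"
      unfolding sum_distrib_right by (subst sum.swap) (intro sum.cong refl, simp)
    also have "\<dots> = 0" unfolding c by simp
    finally show "(?M\<^sup>T *\<^sub>v vec k c) $ j = 0\<^sub>v k $ j" using j by simp
  qed simp
  have "vec k c = 0\<^sub>v k"
  proof (rule ccontr)
    assume "vec k c \<noteq> 0\<^sub>v k"
    then have "det ?M\<^sup>T = 0"
      by (intro iffD2[OF det_0_iff_vec_prod_zero[OF M]] exI[of _ "vec k c"] conjI zero vec_carrier)
    with det show False by (rule notE)
  qed
  then have "vec k c $ i = 0\<^sub>v k $ i" by (rule arg_cong)
  then show "c i = 0" using i by simp
qed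

text \<open>The functional dual to \<open>a j\<close> is extended to all functions and evaluated at
  the unit vectors; as the \<open>a i\<close> have support below \<open>N\<close>, these values
  determine it on them.\<close>

lemma indep_dual:
  fixes N :: nat
  assumes "indep k a" "\<And>i l. i < k \<Longrightarrow> l \<ge> N \<Longrightarrow> a i l = 0"
  shows "\<exists>b. \<forall>i<k. \<forall>j<k. (\<Sum>l<N. a i l * b j l) = (if i = j then 1 else 0)"
proof -
  note inj = indep_image(1)[OF assms(1)]
  let ?e = "\<lambda>l m. if m = l then 1 else (0::complex)"
  have "\<exists>b. \<forall>i<k. (\<Sum>l<N. a i l * b l) = (if i = j then 1 else 0)" for j
  proof -
    obtain g where g: "Vector_Spaces.linear (\<lambda>(c::complex) v x. c * v x) (*) g"
      "\<forall>x\<in>a ` {..<k}. g x = (if x = a j then 1 else 0)"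
      using fsp.linear_independent_extend[OF indep_image(2)[OF assms(1)], where f="\<lambda>x. if x = a j then 1 else 0"] by blast
    interpret g: Vector_Spaces.linear "\<lambda>(c::complex) v x. c * v x" "(*)" g by (rule g(1))
    show ?thesis
    proof (cases "j < k")
      case True
      have "(\<Sum>l<N. a i l * g (?e l)) = (if i = j then 1 else 0)" if i: "i < k" for i
      proof -
        have "a i = (\<Sum>l<N. (\<lambda>m. a i l * ?e l m))"
        proof
          fix m
          have "(\<Sum>l<N. a i l * ?e l m) = (\<Sum>l<N. if l = m then a i l else 0)" by (intro sum.cong) auto
          also have "\<dots> = (if m < N then a i m else 0)"
            by (simp only: sum.delta finite_lessThan lessThan_iff)
          also have "\<dots> = a i m" using assms(2)[OF i, of m] by (cases "m < N") simp_all
          finally show "a i m = (\<Sum>l<N. (\<lambda>m. a i l * ?e l m)) m" by (simp only: sum_apply)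
        qed
        then have "g (a i) = g (\<Sum>l<N. (\<lambda>m. a i l * ?e l m))" by (rule arg_cong)
        also have "\<dots> = (\<Sum>l<N. a i l * g (?e l))" by (simp only: g.sum g.scale)
        finally have "g (a i) = (\<Sum>l<N. a i l * g (?e l))" .
        moreover have "g (a i) = (if a i = a j then 1 else 0)" using g(2) i by simp
        moreover have "a i = a j \<longleftrightarrow> i = j" using inj_on_eq_iff[OF inj, of i j] i True by simp
        ultimately show ?thesis by simp
      qed
      then show ?thesis by (intro exI[of _ "\<lambda>l. g (?e l)"] allI impI)
    next
      case False
      then show ?thesis by (intro exI[of _ "\<lambda>_. 0"]) auto
    qed
  qed
  then have "\<forall>j. \<exists>b. \<forall>i<k. (\<Sum>l<N. a i l * b l) = (if i = j then 1 else 0)" by (rule allI)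
  then obtain b where "\<forall>j. \<forall>i<k. (\<Sum>l<N. a i l * b j l) = (if i = j then 1 else 0)"
    by (rule choice[THEN exE])
  then show ?thesis by (intro exI[of _ b]) blast
qed

lemma gram_dual:
  assumes "\<forall>i<k. \<forall>j<k. (\<Sum>l<N. a i l * b j l) = (if i = j then 1 else 0)"
  shows "gram k N a b = 1"
proof -
  have "mat k k (\<lambda>(i, j). \<Sum>l<N. a i l * b j l) = 1\<^sub>m k"
    using assms by (intro eq_matI) auto
  then show ?thesis by (simp add: gram_det)
qed

text \<open>If one of the \<open>K\<close> vectors depended on the others, fewer than
  \<open>N\<close> vectors would span \<open>N\<close> independent unit vectors.\<close>

lemma spanning_indep:
  assumes "\<And>j. j < N \<Longrightarrow> (\<lambda>l. if l = j then 1 else 0) \<in> fs.span (v ` {..<K})" "K \<le> N"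
  shows "indep K (v :: nat \<Rightarrow> nat \<Rightarrow> complex)"
proof (rule ccontr)
  assume "\<not> ?thesis"
  then obtain c i where c: "\<And>x. (\<Sum>i<K. c i * v i x) = 0" and i: "i < K" "c i \<noteq> 0"
    unfolding indep_def by blast
  let ?B = "v ` ({..<K} - {i})"
  have "v i = (\<Sum>j\<in>{..<K} - {i}. (\<lambda>x. (- c j / c i) * v j x))"
  proof
    fix x
    have "c i * v i x + (\<Sum>j\<in>{..<K} - {i}. c j * v j x) = 0"
      using c[of x] sum.remove[of "{..<K}" i "\<lambda>j. c j * v j x"] i(1) by simp
    then have "v i x = - (\<Sum>j\<in>{..<K} - {i}. c j * v j x) / c i"
      using i(2) by (simp add: field_simps add_eq_0_iff)
    also have "\<dots> = (\<Sum>j\<in>{..<K} - {i}. (- c j / c i) * v j x)"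
      by (simp add: sum_divide_distrib sum_negf)
    finally show "v i x = (\<Sum>j\<in>{..<K} - {i}. (\<lambda>x. (- c j / c i) * v j x)) x" by (simp add: sum_apply)
  qed
  moreover have "(\<Sum>j\<in>{..<K} - {i}. (\<lambda>x. (- c j / c i) * v j x)) \<in> fs.span ?B"
    by (intro fs.span_sum fs.span_scale fs.span_base) blast
  ultimately have "v i \<in> fs.span ?B" by (simp only:)
  moreover have "v j \<in> fs.span ?B" if "j < K" "j \<noteq> i" for j using that by (intro fs.span_base) blast
  ultimately have "v ` {..<K} \<subseteq> fs.span ?B" by blast
  then have sp: "fs.span (v ` {..<K}) \<subseteq> fs.span ?B" by (rule fs.span_minimal[OF _ fs.subspace_span])
  have "indep N (\<lambda>j l. if l = j then 1 else 0 :: complex)"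
  proof (rule indepI)
    fix d :: "nat \<Rightarrow> complex" and j
    assume d: "\<And>x. (\<Sum>i<N. d i * (if x = i then 1 else 0)) = 0" and j: "j < N"
    have "(\<Sum>i<N. d i * (if j = i then 1 else 0)) = (\<Sum>i<N. if i = j then d i else 0)" by (intro sum.cong) auto
    then show "d j = 0" using d[of j] j by simp
  qed
  then have "N \<le> card ?B" by (rule indep_span_le) (use assms(1) sp in auto)
  also have "card ?B \<le> card ({..<K} - {i})" by (rule card_image_le) simp
  also have "\<dots> < K" using i(1) by simp
  finally show False using assms(2) by simp
qed

subsection \<open>Algebraic independence and the Jacobian criterion\<close>

text \<open>Independence of the restrictions to \<open>A\<close>. A relation \<open>F\<close> is a
  function, and over the complex numbers the zero function is the zero polynomial.\<close>

definition algindep :: "nat \<Rightarrow> (nat \<Rightarrow> 'a \<Rightarrow> complex) \<Rightarrow> 'a set \<Rightarrow> bool" where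
  "algindep k g A \<longleftrightarrow> (\<forall>F. polyf k F \<longrightarrow> (\<forall>x\<in>A. F (\<lambda>i. g i x) = 0) \<longrightarrow> (\<forall>y. F y = 0))"

lemma algindepD: "algindep k g A \<Longrightarrow> polyf k F \<Longrightarrow> (\<And>x. x \<in> A \<Longrightarrow> F (\<lambda>i. g i x) = 0) \<Longrightarrow> F y = 0"
  unfolding algindep_def by blast

lemma algindep_cong:
  assumes "algindep k g A" "\<And>i x. i < k \<Longrightarrow> x \<in> A \<Longrightarrow> g i x = h i x"
  shows "algindep k h A"
  unfolding algindep_def
proof (intro allI impI)
  fix F y assume F: "polyf k F" "\<forall>x\<in>A. F (\<lambda>i. h i x) = 0"
  show "F y = 0"
  proof (rule algindepD[OF assms(1) F(1)])
    fix x assume x: "x \<in> A"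
    have "F (\<lambda>i. g i x) = F (\<lambda>i. h i x)" by (rule polyf_cong[OF F(1) assms(2)[OF _ x]])
    then show "F (\<lambda>i. g i x) = 0" using F(2) x by simp
  qed
qed

text \<open>By the chain rule the univariate restriction has derivative zero, and in characteristic
  0 it is then constant.\<close>

lemma polyf_const_along_curve:
  assumes "polyf N F" "\<And>t. (\<Sum>i<N. pd i F (\<lambda>i. poly (c i) t) * poly (pderiv (c i)) t) = 0"
  shows "F (\<lambda>i. poly (c i) s) = F (\<lambda>i. poly (c i) t)"
proof -
  obtain p where p: "\<forall>t. poly p t = F (\<lambda>i. poly (c i) t)"
    using polyf_curve[OF assms(1), of c] by blast
  have pe: "poly p = (\<lambda>t. F (\<lambda>i. poly (c i) t))" by (rule ext) (rule p[THEN spec])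
  have "poly (pderiv p) t = 0" for t
  proof -
    have "((\<lambda>s. F (\<lambda>i. poly (c i) s)) has_field_derivative
        (\<Sum>i<N. pd i F (\<lambda>i. poly (c i) t) * poly (pderiv (c i)) t)) (at t)"
      by (rule hasgradD[OF hasgrad_polyf[OF assms(1)], where c="\<lambda>s i. poly (c i) s" and t=t])
        (rule refl, rule poly_DERIV)
    then have "(poly p has_field_derivative 0) (at t)" unfolding assms(2) pe .
    then show ?thesis by (rule DERIV_unique[OF poly_DERIV])
  qed
  then have "pderiv p = 0" by (intro iffD1[OF poly_all_0_iff_0] allI)
  then have "degree p = 0" by (simp add: pderiv_eq_0_iff)
  then obtain c where "p = [:c:]" by (rule degree_eq_zeroE)
  then have "poly p s = poly p t" by simp
  then show ?thesis unfolding pe .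
qed

lemma polyf_pd_zero_const:
  assumes "polyf N F" "\<And>j y. j < N \<Longrightarrow> pd j F y = 0"
  shows "F x = F y"
  using polyf_const_along_curve[OF assms(1), of "\<lambda>i. [:x i, y i - x i:]" 0 1] assms(2) by simp

lemma polyf_pd_zero_upd:
  assumes "polyf N F" "\<And>y. pd l F y = 0"
  shows "F y = F (y(l := 0))"
proof -
  let ?c = "\<lambda>i. if i = l then [:0, 1:] else [:y i:]"
  have c: "(\<lambda>i. poly (?c i) t) = y(l := t)" for t by (rule ext) simp
  have "F (\<lambda>i. poly (?c i) (y l)) = F (\<lambda>i. poly (?c i) 0)"
    by (rule polyf_const_along_curve[OF assms(1)])
      (rule sum.neutral, simp add: assms(2) pderiv_pCons)
  then show ?thesis unfolding c by simp
qed

lemma reg_gram: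
  assumes "polyf N q" "\<And>i l. i < k \<Longrightarrow> reg N q (a i l)"
  shows "reg N q (\<lambda>x. gram k M (\<lambda>i l. a i l x) b)"
  unfolding gram_def
  by (intro reg_sum reg_mult reg_const reg_prod assms) simp

text \<open>Differentiating an algebraic relation by the chain rule yields a linear relation among
  the gradients, with the partial derivatives of \<open>F\<close> as coefficients.\<close>

lemma relation_gradient:
  assumes q: "polyf N q" "q x \<noteq> 0" and g: "\<And>i. i < k \<Longrightarrow> reg N q (g i)"
    and F: "polyf k F" "\<And>x. q x \<noteq> 0 \<Longrightarrow> F (\<lambda>i. g i x) = 0"
  shows "(\<Sum>i<k. pd i F (\<lambda>i. g i x) * pd l (g i) x) = 0"
proof (cases "l < N")
  case True
  have 1: "hasgrad N (\<lambda>x. F (\<lambda>i. g i x)) x (\<lambda>l. \<Sum>i<k. pd i F (\<lambda>i. g i x) * pd l (g i) x)"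
    by (rule hasgrad_compose[OF hasgrad_polyf[OF F(1)]]) (rule reg_gradient(2)[OF q(1) g q(2)])
  have 2: "hasgrad N (\<lambda>x. F (\<lambda>i. g i x)) x (\<lambda>_. 0)"
    by (rule hasgrad_transform[OF hasgrad_const q F(2)])
  show ?thesis using hasgrad_pd[OF 1 True] hasgrad_pd[OF 2 True] by (rule trans[OF sym])
next
  case False
  then show ?thesis using reg_gradient(3)[OF q(1) g q(2)] by (intro sum.neutral) simp
qed

text \<open>The easy half of the Jacobian criterion, by induction on the degree of a relation
  \<open>F\<close>. Its partial derivatives are relations of smaller degree, hence zero; so
  \<open>F\<close> is constant, and its value at the image of \<open>a\<close> is 0.\<close>

theorem algindep_if_gradients_indep:
  assumes q: "polyf N q" "q a \<noteq> 0" and g: "\<And>i. i < k \<Longrightarrow> reg N q (g i)"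
    and ind: "indep k (\<lambda>i l. pd l (g i) a)"
  shows "algindep k g {x. q x \<noteq> 0}"
proof -
  have supp: "pd l (g i) a = 0" if "i < k" "l \<ge> N" for i l
    using reg_gradient(3)[OF q(1) g[OF that(1)] q(2) that(2)] .
  obtain b where "\<forall>i<k. \<forall>j<k. (\<Sum>l<N. pd l (g i) a * b j l) = (if i = j then 1 else 0)"
    using indep_dual[OF ind, of N] supp by blast
  then have "gram k N (\<lambda>i l. pd l (g i) a) b = 1" by (rule gram_dual)
  then have ra: "gram k N (\<lambda>i l. pd l (g i) a) b \<noteq> 0" by simp
  let ?r = "\<lambda>x. gram k N (\<lambda>i l. pd l (g i) x) b"
  have r: "reg N q ?r" by (rule reg_gram[OF q(1)]) (rule reg_gradient(1)[OF q(1) g])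
  have main: "F y = 0" if "polyd k D F" "\<And>x. q x \<noteq> 0 \<Longrightarrow> F (\<lambda>i. g i x) = 0" for D F y
    using that
  proof (induction D arbitrary: F y)
    case (0 F y)
    have "polyf k F" using 0 unfolding polyf_def by blast
    then have "F y = F (\<lambda>i. g i a)" by (rule polyf_pd_zero_const) (rule polyd_pd(2)[OF 0(1)], simp_all)
    then show ?case using 0(2)[OF q(2)] by simp
  next
    case (Suc D F y)
    have F: "polyf k F" using Suc.prems unfolding polyf_def by blast
    have "pd j F z = 0" if j: "j < k" for j z
    proof (rule Suc.IH[of "pd j F"])
      show "polyd k D (pd j F)" using polyd_pd(1)[OF Suc.prems(1) j] by simp
      fix x assume x: "q x \<noteq> 0"
      \<comment> \<open>Where the Gram determinant is nonzero the gradients are independent and the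
        coefficient vanishes; irreducibility then removes the factor.\<close>
      have rp: "?r x * pd j F (\<lambda>i. g i x) = 0" if x: "q x \<noteq> 0" for x
      proof (cases "?r x = 0")
        case False
        have "pd j F (\<lambda>i. g i x) = 0"
          by (rule indepD[OF gram_nonzero_indep[OF False]
              relation_gradient[OF q(1) x g F Suc.prems(2)] j])
        then show ?thesis by simp
      qed simp
      have h: "reg N q (\<lambda>x. pd j F (\<lambda>i. g i x))" by (rule reg_compose[OF polyf_pd[OF F] q(1) g])
      show "pd j F (\<lambda>i. g i x) = 0"
        by (rule reg_prod_zero[OF q(1) r h rp q(2) x ra])
    qed
    then have "F y = F (\<lambda>i. g i a)" by (rule polyf_pd_zero_const[OF F])
    then show ?case using Suc.prems(2)[OF q(2)] by simp
  qed
  show ?thesis unfolding algindep_def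
  proof (intro allI impI)
    fix F y assume F: "polyf k F" "\<forall>x\<in>{x. q x \<noteq> 0}. F (\<lambda>i. g i x) = 0"
    then obtain D where "polyd k D F" unfolding polyf_def by blast
    then show "F y = 0" by (rule main) (use F(2) in simp)
  qed
qed

section \<open>Counting monomials: at most N independent functions of N variables\<close>

text \<open>Every single exponent is bounded by \<open>D\<close>, not the total degree: this larger
  set is counted at once and still small enough for the comparison below.\<close>

definition monoms :: "nat \<Rightarrow> nat \<Rightarrow> ((nat \<Rightarrow> complex) \<Rightarrow> complex) set" where
  "monoms N D = (\<lambda>e x. \<Prod>i<N. x i ^ e i) ` ({..<N} \<rightarrow>\<^sub>E {..D})"

lemma finite_monoms: "finite (monoms N D)"
  unfolding monoms_def by (intro finite_imageI finite_PiE) auto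

lemma card_monoms: "card (monoms N D) \<le> (D + 1) ^ N"
proof -
  have "card (monoms N D) \<le> card ({..<N} \<rightarrow>\<^sub>E {..D})"
    unfolding monoms_def by (intro card_image_le finite_PiE) auto
  then show ?thesis by (simp add: card_PiE)
qed

lemma monomsI:
  assumes "\<And>i. i < N \<Longrightarrow> e i \<le> D"
  shows "(\<lambda>x. \<Prod>i<N. x i ^ e i) \<in> monoms N D"
proof -
  have "(\<lambda>x :: nat \<Rightarrow> complex. \<Prod>i<N. x i ^ e i) = (\<lambda>x. \<Prod>i<N. x i ^ (restrict e {..<N}) i)"
    by (intro ext prod.cong) auto
  moreover have "restrict e {..<N} \<in> {..<N} \<rightarrow>\<^sub>E {..D}" using assms by auto
  ultimately show ?thesis unfolding monoms_def by (rule image_eqI)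
qed

lemma monoms_var_mult:
  assumes "f \<in> fs.span (monoms N D)" "j < N"
  shows "(\<lambda>x. x j * f x) \<in> fs.span (monoms N (Suc D))"
  using assms(1)
proof (induction rule: fs.span_induct_alt)
  case base
  have "(\<lambda>x :: nat \<Rightarrow> complex. x j * (0 :: (nat \<Rightarrow> complex) \<Rightarrow> complex) x) = 0" by (rule ext) simp
  then show ?case by (simp only: fs.span_zero)
next
  case (step c m g)
  obtain e where e: "e \<in> {..<N} \<rightarrow>\<^sub>E {..D}" "m = (\<lambda>x. \<Prod>i<N. x i ^ e i)"
    using step.hyps unfolding monoms_def by blast
  have "(\<lambda>x. x j * m x) = (\<lambda>x. \<Prod>i<N. x i ^ (e i + (if i = j then 1 else 0)))"
  proof
    fix x :: "nat \<Rightarrow> complex"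
    have "(\<Prod>i<N. x i ^ (e i + (if i = j then 1 else 0))) = (\<Prod>i<N. x i ^ e i) * (\<Prod>i<N. if i = j then x i else 1)"
      unfolding prod.distrib[symmetric] by (intro prod.cong refl) simp
    also have "(\<Prod>i<N. if i = j then x i else 1) = x j"
      using assms(2) by (simp only: prod.delta finite_lessThan lessThan_iff if_True)
    finally show "x j * m x = (\<Prod>i<N. x i ^ (e i + (if i = j then 1 else 0)))"
      unfolding e(2) by (simp only: mult.commute)
  qed
  moreover have "\<dots> \<in> monoms N (Suc D)"
    by (rule monomsI) (use e(1) in \<open>auto simp: PiE_iff intro: le_SucI\<close>)
  ultimately have m: "(\<lambda>x. x j * m x) \<in> fs.span (monoms N (Suc D))" by (simp only: fs.span_base)
  have "(\<lambda>x. x j * ((\<lambda>x. c * m x) + g) x) = (\<lambda>x. c * (x j * m x)) + (\<lambda>x. x j * g x)"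
    by (rule ext) (simp add: distrib_left)
  then show ?case using fs.span_add[OF fs.span_scale[OF m, of c] step.IH] by (simp only:)
qed

lemma polyd_span_monoms:
  assumes "polyd N D f"
  shows "f \<in> fs.span (monoms N D)"
  using assms
proof (induction rule: polyd.induct)
  case (const D c)
  have "(\<lambda>x. c * (\<Prod>i<N. x i ^ (\<lambda>_. 0) i)) \<in> fs.span (monoms N D)"
    by (intro fs.span_scale fs.span_base monomsI) simp
  then show ?case by simp
next
  case (step D f g i)
  have "(\<lambda>x. x i * f x + g x) = (\<lambda>x. x i * f x) + g" by (rule ext) simp
  then show ?case using fs.span_add[OF monoms_var_mult[OF step.IH(1) step.hyps(3)] step.IH(2)] by (simp only:)
qed

lemma polyd_power: "polyd N D f \<Longrightarrow> polyd N (D * e) (\<lambda>x. f x ^ e)"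
proof (induction e)
  case (Suc e)
  have "polyd N (D + D * e) (\<lambda>x. f x * f x ^ e)" by (rule polyd_mult[OF Suc.prems Suc.IH[OF Suc.prems]])
  then show ?case by simp
qed (simp add: polyd.const)

lemma polyd_prod:
  assumes "\<And>i. i < k \<Longrightarrow> polyd N D (f i)"
  shows "polyd N (k * D) (\<lambda>x. \<Prod>i<k. f i x)"
  using assms
proof (induction k)
  case (Suc k)
  have "polyd N (k * D + D) (\<lambda>x. (\<Prod>i<k. f i x) * f k x)"
    using Suc by (intro polyd_mult) simp_all
  then show ?case by (simp add: add.commute)
qed (simp add: polyd.const)

text \<open>Exponent vectors with entries below \<open>b\<close> are numbered by their base
  \<open>b\<close> expansions.\<close>

lemma digits_sum:
  fixes b :: nat
  assumes "u < b ^ k"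
  shows "(\<Sum>i<k. (u div b ^ i mod b) * b ^ i) = u"
  using assms
proof (induction k arbitrary: u)
  case (Suc k)
  have b: "b > 0" using Suc.prems by (cases "b = 0") auto
  have "u div b < b ^ k" using Suc.prems b by (simp add: less_mult_imp_div_less mult.commute)
  have "(\<Sum>i<Suc k. (u div b ^ i mod b) * b ^ i) = u mod b + (\<Sum>i<k. (u div b ^ Suc i mod b) * b ^ Suc i)"
    by (subst sum.lessThan_Suc_shift) simp
  also have "(\<Sum>i<k. (u div b ^ Suc i mod b) * b ^ Suc i) = b * (\<Sum>i<k. (u div b div b ^ i mod b) * b ^ i)"
    unfolding sum_distrib_left by (intro sum.cong refl) (simp add: div_mult2_eq)
  also have "\<dots> = b * (u div b)" using Suc.IH[OF \<open>u div b < b ^ k\<close>] by simp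
  finally show ?case by simp
qed simp

text \<open>A dimension count. The monomials in the \<open>g i\<close> with exponents at most
  \<open>B\<close>, brought to a common denominator, have numerators in a space of polynomials of
  dimension of order \<open>B ^ N\<close>; there are \<open>(B + 1) ^ k\<close> of them, too many if
  \<open>k > N\<close>.\<close>

theorem algindep_le:
  assumes q: "polyf N q" "q a \<noteq> 0" and g: "\<And>i. i < k \<Longrightarrow> reg N q (g i)"
    and ind: "algindep k g {x. q x \<noteq> 0}"
  shows "k \<le> N"
proof (rule ccontr)
  assume "\<not> k \<le> N"
  then have kN: "Suc N \<le> k" by simp
  have "\<forall>i\<in>{..<k}. \<exists>ep. polyf N (snd ep) \<and> (\<forall>x. q x \<noteq> 0 \<longrightarrow> g i x = snd ep x / q x ^ fst ep)"
    using g unfolding reg_def by simp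
  then obtain ep where ep: "\<forall>i\<in>{..<k}. polyf N (snd (ep i)) \<and> (\<forall>x. q x \<noteq> 0 \<longrightarrow> g i x = snd (ep i) x / q x ^ fst (ep i))"
    by (rule bchoice[THEN exE])
  define E where "E = (\<Sum>i<k. fst (ep i))"
  define Q where "Q = (\<lambda>x. q x ^ E)"
  define P where "P = (\<lambda>i x. snd (ep i) x * q x ^ (E - fst (ep i)))"
  have gP: "g i x = P i x / Q x" if "i < k" "q x \<noteq> 0" for i x
  proof -
    have "fst (ep i) \<le> E" unfolding E_def using that(1) by (intro member_le_sum) auto
    then have "Q x = q x ^ fst (ep i) * q x ^ (E - fst (ep i))" unfolding Q_def by (simp flip: power_add)
    then show ?thesis using ep that unfolding P_def by simp
  qed
  have Qp: "polyf N Q" unfolding Q_def using q(1) by simp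
  have "polyf N (P i)" if "i < k" for i unfolding P_def using ep that q(1) by simp
  then have "\<forall>i\<in>{..<k}. \<exists>D. polyd N D (P i)" unfolding polyf_def by simp
  then obtain DP where DP: "\<forall>i\<in>{..<k}. polyd N (DP i) (P i)" by (rule bchoice[THEN exE])
  obtain DQ where DQ: "polyd N DQ Q" using Qp unfolding polyf_def by blast
  define \<Delta> where "\<Delta> = Suc (DQ + (\<Sum>i<k. DP i))"
  have P\<Delta>: "polyd N \<Delta> (P i)" if "i < k" for i
  proof (rule polyd_mono)
    show "polyd N (DP i) (P i)" using DP that by simp
    have "DP i \<le> (\<Sum>i<k. DP i)" using that by (intro member_le_sum) auto
    then show "DP i \<le> \<Delta>" unfolding \<Delta>_def by simp
  qed
  have Q\<Delta>: "polyd N \<Delta> Q" by (rule polyd_mono[OF DQ]) (simp add: \<Delta>_def)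
  \<comment> \<open>With \<open>b = B + 1\<close> the numerator space has dimension at most
    \<open>(k * \<Delta> * b) ^ N = B * b ^ N\<close>, which is less than \<open>b ^ Suc N\<close>;
    this dictates the value of \<open>B\<close>.\<close>
  define B where "B = (k * \<Delta>) ^ N"
  define b where "b = Suc B"
  define dig where "dig = (\<lambda>u i. u div b ^ i mod b)"
  have dig_le: "dig u i \<le> B" for u i unfolding dig_def b_def by (simp add: less_Suc_eq_le[symmetric])
  \<comment> \<open>The numerator of the monomial with exponent vector \<open>dig u\<close> over the
    denominator \<open>Q ^ (B * k)\<close>, the same for all \<open>u\<close>.\<close>
  define v where "v = (\<lambda>u x. \<Prod>i<k. P i x ^ dig u i * Q x ^ (B - dig u i))"
  have "polyd N (k * (\<Delta> * B)) (v u)" for u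
    unfolding v_def
  proof (rule polyd_prod)
    fix i assume i: "i < k"
    have "polyd N (\<Delta> * dig u i + \<Delta> * (B - dig u i)) (\<lambda>x. P i x ^ dig u i * Q x ^ (B - dig u i))"
      by (intro polyd_mult polyd_power P\<Delta>[OF i] Q\<Delta>)
    moreover have "\<Delta> * dig u i + \<Delta> * (B - dig u i) = \<Delta> * B"
      using dig_le[of u i] by (simp add: distrib_left[symmetric])
    ultimately show "polyd N (\<Delta> * B) (\<lambda>x. P i x ^ dig u i * Q x ^ (B - dig u i))" by simp
  qed
  then have sp: "v u \<in> fs.span (monoms N (k * (\<Delta> * B)))" for u by (rule polyd_span_monoms)
  have k0: "k * \<Delta> \<ge> 1" using kN unfolding \<Delta>_def by (cases k) auto
  have "card (monoms N (k * (\<Delta> * B))) \<le> (k * (\<Delta> * B) + 1) ^ N" by (rule card_monoms)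
  also have "\<dots> \<le> (k * \<Delta> * b) ^ N"
    by (rule power_mono) (use k0 in \<open>simp_all add: b_def mult.assoc\<close>)
  also have "\<dots> = B * b ^ N" by (simp add: power_mult_distrib B_def)
  also have "\<dots> < b ^ Suc N" unfolding b_def by simp
  also have "\<dots> \<le> b ^ k" using kN by (intro power_increasing) (simp_all add: b_def)
  finally have "card (monoms N (k * (\<Delta> * B))) < b ^ k" .
  then have "\<not> indep (b ^ k) v"
    using indep_span_le[of "b ^ k" v "monoms N (k * (\<Delta> * B))", OF _ finite_monoms sp] by (meson not_less)
  then obtain c u0 where c: "\<And>x. (\<Sum>u<b ^ k. c u * v u x) = 0" and u0: "u0 < b ^ k" "c u0 \<noteq> 0"
    unfolding indep_def by blast
  define F where "F = (\<lambda>y :: nat \<Rightarrow> complex. \<Sum>u<b ^ k. c u * (\<Prod>i<k. y i ^ dig u i))"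
  have "polyf k F" unfolding F_def by (intro polyf_sum polyf_mult polyf_const polyf_prod polyf_power polyf_var) simp
  moreover have "F (\<lambda>i. g i x) = 0" if "x \<in> {x. q x \<noteq> 0}" for x
  proof -
    have x: "q x \<noteq> 0" "Q x \<noteq> 0" using that unfolding Q_def by auto
    have "(\<Prod>i<k. g i x ^ dig u i) = v u x / Q x ^ (B * k)" for u
    proof -
      have "(\<Prod>i<k. g i x ^ dig u i) * Q x ^ (B * k) = (\<Prod>i<k. g i x ^ dig u i * Q x ^ B)"
        by (simp add: prod.distrib power_mult)
      also have "\<dots> = v u x"
        unfolding v_def
      proof (rule prod.cong[OF refl])
        fix i assume "i \<in> {..<k}"
        then have "g i x ^ dig u i * Q x ^ B = (P i x / Q x) ^ dig u i * (Q x ^ dig u i * Q x ^ (B - dig u i))"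
          using gP[of i x] x(1) dig_le[of u i] by (simp flip: power_add)
        also have "\<dots> = P i x ^ dig u i * Q x ^ (B - dig u i)" using x(2) by (simp add: power_divide)
        finally show "g i x ^ dig u i * Q x ^ B = P i x ^ dig u i * Q x ^ (B - dig u i)" .
      qed
      finally show ?thesis using x(2) by (simp add: field_simps)
    qed
    then have "F (\<lambda>i. g i x) = (\<Sum>u<b ^ k. c u * v u x) / Q x ^ (B * k)"
      unfolding F_def by (simp add: sum_divide_distrib)
    then show ?thesis by (simp add: c)
  qed
  ultimately have F0: "F y = 0" for y by (rule algindepD[OF ind])
  \<comment> \<open>Kronecker substitution: at the point with coordinates \<open>t ^ (b ^ i)\<close>
    the monomial number \<open>u\<close> becomes \<open>t ^ u\<close>, so the zero function
    \<open>F\<close> has zero coefficients.\<close>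
  define p where "p = (\<Sum>u<b ^ k. monom (c u) u)"
  have "poly p t = 0" for t
  proof -
    have "F (\<lambda>i. t ^ (b ^ i)) = (\<Sum>u<b ^ k. c u * t ^ u)"
      unfolding F_def
    proof (rule sum.cong[OF refl])
      fix u assume "u \<in> {..<b ^ k}"
      then have "(\<Sum>i<k. b ^ i * dig u i) = u" using digits_sum[of u b k] by (simp add: dig_def mult.commute)
      then have "(\<Prod>i<k. (t ^ (b ^ i)) ^ dig u i) = t ^ u" by (simp flip: power_mult power_sum)
      then show "c u * (\<Prod>i<k. (t ^ (b ^ i)) ^ dig u i) = c u * t ^ u" by simp
    qed
    then show ?thesis using F0[of "\<lambda>i. t ^ (b ^ i)"] unfolding p_def by (simp add: poly_sum poly_monom)
  qed
  then have "p = 0" by (intro iffD1[OF poly_all_0_iff_0] allI)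
  then have "coeff p u0 = 0" by simp
  moreover have "coeff p u0 = c u0"
    unfolding p_def coeff_sum coeff_monom using u0(1) by (simp only: sum.delta finite_lessThan lessThan_iff if_True)
  ultimately show False using u0(2) by simp
qed

text \<open>The harder half of the Jacobian criterion. The \<open>g i\<close> are completed by
  coordinates to a transcendence basis of \<open>K \<le> N\<close> elements. Every coordinate is
  algebraic over it, and differentiating such relations at a general point puts all \<open>N\<close>
  unit vectors into the span of \<open>K\<close> gradients, which are therefore independent.\<close>

theorem gradients_indep_if_algindep:
  assumes q: "polyf N q" "q a \<noteq> 0" and g: "\<And>i. i < k \<Longrightarrow> reg N q (g i)"
    and ind: "algindep k g {x. q x \<noteq> 0}"
  shows "\<exists>x. q x \<noteq> 0 \<and> indep k (\<lambda>i l. pd l (g i) x)"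
proof -
  \<comment> \<open>The family \<open>g\<close> followed by the coordinates listed in
    \<open>js\<close>; a longest list keeping it independent exists by the bound on independent
    families.\<close>
  define h where "h = (\<lambda>js i x. if i < k then g i x else x (js ! (i - k)))"
  define good where "good = (\<lambda>js. set js \<subseteq> {..<N} \<and> algindep (k + length js) (h js) {x. q x \<noteq> 0})"
  have reg_h: "reg N q (h js i)" if "set js \<subseteq> {..<N}" "i < k + length js" for js i
  proof (cases "i < k")
    case True
    then show ?thesis using g[OF True] unfolding h_def by simp
  next
    case False
    then have "js ! (i - k) \<in> set js" using that(2) by (intro nth_mem) arith
    then have "js ! (i - k) < N" using that(1) by auto
    then show ?thesis using False unfolding h_def by (simp add: reg_polyf polyf_var)
  qed
  have good0: "good []" unfolding good_def
    using algindep_cong[OF ind, of "h []"] by (simp add: h_def)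
  have bound: "length js \<le> N" if "good js" for js
  proof -
    have "k + length js \<le> N"
      by (rule algindep_le[OF q reg_h]) (use that in \<open>auto simp: good_def\<close>)
    then show ?thesis by simp
  qed
  obtain js where js: "good js" and js_max: "\<And>js'. good js' \<Longrightarrow> length js' \<le> length js"
    using ex_has_greatest_nat[of good "[]" length "Suc N"] good0 bound le_imp_less_Suc by blast
  define K where "K = k + length js"
  have KN: "K \<le> N" unfolding K_def
    by (rule algindep_le[OF q reg_h]) (use js in \<open>auto simp: good_def\<close>)
  have indK: "algindep K (h js) {x. q x \<noteq> 0}" using js unfolding good_def K_def by blast
  have regK: "reg N q (h js i)" if "i < K" for i using reg_h js that unfolding good_def K_def by blast
  define H where "H = (\<lambda>j i x. if i < K then h js i x else x j)"
  have regH: "reg N q (H j i)" if "i < Suc K" "j < N" for i j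
  proof (cases "i < K")
    case True then show ?thesis using regK unfolding H_def by simp
  next
    case False then show ?thesis using that(2) unfolding H_def by (simp add: reg_polyf polyf_var)
  qed
  have "\<exists>F. polyf (Suc K) F \<and> (\<forall>x. q x \<noteq> 0 \<longrightarrow> F (\<lambda>i. H j i x) = 0) \<and>
      (\<exists>x. q x \<noteq> 0 \<and> pd K F (\<lambda>i. H j i x) \<noteq> 0)" if j: "j < N" for j
  proof -
    have "\<not> good (js @ [j])" using js_max[of "js @ [j]"] by auto
    then have "\<not> algindep (Suc K) (h (js @ [j])) {x. q x \<noteq> 0}"
      using js j unfolding good_def K_def by auto
    then obtain F0 y0 where F0: "polyf (Suc K) F0" "\<And>x. q x \<noteq> 0 \<Longrightarrow> F0 (\<lambda>i. h (js @ [j]) i x) = 0" "F0 y0 \<noteq> 0"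
      unfolding algindep_def by auto
    have hH: "h (js @ [j]) i x = H j i x" if "i < Suc K" for i x
      using that unfolding h_def H_def K_def by (auto simp: nth_append less_diff_conv2)
    have F0': "F0 (\<lambda>i. H j i x) = 0" if "q x \<noteq> 0" for x
      using F0(2)[OF that] polyf_cong[OF F0(1), of "\<lambda>i. h (js @ [j]) i x" "\<lambda>i. H j i x"] hH by simp
    \<comment> \<open>A nonzero relation of least degree is separable in the last variable: its
      derivative there would otherwise be a smaller relation or zero, and zero would leave a
      relation inside the independent family.\<close>
    define rel where "rel = (\<lambda>D F. polyd (Suc K) D F \<and> (\<forall>x. q x \<noteq> 0 \<longrightarrow> F (\<lambda>i. H j i x) = 0) \<and> (\<exists>y. F y \<noteq> 0))"
    have ex: "\<exists>D F. rel D F" using F0 F0' unfolding rel_def polyf_def by blast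
    define D where "D = (LEAST D. \<exists>F. rel D F)"
    obtain F where F: "rel D F" unfolding D_def using LeastI_ex[OF ex] by blast
    have D_min: "D \<le> D'" if "rel D' F'" for D' F' unfolding D_def using that by (intro Least_le) blast
    have Fp: "polyf (Suc K) F" using F unfolding rel_def polyf_def by blast
    have "\<exists>x. q x \<noteq> 0 \<and> pd K F (\<lambda>i. H j i x) \<noteq> 0"
    proof (rule ccontr)
      assume "\<not> ?thesis"
      then have z: "pd K F (\<lambda>i. H j i x) = 0" if "q x \<noteq> 0" for x using that by blast
      have pd0: "pd K F y = 0" for y
      proof (rule ccontr)
        assume y: "pd K F y \<noteq> 0"
        have Dp: "polyd (Suc K) D F" using F unfolding rel_def by blast
        have "D \<noteq> 0" using polyd_pd(2)[OF Dp, of K] y by (metis lessI)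
        have "rel (D - 1) (pd K F)"
          unfolding rel_def using polyd_pd(1)[OF Dp, of K] z y by (intro conjI) auto
        from D_min[OF this] \<open>D \<noteq> 0\<close> show False by simp
      qed
      have Fupd: "F y = F (y(K := 0))" for y by (rule polyf_pd_zero_upd[OF Fp pd0])
      define F1 where "F1 = (\<lambda>y. F (\<lambda>i. if i < K then y i else 0))"
      have "polyf K F1"
        unfolding F1_def
      proof (rule polyf_compose[OF Fp])
        fix i show "polyf K (\<lambda>x. if i < K then x i else 0)" by (cases "i < K") auto
      qed
      moreover have FF1: "F y = F1 y" for y
      proof -
        have "F (y(K := 0)) = F (\<lambda>i. if i < K then y i else 0)" by (rule polyf_cong[OF Fp]) auto
        then show ?thesis using Fupd unfolding F1_def by simp
      qed
      moreover have "F1 (\<lambda>i. h js i x) = 0" if "x \<in> {x. q x \<noteq> 0}" for x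
      proof -
        have "F1 (\<lambda>i. h js i x) = F1 (\<lambda>i. H j i x)"
          by (rule polyf_cong[OF \<open>polyf K F1\<close>]) (simp add: H_def)
        then show ?thesis using that F FF1[of "\<lambda>i. H j i x"] unfolding rel_def by simp
      qed
      ultimately have "F y = 0" for y using algindepD[OF indK, of F1] by simp
      then show False using F unfolding rel_def by blast
    qed
    then show ?thesis using F Fp unfolding rel_def by blast
  qed
  then have "\<forall>j\<in>{..<N}. \<exists>F. polyf (Suc K) F \<and> (\<forall>x. q x \<noteq> 0 \<longrightarrow> F (\<lambda>i. H j i x) = 0) \<and>
      (\<exists>x. q x \<noteq> 0 \<and> pd K F (\<lambda>i. H j i x) \<noteq> 0)" by blast
  then obtain F where F: "\<forall>j\<in>{..<N}. polyf (Suc K) (F j) \<and> (\<forall>x. q x \<noteq> 0 \<longrightarrow> F j (\<lambda>i. H j i x) = 0) \<and>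
      (\<exists>x. q x \<noteq> 0 \<and> pd K (F j) (\<lambda>i. H j i x) \<noteq> 0)" by (rule bchoice[THEN exE])
  \<comment> \<open>One point at which all these derivatives are nonzero, so that the relations can
    be solved for every unit vector simultaneously.\<close>
  have "\<exists>z. q z \<noteq> 0 \<and> (\<forall>j\<in>{..<N}. pd K (F j) (\<lambda>i. H j i z) \<noteq> 0)"
  proof (rule reg_nonzero_common_finite[OF q, where f="\<lambda>j x. pd K (F j) (\<lambda>i. H j i x)"])
    fix j assume j: "j \<in> {..<N}"
    show "reg N q (\<lambda>x. pd K (F j) (\<lambda>i. H j i x))"
      by (rule reg_compose[OF polyf_pd q(1) regH]) (use F j in auto)
    show "\<exists>x. q x \<noteq> 0 \<and> pd K (F j) (\<lambda>i. H j i x) \<noteq> 0" using F j by blast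
  qed simp
  then obtain z where z: "q z \<noteq> 0" "\<And>j. j < N \<Longrightarrow> pd K (F j) (\<lambda>i. H j i z) \<noteq> 0" by blast
  let ?v = "\<lambda>i l. pd l (h js i) z"
  have "(\<lambda>l. if l = j then 1 else 0) \<in> fs.span (?v ` {..<K})" if j: "j < N" for j
  proof -
    let ?f = "\<lambda>i. pd i (F j) (\<lambda>i. H j i z)"
    have fK: "?f K \<noteq> 0" using z(2)[OF j] .
    have Fj: "polyf (Suc K) (F j)" "\<And>x. q x \<noteq> 0 \<Longrightarrow> F j (\<lambda>i. H j i x) = 0" using F j by auto
    have rel: "(\<Sum>i<Suc K. ?f i * pd l (H j i) z) = 0" for l
      by (rule relation_gradient[OF q(1) z(1) regH Fj]) (use j in auto)
    have HK: "pd l (H j K) z = (if l = j then 1 else 0)" for l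
    proof -
      have "H j K = (\<lambda>x. x j)" unfolding H_def by simp
      moreover have "pd l (\<lambda>x. x j) z = (if l = j then 1 else 0)"
        by (rule pd_eqI) (cases "l = j", simp_all)
      ultimately show ?thesis by (simp only:)
    qed
    have Hi: "pd l (H j i) z = ?v i l" if "i < K" for i l
    proof -
      have "H j i = h js i" using that unfolding H_def by simp
      then show ?thesis by (simp only:)
    qed
    have "(\<lambda>l. if l = j then 1 else 0) = (\<Sum>i<K. (\<lambda>l. (- ?f i / ?f K) * ?v i l))"
    proof
      fix l
      have "(\<Sum>i<K. ?f i * ?v i l) + ?f K * (if l = j then 1 else 0) = 0"
        using rel[of l] HK[of l] Hi by simp
      then have "(if l = j then 1 else 0) = - (\<Sum>i<K. ?f i * ?v i l) / ?f K"
        using fK by (simp add: field_simps add_eq_0_iff)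
      also have "\<dots> = (\<Sum>i<K. (- ?f i / ?f K) * ?v i l)"
        by (simp add: sum_divide_distrib sum_negf)
      finally show "(if l = j then 1 else 0) = (\<Sum>i<K. (\<lambda>l. (- ?f i / ?f K) * ?v i l)) l"
        by (simp only: sum_apply)
    qed
    moreover have "(\<Sum>i<K. (\<lambda>l. (- ?f i / ?f K) * ?v i l)) \<in> fs.span (?v ` {..<K})"
      by (intro fs.span_sum fs.span_scale fs.span_base imageI)
    ultimately show ?thesis by (simp only:)
  qed
  then have "indep K ?v" by (rule spanning_indep[OF _ KN])
  then have "indep k ?v" by (rule indep_mono) (simp add: K_def)
  moreover have "pd l (h js i) z = pd l (g i) z" if "i < k" for i l
  proof -
    have "h js i = g i" using that unfolding h_def by simp
    then show ?thesis by (simp only:)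
  qed
  ultimately have "indep k (\<lambda>i l. pd l (g i) z)" unfolding indep_def by simp
  with z(1) show ?thesis by blast
qed

subsection \<open>Algebraic dimension of a set\<close>

text \<open>The ring of polynomial functions on \<open>X\<close> has transcendence degree at most
  \<open>d\<close>. This is the bridge between Krull dimension and Jacobian rank.\<close>

definition alg_dim_le :: "nat \<Rightarrow> nat \<Rightarrow> (nat \<Rightarrow> complex) set \<Rightarrow> bool" where
  "alg_dim_le m d X \<longleftrightarrow> (\<forall>b. (\<forall>i\<le>d. polyf m (b i)) \<longrightarrow> \<not> algindep (Suc d) b X)"

lemma alg_dim_leD:
  "alg_dim_le m d X \<Longrightarrow> (\<And>i. i \<le> d \<Longrightarrow> polyf m (b i)) \<Longrightarrow> algindep (Suc d) b X \<Longrightarrow> False"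
  unfolding alg_dim_le_def by simp

text \<open>Independent functions on \<open>Y\<close> pull back along the polynomial map
  \<open>B\<close> to independent functions on \<open>X\<close>.\<close>

lemma alg_dim_le_image:
  assumes "alg_dim_le m d X" "\<And>i. i < m' \<Longrightarrow> polyf m (B i)"
    and "\<And>y. y \<in> Y \<Longrightarrow> \<exists>x\<in>X. \<forall>i<m'. y i = B i x"
  shows "alg_dim_le m' d Y"
  unfolding alg_dim_le_def
proof (intro allI impI notI)
  fix b assume b: "\<forall>i\<le>d. polyf m' (b i)" and ind: "algindep (Suc d) b Y"
  have "algindep (Suc d) (\<lambda>i x. b i (\<lambda>j. B j x)) X"
    unfolding algindep_def
  proof (intro allI impI)
    fix F y assume F: "polyf (Suc d) F" "\<forall>x\<in>X. F (\<lambda>i. b i (\<lambda>j. B j x)) = 0"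
    show "F y = 0"
    proof (rule algindepD[OF ind F(1)])
      fix y assume "y \<in> Y"
      then obtain x where x: "x \<in> X" "\<forall>i<m'. y i = B i x" using assms(3) by blast
      have "F (\<lambda>i. b i y) = F (\<lambda>i. b i (\<lambda>j. B j x))"
      proof (rule polyf_cong[OF F(1)])
        fix i assume "i < Suc d"
        then have "polyf m' (b i)" using b by simp
        then show "b i y = b i (\<lambda>j. B j x)" by (rule polyf_cong) (use x(2) in simp)
      qed
      then show "F (\<lambda>i. b i y) = 0" using F(2) x(1) by simp
    qed
  qed
  then show False
    by (rule alg_dim_leD[OF assms(1), rotated]) (rule polyf_compose[of m'], use b assms(2) in simp_all)
qed

text \<open>By the chain rule, gradients of polynomials in the \<open>\<phi> i\<close> stay in the
  span of the gradients of the \<open>\<phi> i\<close>; \<open>Suc d\<close> independent ones would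
  contradict the bound.\<close>

lemma alg_dim_le_if_rank_le:
  assumes q: "polyf N q" "q a \<noteq> 0" and \<phi>: "\<And>i. i < m \<Longrightarrow> reg N q (\<phi> i)"
    and rk: "\<And>x. q x \<noteq> 0 \<Longrightarrow> rank_le d ((\<lambda>i l. pd l (\<phi> i) x) ` {..<m})"
  shows "alg_dim_le m d ((\<lambda>x i. \<phi> i x) ` {x. q x \<noteq> 0})"
  unfolding alg_dim_le_def
proof (intro allI impI notI)
  fix b assume b: "\<forall>i\<le>d. polyf m (b i)" and ind: "algindep (Suc d) b ((\<lambda>x i. \<phi> i x) ` {x. q x \<noteq> 0})"
  let ?g = "\<lambda>i x. b i (\<lambda>j. \<phi> j x)"
  have "algindep (Suc d) ?g {x. q x \<noteq> 0}"
    using ind unfolding algindep_def by simp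
  moreover have "reg N q (?g i)" if "i < Suc d" for i
    using b that by (intro reg_compose[OF _ q(1) \<phi>]) simp_all
  ultimately have "\<exists>x. q x \<noteq> 0 \<and> indep (Suc d) (\<lambda>i l. pd l (?g i) x)"
    by (intro gradients_indep_if_algindep[OF q])
  then obtain x where x: "q x \<noteq> 0" "indep (Suc d) (\<lambda>i l. pd l (?g i) x)"
    by (elim exE conjE)
  obtain B where B: "finite B" "card B \<le> d" "(\<lambda>i l. pd l (\<phi> i) x) ` {..<m} \<subseteq> fs.span B"
    using rk[OF x(1)] unfolding rank_le_def by blast
  have "(\<lambda>l. pd l (?g i) x) \<in> fs.span B" if i: "i < Suc d" for i
  proof -
    have bi: "polyf m (b i)" using b i by simp
    have 1: "hasgrad N (?g i) x (\<lambda>l. \<Sum>j<m. pd j (b i) (\<lambda>j. \<phi> j x) * pd l (\<phi> j) x)"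
      by (rule hasgrad_compose[OF hasgrad_polyf[OF bi]]) (rule reg_gradient(2)[OF q(1) \<phi> x(1)])
    have r: "reg N q (?g i)" by (rule reg_compose[OF bi q(1) \<phi>])
    have "(\<lambda>l. pd l (?g i) x) = (\<Sum>j<m. (\<lambda>l. pd j (b i) (\<lambda>j. \<phi> j x) * pd l (\<phi> j) x))"
    proof
      fix l
      show "pd l (?g i) x = (\<Sum>j<m. (\<lambda>l. pd j (b i) (\<lambda>j. \<phi> j x) * pd l (\<phi> j) x)) l"
      proof (cases "l < N")
        case True
        then show ?thesis using hasgrad_pd[OF 1 True] by (simp only: sum_apply)
      next
        case False
        then have "pd l (?g i) x = 0" using reg_gradient(3)[OF q(1) r x(1)] by simp
        moreover have "pd l (\<phi> j) x = 0" if "j < m" for j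
          using reg_gradient(3)[OF q(1) \<phi>[OF that] x(1)] False by simp
        ultimately show ?thesis by (simp add: sum_apply)
      qed
    qed
    moreover have "(\<Sum>j<m. (\<lambda>l. pd j (b i) (\<lambda>j. \<phi> j x) * pd l (\<phi> j) x)) \<in> fs.span B"
      by (intro fs.span_sum fs.span_scale) (use B(3) in blast)
    ultimately show ?thesis by (simp only:)
  qed
  from indep_span_le[OF x(2) B(1) this] B(2) show False by simp
qed

text \<open>\<open>Suc d\<close> independent gradients at a single point already make the
  corresponding coordinates algebraically independent on the image; hence the bound at every point
  of the open set.\<close>

lemma rank_le_if_alg_dim_le:
  assumes q: "polyf N q" and \<phi>: "\<And>i. i < m \<Longrightarrow> reg N q (\<phi> i)"
    and ad: "alg_dim_le m d ((\<lambda>x i. \<phi> i x) ` {x. q x \<noteq> 0})" and x: "q x \<noteq> 0"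
  shows "rank_le d ((\<lambda>i l. pd l (\<phi> i) x) ` {..<m})"
proof (rule ccontr)
  assume "\<not> ?thesis"
  from not_rank_le_indep[OF this]
  obtain h where h: "\<forall>i\<le>d. h i < m" "indep (Suc d) (\<lambda>i l. pd l (\<phi> (h i)) x)"
    by (elim exE conjE)
  have "algindep (Suc d) (\<lambda>i. \<phi> (h i)) {x. q x \<noteq> 0}"
    by (rule algindep_if_gradients_indep[OF q x \<phi> h(2)]) (use h(1) in simp)
  then have "algindep (Suc d) (\<lambda>i y. y (h i)) ((\<lambda>x i. \<phi> i x) ` {x. q x \<noteq> 0})"
    unfolding algindep_def by simp
  then show False by (rule alg_dim_leD[OF ad, rotated]) (use h(1) in simp)
qed

subsection \<open>Polynomial functions on vectors\<close>

abbreviation coords :: "complex vec \<Rightarrow> nat \<Rightarrow> complex" where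
  "coords v \<equiv> (\<lambda>i. v $ i)"

lemma polynomial_fun_add:
  assumes "polynomial_fun n f" "polynomial_fun n g"
  shows "polynomial_fun n (\<lambda>v. f v + g v)"
proof -
  obtain M c where M: "finite M"
    and f: "\<And>v. v \<in> carrier_vec n \<Longrightarrow> f v = (\<Sum>a\<in>M. c a * (\<Prod>i<n. (v $ i) ^ a i))"
    using assms(1) unfolding polynomial_fun_def by blast
  obtain N d where N: "finite N"
    and g: "\<And>v. v \<in> carrier_vec n \<Longrightarrow> g v = (\<Sum>b\<in>N. d b * (\<Prod>i<n. (v $ i) ^ b i))"
    using assms(2) unfolding polynomial_fun_def by blast
  define e where "e = (\<lambda>a. (if a \<in> M then c a else 0) + (if a \<in> N then d a else 0))"
  have "f v + g v = (\<Sum>a\<in>M \<union> N. e a * (\<Prod>i<n. (v $ i) ^ a i))" if v: "v \<in> carrier_vec n" for v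
  proof -
    have "(\<Sum>a\<in>M \<union> N. e a * (\<Prod>i<n. (v $ i) ^ a i)) =
        (\<Sum>a\<in>M \<union> N. (if a \<in> M then c a else 0) * (\<Prod>i<n. (v $ i) ^ a i)) +
        (\<Sum>a\<in>M \<union> N. (if a \<in> N then d a else 0) * (\<Prod>i<n. (v $ i) ^ a i))"
      unfolding e_def by (simp only: sum.distrib distrib_right)
    also have "(\<Sum>a\<in>M \<union> N. (if a \<in> M then c a else 0) * (\<Prod>i<n. (v $ i) ^ a i)) = f v"
      unfolding f[OF v] by (rule sum.mono_neutral_cong_right) (use M N in auto)
    also have "(\<Sum>a\<in>M \<union> N. (if a \<in> N then d a else 0) * (\<Prod>i<n. (v $ i) ^ a i)) = g v"
      unfolding g[OF v] by (rule sum.mono_neutral_cong_right) (use M N in auto)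
    finally show ?thesis by simp
  qed
  then show ?thesis
    unfolding polynomial_fun_def using M N by (intro exI[of _ "M \<union> N"] exI[of _ e]) simp
qed

lemma polynomial_fun_polyf:
  assumes "polyf n p"
  shows "polynomial_fun n (\<lambda>v. p (coords v))"
  using assms
proof (induction rule: polyf_induct)
  case (const c)
  show ?case unfolding polynomial_fun_def by (intro exI[of _ "{\<lambda>_. 0}"] exI[of _ "\<lambda>_. c"]) simp
next
  case (var i)
  have "(\<Prod>j<n. (v $ j) ^ (if j = i then 1 else 0)) = v $ i" for v :: "complex vec"
  proof -
    have "(\<Prod>j<n. (v $ j) ^ (if j = i then 1 else 0)) = (\<Prod>j<n. if j = i then v $ j else 1)"
      by (rule prod.cong) auto
    then show ?thesis using var by (simp only: prod.delta finite_lessThan lessThan_iff if_True)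
  qed
  then show ?case unfolding polynomial_fun_def
    by (intro exI[of _ "{\<lambda>j. if j = i then 1 else 0}"] exI[of _ "\<lambda>_. 1"]) simp
next
  case (add f g) then show ?case by (intro polynomial_fun_add)
next
  case (mult f g) then show ?case by (intro polynomial_fun_mult)
qed

lemma polynomial_fun_obtain:
  assumes "polynomial_fun n f"
  shows "\<exists>p. polyf n p \<and> (\<forall>v\<in>carrier_vec n. f v = p (coords v))"
proof -
  obtain M c where M: "finite M"
    and f: "\<And>v. v \<in> carrier_vec n \<Longrightarrow> f v = (\<Sum>a\<in>M. c a * (\<Prod>i<n. (v $ i) ^ a i))"
    using assms unfolding polynomial_fun_def by blast
  have "polyf n (\<lambda>x. \<Sum>a\<in>M. c a * (\<Prod>i<n. x i ^ a i))"
    by (intro polyf_sum polyf_mult polyf_const polyf_prod polyf_power polyf_var) simp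
  then show ?thesis using f by (intro exI[of _ "\<lambda>x. \<Sum>a\<in>M. c a * (\<Prod>i<n. x i ^ a i)"]) simp
qed

lemma polyf_coords_vec: "polyf n p \<Longrightarrow> p (coords (vec n x)) = p x"
  by (rule polyf_cong[of n]) simp_all

lemma closedin_zeros:
  assumes "polyf n p"
  shows "closedin (zariski n) {v \<in> carrier_vec n. p (coords v) = 0}"
  unfolding closedin_zariski algebraic_set_def
  by (intro exI[of _ "{\<lambda>v. p (coords v)}"]) (use polynomial_fun_polyf[OF assms] in auto)

lemma closedin_separate:
  assumes "closedin (zariski n) Z" "v \<in> carrier_vec n" "v \<notin> Z"
  shows "\<exists>p. polyf n p \<and> (\<forall>z\<in>Z. p (coords z) = 0) \<and> p (coords v) \<noteq> 0"
proof -
  obtain P where P: "\<forall>p\<in>P. polynomial_fun n p" "Z = {v \<in> carrier_vec n. \<forall>p\<in>P. p v = 0}"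
    using assms(1) unfolding closedin_zariski algebraic_set_def by blast
  then obtain f where f: "f \<in> P" "f v \<noteq> 0" using assms by blast
  then obtain p where "polyf n p" "\<forall>v\<in>carrier_vec n. f v = p (coords v)"
    using polynomial_fun_obtain P(1) by blast
  then show ?thesis using P(2) f assms(2) by (intro exI[of _ p]) auto
qed

lemma closedin_zariski_subset: "closedin (zariski n) Z \<Longrightarrow> Z \<subseteq> carrier_vec n"
  using closedin_subset topspace_zariski by metis

lemma zero_on_closure:
  assumes "polyf n p" "X \<subseteq> carrier_vec n" "\<And>v. v \<in> X \<Longrightarrow> p (coords v) = 0" "v \<in> zariski n closure_of X"
  shows "p (coords v) = 0"
proof -
  have "zariski n closure_of X \<subseteq> {v \<in> carrier_vec n. p (coords v) = 0}"
    by (rule closure_of_minimal) (use assms closedin_zeros in auto)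
  then show ?thesis using assms(4) by blast
qed

lemma irreducible_prod_zero:
  assumes Z: "closedin (zariski n) Z" "irreducible_space (subtopology (zariski n) Z)"
    and f: "polyf n f" and g: "polyf n g"
    and zero: "\<And>v. v \<in> Z \<Longrightarrow> f (coords v) * g (coords v) = 0" and v: "v \<in> Z" "f (coords v) \<noteq> 0" and w: "w \<in> Z"
  shows "g (coords w) = 0"
proof -
  have top: "topspace (subtopology (zariski n) Z) = Z"
    using closedin_zariski_subset[OF Z(1)] by (auto simp: topspace_zariski)
  have cl: "closedin (subtopology (zariski n) Z) {v \<in> Z. p (coords v) = 0}" if "polyf n p" for p
  proof -
    have "{v \<in> Z. p (coords v) = 0} = Z \<inter> {v \<in> carrier_vec n. p (coords v) = 0}"
      using closedin_zariski_subset[OF Z(1)] by auto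
    then show ?thesis using closedin_zeros[OF that] by (simp add: closedin_subtopology_Int_closed)
  qed
  have "{v \<in> Z. f (coords v) = 0} \<union> {v \<in> Z. g (coords v) = 0} = Z"
    using zero by auto
  then have "{v \<in> Z. f (coords v) = 0} = Z \<or> {v \<in> Z. g (coords v) = 0} = Z"
    using Z(2) cl[OF f] cl[OF g] unfolding irreducible_space_def top by blast
  then show ?thesis using v w by blast
qed

text \<open>Irreducibility of the closure is tested on the dense set \<open>X\<close>, by primeness
  of its vanishing ideal.\<close>

lemma irreducible_closure:
  assumes X: "X \<subseteq> carrier_vec n" "X \<noteq> {}"
    and zero: "\<And>f g. polyf n f \<Longrightarrow> polyf n g \<Longrightarrow> (\<And>v. v \<in> X \<Longrightarrow> f (coords v) * g (coords v) = 0) \<Longrightarrow>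
      (\<forall>v\<in>X. f (coords v) = 0) \<or> (\<forall>v\<in>X. g (coords v) = 0)"
  shows "irreducible_space (subtopology (zariski n) (zariski n closure_of X))"
proof -
  let ?Z = "zariski n closure_of X"
  have cl: "closedin (zariski n) ?Z" by (rule closedin_closure_of)
  have sub: "X \<subseteq> ?Z" using X(1) by (simp add: closure_of_subset topspace_zariski)
  have top: "topspace (subtopology (zariski n) ?Z) = ?Z"
    using closedin_zariski_subset[OF cl] by (auto simp: topspace_zariski)
  have "A = ?Z \<or> B = ?Z"
    if AB: "closedin (subtopology (zariski n) ?Z) A" "closedin (subtopology (zariski n) ?Z) B" "A \<union> B = ?Z" for A B
  proof (rule ccontr)
    assume "\<not> ?thesis"
    moreover have A: "closedin (zariski n) A" "A \<subseteq> ?Z" and B: "closedin (zariski n) B" "B \<subseteq> ?Z"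
      using AB cl by (simp_all add: closedin_closed_subtopology)
    ultimately obtain a b where ab: "a \<in> ?Z" "a \<notin> A" "b \<in> ?Z" "b \<notin> B" by blast
    have abc: "a \<in> carrier_vec n" "b \<in> carrier_vec n" using closedin_zariski_subset[OF cl] ab by auto
    obtain f where f: "polyf n f" "\<forall>z\<in>A. f (coords z) = 0" "f (coords a) \<noteq> 0"
      using closedin_separate[OF A(1) abc(1) ab(2)] by blast
    obtain g where g: "polyf n g" "\<forall>z\<in>B. g (coords z) = 0" "g (coords b) \<noteq> 0"
      using closedin_separate[OF B(1) abc(2) ab(4)] by blast
    have "f (coords v) * g (coords v) = 0" if "v \<in> X" for v
      using that sub AB(3) f(2) g(2) by fastforce
    from zero[OF f(1) g(1) this]
    show False
    proof
      assume "\<forall>v\<in>X. f (coords v) = 0"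
      then have "f (coords a) = 0" using zero_on_closure[OF f(1) X(1) _ ab(1)] by blast
      then show False using f(3) by blast
    next
      assume "\<forall>v\<in>X. g (coords v) = 0"
      then have "g (coords b) = 0" using zero_on_closure[OF g(1) X(1) _ ab(3)] by blast
      then show False using g(3) by blast
    qed
  qed
  then show ?thesis unfolding irreducible_space_def top using X(2) sub by blast
qed

subsection \<open>Krull dimension\<close>

text \<open>A relation on \<open>Z'\<close>, with its last variable set to 0, is a relation on
  \<open>Z\<close> and so vanishes. Hence the last variable divides it; irreducibility of
  \<open>Z'\<close> cancels \<open>b e\<close>, and the quotient is a relation of smaller
  degree.\<close>

lemma algindep_extend:
  assumes Z': "closedin (zariski n) Z'" "irreducible_space (subtopology (zariski n) Z')" and sub: "Z \<subseteq> Z'"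
    and b: "\<And>i. i < e \<Longrightarrow> polyf n (b i)" and ind: "algindep e b (coords ` Z)"
    and be: "polyf n (b e)" "\<And>z. z \<in> Z \<Longrightarrow> b e (coords z) = 0" and v: "v \<in> Z'" "b e (coords v) \<noteq> 0"
  shows "algindep (Suc e) b (coords ` Z')"
proof -
  have bi: "polyf n (b i)" if "i < Suc e" for i using b be(1) that by (cases "i = e") auto
  have main: "F y = 0" if "polyd (Suc e) D F" "\<And>z. z \<in> Z' \<Longrightarrow> F (\<lambda>i. b i (coords z)) = 0" for D F y
    using that
  proof (induction D arbitrary: F y rule: less_induct)
    case (less D F y)
    have Fp: "polyf (Suc e) F" using less.prems(1) unfolding polyf_def by blast
    obtain h where h: "polyd (Suc e) (D - 1) h" "D = 0 \<longrightarrow> h = (\<lambda>_. 0)" "\<forall>x. F x = F (x(e := 0)) + x e * h x"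
      using polyd_split_var[OF less.prems(1) lessI] by (elim exE conjE)
    define F0 where "F0 = (\<lambda>y. F (\<lambda>i. if i < e then y i else 0))"
    have F0p: "polyf e F0"
      unfolding F0_def
    proof (rule polyf_compose[OF Fp])
      fix i show "polyf e (\<lambda>x. if i < e then x i else 0)" by (cases "i < e") auto
    qed
    have F0: "F (x(e := 0)) = F0 x" for x
      unfolding F0_def by (rule polyf_cong[OF Fp]) auto
    have "F0 y = 0" for y
    proof (rule algindepD[OF ind F0p])
      fix x assume "x \<in> coords ` Z"
      then obtain z where z: "z \<in> Z" "x = coords z" by blast
      have "F0 (\<lambda>i. b i x) = F (\<lambda>i. b i (coords z))"
        unfolding F0_def by (rule polyf_cong[OF Fp]) (use z be(2) in \<open>auto simp: less_Suc_eq\<close>)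
      then show "F0 (\<lambda>i. b i x) = 0" using less.prems(2) z(1) sub by (metis subsetD)
    qed
    then have Fh: "F x = x e * h x" for x using h(3)[THEN spec, of x] F0 by simp
    show "F y = 0"
    proof (cases "D = 0")
      case True
      then show ?thesis using Fh h(2) by simp
    next
      case False
      have hp: "polyf (Suc e) h" using h(1) unfolding polyf_def by blast
      have "h y = 0"
      proof (rule less.IH[of "D - 1" h])
        show "D - 1 < D" using False by simp
        show "polyd (Suc e) (D - 1) h" by (rule h(1))
        fix z assume z: "z \<in> Z'"
        have hb: "polyf n (\<lambda>x. h (\<lambda>i. b i x))" by (rule polyf_compose[OF hp bi])
        show "h (\<lambda>i. b i (coords z)) = 0"
        proof (rule irreducible_prod_zero[OF Z' be(1) hb _ v z])
          fix w assume "w \<in> Z'"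
          then show "b e (coords w) * h (\<lambda>i. b i (coords w)) = 0"
            using less.prems(2)[of w] Fh[of "\<lambda>i. b i (coords w)"] by simp
        qed
      qed
      then show ?thesis using Fh by simp
    qed
  qed
  show ?thesis unfolding algindep_def
  proof (intro allI impI)
    fix F y assume F: "polyf (Suc e) F" "\<forall>x\<in>coords ` Z'. F (\<lambda>i. b i x) = 0"
    then obtain D where "polyd (Suc e) D F" unfolding polyf_def by blast
    then show "F y = 0" by (rule main) (use F(2) in simp)
  qed
qed

lemma algindep_mono_card:
  assumes "algindep K b A" "k \<le> K"
  shows "algindep k b A"
  unfolding algindep_def
proof (intro allI impI)
  fix F y assume F: "polyf k F" "\<forall>x\<in>A. F (\<lambda>i. b i x) = 0"
  show "F y = 0" by (rule algindepD[OF assms(1) polyf_mono[OF F(1) assms(2)]]) (use F(2) in blast)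
qed

text \<open>Each strict inclusion supplies one new function, vanishing on the smaller set but not on
  the larger one.\<close>

lemma chain_algindep:
  assumes "\<And>i. i \<le> k \<Longrightarrow> closedin (zariski m) (Z i) \<and> irreducible_space (subtopology (zariski m) (Z i))"
    and "\<And>i. i < k \<Longrightarrow> Z i \<subset> Z (Suc i)"
  shows "\<exists>b. (\<forall>i<k. polyf m (b i)) \<and> algindep k b (coords ` Z k)"
  using assms
proof (induction k)
  case 0
  have Z: "closedin (zariski m) (Z 0)" "irreducible_space (subtopology (zariski m) (Z 0))"
    using 0(1)[of 0] by auto
  then obtain z where z: "z \<in> Z 0" unfolding irreducible_space_def by auto
  have "algindep 0 (\<lambda>_ _. 0) (coords ` Z 0)"
    unfolding algindep_def
  proof (intro allI impI)
    fix F :: "(nat \<Rightarrow> complex) \<Rightarrow> complex" and y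
    assume F: "polyf 0 F" "\<forall>x\<in>coords ` Z 0. F (\<lambda>i. 0) = 0"
    have "F y = F (\<lambda>i. 0)" by (rule polyf_cong[OF F(1)]) simp
    then show "F y = 0" using F(2) z by auto
  qed
  then show ?case by (intro exI[of _ "\<lambda>_ _. 0"]) simp
next
  case (Suc k)
  then obtain b where b: "\<forall>i<k. polyf m (b i)" "algindep k b (coords ` Z k)" by force
  have Zk: "closedin (zariski m) (Z k)" using Suc.prems(1)[of k] by simp
  have Zk': "closedin (zariski m) (Z (Suc k))" "irreducible_space (subtopology (zariski m) (Z (Suc k)))"
    using Suc.prems(1)[of "Suc k"] by simp_all
  have sub: "Z k \<subset> Z (Suc k)" using Suc.prems(2)[of k] by simp
  then obtain v where v: "v \<in> Z (Suc k)" "v \<notin> Z k" by blast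
  obtain p where p: "polyf m p" "\<forall>z\<in>Z k. p (coords z) = 0" "p (coords v) \<noteq> 0"
    using closedin_separate[OF Zk _ v(2)] closedin_zariski_subset[OF Zk'(1)] v(1) by blast
  have "algindep (Suc k) (b(k := p)) (coords ` Z (Suc k))"
  proof (rule algindep_extend[OF Zk' _ _ _ _ _ v(1)])
    show "Z k \<subseteq> Z (Suc k)" using sub by blast
    show "algindep k (b(k := p)) (coords ` Z k)" by (rule algindep_cong[OF b(2)]) simp
  qed (use b p in auto)
  moreover have "\<forall>i<Suc k. polyf m ((b(k := p)) i)" using b(1) p(1) by simp
  ultimately show ?case by (intro exI[of _ "b(k := p)"] conjI)
qed

lemma closed_chain_iff:
  assumes "closedin T C"
  shows "closedin (subtopology T C) Z \<and> irreducible_space (subtopology (subtopology T C) Z) \<longleftrightarrow>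
    Z \<subseteq> C \<and> closedin T Z \<and> irreducible_space (subtopology T Z)"
  using assms by (auto simp: closedin_closed_subtopology subtopology_subtopology Int_absorb1)

text \<open>Relations extend from \<open>X\<close> to its closure, so functions independent on the
  top of a chain are independent on \<open>X\<close>.\<close>

theorem image_dim_le_if_alg_dim_le:
  assumes X: "X \<subseteq> carrier_vec m" and ad: "alg_dim_le m d (coords ` X)"
  shows "image_dim m X \<le> enat d"
  unfolding image_dim_def krull_dim_def
proof (rule Sup_least)
  let ?C = "zariski m closure_of X"
  let ?T = "subtopology (zariski m) ?C"
  fix e assume "e \<in> {enat k | k. \<exists>Z :: nat \<Rightarrow> complex vec set.
     (\<forall>i\<le>k. closedin ?T (Z i) \<and> irreducible_space (subtopology ?T (Z i))) \<and> (\<forall>i<k. Z i \<subset> Z (Suc i))}"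
  then obtain k Z where e: "e = enat k"
    and Z: "\<forall>i\<le>k. closedin ?T (Z i) \<and> irreducible_space (subtopology ?T (Z i))" "\<forall>i<k. Z i \<subset> Z (Suc i)"
    by (elim CollectE exE conjE)
  have Z1: "Z i \<subseteq> ?C \<and> closedin (zariski m) (Z i) \<and> irreducible_space (subtopology (zariski m) (Z i))"
    if "i \<le> k" for i
    using Z(1) that closed_chain_iff[OF closedin_closure_of, of "zariski m" X "Z i"] by blast
  have "\<exists>b. (\<forall>i<k. polyf m (b i)) \<and> algindep k b (coords ` Z k)"
    by (rule chain_algindep) (use Z1 Z(2) in blast)+
  then obtain b where b: "\<forall>i<k. polyf m (b i)" "algindep k b (coords ` Z k)"
    by (elim exE conjE)
  have "k \<le> d"
  proof (rule ccontr)
    assume "\<not> k \<le> d"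
    then have kd: "Suc d \<le> k" by simp
    have "algindep (Suc d) b (coords ` X)"
      unfolding algindep_def
    proof (intro allI impI)
      fix F y assume F: "polyf (Suc d) F" "\<forall>x\<in>coords ` X. F (\<lambda>i. b i x) = 0"
      have Fb: "polyf m (\<lambda>x. F (\<lambda>i. b i x))" by (rule polyf_compose[OF F(1)]) (use b(1) kd in simp)
      show "F y = 0"
      proof (rule algindepD[OF algindep_mono_card[OF b(2) kd] F(1)])
        fix x assume "x \<in> coords ` Z k"
        then obtain z where z: "z \<in> Z k" "x = coords z" by blast
        have "z \<in> ?C" using Z1[of k] z(1) by blast
        have "F (\<lambda>i. b i (coords z)) = 0"
          by (rule zero_on_closure[OF Fb X _ \<open>z \<in> ?C\<close>]) (use F(2) in blast)
        then show "F (\<lambda>i. b i x) = 0" unfolding z(2) .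
      qed
    qed
    then show False by (rule alg_dim_leD[OF ad, rotated]) (use b(1) kd in simp)
  qed
  then show "e \<le> enat d" unfolding e by simp
qed

text \<open>A rank above \<open>d\<close> at one point yields a chain of length
  \<open>Suc d\<close>: the closures of the images of nested affine spaces through
  \<open>x0\<close>. They are irreducible because the parameter spaces are, and strictly increasing
  because the space with \<open>j\<close> parameters carries \<open>j\<close> independent functions
  and never \<open>Suc j\<close>.\<close>

theorem rank_le_if_image_dim_le:
  assumes q: "polyf N q" and \<phi>: "\<And>i. i < m \<Longrightarrow> reg N q (\<phi> i)"
    and X: "X = (\<lambda>x. vec m (\<lambda>i. \<phi> i x)) ` {x. q x \<noteq> 0}"
    and dim: "image_dim m X \<le> enat d" and x0: "q x0 \<noteq> 0"
  shows "rank_le d ((\<lambda>i l. pd l (\<phi> i) x0) ` {..<m})"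
proof (rule ccontr)
  assume "\<not> ?thesis"
  from not_rank_le_indep[OF this]
  obtain h where h: "\<forall>i\<le>d. h i < m" and ind: "indep (Suc d) (\<lambda>i l. pd l (\<phi> (h i)) x0)"
    by (elim exE conjE)
  have \<phi>h: "reg N q (\<phi> (h i))" if "i < Suc d" for i using h that by (intro \<phi>) simp
  obtain b where b: "\<And>i j. i < Suc d \<Longrightarrow> j < Suc d \<Longrightarrow>
      (\<Sum>l<N. pd l (\<phi> (h i)) x0 * b j l) = (if i = j then 1 else 0)"
    using indep_dual[OF ind, of N] reg_gradient(3)[OF q \<phi>h x0] by blast
  \<comment> \<open>An affine space through \<open>x0\<close> in directions dual to the selected
    gradients; restricted to it, the selected functions have the unit vectors as gradients at the
    origin.\<close>
  define L where "L = (\<lambda>j t l. x0 l + (\<Sum>s<j. t s * b s l))"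
  have Lp: "polyf j (\<lambda>t. L j t l)" for j l
    unfolding L_def by (intro polyf_add polyf_const polyf_sum polyf_mult polyf_var) simp
  define Q where "Q = (\<lambda>j t. q (L j t))"
  have Qp: "polyf j (Q j)" for j unfolding Q_def by (rule polyf_compose[OF q Lp])
  have L0: "L j (\<lambda>_. 0) = x0" for j unfolding L_def by simp
  have Q0: "Q j (\<lambda>_. 0) \<noteq> 0" for j using x0 unfolding Q_def L0 .
  define \<psi> where "\<psi> = (\<lambda>j i t. \<phi> i (L j t))"
  have \<psi>reg: "reg j (Q j) (\<psi> j i)" if im: "i < m" for i j
  proof -
    obtain e p where p: "polyf N p" "\<forall>x. q x \<noteq> 0 \<longrightarrow> \<phi> i x = p x / q x ^ e"
      using \<phi>[OF im] unfolding reg_def by blast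
    have "polyf j (\<lambda>t. p (L j t))" by (rule polyf_compose[OF p(1) Lp])
    then show ?thesis unfolding reg_def \<psi>_def Q_def using p(2)
      by (intro exI[of _ e] exI[of _ "\<lambda>t. p (L j t)"]) simp
  qed
  have \<psi>ind: "algindep j (\<lambda>i. \<psi> j (h i)) {t. Q j t \<noteq> 0}" if j: "j \<le> Suc d" for j
  proof (rule algindep_if_gradients_indep[OF Qp Q0])
    show "reg j (Q j) (\<psi> j (h i))" if "i < j" for i using h that j by (intro \<psi>reg) simp
    have g: "pd s (\<psi> j (h i)) (\<lambda>_. 0) = (if i = s then 1 else 0)" if ij: "i < j" "s < j" for i s
    proof (rule pd_eqI)
      have Lupd: "L j ((\<lambda>_. 0)(s := t)) = (\<lambda>l. x0 l + t * b s l)" for t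
      proof
        fix l
        have "(\<Sum>r<j. ((\<lambda>_. 0)(s := t)) r * b r l) = (\<Sum>r<j. if r = s then t * b r l else 0)"
          by (rule sum.cong) auto
        also have "\<dots> = t * b s l" using ij(2) by (simp only: sum.delta finite_lessThan lessThan_iff if_True)
        finally show "L j ((\<lambda>_. 0)(s := t)) l = x0 l + t * b s l" unfolding L_def by simp
      qed
      have "((\<lambda>t. \<phi> (h i) (\<lambda>l. x0 l + t * b s l)) has_field_derivative
          (\<Sum>l<N. pd l (\<phi> (h i)) x0 * b s l)) (at 0)"
      proof (rule hasgradD[OF reg_gradient(2)[OF q \<phi>h x0], where c="\<lambda>t l. x0 l + t * b s l" and t=0])
        show "i < Suc d" using ij j by simp
        show "((\<lambda>t. x0 l + t * b s l) has_field_derivative b s l) (at 0)" for l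
          by (auto intro!: derivative_eq_intros)
      qed simp
      moreover have "(\<Sum>l<N. pd l (\<phi> (h i)) x0 * b s l) = (if i = s then 1 else 0)"
        by (rule b) (use ij j in simp_all)
      ultimately show "((\<lambda>t. \<psi> j (h i) ((\<lambda>_. 0)(s := t))) has_field_derivative (if i = s then 1 else 0)) (at 0)"
        unfolding \<psi>_def Lupd by (simp only:)
    qed
    show "indep j (\<lambda>i l. pd l (\<psi> j (h i)) (\<lambda>_. 0))"
    proof (rule indepI)
      fix c s assume c: "\<And>x. (\<Sum>i<j. c i * pd x (\<psi> j (h i)) (\<lambda>_. 0)) = 0" and s: "s < j"
      have "(\<Sum>i<j. c i * pd s (\<psi> j (h i)) (\<lambda>_. 0)) = (\<Sum>i<j. if i = s then c i else 0)"
        by (rule sum.cong) (use g s in auto)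
      also have "\<dots> = c s" using s by (simp only: sum.delta finite_lessThan lessThan_iff if_True)
      finally show "c s = 0" unfolding c by (rule sym)
    qed
  qed
  define Y where "Y = (\<lambda>j. (\<lambda>t. vec m (\<lambda>i. \<psi> j i t)) ` {t. Q j t \<noteq> 0})"
  have Yc: "Y j \<subseteq> carrier_vec m" for j unfolding Y_def by auto
  define Z where "Z = (\<lambda>j. zariski m closure_of Y j)"
  have irr: "irreducible_space (subtopology (zariski m) (Z j))" for j
    unfolding Z_def
  proof (rule irreducible_closure[OF Yc])
    show "Y j \<noteq> {}" unfolding Y_def using Q0 by blast
    fix f g assume f: "polyf m f" and g: "polyf m g" and fg: "\<And>v. v \<in> Y j \<Longrightarrow> f (coords v) * g (coords v) = 0"
    have val: "p (coords (vec m (\<lambda>i. \<psi> j i t))) = p (\<lambda>i. \<psi> j i t)" if "polyf m p" for p t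
      by (rule polyf_coords_vec[OF that])
    have r: "reg j (Q j) (\<lambda>t. p (\<lambda>i. \<psi> j i t))" if "polyf m p" for p
      by (rule reg_compose[OF that Qp \<psi>reg])
    have z: "f (\<lambda>i. \<psi> j i t) * g (\<lambda>i. \<psi> j i t) = 0" if "Q j t \<noteq> 0" for t
      using fg[of "vec m (\<lambda>i. \<psi> j i t)"] that val[OF f] val[OF g] unfolding Y_def by auto
    show "(\<forall>v\<in>Y j. f (coords v) = 0) \<or> (\<forall>v\<in>Y j. g (coords v) = 0)"
    proof (rule ccontr)
      assume "\<not> ?thesis"
      then obtain s t where st: "Q j s \<noteq> 0" "Q j t \<noteq> 0" "f (\<lambda>i. \<psi> j i s) \<noteq> 0" "g (\<lambda>i. \<psi> j i t) \<noteq> 0"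
        using val[OF f] val[OF g] unfolding Y_def by auto
      have "g (\<lambda>i. \<psi> j i t) = 0"
        by (rule reg_prod_zero[OF Qp r[OF f] r[OF g] z st(1,2,3)])
      then show False using st(4) by blast
    qed
  qed
  have Ysub: "Y j \<subseteq> Y (Suc j)" for j
  proof
    fix v assume "v \<in> Y j"
    then obtain t where t: "Q j t \<noteq> 0" "v = vec m (\<lambda>i. \<psi> j i t)" unfolding Y_def by blast
    have "L j t = L (Suc j) (t(j := 0))" unfolding L_def by (rule ext) simp
    then have "Q (Suc j) (t(j := 0)) \<noteq> 0" "v = vec m (\<lambda>i. \<psi> (Suc j) i (t(j := 0)))"
      using t unfolding Q_def \<psi>_def by simp_all
    then show "v \<in> Y (Suc j)" unfolding Y_def by blast
  qed
  have Zsub: "Z j \<subset> Z (Suc j)" if j: "j < Suc d" for j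
  proof
    show "Z j \<subseteq> Z (Suc j)" unfolding Z_def by (rule closure_of_mono[OF Ysub])
    show "Z j \<noteq> Z (Suc j)"
    proof
      assume eq: "Z j = Z (Suc j)"
      have hm: "h i < m" if "i < Suc j" for i using h that j by simp
      \<comment> \<open>With \<open>j\<close> parameters, \<open>Suc j\<close> functions satisfy a
        relation. It persists on the closure, whereas the next affine space admits none.\<close>
      have "\<not> algindep (Suc j) (\<lambda>i. \<psi> j (h i)) {t. Q j t \<noteq> 0}"
      proof
        assume "algindep (Suc j) (\<lambda>i. \<psi> j (h i)) {t. Q j t \<noteq> 0}"
        from algindep_le[OF Qp Q0 \<psi>reg[OF hm] this] show False by simp
      qed
      then obtain F y where F: "polyf (Suc j) F" "\<And>t. Q j t \<noteq> 0 \<Longrightarrow> F (\<lambda>i. \<psi> j (h i) t) = 0" "F y \<noteq> 0"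
        unfolding algindep_def by blast
      define G where "G = (\<lambda>x :: nat \<Rightarrow> complex. F (\<lambda>i. x (h i)))"
      have G: "polyf m G" unfolding G_def by (rule polyf_compose[OF F(1)]) (use hm in simp)
      have val: "G (coords (vec m (\<lambda>i. \<psi> j' i t))) = F (\<lambda>i. \<psi> j' (h i) t)" for t j'
        unfolding polyf_coords_vec[OF G] unfolding G_def ..
      have "G (coords v) = 0" if "v \<in> Y j" for v
        using that F(2) val unfolding Y_def by auto
      then have GZ: "G (coords v) = 0" if "v \<in> Z j" for v
        using zero_on_closure[OF G Yc] that unfolding Z_def by blast
      have "F y = 0"
      proof (rule algindepD[OF \<psi>ind F(1)])
        fix t assume "t \<in> {t. Q (Suc j) t \<noteq> 0}"
        then have "vec m (\<lambda>i. \<psi> (Suc j) i t) \<in> Y (Suc j)" unfolding Y_def by blast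
        then have "vec m (\<lambda>i. \<psi> (Suc j) i t) \<in> Z (Suc j)"
          unfolding Z_def using closure_of_subset[of "Y (Suc j)" "zariski m"] Yc by (auto simp: topspace_zariski)
        then show "F (\<lambda>i. \<psi> (Suc j) (h i) t) = 0" using GZ val eq by metis
      qed (use j in simp)
      then show False using F(3) by blast
    qed
  qed
  have ZX: "Z j \<subseteq> zariski m closure_of X" for j
    unfolding Z_def
  proof (rule closure_of_mono)
    show "Y j \<subseteq> X" unfolding Y_def X \<psi>_def Q_def by blast
  qed
  let ?T = "subtopology (zariski m) (zariski m closure_of X)"
  have ch: "closedin ?T (Z i) \<and> irreducible_space (subtopology ?T (Z i))" for i
  proof -
    have "closedin (zariski m) (Z i)" unfolding Z_def by (rule closedin_closure_of)
    then show ?thesis unfolding closed_chain_iff[OF closedin_closure_of] using ZX irr by blast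
  qed
  have "enat (Suc d) \<le> image_dim m X"
    unfolding image_dim_def krull_dim_def
    by (intro Sup_upper CollectI exI[of _ "Suc d"] exI[of _ Z] conjI refl allI impI)
      (use ch Zsub in blast)+
  with dim have "enat (Suc d) \<le> enat d" by (rule order_trans[rotated])
  then show False by simp
qed

subsection \<open>Differentiation rules\<close>

lemma pd_reg_compose:
  assumes q: "polyf N q" "q x \<noteq> 0" and F: "polyf k F" and g: "\<And>i. i < k \<Longrightarrow> reg N q (g i)"
  shows "pd l (\<lambda>x. F (\<lambda>i. g i x)) x = (\<Sum>i<k. pd i F (\<lambda>i. g i x) * pd l (g i) x)"
proof (cases "l < N")
  case True
  have "hasgrad N (\<lambda>x. F (\<lambda>i. g i x)) x (\<lambda>l. \<Sum>i<k. pd i F (\<lambda>i. g i x) * pd l (g i) x)"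
    by (rule hasgrad_compose[OF hasgrad_polyf[OF F]]) (rule reg_gradient(2)[OF q(1) g q(2)])
  then show ?thesis by (rule hasgrad_pd[OF _ True])
next
  case False
  then have "pd l (\<lambda>x. F (\<lambda>i. g i x)) x = 0"
    using reg_gradient(3)[OF q(1) reg_compose[OF F q(1) g] q(2)] by simp
  moreover have "pd l (g i) x = 0" if "i < k" for i
    using reg_gradient(3)[OF q(1) g[OF that] q(2)] False by simp
  ultimately show ?thesis by simp
qed

lemma pd_reg_mult:
  assumes q: "polyf N q" "q x \<noteq> 0" and f: "reg N q f" and g: "reg N q g"
  shows "pd l (\<lambda>x. f x * g x) x = f x * pd l g x + pd l f x * g x"
proof (cases "l < N")
  case True
  show ?thesis
    by (rule hasgrad_pd[OF hasgrad_mult[OF reg_gradient(2)[OF q(1) f q(2)] reg_gradient(2)[OF q(1) g q(2)]] True])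
next
  case False
  then have "l \<ge> N" by simp
  then show ?thesis
    by (simp only: reg_gradient(3)[OF q(1) f q(2)] reg_gradient(3)[OF q(1) g q(2)]
        reg_gradient(3)[OF q(1) reg_mult[OF f g] q(2)] mult_zero_left mult_zero_right add_0)
qed

lemma pd_polyf_divide:
  assumes p: "polyf N p" and q: "polyf N q" "q x \<noteq> 0"
  shows "pd l (\<lambda>x. p x / q x) x = (pd l p x * q x - p x * pd l q x) / (q x)^2"
proof -
  \<comment> \<open>Adding coordinates makes \<open>l\<close> an admissible index, which removes the
    case \<open>l \<ge> N\<close>.\<close>
  let ?M = "max N (Suc l)"
  have "polyf ?M p" "polyf ?M q" using polyf_mono[OF p] polyf_mono[OF q(1)] by simp_all
  note P = hasgrad_polyf[OF this(1), of x] and Q = hasgrad_polyf[OF this(2), of x]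
  show ?thesis
    by (rule hasgrad_pd[OF hasgrad_divide[OF P Q q(2)]]) simp
qed

lemma pd_polyf_scaled:
  assumes "polyf N p"
  shows "pd l (\<lambda>x. p (\<lambda>i. c i * x i)) x = pd l p (\<lambda>i. c i * x i) * c l"
proof -
  let ?M = "max N (Suc l)"
  have p: "polyf ?M p" using polyf_mono[OF assms] by simp
  have h: "hasgrad ?M (\<lambda>x. c i * x i) x (\<lambda>m. c i * (if m = i then 1 else 0) + 0 * x i)" if "i < ?M" for i
    by (rule hasgrad_mult[OF hasgrad_const hasgrad_var[OF that]])
  have "pd l (\<lambda>x. p (\<lambda>i. c i * x i)) x =
      (\<Sum>i<?M. pd i p (\<lambda>i. c i * x i) * (c i * (if l = i then 1 else 0) + 0 * x i))"
    by (rule hasgrad_pd[OF hasgrad_compose[OF hasgrad_polyf[OF p] h]]) simp_all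
  also have "\<dots> = (\<Sum>i<?M. if i = l then pd i p (\<lambda>i. c i * x i) * c i else 0)"
    by (rule sum.cong) auto
  also have "\<dots> = pd l p (\<lambda>i. c i * x i) * c l"
    by (simp only: sum.delta finite_lessThan lessThan_iff) simp
  finally show ?thesis .
qed

lemma pd_polyf_sum:
  assumes "\<And>k. k \<in> I \<Longrightarrow> polyf N (f k)"
  shows "pd l (\<lambda>x. \<Sum>k\<in>I. c k * f k x) x = (\<Sum>k\<in>I. c k * pd l (f k) x)"
proof -
  let ?M = "max N (Suc l)"
  have "hasgrad ?M (\<lambda>x. \<Sum>k\<in>I. c k * f k x) x (\<lambda>l. \<Sum>k\<in>I. c k * pd l (f k) x)"
    using assms
  proof (induction I rule: infinite_finite_induct)
    case (insert k I)
    have "polyf ?M (f k)" using polyf_mono[of N "f k" ?M] insert.prems by simp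
    then have 1: "hasgrad ?M (\<lambda>x. c k * f k x) x (\<lambda>l. c k * pd l (f k) x + 0 * f k x)"
      by (rule hasgrad_mult[OF hasgrad_const hasgrad_polyf])
    have 2: "hasgrad ?M (\<lambda>x. \<Sum>k\<in>I. c k * f k x) x (\<lambda>l. \<Sum>k\<in>I. c k * pd l (f k) x)"
      using insert by simp
    show ?case using hasgrad_add[OF 1 2] insert.hyps by simp
  qed (simp_all add: hasgrad_const)
  then show ?thesis by (rule hasgrad_pd) simp
qed

lemma pd_polyf_zero: "polyf N f \<Longrightarrow> l \<ge> N \<Longrightarrow> pd l f x = 0"
  using reg_gradient(3)[OF polyf_const[of N 1] reg_polyf] by simp

text \<open>Two ways of differentiating along the ray through \<open>x\<close>, at t = 1.\<close>

lemma euler_identity: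
  assumes "polyf N f" "\<And>t. f (\<lambda>i. t * x i) = t ^ a * f x"
  shows "(\<Sum>l<N. pd l f x * x l) = of_nat a * f x"
proof -
  have "((\<lambda>t. f (\<lambda>i. t * x i)) has_field_derivative (\<Sum>l<N. pd l f x * x l)) (at 1)"
    by (rule hasgradD[OF hasgrad_polyf[OF assms(1)], where c="\<lambda>t i. t * x i" and t=1])
      (simp, auto intro!: derivative_eq_intros)
  moreover have "((\<lambda>t. f (\<lambda>i. t * x i)) has_field_derivative of_nat a * f x) (at 1)"
    unfolding assms(2) by (auto intro!: derivative_eq_intros)
  ultimately show ?thesis by (rule DERIV_unique)
qed

subsection \<open>Leading forms\<close>

lemma indep_scale:
  assumes "indep k v" "\<And>i. i < k \<Longrightarrow> c i \<noteq> 0" "\<And>l. d l \<noteq> 0"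
    and "\<And>i l. i < k \<Longrightarrow> u i l = c i * d l * v i l"
  shows "indep k u"
proof (rule indepI)
  fix e i assume e: "\<And>x. (\<Sum>i<k. e i * u i x) = 0" and i: "i < k"
  have "(\<Sum>i<k. (e i * c i) * v i x) = 0" for x
  proof -
    have "d x * (\<Sum>i<k. (e i * c i) * v i x) = (\<Sum>i<k. e i * u i x)"
      unfolding sum_distrib_left by (intro sum.cong refl) (simp add: assms(4))
    then show ?thesis using e assms(3)[of x] by simp
  qed
  from indepD[OF assms(1) this i] assms(2)[OF i] show "e i = 0" by simp
qed

lemma tendsto_gram:
  assumes "\<And>i l. i < k \<Longrightarrow> ((\<lambda>s. a s i l) \<longlongrightarrow> a0 i l) F"
  shows "((\<lambda>s. gram k N (a s) b) \<longlongrightarrow> gram k N a0 b) F"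
  unfolding gram_def by (intro tendsto_sum tendsto_mult tendsto_prod tendsto_const assms) simp

text \<open>The counterpart of \<open>hc_tendsto\<close> for gradients: rescaling the point
  multiplies the partial derivative number \<open>l\<close> by the power of the parameter with
  exponent \<open>w l\<close>.\<close>

lemma hc_gradient_tendsto:
  assumes p: "polyf N p" and a: "\<And>k x. k > a \<Longrightarrow> hc w k p x = 0"
  shows "((\<lambda>s. s ^ a * (1 / s) ^ w l * pd l p (\<lambda>i. (1 / s) ^ w i * x i)) \<longlongrightarrow> pd l (hc w a p) x) (at 0)"
proof -
  have eq: "s ^ a * (1 / s) ^ w l * pd l p (\<lambda>i. (1 / s) ^ w i * x i) =
      (\<Sum>k\<le>a. s ^ (a - k) * pd l (hc w k p) x)" if "s \<noteq> 0" for s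
  proof -
    have "pd l p (\<lambda>i. (1 / s) ^ w i * x i) * (1 / s) ^ w l = pd l (\<lambda>x. p (\<lambda>i. (1 / s) ^ w i * x i)) x"
      by (rule pd_polyf_scaled[OF p, symmetric])
    also have "(\<lambda>x. p (\<lambda>i. (1 / s) ^ w i * x i)) = (\<lambda>x. \<Sum>k\<le>a. (1 / s) ^ k * hc w k p x)"
      by (rule ext) (rule hc_expand[OF p a])
    also have "pd l \<dots> x = (\<Sum>k\<le>a. (1 / s) ^ k * pd l (hc w k p) x)"
      by (rule pd_polyf_sum) (rule polyf_hc[OF p])
    finally have "s ^ a * (1 / s) ^ w l * pd l p (\<lambda>i. (1 / s) ^ w i * x i) =
        (\<Sum>k\<le>a. s ^ a * ((1 / s) ^ k * pd l (hc w k p) x))"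
      by (simp only: sum_distrib_left[symmetric] ac_simps)
    also have "\<dots> = (\<Sum>k\<le>a. s ^ (a - k) * pd l (hc w k p) x)"
    proof (rule sum.cong[OF refl])
      fix k assume "k \<in> {..a}"
      then show "s ^ a * ((1 / s) ^ k * pd l (hc w k p) x) = s ^ (a - k) * pd l (hc w k p) x"
        using \<open>s \<noteq> 0\<close> by (simp add: power_diff power_one_over field_simps)
    qed
    finally show ?thesis .
  qed
  have "((\<lambda>s. \<Sum>k\<le>a. s ^ (a - k) * pd l (hc w k p) x) \<longlongrightarrow> (\<Sum>k\<le>a. 0 ^ (a - k) * pd l (hc w k p) x)) (at 0)"
    by (intro tendsto_intros)
  moreover have "(\<Sum>k\<le>a. 0 ^ (a - k) * pd l (hc w k p) x) = (\<Sum>k\<le>a. if k = a then pd l (hc w k p) x else 0)"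
    by (intro sum.cong) (auto simp: zero_power)
  ultimately have "((\<lambda>s. \<Sum>k\<le>a. s ^ (a - k) * pd l (hc w k p) x) \<longlongrightarrow> pd l (hc w a p) x) (at 0)" by simp
  then show ?thesis
    by (rule Lim_transform_eventually) (auto simp: eventually_at_filter eq)
qed

text \<open>Semicontinuity of rank. Along \<open>y s\<close> the gradients of
  \<open>p i / q\<close>, rescaled in rows by powers depending on \<open>i\<close> and in columns by
  powers depending on \<open>l\<close>, converge to those of the leading forms up to a nonzero
  factor. A Gram determinant nonzero in the limit is nonzero for small s, and the rescaling does not
  affect independence.\<close>

theorem leading_forms_indep:
  assumes p: "\<And>i. i < k \<Longrightarrow> polyf N (p i)" and a: "\<And>i j x. i < k \<Longrightarrow> j > a i \<Longrightarrow> hc w j (p i) x = 0"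
    and q: "polyf N q" and b: "\<And>j x. j > b \<Longrightarrow> hc w j q x = 0"
    and x0: "hc w b q x0 \<noteq> 0"
    and ind: "indep k (\<lambda>i l. pd l (\<lambda>x. hc w (a i) (p i) x / hc w b q x) x0)"
  shows "\<exists>x. q x \<noteq> 0 \<and> indep k (\<lambda>i l. pd l (\<lambda>x. p i x / q x) x)"
proof -
  \<comment> \<open>\<open>V\<close> and \<open>V0\<close> are the numerators in the quotient rule,
    for the given quotients and for those of the leading forms; the denominators are nonzero
    scalars.\<close>
  define V where "V = (\<lambda>i l x. pd l (p i) x * q x - p i x * pd l q x)"
  define V0 where "V0 = (\<lambda>i l. pd l (hc w (a i) (p i)) x0 * hc w b q x0 - hc w (a i) (p i) x0 * pd l (hc w b q) x0)"
  \<comment> \<open>As s tends to 0 this runs along the weighted scaling orbit with parameter 1/s,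
    where the top components dominate.\<close>
  define y where "y = (\<lambda>s i. (1 / s) ^ w i * x0 i)"
  have lim: "((\<lambda>s. s ^ (a i + b) * (1 / s) ^ w l * V i l (y s)) \<longlongrightarrow> V0 i l) (at 0)" if i: "i < k" for i l
  proof -
    have "((\<lambda>s. (s ^ a i * (1 / s) ^ w l * pd l (p i) (y s)) * (s ^ b * q (y s))
        - (s ^ a i * p i (y s)) * (s ^ b * (1 / s) ^ w l * pd l q (y s))) \<longlongrightarrow> V0 i l) (at 0)"
      unfolding V0_def y_def
      by (intro tendsto_diff tendsto_mult[OF hc_gradient_tendsto[OF p[OF i]] hc_tendsto[OF q]]
          tendsto_mult[OF hc_tendsto[OF p[OF i]] hc_gradient_tendsto[OF q]] a[OF i] b)
    moreover have "(s ^ a i * (1 / s) ^ w l * pd l (p i) (y s)) * (s ^ b * q (y s))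
        - (s ^ a i * p i (y s)) * (s ^ b * (1 / s) ^ w l * pd l q (y s)) =
        s ^ (a i + b) * (1 / s) ^ w l * V i l (y s)" for s
      unfolding V_def power_add right_diff_distrib by (simp only: ac_simps)
    ultimately show ?thesis by simp
  qed
  have V0eq: "V0 i l = (hc w b q x0)^2 * 1 * pd l (\<lambda>x. hc w (a i) (p i) x / hc w b q x) x0" if "i < k" for i l
    unfolding V0_def pd_polyf_divide[OF polyf_hc[OF p[OF that]] polyf_hc[OF q] x0] using x0 by simp
  have indV0: "indep k V0" by (rule indep_scale[OF ind _ _ V0eq]) (use x0 in simp_all)
  have supp: "V0 i l = 0" if "i < k" "l \<ge> N" for i l
    unfolding V0_def using pd_polyf_zero[OF polyf_hc[OF p[OF that(1)]] that(2)] pd_polyf_zero[OF polyf_hc[OF q] that(2)] by simp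
  obtain d where "\<forall>i<k. \<forall>j<k. (\<Sum>l<N. V0 i l * d j l) = (if i = j then 1 else 0)"
    using indep_dual[OF indV0, of N] supp by blast
  then have "gram k N V0 d = 1" by (rule gram_dual)
  then have g0: "gram k N V0 d \<noteq> 0" by simp
  have "((\<lambda>s. gram k N (\<lambda>i l. s ^ (a i + b) * (1 / s) ^ w l * V i l (y s)) d) \<longlongrightarrow> gram k N V0 d) (at 0)"
    by (rule tendsto_gram) (rule lim)
  then have ev1: "eventually (\<lambda>s. gram k N (\<lambda>i l. s ^ (a i + b) * (1 / s) ^ w l * V i l (y s)) d \<noteq> 0) (at 0)"
    using g0 by (rule tendsto_imp_eventually_ne)
  have "((\<lambda>s. s ^ b * q (y s)) \<longlongrightarrow> hc w b q x0) (at 0)"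
    unfolding y_def by (rule hc_tendsto[OF q b])
  then have ev2: "eventually (\<lambda>s. s ^ b * q (y s) \<noteq> 0) (at 0)"
    using x0 by (rule tendsto_imp_eventually_ne)
  have ev3: "eventually (\<lambda>s. s \<noteq> 0) (at (0::complex))" by (simp add: eventually_at_filter)
  have "eventually (\<lambda>s. gram k N (\<lambda>i l. s ^ (a i + b) * (1 / s) ^ w l * V i l (y s)) d \<noteq> 0 \<and>
      s ^ b * q (y s) \<noteq> 0 \<and> s \<noteq> 0) (at 0)"
    by (intro eventually_conj ev1 ev2 ev3)
  then obtain s where s: "gram k N (\<lambda>i l. s ^ (a i + b) * (1 / s) ^ w l * V i l (y s)) d \<noteq> 0"
      "s ^ b * q (y s) \<noteq> 0" "s \<noteq> 0"
    using eventually_happens'[of "at (0::complex)"] by auto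
  have qs: "q (y s) \<noteq> 0" using s(2) by auto
  have "indep k (\<lambda>i l. s ^ (a i + b) * (1 / s) ^ w l * V i l (y s))"
    by (rule gram_nonzero_indep[OF s(1)])
  then have "indep k (\<lambda>i l. pd l (\<lambda>x. p i x / q x) (y s))"
  proof (rule indep_scale[where c="\<lambda>i. 1 / (s ^ (a i + b) * (q (y s))^2)" and d="\<lambda>l. s ^ w l"])
    show "1 / (s ^ (a i + b) * (q (y s))^2) \<noteq> 0" for i using s(3) qs by simp
    show "s ^ w l \<noteq> 0" for l using s(3) by simp
    fix i l assume i: "i < k"
    have "s ^ w l * (1 / s) ^ w l = 1" using s(3) by (simp add: power_one_over)
    have "1 / (s ^ (a i + b) * (q (y s))^2) * s ^ w l * (s ^ (a i + b) * (1 / s) ^ w l * V i l (y s))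
        = (s ^ w l * (1 / s) ^ w l) * (1 / (s ^ (a i + b) * (q (y s))^2) * (s ^ (a i + b) * V i l (y s)))"
      by (simp only: ac_simps)
    also have "\<dots> = 1 / (s ^ (a i + b) * (q (y s))^2) * (s ^ (a i + b) * V i l (y s))"
      unfolding \<open>s ^ w l * (1 / s) ^ w l = 1\<close> by (rule mult_1)
    also have "\<dots> = V i l (y s) / (q (y s))^2" using s(3) by simp
    finally show "pd l (\<lambda>x. p i x / q x) (y s) = 1 / (s ^ (a i + b) * (q (y s))^2) * s ^ w l *
        (s ^ (a i + b) * (1 / s) ^ w l * V i l (y s))"
      unfolding pd_polyf_divide[OF p[OF i] q qs] V_def by (rule sym)
  qed
  with qs show ?thesis by blast
qed

text \<open>One degree common to the whole family, as the leading parts are permuted among each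
  other by the group.\<close>

lemma top_degree_exists:
  fixes n :: nat
  assumes p: "\<And>i. i < n \<Longrightarrow> polyf N (p i)" and nz: "i0 < n" "p i0 x0 \<noteq> 0"
  shows "\<exists>a. (\<exists>i<n. \<exists>x. hc w a (p i) x \<noteq> 0) \<and> (\<forall>j>a. \<forall>i<n. \<forall>x. hc w j (p i) x = 0)"
proof -
  have "\<forall>i\<in>{..<n}. \<exists>K. \<forall>k>K. \<forall>x. hc w k (p i) x = 0"
    using polyf_hc_bounded[OF p] by simp
  then obtain K where K: "\<forall>i\<in>{..<n}. \<forall>k>K i. \<forall>x. hc w k (p i) x = 0" by (rule bchoice[THEN exE])
  let ?P = "\<lambda>a. \<exists>i<n. \<exists>x. hc w a (p i) x \<noteq> 0"
  obtain k0 where k0: "hc w k0 (p i0) x0 \<noteq> 0" using hc_nonzero[OF p[OF nz(1)] nz(2)] by blast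
  have bnd: "a \<le> (\<Sum>i<n. K i)" if Pa: "?P a" for a
  proof -
    obtain i x where i: "i < n" "hc w a (p i) x \<noteq> 0" using Pa by blast
    then have "a \<le> K i" using K by (meson lessThan_iff not_less)
    also have "K i \<le> (\<Sum>i<n. K i)" using i(1) by (intro member_le_sum) auto
    finally show ?thesis .
  qed
  have P0: "?P k0" using k0 nz(1) by blast
  have "?P (GREATEST a. ?P a)" by (rule GreatestI_nat[of ?P, OF P0]) (use bnd in blast)
  moreover have "a \<le> (GREATEST a. ?P a)" if "?P a" for a
    by (rule Greatest_le_nat[of ?P, OF that]) (use bnd in blast)
  ultimately show ?thesis by (intro exI[of _ "GREATEST a. ?P a"]) (meson not_less)
qed

subsection \<open>Rank of homogeneous maps\<close>

text \<open>The combinations \<open>?w i\<close> of the gradients of \<open>\<phi> i\<close> and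
  \<open>\<phi> k\<close> annihilate the radial vector by Euler's identity, while the gradient of
  \<open>\<phi> k\<close> does not; so they have rank at most \<open>d - 1\<close>. Modulo the
  gradient of the product of \<open>h\<close> and \<open>\<phi> k\<close>, they account for the
  gradients of all products.\<close>

lemma rank_le_mult_homogeneous:
  assumes q: "polyf N q" "q x \<noteq> 0" and \<phi>: "\<And>i. i < m \<Longrightarrow> reg N q (\<phi> i)" and h: "reg N q h"
    and eu: "\<And>i. i < m \<Longrightarrow> (\<Sum>l<N. pd l (\<phi> i) x * x l) = c * \<phi> i x" and c: "c \<noteq> 0"
    and k: "k < m" "\<phi> k x \<noteq> 0"
    and rk: "rank_le d ((\<lambda>i l. pd l (\<phi> i) x) ` {..<m})"
  shows "rank_le d ((\<lambda>i l. pd l (\<lambda>x. h x * \<phi> i x) x) ` {..<m})"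
proof -
  let ?v = "\<lambda>i l. pd l (\<phi> i) x"
  let ?u = "\<lambda>i l. pd l (\<lambda>x. h x * \<phi> i x) x"
  let ?w = "\<lambda>i l. \<phi> k x * ?v i l + (- \<phi> i x) * ?v k l"
  have wsp: "?w i \<in> fs.span (?v ` {..<m})" if "i < m" for i
  proof -
    have "?w i = (\<lambda>l. \<phi> k x * ?v i l) + (\<lambda>l. (- \<phi> i x) * ?v k l)" by (rule ext) simp
    moreover have "(\<lambda>l. \<phi> k x * ?v i l) + (\<lambda>l. (- \<phi> i x) * ?v k l) \<in> fs.span (?v ` {..<m})"
      by (intro fs.span_add fs.span_scale fs.span_base imageI) (use that k in simp_all)
    ultimately show ?thesis by (simp only:)
  qed
  have alg0: "a * (c * b) + (- b) * (c * a) = 0" for a b :: complex by simp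
  have "d > 0 \<and> rank_le (d - 1) (?w ` {..<m})"
  proof (rule rank_le_hyperplane[OF rk, where v="?v k" and I="{..<N}" and b=x])
    show "?w ` {..<m} \<subseteq> fs.span (?v ` {..<m})" using wsp by blast
    show "?v k \<in> fs.span (?v ` {..<m})" by (intro fs.span_base imageI) (use k in simp)
    show "(\<Sum>l<N. ?v k l * x l) \<noteq> 0" using eu[OF k(1)] c k(2) by simp
    fix w assume "w \<in> ?w ` {..<m}"
    then obtain i where i: "i < m" "w = ?w i" by blast
    have "(\<Sum>l<N. w l * x l) = \<phi> k x * (\<Sum>l<N. ?v i l * x l) + (- \<phi> i x) * (\<Sum>l<N. ?v k l * x l)"
      unfolding i(2) sum_distrib_left sum.distrib[symmetric] by (simp only: distrib_right mult.assoc)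
    then show "(\<Sum>l<N. w l * x l) = 0" unfolding eu[OF i(1)] eu[OF k(1)] by (simp only: alg0)
  qed
  then have d: "d > 0" and rw: "rank_le (d - 1) (?w ` {..<m})" by simp_all
  have alg: "H * s + g * f = f / e * (H * t + g * e) + H / e * (e * s + - f * t)"
    if "e \<noteq> 0" for H s g f e t :: complex
  proof -
    have "f / e * (H * t + g * e) + H / e * (e * s + - f * t) = g * f * (e / e) + H * s * (e / e)"
      unfolding distrib_left by simp
    then show ?thesis using that by simp
  qed
  have u: "?u i l = h x * ?v i l + pd l h x * \<phi> i x" if "i < m" for i l
    by (rule pd_reg_mult[OF q h \<phi>[OF that]])
  have "rank_le (Suc (d - 1)) (insert (?u k) (?w ` {..<m}))" by (rule rank_le_insert[OF rw])
  then have "rank_le d (insert (?u k) (?w ` {..<m}))" using d by simp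
  then show ?thesis
  proof (rule rank_le_mono)
    show "?u ` {..<m} \<subseteq> fs.span (insert (?u k) (?w ` {..<m}))"
    proof
      fix z assume "z \<in> ?u ` {..<m}"
      then obtain i where i: "i < m" "z = ?u i" by blast
      have "z = (\<lambda>l. (\<phi> i x / \<phi> k x) * ?u k l) + (\<lambda>l. (h x / \<phi> k x) * ?w i l)"
      proof
        fix l
        have "z l = h x * ?v i l + pd l h x * \<phi> i x" unfolding i(2) by (rule u[OF i(1)])
        also have "\<dots> = (\<phi> i x / \<phi> k x) * (h x * ?v k l + pd l h x * \<phi> k x) + (h x / \<phi> k x) * ?w i l"
          by (rule alg[OF k(2)])
        finally show "z l = ((\<lambda>l. (\<phi> i x / \<phi> k x) * ?u k l) + (\<lambda>l. (h x / \<phi> k x) * ?w i l)) l"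
          using u[OF k(1)] by simp
      qed
      moreover have "\<dots> \<in> fs.span (insert (?u k) (?w ` {..<m}))"
        by (intro fs.span_add fs.span_scale fs.span_base) (use i in auto)
      ultimately show "z \<in> fs.span (insert (?u k) (?w ` {..<m}))" by (simp only:)
    qed
  qed
qed

text \<open>By the product rule the gradient of \<open>h\<close> is the only new direction.\<close>

lemma rank_le_mult:
  assumes q: "polyf N q" "q x \<noteq> 0" and \<phi>: "\<And>i. i < m \<Longrightarrow> reg N q (\<phi> i)" and h: "reg N q h"
    and rk: "rank_le d ((\<lambda>i l. pd l (\<phi> i) x) ` {..<m})"
  shows "rank_le (Suc d) ((\<lambda>i l. pd l (\<lambda>x. h x * \<phi> i x) x) ` {..<m})"
proof (rule rank_le_mono[OF rank_le_insert[OF rk, of "\<lambda>l. pd l h x"]])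
  let ?S = "insert (\<lambda>l. pd l h x) ((\<lambda>i l. pd l (\<phi> i) x) ` {..<m})"
  show "(\<lambda>i l. pd l (\<lambda>x. h x * \<phi> i x) x) ` {..<m} \<subseteq> fs.span ?S"
  proof
    fix z assume "z \<in> (\<lambda>i l. pd l (\<lambda>x. h x * \<phi> i x) x) ` {..<m}"
    then obtain i where i: "i < m" "z = (\<lambda>l. pd l (\<lambda>x. h x * \<phi> i x) x)" by blast
    have "z = (\<lambda>l. h x * pd l (\<phi> i) x) + (\<lambda>l. \<phi> i x * pd l h x)"
      unfolding i(2) by (rule ext) (simp add: pd_reg_mult[OF q h \<phi>[OF i(1)]])
    moreover have "(\<lambda>l. h x * pd l (\<phi> i) x) + (\<lambda>l. \<phi> i x * pd l h x) \<in> fs.span ?S"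
      by (intro fs.span_add fs.span_scale fs.span_base) (use i in auto)
    ultimately show "z \<in> fs.span ?S" by (simp only:)
  qed
qed

subsection \<open>Equivariant polynomial maps of the symmetric group\<close>

text \<open>Equivariance for the action moving entry \<open>j\<close> to place \<open>p j\<close>,
  written without inverse permutations.\<close>

definition sym_equivariant :: "nat \<Rightarrow> (nat \<Rightarrow> (nat \<Rightarrow> complex) \<Rightarrow> complex) \<Rightarrow> bool" where
  "sym_equivariant n f \<longleftrightarrow>
     (\<forall>p i x. p permutes {..<n} \<longrightarrow> i < n \<longrightarrow> f (p i) x = f i (\<lambda>j. x (p j)))"

lemma sym_equivariantD:
  "sym_equivariant n f \<Longrightarrow> p permutes {..<n} \<Longrightarrow> i < n \<Longrightarrow> f (p i) x = f i (\<lambda>j. x (p j))"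
  unfolding sym_equivariant_def by blast

lemma permutes_two_transitive:
  assumes "i < n" "j < n" "i' < n" "j' < n" "i \<noteq> j" "i' \<noteq> j'"
  shows "\<exists>p. p permutes {..<n} \<and> p i = i' \<and> p j = j'"
proof -
  let ?s = "Transposition.transpose i i'"
  let ?t = "Transposition.transpose (?s j) j'"
  have s: "?s permutes {..<n}" using assms by (intro permutes_swap_id) auto
  have "?s j \<in> {..<n}" using permutes_in_image[OF s, of j] assms(2) by simp
  then have t: "?t permutes {..<n}" using assms by (intro permutes_swap_id) auto
  have "?s i = i'" by simp
  moreover have "?s j \<noteq> i'" using assms(5) by (metis transpose_apply_first transpose_eq_iff)
  ultimately have "(?t \<circ> ?s) i = i'" "(?t \<circ> ?s) j = j'"
    using assms(6) by (simp_all add: transpose_apply_other)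
  then show ?thesis using permutes_compose[OF s t] by blast
qed

text \<open>Double transitivity spreads a proportionality with factor \<open>c\<close> to all
  ordered pairs. Going back and forth gives \<open>c * c = 1\<close>; reaching a third index
  directly and through another gives \<open>c = c * c\<close>. So \<open>c = 1\<close>, all
  components agree, and the zero sum kills them.\<close>

lemma equivariant_not_proportional:
  assumes n: "n \<ge> 3" and F: "sym_equivariant n F" and sum0: "\<And>x. (\<Sum>i<n. F i x) = 0"
    and nz: "i0 < n" "F i0 x0 \<noteq> 0" and ij: "i < n" "j < n" "i \<noteq> j"
  shows "\<exists>x. F j x \<noteq> c * F i x"
proof (rule ccontr)
  assume "\<not> ?thesis"
  then have eq: "F j x = c * F i x" for x by blast
  have all: "F j' x = c * F i' x" if ij': "i' < n" "j' < n" "i' \<noteq> j'" for i' j' x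
  proof -
    obtain p where p: "p permutes {..<n}" "p i = i'" "p j = j'"
      using permutes_two_transitive[OF ij(1,2) ij'(1,2) ij(3) ij'(3)] by blast
    have "F j' x = F j (\<lambda>l. x (p l))" using sym_equivariantD[OF F p(1) ij(2)] unfolding p(3) .
    also have "\<dots> = c * F i (\<lambda>l. x (p l))" by (rule eq)
    also have "F i (\<lambda>l. x (p l)) = F i' x" using sym_equivariantD[OF F p(1) ij(1), symmetric] unfolding p(2) .
    finally show ?thesis .
  qed
  have "\<exists>k<n. \<exists>l<n. k \<noteq> i0 \<and> l \<noteq> i0 \<and> k \<noteq> l"
  proof -
    have "card ({..<n} - {i0}) \<ge> 2" using n nz(1) by simp
    then obtain S where S: "S \<subseteq> {..<n} - {i0}" "card S = 2" by (rule obtain_subset_with_card_n)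
    from S(2) obtain k l where "S = {k, l}" "k \<noteq> l" unfolding card_2_iff by blast
    then have "k < n" "l < n" "k \<noteq> i0" "l \<noteq> i0" using S(1) by auto
    with \<open>k \<noteq> l\<close> show ?thesis by blast
  qed
  then obtain k l where kl: "k < n" "l < n" "k \<noteq> i0" "l \<noteq> i0" "k \<noteq> l" by blast
  have 1: "F k x0 = c * F i0 x0" by (rule all[OF nz(1) kl(1)]) (use kl in simp)
  have 2: "F i0 x0 = c * F k x0" by (rule all[OF kl(1) nz(1) kl(3)])
  have 3: "F l x0 = c * F i0 x0" by (rule all[OF nz(1) kl(2)]) (use kl in simp)
  have 4: "F l x0 = c * F k x0" by (rule all[OF kl(1,2,5)])
  have "(c * c) * F i0 x0 = F i0 x0" using 2[symmetric] unfolding 1 mult.assoc .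
  then have "(c * c - 1) * F i0 x0 = 0" unfolding left_diff_distrib by simp
  then have cc: "c * c = 1" using nz(2) by simp
  have "c * F i0 x0 = (c * c) * F i0 x0" using 3 4 unfolding 1 mult.assoc by (rule trans[OF sym])
  then have "c * F i0 x0 = 1 * F i0 x0" unfolding cc .
  then have c: "c = 1" using nz(2) by (simp only: mult_cancel_right simp_thms)
  have "F i' x0 = F i0 x0" if "i' < n" for i'
  proof (cases "i' = i0")
    case False
    then have "F i' x0 = c * F i0 x0" by (intro all[OF nz(1) that]) simp
    then show ?thesis by (simp only: c mult_1)
  qed simp
  then have "(\<Sum>i<n. F i x0) = (\<Sum>i<n. F i0 x0)" by (intro sum.cong refl) (simp only: lessThan_iff)
  also have "\<dots> = of_nat n * F i0 x0" by simp
  finally show False using nz(2) n unfolding sum0 by simp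
qed

text \<open>Equal \<open>n\<close>-th powers at a point mean proportionality by a root of unity
  there; a general point avoids all of these finitely many factors at once.\<close>

lemma equivariant_powers_distinct:
  assumes n: "n \<ge> 3" and Fp: "\<And>i. i < n \<Longrightarrow> polyf n (F i)" and F: "sym_equivariant n F"
    and sum0: "\<And>x. (\<Sum>i<n. F i x) = 0"
    and nz: "i0 < n" "F i0 x0 \<noteq> 0" and ij: "i < n" "j < n" "i \<noteq> j"
  shows "\<exists>x. F j x ^ n \<noteq> F i x ^ n"
proof -
  let ?R = "{z :: complex. z ^ n = 1}"
  have fin: "finite ?R" using n by (intro finite_roots_unity) simp
  have "\<exists>z. \<forall>c\<in>?R. F j z - c * F i z \<noteq> 0"
  proof (rule polyf_nonzero_common_finite[OF fin, of n])
    fix c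
    show "polyf n (\<lambda>x. F j x - c * F i x)" using Fp ij by simp
    show "\<exists>x. F j x - c * F i x \<noteq> 0"
      using equivariant_not_proportional[OF n F sum0 nz ij, of c] by simp
  qed
  then obtain z where z: "\<And>c. c ^ n = 1 \<Longrightarrow> F j z \<noteq> c * F i z" by auto
  have "F j z ^ n \<noteq> F i z ^ n"
  proof
    assume e: "F j z ^ n = F i z ^ n"
    show False
    proof (cases "F i z = 0")
      case True
      then have "F j z ^ n = 0" using e n by (simp add: power_0_left)
      then have "F j z = 0" by simp
      then show False using z[of 1] True by simp
    next
      case False
      then have "(F j z / F i z) ^ n = 1" using e by (simp add: power_divide)
      from z[OF this] False show False by simp
    qed
  qed
  then show ?thesis by blast
qed

text \<open>Subtracting the mean acts linearly on the image, so it does not raise the dimension, and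
  the common top degree keeps the leading forms equivariant. A nonzero form of degree
  \<open>a\<close> satisfies F(-x) = (-1)^a F(x); this is how the parities of \<open>f\<close> and
  \<open>Q\<close> pass to the degrees. The last clause covers polynomial covariants.\<close>

theorem leading_normal_form:
  assumes n: "n \<ge> 1" and fp': "\<forall>i<n. polyf n (f i)" and Qp: "polyf n Q" and Q0: "Q v \<noteq> 0"
    and f: "sym_equivariant n f" and neq: "i0 < n" "j0 < n" "f i0 u \<noteq> f j0 u"
    and ad: "alg_dim_le n d ((\<lambda>x i. f i x / Q x) ` {x. Q x \<noteq> 0})"
  shows "\<exists>F B a b. (\<forall>i<n. polyf n (F i)) \<and> polyf n B \<and> (\<exists>i<n. \<exists>x. F i x \<noteq> 0) \<and> (\<exists>x. B x \<noteq> 0) \<and>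
    sym_equivariant n F \<and> (\<forall>x. (\<Sum>i<n. F i x) = 0) \<and>
    (\<forall>i<n. \<forall>t x. F i (\<lambda>l. t * x l) = t ^ a * F i x) \<and> (\<forall>t x. B (\<lambda>l. t * x l) = t ^ b * B x) \<and>
    (\<forall>x. B x \<noteq> 0 \<longrightarrow> rank_le d ((\<lambda>i l. pd l (\<lambda>x. F i x / B x) x) ` {..<n})) \<and>
    ((\<forall>i<n. \<forall>x. f i (\<lambda>l. - x l) = - f i x) \<longrightarrow> odd a) \<and>
    ((\<forall>x. Q (\<lambda>l. - x l) = Q x) \<longrightarrow> even b) \<and>
    (Q = (\<lambda>_. 1) \<longrightarrow> b = 0 \<and> B = (\<lambda>_. 1))"
proof -
  note fp = fp'[rule_format]
  define w :: "nat \<Rightarrow> nat" where "w = (\<lambda>_. 1)"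
  define g where "g = (\<lambda>i x. f i x - (\<Sum>j<n. f j x) / of_nat n)"
  have gp: "polyf n (g i)" if "i < n" for i
    unfolding g_def by (intro polyf_diff polyf_divide_const polyf_sum fp that) simp
  have g0: "(\<Sum>i<n. g i x) = 0" for x using n unfolding g_def by (simp add: sum_subtractf)
  \<comment> \<open>Differences of components are unchanged by subtracting the mean.\<close>
  have "g i0 u \<noteq> 0 \<or> g j0 u \<noteq> 0" using neq(3) unfolding g_def by auto
  then obtain k0 where k0: "k0 < n" "g k0 u \<noteq> 0" using neq by blast
  have "\<exists>a. (\<exists>i<n. \<exists>x. hc w a (g i) x \<noteq> 0) \<and> (\<forall>j>a. \<forall>i<n. \<forall>x. hc w j (g i) x = 0)"
    by (rule top_degree_exists[where p=g, OF gp k0])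
  then obtain a where "(\<exists>i<n. \<exists>x. hc w a (g i) x \<noteq> 0) \<and> (\<forall>j>a. \<forall>i<n. \<forall>x. hc w j (g i) x = 0)"
    by (rule exE)
  note a1 = conjunct1[OF this] and a2 = conjunct2[OF this]
  have a3: "hc w j (g i) x = 0" if "j > a" "i < n" for j i x using a2 that by simp
  have "\<exists>b. (\<exists>i<Suc 0. \<exists>x. hc w b Q x \<noteq> 0) \<and> (\<forall>j>b. \<forall>i<Suc 0. \<forall>x. hc w j Q x = 0)"
    by (rule top_degree_exists[where p="\<lambda>_. Q", OF Qp lessI Q0])
  then obtain b where b0: "\<exists>x. hc w b Q x \<noteq> 0" and b1: "\<forall>j>b. \<forall>x. hc w j Q x = 0" by auto
  have b: "hc w j Q x = 0" if "j > b" for j x using b1 that by simp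
  let ?F = "\<lambda>i. hc w a (g i)"
  let ?B = "hc w b Q"
  have Fp: "polyf n (?F i)" if "i < n" for i by (rule polyf_hc[OF gp[OF that]])
  have Bp: "polyf n ?B" by (rule polyf_hc[OF Qp])
  have gse: "g (p i) x = g i (\<lambda>j. x (p j))" if p: "p permutes {..<n}" and i: "i < n" for p i x
  proof -
    have "(\<Sum>j<n. f j x) = (\<Sum>j<n. f (p j) x)"
      using sum.permute[OF p, of "\<lambda>j. f j x"] by (simp add: comp_def)
    also have "\<dots> = (\<Sum>j<n. f j (\<lambda>j. x (p j)))"
      by (rule sum.cong) (simp_all add: sym_equivariantD[OF f p])
    finally show ?thesis unfolding g_def using sym_equivariantD[OF f p i] by simp
  qed
  have Fse: "sym_equivariant n ?F"
    unfolding sym_equivariant_def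
  proof (intro allI impI)
    fix p i x assume p: "p permutes {..<n}" and i: "i < n"
    show "hc w a (g (p i)) x = hc w a (g i) (\<lambda>j. x (p j))"
      by (rule hc_cong) (simp add: gse[OF p i] w_def)
  qed
  have F0: "(\<Sum>i<n. ?F i x) = 0" for x
  proof -
    have "(\<Sum>i<n. ?F i x) = hc w a (\<lambda>x. \<Sum>i<n. g i x) x"
      by (rule hc_sum[symmetric, of _ n]) (simp_all add: gp)
    also have "\<dots> = 0" unfolding g0 by (simp add: hc_const)
    finally show ?thesis .
  qed
  have Fh: "?F i (\<lambda>l. t * x l) = t ^ a * ?F i x" if "i < n" for i t x
    using hc_homogeneous[OF gp[OF that], of w a t x] by (simp add: w_def)
  have Bh: "?B (\<lambda>l. t * x l) = t ^ b * ?B x" for t x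
    using hc_homogeneous[OF Qp, of w b t x] by (simp add: w_def)
  have "alg_dim_le n d ((\<lambda>x i. g i x / Q x) ` {x. Q x \<noteq> 0})"
  proof (rule alg_dim_le_image[OF ad])
    show "polyf n (\<lambda>y. y i - (\<Sum>j<n. y j) / of_nat n)" if "i < n" for i
      using that by (intro polyf_diff polyf_divide_const polyf_sum polyf_var) simp_all
    fix y assume "y \<in> (\<lambda>x i. g i x / Q x) ` {x. Q x \<noteq> 0}"
    then obtain x where x: "Q x \<noteq> 0" "y = (\<lambda>i. g i x / Q x)" by blast
    have "y i = f i x / Q x - (\<Sum>j<n. f j x / Q x) / of_nat n" for i
      unfolding x(2) g_def by (simp add: diff_divide_distrib sum_divide_distrib[symmetric])
    then show "\<exists>z\<in>(\<lambda>x i. f i x / Q x) ` {x. Q x \<noteq> 0}. \<forall>i<n. y i = z i - (\<Sum>j<n. z j) / of_nat n"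
      using x(1) by (intro bexI[of _ "\<lambda>i. f i x / Q x"]) auto
  qed
  note ad' = this
  have gr: "rank_le d ((\<lambda>i l. pd l (\<lambda>x. g i x / Q x) x) ` {..<n})" if "Q x \<noteq> 0" for x
    by (rule rank_le_if_alg_dim_le[OF Qp reg_divide[OF gp] ad' that])
  have Fr: "rank_le d ((\<lambda>i l. pd l (\<lambda>x. ?F i x / ?B x) x) ` {..<n})" if x: "?B x \<noteq> 0" for x
  proof (rule ccontr)
    assume "\<not> ?thesis"
    from not_rank_le_indep[OF this]
    obtain h where h: "\<forall>i\<le>d. h i < n" and ind: "indep (Suc d) (\<lambda>i l. pd l (\<lambda>x. ?F (h i) x / ?B x) x)"
      by (elim exE conjE)
    have hn: "h i < n" if "i < Suc d" for i using h that by simp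
    have "\<exists>x. Q x \<noteq> 0 \<and> indep (Suc d) (\<lambda>i l. pd l (\<lambda>x. g (h i) x / Q x) x)"
      by (rule leading_forms_indep[OF gp[OF hn] a3[OF _ hn] Qp b x ind])
    then obtain y where y: "Q y \<noteq> 0" "indep (Suc d) (\<lambda>i l. pd l (\<lambda>x. g (h i) x / Q x) y)"
      by (elim exE conjE)
    obtain S where S: "finite S" "card S \<le> d" "(\<lambda>i l. pd l (\<lambda>x. g i x / Q x) y) ` {..<n} \<subseteq> fs.span S"
      using gr[OF y(1)] unfolding rank_le_def by (elim exE conjE)
    have "(\<lambda>l. pd l (\<lambda>x. g (h i) x / Q x) y) \<in> fs.span S" if "i < Suc d" for i
      using S(3) hn[OF that] by (auto simp: image_subset_iff)
    from indep_span_le[OF y(2) S(1) this] S(2) show False by simp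
  qed
  obtain k z where k: "k < n" "?F k z \<noteq> 0" using a1 by (elim exE conjE)
  obtain y where y: "?B y \<noteq> 0" using b0 by (elim exE)
  have odd: "odd a" if o: "\<forall>i<n. \<forall>x. f i (\<lambda>l. - x l) = - f i x"
  proof -
    have "g k (\<lambda>l. - x l) = (- 1) * g k x" for x
      unfolding g_def using o k(1) by (simp add: sum_negf)
    from this[of "\<lambda>i. t ^ w i * z i" for t]
    have "?F k (\<lambda>l. - z l) = hc w a (\<lambda>x. (- 1) * g k x) z"
      by (intro hc_cong) (simp only: mult_minus_right)
    also have "\<dots> = - ?F k z" using hc_cmult[OF gp[OF k(1)], of w a "- 1"] by simp
    finally have "(- 1) ^ a * ?F k z = - ?F k z" using Fh[OF k(1), of "- 1" z] by simp
    then show ?thesis using k(2) by (cases "even a") auto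
  qed
  have even: "even b" if o: "\<forall>x. Q (\<lambda>l. - x l) = Q x"
  proof -
    have "?B (\<lambda>l. - y l) = ?B y"
      by (rule hc_cong) (simp only: mult_minus_right o[THEN spec, of "\<lambda>i. t ^ w i * y i" for t])
    then have "(- 1) ^ b * ?B y = ?B y" using Bh[of "- 1" y] by simp
    then show ?thesis using y by (cases "even b") auto
  qed
  have one: "b = 0 \<and> ?B = (\<lambda>_. 1)" if "Q = (\<lambda>_. 1)"
    using y unfolding that hc_const by (cases "b = 0") (auto simp: hc_const)
  show ?thesis
  proof (intro exI conjI allI impI)
    show "polyf n (?F i)" if "i < n" for i by (rule Fp[OF that])
    show "polyf n ?B" by (rule Bp)
    show "k < n" "?F k z \<noteq> 0" by (rule k)+
    show "?B y \<noteq> 0" by (rule y)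
    show "sym_equivariant n ?F" by (rule Fse)
    show "(\<Sum>i<n. ?F i x) = 0" for x by (rule F0)
    show "?F i (\<lambda>l. t * x l) = t ^ a * ?F i x" if "i < n" for i t x by (rule Fh[OF that])
    show "?B (\<lambda>l. t * x l) = t ^ b * ?B x" for t x by (rule Bh)
    show "rank_le d ((\<lambda>i l. pd l (\<lambda>x. ?F i x / ?B x) x) ` {..<n})" if "?B x \<noteq> 0" for x
      by (rule Fr[OF that])
    show "odd a" if "\<forall>i<n. \<forall>x. f i (\<lambda>l. - x l) = - f i x" by (rule odd[OF that])
    show "even b" if "\<forall>x. Q (\<lambda>l. - x l) = Q x" by (rule even[OF that])
    show "b = 0" "?B = (\<lambda>_. 1)" if "Q = (\<lambda>_. 1)" using one[OF that] by (rule conjunct1, rule conjunct2)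
  qed
qed

subsection \<open>Compression onto twisted permutation modules\<close>

lemma mult_mat_vec_coord:
  "M \<in> carrier_mat m N \<Longrightarrow> v \<in> carrier_vec N \<Longrightarrow> i < m \<Longrightarrow> (M *\<^sub>v v) $ i = (\<Sum>j<N. M $$ (i, j) * v $ j)"
  by (auto simp: scalar_prod_def atLeast0LessThan intro!: sum.cong)

lemma polyf_mat:
  assumes "polyf m F" "M \<in> carrier_mat m N"
  shows "polyf N (\<lambda>x. F (coords (M *\<^sub>v vec N x)))"
proof (rule polyf_compose[OF assms(1)])
  fix i assume i: "i < m"
  have "(\<lambda>x. (M *\<^sub>v vec N x) $ i) = (\<lambda>x. \<Sum>j<N. M $$ (i, j) * x j)"
    by (rule ext) (simp add: mult_mat_vec_coord[OF assms(2) _ i])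
  moreover have "polyf N (\<lambda>x. \<Sum>j<N. M $$ (i, j) * x j)"
    by (intro polyf_sum polyf_mult polyf_const polyf_var) simp
  ultimately show "polyf N (\<lambda>x. (M *\<^sub>v vec N x) $ i)" by (simp only:)
qed

lemma (in group) bij_betw_left_mult:
  assumes "k \<in> carrier G"
  shows "bij_betw (\<lambda>h. k \<otimes> h) (carrier G) (carrier G)"
  by (rule bij_betwI[where g="\<lambda>h. inv k \<otimes> h"]) (use assms in \<open>auto simp: m_assoc[symmetric]\<close>)

lemma vec_coords: "v \<in> carrier_vec N \<Longrightarrow> vec N (coords v) = v"
  by (intro eq_vecI) auto

text \<open>The new map is a composite of three equivariant maps. The map \<open>A\<close> is an
  average of translates carrying the free orbit of \<open>v0\<close> to that of \<open>u0\<close>;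
  then comes \<open>\<phi>\<close>; then an average carries the orbit of \<open>\<phi> u0\<close>
  back to that of \<open>v0\<close>. Hence \<open>v0\<close> is fixed up to the factor
  \<open>Q\<close>, and the dimension cannot grow because the last map is polynomial.\<close>

theorem versal_compression:
  fixes H :: "('h, 'r) monoid_scheme" (structure)
  assumes grp: "group H" and fin: "finite (carrier H)"
    and \<rho>: "\<And>h. h \<in> carrier H \<Longrightarrow> \<rho> h \<in> carrier_mat N N"
      "\<And>h k. h \<in> carrier H \<Longrightarrow> k \<in> carrier H \<Longrightarrow> \<rho> (h \<otimes> k) = \<rho> h * \<rho> k" "\<rho> \<one> = 1\<^sub>m N"
    and \<sigma>: "\<And>h. h \<in> carrier H \<Longrightarrow> \<sigma> h \<in> carrier_mat m m"
    and P: "\<And>i. i < m \<Longrightarrow> polyf N (P i)" and q: "polyf N q" "q z \<noteq> 0"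
    and \<phi>c: "\<And>v. v \<in> carrier_vec N \<Longrightarrow> q (coords v) \<noteq> 0 \<Longrightarrow> \<phi> v \<in> carrier_vec m"
    and \<phi>: "\<And>v i. v \<in> carrier_vec N \<Longrightarrow> q (coords v) \<noteq> 0 \<Longrightarrow> i < m \<Longrightarrow> \<phi> v $ i = P i (coords v) / q (coords v)"
    and equiv: "\<And>h v. h \<in> carrier H \<Longrightarrow> v \<in> carrier_vec N \<Longrightarrow> q (coords v) \<noteq> 0 \<Longrightarrow> \<phi> (\<rho> h *\<^sub>v v) = \<sigma> h *\<^sub>v \<phi> v"
    and faith: "\<And>h. h \<in> carrier H \<Longrightarrow> h \<noteq> \<one> \<Longrightarrow> \<exists>v\<in>carrier_vec N. q (coords v) \<noteq> 0 \<and> \<sigma> h *\<^sub>v \<phi> v \<noteq> \<phi> v"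
    and \<pi>: "\<And>h. h \<in> carrier H \<Longrightarrow> \<pi> h permutes {..<n}"
      "\<And>h k. h \<in> carrier H \<Longrightarrow> k \<in> carrier H \<Longrightarrow> \<pi> (h \<otimes> k) = \<pi> h \<circ> \<pi> k"
    and \<epsilon>: "\<And>h. h \<in> carrier H \<Longrightarrow> \<epsilon> h = 1 \<or> \<epsilon> h = (- 1 :: complex)"
      "\<And>h k. h \<in> carrier H \<Longrightarrow> k \<in> carrier H \<Longrightarrow> \<epsilon> (h \<otimes> k) = \<epsilon> h * \<epsilon> k"
    and inj: "\<And>h. h \<in> carrier H \<Longrightarrow> \<pi> h = id \<Longrightarrow> \<epsilon> h = 1 \<Longrightarrow> h = \<one>"
    and n: "n \<ge> 1"
    and ad: "alg_dim_le m d ((\<lambda>x i. P i x / q x) ` {x. q x \<noteq> 0})"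
  shows "\<exists>f Q. (\<forall>i<n. polyf n (f i)) \<and> polyf n Q \<and> Q (\<lambda>i. of_nat (Suc i)) \<noteq> 0 \<and>
    (\<forall>i<n. f i (\<lambda>i. of_nat (Suc i)) = Q (\<lambda>i. of_nat (Suc i)) * of_nat (Suc i)) \<and>
    (\<forall>h\<in>carrier H. \<forall>i<n. \<forall>x. f (\<pi> h i) x = \<epsilon> h * f i (\<lambda>j. \<epsilon> h * x (\<pi> h j))) \<and>
    (\<forall>h\<in>carrier H. \<forall>x. Q (\<lambda>j. \<epsilon> h * x (\<pi> h j)) = Q x) \<and>
    alg_dim_le n d ((\<lambda>x i. f i x / Q x) ` {x. Q x \<noteq> 0}) \<and>
    ((\<forall>x. q x = 1) \<longrightarrow> Q = (\<lambda>_. 1))"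
proof -
  interpret group H by (rule grp)
  \<comment> \<open>The inverse of the signed permutation action on \<complex>^n; it is therefore a
    right action.\<close>
  define tw where "tw = (\<lambda>h x j. \<epsilon> h * x (\<pi> h j) :: complex)"
  have tw_tw: "tw h (tw k x) = tw (k \<otimes> h) x" if "h \<in> carrier H" "k \<in> carrier H" for h k x
    unfolding tw_def \<pi>(2)[OF that(2,1)] \<epsilon>(2)[OF that(2,1)] by (rule ext) simp
  have \<pi>1: "\<pi> \<one> = id"
  proof -
    have "\<pi> \<one> \<circ> \<pi> \<one> = \<pi> \<one>" using \<pi>(2)[of \<one> \<one>] by simp
    moreover have "inj (\<pi> \<one>)" using \<pi>(1)[OF one_closed] by (rule permutes_inj)
    ultimately show ?thesis by (metis fun.map_id inj_eq comp_apply eq_id_iff)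
  qed
  have \<epsilon>1: "\<epsilon> \<one> = 1" using \<epsilon>(1)[of \<one>] \<epsilon>(2)[of \<one> \<one>] by auto
  have tw1: "tw \<one> x = x" for x unfolding tw_def \<pi>1 \<epsilon>1 by simp
  have \<pi>n: "\<pi> h j < n" if "h \<in> carrier H" "j < n" for h j
    using permutes_in_image[OF \<pi>(1)[OF that(1)], of j] that(2) by simp
  have polyf_tw: "polyf n (\<lambda>x. F (tw h x))" if "polyf n F" "h \<in> carrier H" for F h
    unfolding tw_def by (rule polyf_compose[OF that(1)]) (intro polyf_mult polyf_const polyf_var \<pi>n that(2))
  \<comment> \<open>Positive entries exclude the sign -1 and distinct entries exclude nontrivial
    permutations, so the stabiliser is trivial.\<close>
  define v0 :: "nat \<Rightarrow> complex" where "v0 = (\<lambda>i. of_nat (Suc i))"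
  have v0_free: "\<exists>j<n. tw h v0 j \<noteq> v0 j" if h: "h \<in> carrier H" "h \<noteq> \<one>" for h
  proof (rule ccontr)
    assume "\<not> ?thesis"
    then have e: "\<epsilon> h * of_nat (Suc (\<pi> h j)) = of_nat (Suc j)" if "j < n" for j
      using that unfolding tw_def v0_def by blast
    have "\<epsilon> h = 1"
    proof (rule ccontr)
      assume "\<epsilon> h \<noteq> 1"
      then have "\<epsilon> h = - 1" using \<epsilon>(1)[OF h(1)] by blast
      then have "- of_nat (Suc (\<pi> h 0)) = (of_nat (Suc 0) :: complex)" using e[of 0] n by simp
      then have "Re (- of_nat (Suc (\<pi> h 0))) = Re (of_nat (Suc 0))" by (rule arg_cong)
      then show False by simp
    qed
    moreover have "\<pi> h = id"
    proof
      fix j show "\<pi> h j = id j"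
      proof (cases "j < n")
        case True
        have "(of_nat (Suc (\<pi> h j)) :: complex) = of_nat (Suc j)"
          using e[OF True] unfolding \<open>\<epsilon> h = 1\<close> mult_1 .
        then show ?thesis by (simp only: of_nat_eq_iff Suc_inject id_apply)
      next
        case False
        then show ?thesis using permutes_not_in[OF \<pi>(1)[OF h(1)], of j] by simp
      qed
    qed
    ultimately show False using inj[OF h(1)] h(2) by blast
  qed
  have vc: "vec N x \<in> carrier_vec N" for x :: "nat \<Rightarrow> complex" by simp
  have \<rho>v: "\<rho> h *\<^sub>v v \<in> carrier_vec N" if "h \<in> carrier H" "v \<in> carrier_vec N" for h v
    using \<rho>(1)[OF that(1)] that(2) by (rule mult_mat_vec_carrier)
  have \<rho>\<rho>: "\<rho> h *\<^sub>v (\<rho> k *\<^sub>v v) = \<rho> (h \<otimes> k) *\<^sub>v v" if "h \<in> carrier H" "k \<in> carrier H" "v \<in> carrier_vec N" for h k v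
    unfolding \<rho>(2)[OF that(1,2)] by (rule assoc_mult_mat_vec[OF \<rho>(1)[OF that(1)] \<rho>(1)[OF that(2)] that(3), symmetric])
  have \<rho>1: "\<rho> \<one> *\<^sub>v v = v" if "v \<in> carrier_vec N" for v unfolding \<rho>(3) using that by simp
  have "\<forall>h\<in>carrier H - {\<one>}. \<exists>i<m. \<exists>x. (\<Sum>j<m. \<sigma> h $$ (i, j) * P j x) - P i x \<noteq> 0"
  proof
    fix h assume "h \<in> carrier H - {\<one>}"
    then have h: "h \<in> carrier H" "h \<noteq> \<one>" by simp_all
    obtain v where v: "v \<in> carrier_vec N" "q (coords v) \<noteq> 0" "\<sigma> h *\<^sub>v \<phi> v \<noteq> \<phi> v"
      using faith[OF h] by blast
    have c: "\<phi> v \<in> carrier_vec m" by (rule \<phi>c[OF v(1,2)])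
    have "\<exists>i<m. (\<sigma> h *\<^sub>v \<phi> v) $ i \<noteq> \<phi> v $ i"
    proof (rule ccontr)
      assume "\<not> ?thesis"
      then have "\<sigma> h *\<^sub>v \<phi> v = \<phi> v" using c \<sigma>[OF h(1)] by (intro eq_vecI) auto
      then show False using v(3) by blast
    qed
    then obtain i where i: "i < m" "(\<sigma> h *\<^sub>v \<phi> v) $ i \<noteq> \<phi> v $ i" by blast
    have "(\<sigma> h *\<^sub>v \<phi> v) $ i = (\<Sum>j<m. \<sigma> h $$ (i, j) * (P j (coords v) / q (coords v)))"
      unfolding mult_mat_vec_coord[OF \<sigma>[OF h(1)] c i(1)] by (rule sum.cong) (simp_all add: \<phi>[OF v(1,2)])
    also have "\<dots> = (\<Sum>j<m. \<sigma> h $$ (i, j) * P j (coords v)) / q (coords v)"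
      by (simp add: sum_divide_distrib)
    finally have "(\<Sum>j<m. \<sigma> h $$ (i, j) * P j (coords v)) - P i (coords v) \<noteq> 0"
      using i(2) v(2) \<phi>[OF v(1,2) i(1)] by auto
    then show "\<exists>i<m. \<exists>x. (\<Sum>j<m. \<sigma> h $$ (i, j) * P j x) - P i x \<noteq> 0" using i(1) by blast
  qed
  from bchoice[OF this] obtain I where I: "\<forall>h\<in>carrier H - {\<one>}. I h < m \<and>
      (\<exists>x. (\<Sum>j<m. \<sigma> h $$ (I h, j) * P j x) - P (I h) x \<noteq> 0)" by blast
  \<comment> \<open>The polynomials that must not vanish at \<open>x0\<close>: with
    \<open>True\<close>, \<open>q\<close> along the orbit of the source vector; with
    \<open>False\<close>, a coordinate in which \<open>h\<close> moves its image.\<close>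
  define DD where "DD = (\<lambda>(h, b) x. if b then q (coords (\<rho> h *\<^sub>v vec N x))
      else if h = \<one> then 1 else (\<Sum>j<m. \<sigma> h $$ (I h, j) * P j x) - P (I h) x)"
  have "\<exists>x. \<forall>i\<in>carrier H \<times> UNIV. DD i x \<noteq> 0"
  proof (rule polyf_nonzero_common_finite[where N=N])
    show "finite (carrier H \<times> (UNIV :: bool set))" using fin by simp
  next
    fix hb :: "'h \<times> bool" assume "hb \<in> carrier H \<times> UNIV"
    then obtain h b where hb: "hb = (h, b)" "h \<in> carrier H" by auto
    have Ip: "polyf N (\<lambda>x. (\<Sum>j<m. \<sigma> h $$ (I h, j) * P j x) - P (I h) x)" if "h \<noteq> \<one>"
      using I hb(2) that by (intro polyf_diff polyf_sum polyf_mult polyf_const P) auto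
    show "polyf N (DD hb)"
      unfolding hb(1) DD_def using Ip polyf_mat[OF q(1) \<rho>(1)[OF hb(2)]] by (cases b; cases "h = \<one>") simp_all
    show "\<exists>x. DD hb x \<noteq> 0"
    proof (cases b)
      case True
      let ?x = "coords (\<rho> (inv h) *\<^sub>v vec N z)"
      have c: "\<rho> (inv h) *\<^sub>v vec N z \<in> carrier_vec N" using hb(2) by (intro \<rho>v vc) simp
      have "vec N ?x = \<rho> (inv h) *\<^sub>v vec N z" by (rule vec_coords[OF c])
      then have "\<rho> h *\<^sub>v vec N ?x = vec N z" using \<rho>\<rho>[of h "inv h" "vec N z"] hb(2) \<rho>1 by simp
      then have "DD hb ?x = q z" unfolding hb(1) DD_def using True polyf_coords_vec[OF q(1)] by simp
      then show ?thesis using q(2) by (intro exI[of _ ?x]) simp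
    next
      case False
      then show ?thesis unfolding hb(1) DD_def using I hb(2) by (cases "h = \<one>") auto
    qed
  qed
  then obtain x0 where x0: "\<And>h b. h \<in> carrier H \<Longrightarrow> DD (h, b) x0 \<noteq> 0" by blast
  define u0 where "u0 = vec N x0"
  have u0c: "u0 \<in> carrier_vec N" unfolding u0_def by simp
  have qu0: "q (coords (\<rho> h *\<^sub>v u0)) \<noteq> 0" if "h \<in> carrier H" for h
    using x0[OF that, of True] unfolding DD_def u0_def by simp
  have q1u0: "q (coords u0) \<noteq> 0" using qu0[OF one_closed] \<rho>1[OF u0c] by simp
  \<comment> \<open>The orbit of the image point, which \<open>s\<close> will separate: 1 at the
    neutral element and 0 at all others.\<close>
  define y where "y = (\<lambda>h. coords (\<phi> (\<rho> h *\<^sub>v u0)))"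
  have yfree: "\<exists>i<m. y h i \<noteq> y \<one> i" if h: "h \<in> carrier H" "h \<noteq> \<one>" for h
  proof -
    have i: "I h < m" using I h by blast
    have c: "\<phi> u0 \<in> carrier_vec m" by (rule \<phi>c[OF u0c q1u0])
    have "y h (I h) = (\<sigma> h *\<^sub>v \<phi> u0) $ I h" unfolding y_def equiv[OF h(1) u0c q1u0] ..
    also have "\<dots> = (\<Sum>j<m. \<sigma> h $$ (I h, j) * (P j x0 / q x0))"
      unfolding mult_mat_vec_coord[OF \<sigma>[OF h(1)] c i]
    proof (rule sum.cong[OF refl])
      fix j assume "j \<in> {..<m}"
      then have j: "j < m" by simp
      show "\<sigma> h $$ (I h, j) * \<phi> u0 $ j = \<sigma> h $$ (I h, j) * (P j x0 / q x0)"
        unfolding \<phi>[OF u0c q1u0 j] unfolding u0_def polyf_coords_vec[OF P[OF j]] polyf_coords_vec[OF q(1)] ..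
    qed
    also have "\<dots> = (\<Sum>j<m. \<sigma> h $$ (I h, j) * P j x0) / q x0"
      by (simp add: sum_divide_distrib)
    finally have 1: "y h (I h) = (\<Sum>j<m. \<sigma> h $$ (I h, j) * P j x0) / q x0" .
    have 2: "y \<one> (I h) = P (I h) x0 / q x0"
      unfolding y_def \<rho>1[OF u0c] \<phi>[OF u0c q1u0 i]
      unfolding u0_def polyf_coords_vec[OF P[OF i]] polyf_coords_vec[OF q(1)] ..
    have "q x0 \<noteq> 0" using q1u0 unfolding u0_def polyf_coords_vec[OF q(1)] .
    moreover have "(\<Sum>j<m. \<sigma> h $$ (I h, j) * P j x0) - P (I h) x0 \<noteq> 0"
      using x0[OF h(1), of False] h(2) unfolding DD_def by simp
    ultimately have "y h (I h) \<noteq> y \<one> (I h)" unfolding 1 2 by simp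
    then show ?thesis using i by blast
  qed
  have "\<exists>s. polyf m s \<and> s (y \<one>) = 1 \<and> (\<forall>w\<in>y ` (carrier H - {\<one>}). s w = 0)"
    by (rule polyf_interpolate) (use fin yfree in auto)
  then obtain s where s: "polyf m s" "s (y \<one>) = 1" "\<And>h. h \<in> carrier H \<Longrightarrow> h \<noteq> \<one> \<Longrightarrow> s (y h) = 0" by blast
  have "\<exists>p. polyf n p \<and> p v0 = 1 \<and> (\<forall>w\<in>(\<lambda>h. tw h v0) ` (carrier H - {\<one>}). p w = 0)"
    by (rule polyf_interpolate) (use fin v0_free in auto)
  then obtain p where p: "polyf n p" "p v0 = 1" "\<And>h. h \<in> carrier H \<Longrightarrow> h \<noteq> \<one> \<Longrightarrow> p (tw h v0) = 0" by blast
  \<comment> \<open>The translates of \<open>u0\<close>, weighted by a function that is 1 at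
    \<open>v0\<close> and 0 on the rest of its orbit; summing over the group makes the map
    equivariant.\<close>
  define \<alpha> where "\<alpha> = (\<lambda>i x. \<Sum>h\<in>carrier H. p (tw h x) * (\<rho> h *\<^sub>v u0) $ i)"
  define A where "A = (\<lambda>x. vec N (\<lambda>i. \<alpha> i x))"
  have \<alpha>p: "polyf n (\<alpha> i)" for i
    unfolding \<alpha>_def by (intro polyf_sum polyf_mult polyf_const polyf_tw p(1))
  have Ac: "A x \<in> carrier_vec N" for x unfolding A_def by simp
  have polyf_A: "polyf n (\<lambda>x. F (coords (A x)))" if "polyf N F" for F
    unfolding A_def polyf_coords_vec[OF that] by (rule polyf_compose[OF that \<alpha>p])
  have A_eq: "\<rho> k *\<^sub>v A (tw k x) = A x" if k: "k \<in> carrier H" for k x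
  proof (rule eq_vecI)
    show "dim_vec (\<rho> k *\<^sub>v A (tw k x)) = dim_vec (A x)" using \<rho>v[OF k Ac] Ac by (metis carrier_vecD)
    fix i assume "i < dim_vec (A x)"
    then have i: "i < N" unfolding A_def by simp
    have "(\<rho> k *\<^sub>v A (tw k x)) $ i = (\<Sum>j<N. \<rho> k $$ (i, j) * \<alpha> j (tw k x))"
      unfolding mult_mat_vec_coord[OF \<rho>(1)[OF k] Ac i] by (rule sum.cong) (simp_all add: A_def)
    also have "\<dots> = (\<Sum>h\<in>carrier H. p (tw h (tw k x)) * (\<Sum>j<N. \<rho> k $$ (i, j) * (\<rho> h *\<^sub>v u0) $ j))"
      unfolding \<alpha>_def sum_distrib_left by (subst sum.swap) (simp only: mult.left_commute)
    also have "\<dots> = (\<Sum>h\<in>carrier H. p (tw (k \<otimes> h) x) * (\<rho> (k \<otimes> h) *\<^sub>v u0) $ i)"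
    proof (rule sum.cong[OF refl])
      fix h assume h: "h \<in> carrier H"
      have "(\<Sum>j<N. \<rho> k $$ (i, j) * (\<rho> h *\<^sub>v u0) $ j) = (\<rho> k *\<^sub>v (\<rho> h *\<^sub>v u0)) $ i"
        by (rule mult_mat_vec_coord[OF \<rho>(1)[OF k] \<rho>v[OF h u0c] i, symmetric])
      then show "p (tw h (tw k x)) * (\<Sum>j<N. \<rho> k $$ (i, j) * (\<rho> h *\<^sub>v u0) $ j) =
          p (tw (k \<otimes> h) x) * (\<rho> (k \<otimes> h) *\<^sub>v u0) $ i"
        unfolding tw_tw[OF h k] \<rho>\<rho>[OF k h u0c] by (simp only:)
    qed
    also have "\<dots> = \<alpha> i x"
      unfolding \<alpha>_def by (rule sum.reindex_bij_betw[OF bij_betw_left_mult[OF k]])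
    also have "\<dots> = A x $ i" unfolding A_def using i by simp
    finally show "(\<rho> k *\<^sub>v A (tw k x)) $ i = A x $ i" .
  qed
  have A_tw: "A (tw k x) = \<rho> (inv k) *\<^sub>v A x" if k: "k \<in> carrier H" for k x
    unfolding A_eq[OF k, of x, symmetric] \<rho>\<rho>[OF inv_closed[OF k] k Ac] l_inv[OF k] \<rho>1[OF Ac] ..
  have A_v0: "A v0 = u0"
  proof (rule eq_vecI)
    show "dim_vec (A v0) = dim_vec u0" unfolding A_def u0_def by simp
    fix i assume "i < dim_vec u0"
    then have i: "i < N" unfolding u0_def by simp
    have "\<alpha> i v0 = (\<Sum>h\<in>carrier H. if h = \<one> then u0 $ i else 0)"
      unfolding \<alpha>_def by (rule sum.cong[OF refl]) (use p tw1 \<rho>1[OF u0c] in auto)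
    also have "\<dots> = u0 $ i" using fin by (simp only: sum.delta one_closed if_True)
    finally show "A v0 $ i = u0 $ i" unfolding A_def using i by simp
  qed
  define qq where "qq = (\<lambda>h x. q (coords (A (tw h x))))"
  have qqp: "polyf n (qq h)" if "h \<in> carrier H" for h
    unfolding qq_def using polyf_tw[OF polyf_A[OF q(1)] that] .
  \<comment> \<open>The product over the group is an invariant denominator, and it is nonzero only
    where all translates are defined.\<close>
  define q1 where "q1 = (\<lambda>x. \<Prod>h\<in>carrier H. qq h x)"
  have q1p: "polyf n q1" unfolding q1_def by (intro polyf_prod qqp)
  have q1_ne: "qq h x \<noteq> 0" if "q1 x \<noteq> 0" "h \<in> carrier H" for h x
    using that fin unfolding q1_def by auto
  have qq_tw: "qq h (tw k x) = qq (k \<otimes> h) x" if "h \<in> carrier H" "k \<in> carrier H" for h k x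
    unfolding qq_def tw_tw[OF that] ..
  have q1_tw: "q1 (tw k x) = q1 x" if k: "k \<in> carrier H" for k x
  proof -
    have "q1 (tw k x) = (\<Prod>h\<in>carrier H. qq (k \<otimes> h) x)"
      unfolding q1_def by (rule prod.cong[OF refl qq_tw[OF _ k]])
    also have "\<dots> = q1 x" unfolding q1_def by (rule prod.reindex_bij_betw[OF bij_betw_left_mult[OF k]])
    finally show ?thesis .
  qed
  have q1v0: "q1 v0 \<noteq> 0"
    unfolding q1_def qq_def using fin qu0 by (simp add: A_tw A_v0)
  define \<psi> where "\<psi> = (\<lambda>x i. P i (coords (A x)) / q (coords (A x)))"
  have \<psi>\<phi>: "\<psi> x i = \<phi> (A x) $ i" if "q (coords (A x)) \<noteq> 0" "i < m" for x i
    unfolding \<psi>_def \<phi>[OF Ac that] ..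
  define \<gamma> where "\<gamma> = (\<lambda>x. s (\<psi> x))"
  have \<gamma>reg: "reg n q1 (\<lambda>x. \<gamma> (tw h x))" if h: "h \<in> carrier H" for h
  proof -
    have "reg n q1 (\<lambda>x. \<psi> (tw h x) i)" if i: "i < m" for i
    proof (rule reg_cong[OF reg_divide])
      show "polyf n (\<lambda>x. P i (coords (A (tw h x))) * (\<Prod>k\<in>carrier H - {h}. qq k x))"
        by (intro polyf_mult polyf_prod qqp polyf_tw[OF polyf_A[OF P[OF i]] h]) simp
      fix x assume x: "q1 x \<noteq> 0"
      have "q1 x = qq h x * (\<Prod>k\<in>carrier H - {h}. qq k x)"
        unfolding q1_def by (rule prod.remove[OF fin h])
      then show "P i (coords (A (tw h x))) * (\<Prod>k\<in>carrier H - {h}. qq k x) / q1 x = \<psi> (tw h x) i"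
        using x unfolding \<psi>_def qq_def by simp
    qed
    then show ?thesis unfolding \<gamma>_def by (rule reg_compose[OF s(1) q1p])
  qed
  \<comment> \<open>The same averaging in the other direction: \<open>tw (inv h) v0\<close> is
    \<open>h\<close> applied to \<open>v0\<close>, and \<open>\<gamma>\<close> recognises the image
    of \<open>v0\<close> within its orbit.\<close>
  define g where "g = (\<lambda>i x. \<Sum>h\<in>carrier H. tw (inv h) v0 i * \<gamma> (tw h x))"
  have greg: "reg n q1 (g i)" for i
    unfolding g_def by (intro reg_sum reg_mult reg_const q1p \<gamma>reg)
  have g_eq: "g (\<pi> k i) x = \<epsilon> k * g i (tw k x)" if k: "k \<in> carrier H" for k i x
  proof -
    have "g (\<pi> k i) x = (\<Sum>h\<in>carrier H. tw (inv (k \<otimes> h)) v0 (\<pi> k i) * \<gamma> (tw (k \<otimes> h) x))"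
      unfolding g_def by (rule sum.reindex_bij_betw[OF bij_betw_left_mult[OF k], symmetric])
    also have "\<dots> = (\<Sum>h\<in>carrier H. \<epsilon> k * (tw (inv h) v0 i * \<gamma> (tw h (tw k x))))"
    proof (rule sum.cong[OF refl])
      fix h assume h: "h \<in> carrier H"
      have kk: "\<epsilon> k * \<epsilon> k = 1" using \<epsilon>(1)[OF k] by auto
      have "tw (inv h) v0 i = tw (inv (k \<otimes> h) \<otimes> k) v0 i"
        using h k by (simp add: inv_mult_group m_assoc)
      also have "\<dots> = tw k (tw (inv (k \<otimes> h)) v0) i" using tw_tw[OF k, of "inv (k \<otimes> h)" v0] h k by simp
      also have "\<dots> = \<epsilon> k * tw (inv (k \<otimes> h)) v0 (\<pi> k i)" unfolding tw_def ..
      finally have "\<epsilon> k * tw (inv h) v0 i = (\<epsilon> k * \<epsilon> k) * tw (inv (k \<otimes> h)) v0 (\<pi> k i)" by (simp only: mult.assoc)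
      then show "tw (inv (k \<otimes> h)) v0 (\<pi> k i) * \<gamma> (tw (k \<otimes> h) x) = \<epsilon> k * (tw (inv h) v0 i * \<gamma> (tw h (tw k x)))"
        unfolding kk tw_tw[OF h k] mult.assoc[symmetric] by simp
    qed
    also have "\<dots> = \<epsilon> k * g i (tw k x)" unfolding g_def sum_distrib_left ..
    finally show ?thesis .
  qed
  have \<psi>v0: "\<gamma> (tw h v0) = (if h = \<one> then 1 else 0)" if h: "h \<in> carrier H" for h
  proof -
    have qn: "q (coords (A (tw h v0))) \<noteq> 0" unfolding A_tw[OF h] A_v0 using qu0 h by simp
    have "\<gamma> (tw h v0) = s (y (inv h))"
      unfolding \<gamma>_def
    proof (rule polyf_cong[OF s(1)])
      fix i assume "i < m"
      then show "\<psi> (tw h v0) i = y (inv h) i" using \<psi>\<phi>[OF qn] unfolding y_def A_tw[OF h] A_v0 by simp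
    qed
    then show ?thesis using s(2) s(3)[of "inv h"] h by (cases "h = \<one>") (auto simp: inv_eq_1_iff)
  qed
  have g_v0: "g i v0 = v0 i" for i
  proof -
    have "g i v0 = (\<Sum>h\<in>carrier H. if h = \<one> then v0 i else 0)"
      unfolding g_def by (rule sum.cong[OF refl]) (simp add: \<psi>v0 tw1)
    also have "\<dots> = v0 i" using fin by (simp only: sum.delta one_closed if_True)
    finally show ?thesis .
  qed
  have "\<forall>i. \<exists>ep. polyf n (snd ep) \<and> (\<forall>x. q1 x \<noteq> 0 \<longrightarrow> g i x = snd ep x / q1 x ^ fst ep)"
    using greg unfolding reg_def by simp
  from choice[OF this] obtain ep where ep: "\<And>i. polyf n (snd (ep i))"
    "\<And>i x. q1 x \<noteq> 0 \<Longrightarrow> g i x = snd (ep i) x / q1 x ^ fst (ep i)" by blast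
  \<comment> \<open>The extra \<open>Suc\<close> makes each numerator divisible by
    \<open>q1\<close>, so that \<open>f i x = Q x * g i x\<close> holds even at the zeros of
    \<open>q1\<close>, where \<open>g\<close> is not controlled.\<close>
  define E where "E = Suc (\<Sum>i<n. fst (ep i))"
  define Q where "Q = (\<lambda>x. q1 x ^ E)"
  define f where "f = (\<lambda>i x. snd (ep i) x * q1 x ^ (E - fst (ep i)))"
  have fp: "polyf n (f i)" for i unfolding f_def using ep(1) q1p by simp
  have Qp: "polyf n Q" unfolding Q_def using q1p by simp
  have le: "fst (ep i) < E" if "i < n" for i
  proof -
    have "fst (ep i) \<le> (\<Sum>i<n. fst (ep i))" using that by (intro member_le_sum) auto
    then show ?thesis unfolding E_def by simp
  qed
  have Q0: "Q x = 0 \<longleftrightarrow> q1 x = 0" for x unfolding Q_def E_def by auto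
  have fg: "f i x = Q x * g i x" if "i < n" for i x
  proof (cases "q1 x = 0")
    case True
    then show ?thesis unfolding f_def Q_def using le[OF that] by (simp add: power_0_left)
  next
    case False
    have "Q x = q1 x ^ fst (ep i) * q1 x ^ (E - fst (ep i))"
      unfolding Q_def using le[OF that] by (simp flip: power_add)
    then show ?thesis unfolding f_def ep(2)[OF False] using False by simp
  qed
  have Q_tw: "Q (tw h x) = Q x" if "h \<in> carrier H" for h x unfolding Q_def q1_tw[OF that] ..
  have f_tw: "f (\<pi> h i) x = \<epsilon> h * f i (tw h x)" if "h \<in> carrier H" "i < n" for h i x
    unfolding fg[OF \<pi>n[OF that]] fg[OF that(2)] Q_tw[OF that(1)] g_eq[OF that(1)] by (simp only: mult.left_commute)
  have "alg_dim_le n d ((\<lambda>x i. f i x / Q x) ` {x. Q x \<noteq> 0})"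
  proof (rule alg_dim_le_image[OF ad])
    \<comment> \<open>By equivariance of \<open>A\<close> and \<open>\<phi>\<close> every summand
      depends only on the single point \<open>\<phi> (A x)\<close>, and this is the polynomial in
      it.\<close>
    show "polyf m (\<lambda>w. \<Sum>h\<in>carrier H. tw (inv h) v0 i * s (coords (\<sigma> (inv h) *\<^sub>v vec m w)))" for i
      by (intro polyf_sum polyf_mult polyf_const polyf_mat[OF s(1)] \<sigma> inv_closed)
    fix w assume "w \<in> (\<lambda>x i. f i x / Q x) ` {x. Q x \<noteq> 0}"
    then obtain x where x: "Q x \<noteq> 0" "w = (\<lambda>i. f i x / Q x)" by blast
    have x1: "q1 x \<noteq> 0" using x(1) Q0 by blast
    have qA: "q (coords (A x)) \<noteq> 0" using q1_ne[OF x1 one_closed] unfolding qq_def tw1 .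
    have "\<psi> x \<in> (\<lambda>x i. P i x / q x) ` {x. q x \<noteq> 0}" unfolding \<psi>_def using qA by blast
    moreover have "w i = (\<Sum>h\<in>carrier H. tw (inv h) v0 i * s (coords (\<sigma> (inv h) *\<^sub>v vec m (\<psi> x))))" if "i < n" for i
    proof -
      have "w i = g i x" unfolding x(2) fg[OF that] using x(1) by simp
      also have "\<dots> = (\<Sum>h\<in>carrier H. tw (inv h) v0 i * s (coords (\<sigma> (inv h) *\<^sub>v vec m (\<psi> x))))"
        unfolding g_def
      proof (rule sum.cong[OF refl])
        fix h assume h: "h \<in> carrier H"
        have qn: "q (coords (A (tw h x))) \<noteq> 0" using q1_ne[OF x1 h] unfolding qq_def .
        have v: "vec m (\<psi> x) = \<phi> (A x)"
          using \<phi>c[OF Ac qA] by (intro eq_vecI) (auto simp: \<psi>\<phi>[OF qA])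
        have "\<gamma> (tw h x) = s (coords (\<phi> (A (tw h x))))"
          unfolding \<gamma>_def by (rule polyf_cong[OF s(1)]) (simp add: \<psi>\<phi>[OF qn])
        also have "\<phi> (A (tw h x)) = \<sigma> (inv h) *\<^sub>v \<phi> (A x)"
          unfolding A_tw[OF h] by (rule equiv[OF inv_closed[OF h] Ac qA])
        finally show "tw (inv h) v0 i * \<gamma> (tw h x) = tw (inv h) v0 i * s (coords (\<sigma> (inv h) *\<^sub>v vec m (\<psi> x)))"
          unfolding v by (simp only:)
      qed
      finally show ?thesis .
    qed
    ultimately show "\<exists>y\<in>(\<lambda>x i. P i x / q x) ` {x. q x \<noteq> 0}. \<forall>i<n. w i =
        (\<Sum>h\<in>carrier H. tw (inv h) v0 i * s (coords (\<sigma> (inv h) *\<^sub>v vec m y)))"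
      by (intro bexI[of _ "\<psi> x"]) simp_all
  qed
  moreover have "f (\<pi> h i) x = \<epsilon> h * f i (\<lambda>j. \<epsilon> h * x (\<pi> h j))" if "h \<in> carrier H" "i < n" for h i x
    using f_tw[OF that] unfolding tw_def .
  moreover have "Q (\<lambda>j. \<epsilon> h * x (\<pi> h j)) = Q x" if "h \<in> carrier H" for h x
    using Q_tw[OF that] unfolding tw_def .
  moreover have "Q = (\<lambda>_. 1)" if "\<forall>x. q x = 1"
    unfolding Q_def q1_def qq_def using that by simp
  moreover have "Q v0 \<noteq> 0" using q1v0 Q0 by blast
  moreover have "f i v0 = Q v0 * of_nat (Suc i)" if "i < n" for i
    unfolding fg[OF that] g_v0 by (simp add: v0_def)
  ultimately show ?thesis
    using fp Qp unfolding v0_def[symmetric]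
    by (intro exI[of _ f] exI[of _ Q] conjI ballI allI impI)
qed

subsection \<open>Representations and faithful actions\<close>

lemma group_GL: "group (GL n)"
proof -
  interpret ring "ring_mat TYPE(complex) n ()" by (rule ring_mat)
  show ?thesis by (rule units_group)
qed

lemma GL_hom:
  assumes "group G" "\<sigma> \<in> hom G (GL m)"
  shows "\<And>g. g \<in> carrier G \<Longrightarrow> \<sigma> g \<in> carrier_mat m m"
    and "\<And>g h. g \<in> carrier G \<Longrightarrow> h \<in> carrier G \<Longrightarrow> \<sigma> (g \<otimes>\<^bsub>G\<^esub> h) = \<sigma> g * \<sigma> h"
    and "\<sigma> \<one>\<^bsub>G\<^esub> = 1\<^sub>m m"
proof -
  show "\<And>g. g \<in> carrier G \<Longrightarrow> \<sigma> g \<in> carrier_mat m m"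
    using hom_in_carrier[OF assms(2)] by (auto simp: units_of_def Units_def ring_mat_simps)
  show "\<And>g h. g \<in> carrier G \<Longrightarrow> h \<in> carrier G \<Longrightarrow> \<sigma> (g \<otimes>\<^bsub>G\<^esub> h) = \<sigma> g * \<sigma> h"
    using hom_mult[OF assms(2)] by (simp add: units_of_def ring_mat_simps)
  have "\<sigma> \<one>\<^bsub>G\<^esub> = \<one>\<^bsub>GL m\<^esub>" by (rule hom_one[OF assms(2,1) group_GL])
  then show "\<sigma> \<one>\<^bsub>G\<^esub> = 1\<^sub>m m" by (simp add: units_of_def ring_mat_simps)
qed

lemma GL_homI:
  fixes G :: "('g, 'r) monoid_scheme" (structure)
  assumes "group G" and c: "\<And>g. g \<in> carrier G \<Longrightarrow> \<sigma> g \<in> carrier_mat m m"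
    and m: "\<And>g h. g \<in> carrier G \<Longrightarrow> h \<in> carrier G \<Longrightarrow> \<sigma> (g \<otimes>\<^bsub>G\<^esub> h) = \<sigma> g * \<sigma> h"
    and o: "\<sigma> \<one>\<^bsub>G\<^esub> = 1\<^sub>m m"
  shows "\<sigma> \<in> hom G (GL m)"
proof (rule homI)
  interpret group G by fact
  fix g assume g: "g \<in> carrier G"
  have "\<sigma> g * \<sigma> (inv g) = 1\<^sub>m m" "\<sigma> (inv g) * \<sigma> g = 1\<^sub>m m"
    using m[OF g inv_closed[OF g]] m[OF inv_closed[OF g] g] g o by simp_all
  then show "\<sigma> g \<in> carrier (GL m)"
    unfolding units_of_def Units_def ring_mat_simps using c[OF g] c[OF inv_closed[OF g]]
    by (simp add: ring_mat_simps) blast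
next
  fix g h assume "g \<in> carrier G" "h \<in> carrier G"
  then show "\<sigma> (g \<otimes>\<^bsub>G\<^esub> h) = \<sigma> g \<otimes>\<^bsub>GL m\<^esub> \<sigma> h" using m by (simp add: units_of_def ring_mat_simps)
qed

text \<open>A faithful action is a homomorphism into the bijections of \<open>X\<close> that is
  injective; stability of \<open>X\<close> gives the homomorphism, and injectivity is triviality of
  the kernel.\<close>

lemma acts_faithfully_iff:
  fixes G :: "('g, 'r) monoid_scheme" (structure)
  assumes G: "group G" and \<sigma>: "\<sigma> \<in> hom G (GL m)" and X: "X \<subseteq> carrier_vec m"
    and stable: "\<And>g w. g \<in> carrier G \<Longrightarrow> w \<in> X \<Longrightarrow> \<sigma> g *\<^sub>v w \<in> X"
  shows "acts_faithfully G \<sigma> X \<longleftrightarrow> (\<forall>g\<in>carrier G. (\<forall>w\<in>X. \<sigma> g *\<^sub>v w = w) \<longrightarrow> g = \<one>\<^bsub>G\<^esub>)"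
proof -
  interpret group G by (rule G)
  note s = GL_hom[OF G \<sigma>]
  let ?a = "\<lambda>g. \<lambda>w\<in>X. \<sigma> g *\<^sub>v w"
  have comp: "\<sigma> g *\<^sub>v (\<sigma> h *\<^sub>v w) = \<sigma> (g \<otimes> h) *\<^sub>v w" if "g \<in> carrier G" "h \<in> carrier G" "w \<in> X" for g h w
    unfolding s(2)[OF that(1,2)] using s(1)[OF that(1)] s(1)[OF that(2)] X that(3)
    by (intro assoc_mult_mat_vec[symmetric]) auto
  have one: "\<sigma> \<one> *\<^sub>v w = w" if "w \<in> X" for w unfolding s(3) using X that by auto
  have bij: "bij_betw (?a g) X X" if g: "g \<in> carrier G" for g
    by (rule bij_betwI[where g="?a (inv g)"]) (use stable g comp one in auto)
  have hom: "?a \<in> hom G (BijGroup X)"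
  proof (rule homI)
    fix g assume "g \<in> carrier G"
    then show "?a g \<in> carrier (BijGroup X)" using bij by (simp add: BijGroup_def Bij_def)
  next
    fix g h assume gh: "g \<in> carrier G" "h \<in> carrier G"
    have "?a g \<in> Bij X" "?a h \<in> Bij X" using bij gh by (simp_all add: Bij_def)
    then show "?a (g \<otimes> h) = ?a g \<otimes>\<^bsub>BijGroup X\<^esub> ?a h"
      unfolding BijGroup_def using stable comp gh by (auto simp: compose_def fun_eq_iff)
  qed
  have ga: "group_action G X ?a"
    unfolding group_action_def group_hom_def group_hom_axioms_def using G group_BijGroup hom by blast
  have "acts_faithfully G \<sigma> X \<longleftrightarrow> inj_on ?a (carrier G)"
    unfolding acts_faithfully_def faithful_action_def faithful_action_axioms_def using ga by blast
  also have "\<dots> \<longleftrightarrow> (\<forall>g\<in>carrier G. (\<forall>w\<in>X. \<sigma> g *\<^sub>v w = w) \<longrightarrow> g = \<one>)"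
  proof
    assume inj: "inj_on ?a (carrier G)"
    show "\<forall>g\<in>carrier G. (\<forall>w\<in>X. \<sigma> g *\<^sub>v w = w) \<longrightarrow> g = \<one>"
    proof (intro ballI impI)
      fix g assume g: "g \<in> carrier G" "\<forall>w\<in>X. \<sigma> g *\<^sub>v w = w"
      then have "?a g = ?a \<one>" using one by (intro restrict_ext) simp
      then show "g = \<one>" using inj_onD[OF inj _ g(1) one_closed] by simp
    qed
  next
    assume f: "\<forall>g\<in>carrier G. (\<forall>w\<in>X. \<sigma> g *\<^sub>v w = w) \<longrightarrow> g = \<one>"
    show "inj_on ?a (carrier G)"
    proof (rule inj_onI)
      fix g h assume gh: "g \<in> carrier G" "h \<in> carrier G" "?a g = ?a h"
      have "\<sigma> (inv g \<otimes> h) *\<^sub>v w = w" if w: "w \<in> X" for w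
      proof -
        have "\<sigma> h *\<^sub>v w = \<sigma> g *\<^sub>v w" using fun_cong[OF gh(3), of w] w by simp
        then have "\<sigma> (inv g \<otimes> h) *\<^sub>v w = \<sigma> (inv g) *\<^sub>v (\<sigma> g *\<^sub>v w)"
          using comp[OF inv_closed[OF gh(1)] gh(2) w] by simp
        also have "\<dots> = w" using comp[OF inv_closed[OF gh(1)] gh(1) w] gh(1) one[OF w] by simp
        finally show ?thesis .
      qed
      then have "inv g \<otimes> h = \<one>" using f gh by simp
      then show "g = h" using gh by (metis inv_closed inv_equality inv_inv)
    qed
  qed
  finally show ?thesis .
qed

subsection \<open>Normal forms of covariants\<close>

text \<open>A common form of polynomial covariants, with \<open>q = 1\<close>, and rational ones.
  The set where \<open>q\<close> is nonzero need not be stable: the value at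
  \<open>\<rho> g *\<^sub>v v\<close> is fixed by equivariance alone.\<close>

definition covariant_data where
  "covariant_data G N \<rho> m \<sigma> \<phi> P q d \<longleftrightarrow>
     \<rho> \<in> hom G (GL N) \<and> \<sigma> \<in> hom G (GL m) \<and>
     (\<forall>i<m. polyf N (P i)) \<and> polyf N q \<and> (\<exists>z. q z \<noteq> 0) \<and>
     (\<forall>v\<in>carrier_vec N. q (coords v) \<noteq> 0 \<longrightarrow> \<phi> v \<in> carrier_vec m \<and>
        (\<forall>i<m. \<phi> v $ i = P i (coords v) / q (coords v)) \<and>
        (\<forall>g\<in>carrier G. \<phi> (\<rho> g *\<^sub>v v) = \<sigma> g *\<^sub>v \<phi> v)) \<and>
     (\<forall>g\<in>carrier G. g \<noteq> \<one>\<^bsub>G\<^esub> \<longrightarrow>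
        (\<exists>v\<in>carrier_vec N. q (coords v) \<noteq> 0 \<and> \<sigma> g *\<^sub>v \<phi> v \<noteq> \<phi> v)) \<and>
     alg_dim_le m d ((\<lambda>x i. P i x / q x) ` {x. q x \<noteq> 0})"

lemma image_dim_mono:
  assumes "X \<subseteq> Y"
  shows "image_dim m X \<le> image_dim m Y"
  unfolding image_dim_def krull_dim_def closed_chain_iff[OF closedin_closure_of]
  by (rule Sup_subset_mono) (use closure_of_mono[OF assms, of "zariski m"] in blast)

text \<open>Krull dimension bounds the transcendence degree by way of the Jacobian rank.\<close>

lemma alg_dim_le_if_image_dim_le:
  assumes q: "polyf N q" "q z \<noteq> 0" and P: "\<And>i. i < m \<Longrightarrow> polyf N (P i)"
    and dim: "image_dim m ((\<lambda>x. vec m (\<lambda>i. P i x / q x)) ` {x. q x \<noteq> 0}) \<le> enat d"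
  shows "alg_dim_le m d ((\<lambda>x i. P i x / q x) ` {x. q x \<noteq> 0})"
proof (rule alg_dim_le_if_rank_le[OF q])
  show r: "reg N q (\<lambda>x. P i x / q x)" if "i < m" for i by (rule reg_divide[OF P[OF that]])
  fix x assume x: "q x \<noteq> 0"
  show "rank_le d ((\<lambda>i l. pd l (\<lambda>x. P i x / q x) x) ` {..<m})"
    by (rule rank_le_if_image_dim_le[OF q(1) r refl dim x])
qed

lemma covariant_data_polynomial:
  assumes G: "group G" and cov: "covariant G N \<rho> m \<sigma> \<phi>" and faith: "acts_faithfully G \<sigma> (\<phi> ` carrier_vec N)"
    and dim: "image_dim m (\<phi> ` carrier_vec N) \<le> enat d"
  shows "\<exists>P. covariant_data G N \<rho> m \<sigma> \<phi> P (\<lambda>_. 1) d"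
proof -
  have \<rho>: "\<rho> \<in> hom G (GL N)" and \<sigma>: "\<sigma> \<in> hom G (GL m)" and \<phi>c: "\<phi> \<in> carrier_vec N \<rightarrow> carrier_vec m"
    and \<phi>p: "\<forall>i<m. polynomial_fun N (\<lambda>v. \<phi> v $ i)"
    and equiv: "\<forall>g\<in>carrier G. \<forall>v\<in>carrier_vec N. \<phi> (\<rho> g *\<^sub>v v) = \<sigma> g *\<^sub>v \<phi> v"
    using cov unfolding covariant_def by simp_all
  have "\<forall>i\<in>{..<m}. \<exists>p. polyf N p \<and> (\<forall>v\<in>carrier_vec N. \<phi> v $ i = p (coords v))"
    using polynomial_fun_obtain \<phi>p by simp
  from bchoice[OF this] obtain P where P: "\<And>i. i < m \<Longrightarrow> polyf N (P i)"
    "\<And>i v. i < m \<Longrightarrow> v \<in> carrier_vec N \<Longrightarrow> \<phi> v $ i = P i (coords v)" by auto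
  have img: "(\<lambda>x. vec m (\<lambda>i. P i x / 1)) ` {x. (1::complex) \<noteq> 0} \<subseteq> \<phi> ` carrier_vec N"
  proof
    fix w assume "w \<in> (\<lambda>x. vec m (\<lambda>i. P i x / 1)) ` {x. (1::complex) \<noteq> 0}"
    then obtain x where w: "w = vec m (\<lambda>i. P i x)" by auto
    have c: "vec N x \<in> carrier_vec N" by simp
    have "w = \<phi> (vec N x)"
      unfolding w
    proof (rule eq_vecI)
      have "\<phi> (vec N x) \<in> carrier_vec m" using \<phi>c c by blast
      then show d: "dim_vec (vec m (\<lambda>i. P i x)) = dim_vec (\<phi> (vec N x))" by simp
      fix i assume "i < dim_vec (\<phi> (vec N x))"
      then have "i < m" using d by simp
      then show "vec m (\<lambda>i. P i x) $ i = \<phi> (vec N x) $ i"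
        using P(2)[OF _ c] polyf_coords_vec[OF P(1)] by simp
    qed
    then show "w \<in> \<phi> ` carrier_vec N" using c by blast
  qed
  have "image_dim m ((\<lambda>x. vec m (\<lambda>i. P i x / 1)) ` {x. (1::complex) \<noteq> 0}) \<le> enat d"
    by (rule order_trans[OF image_dim_mono[OF img] dim])
  then have ad: "alg_dim_le m d ((\<lambda>x i. P i x / 1) ` {x. (1::complex) \<noteq> 0})"
    by (intro alg_dim_le_if_image_dim_le[where q="\<lambda>_. 1" and N=N] P(1)) simp_all
  have st: "\<sigma> g *\<^sub>v w \<in> \<phi> ` carrier_vec N" if g: "g \<in> carrier G" and w: "w \<in> \<phi> ` carrier_vec N" for g w
  proof -
    obtain v where v: "v \<in> carrier_vec N" "w = \<phi> v" using w by blast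
    have "\<rho> g *\<^sub>v v \<in> carrier_vec N" using GL_hom(1)[OF G \<rho> g] v(1) by (rule mult_mat_vec_carrier)
    moreover have "\<sigma> g *\<^sub>v w = \<phi> (\<rho> g *\<^sub>v v)" using equiv g v by simp
    ultimately show ?thesis by blast
  qed
  have "\<forall>g\<in>carrier G. (\<forall>w\<in>\<phi> ` carrier_vec N. \<sigma> g *\<^sub>v w = w) \<longrightarrow> g = \<one>\<^bsub>G\<^esub>"
    using faith acts_faithfully_iff[OF G \<sigma> _ st] \<phi>c by blast
  then have f: "\<forall>g\<in>carrier G. g \<noteq> \<one>\<^bsub>G\<^esub> \<longrightarrow> (\<exists>v\<in>carrier_vec N. \<sigma> g *\<^sub>v \<phi> v \<noteq> \<phi> v)" by blast
  show ?thesis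
    unfolding covariant_data_def using \<rho> \<sigma> P \<phi>c equiv f ad
    by (intro exI[of _ P]) (auto simp: Pi_iff)
qed

text \<open>A common denominator is multiplied by a polynomial vanishing outside \<open>U\<close>,
  so that a nonzero \<open>q\<close> certifies membership in \<open>U\<close>. Faithfulness survives
  on the smaller open set by density.\<close>

lemma covariant_data_rational:
  assumes G: "group G" and cov: "rational_covariant G N \<rho> m \<sigma> U \<phi>" and faith: "acts_faithfully G \<sigma> (\<phi> ` U)"
    and dim: "image_dim m (\<phi> ` U) \<le> enat d"
  shows "\<exists>P q. covariant_data G N \<rho> m \<sigma> \<phi> P q d"
proof -
  have \<rho>: "\<rho> \<in> hom G (GL N)" and \<sigma>: "\<sigma> \<in> hom G (GL m)" and \<phi>c: "\<phi> \<in> U \<rightarrow> carrier_vec m"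
    and U: "openin (zariski N) U" "U \<noteq> {}" "\<forall>g\<in>carrier G. \<forall>v\<in>U. \<rho> g *\<^sub>v v \<in> U"
    and \<phi>p: "\<forall>i<m. \<exists>p q. polynomial_fun N p \<and> polynomial_fun N q \<and> (\<forall>v\<in>U. q v \<noteq> 0 \<and> \<phi> v $ i = p v / q v)"
    and equiv: "\<forall>g\<in>carrier G. \<forall>v\<in>U. \<phi> (\<rho> g *\<^sub>v v) = \<sigma> g *\<^sub>v \<phi> v"
    using cov unfolding rational_covariant_def by simp_all
  have Uc: "U \<subseteq> carrier_vec N" using U(1) by (simp add: openin_zariski)
  have "\<forall>i\<in>{..<m}. \<exists>pq. polyf N (fst pq) \<and> polyf N (snd pq) \<and>
      (\<forall>v\<in>U. snd pq (coords v) \<noteq> 0 \<and> \<phi> v $ i = fst pq (coords v) / snd pq (coords v))"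
  proof
    fix i assume "i \<in> {..<m}"
    then obtain p q where pq: "polynomial_fun N p" "polynomial_fun N q" "\<forall>v\<in>U. q v \<noteq> 0 \<and> \<phi> v $ i = p v / q v"
      using \<phi>p by (elim allE[of _ i]) auto
    obtain p' q' where pq': "polyf N p'" "\<forall>v\<in>carrier_vec N. p v = p' (coords v)"
      "polyf N q'" "\<forall>v\<in>carrier_vec N. q v = q' (coords v)"
      using polynomial_fun_obtain[OF pq(1)] polynomial_fun_obtain[OF pq(2)] by blast
    have "q' (coords v) \<noteq> 0 \<and> \<phi> v $ i = p' (coords v) / q' (coords v)" if v: "v \<in> U" for v
    proof -
      have "v \<in> carrier_vec N" using v Uc by blast
      then have "p v = p' (coords v)" "q v = q' (coords v)" using pq'(2,4) by blast+
      then show ?thesis using bspec[OF pq(3) v] by simp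
    qed
    then show "\<exists>pq. polyf N (fst pq) \<and> polyf N (snd pq) \<and>
        (\<forall>v\<in>U. snd pq (coords v) \<noteq> 0 \<and> \<phi> v $ i = fst pq (coords v) / snd pq (coords v))"
      using pq'(1,3) by (intro exI[of _ "(p', q')"]) simp
  qed
  from bchoice[OF this] obtain pq where pq: "\<And>i. i < m \<Longrightarrow> polyf N (fst (pq i))" "\<And>i. i < m \<Longrightarrow> polyf N (snd (pq i))"
    "\<And>i v. i < m \<Longrightarrow> v \<in> U \<Longrightarrow> snd (pq i) (coords v) \<noteq> 0"
    "\<And>i v. i < m \<Longrightarrow> v \<in> U \<Longrightarrow> \<phi> v $ i = fst (pq i) (coords v) / snd (pq i) (coords v)" by auto
  define q0 where "q0 = (\<lambda>x. \<Prod>j<m. snd (pq j) x)"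
  define P0 where "P0 = (\<lambda>i x. fst (pq i) x * (\<Prod>j\<in>{..<m} - {i}. snd (pq j) x))"
  have q0p: "polyf N q0" unfolding q0_def by (intro polyf_prod pq(2)) simp
  have P0p: "polyf N (P0 i)" if "i < m" for i
    unfolding P0_def by (intro polyf_mult pq(1)[OF that] polyf_prod pq(2)) simp
  have q0U: "q0 (coords v) \<noteq> 0" if "v \<in> U" for v unfolding q0_def using pq(3)[OF _ that] by simp
  have P0U: "\<phi> v $ i = P0 i (coords v) / q0 (coords v)" if "i < m" "v \<in> U" for i v
  proof -
    have "q0 (coords v) = snd (pq i) (coords v) * (\<Prod>j\<in>{..<m} - {i}. snd (pq j) (coords v))"
      unfolding q0_def by (rule prod.remove) (use that in simp_all)
    then show ?thesis using q0U[OF that(2)] unfolding pq(4)[OF that] P0_def by auto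
  qed
  obtain u where u: "u \<in> U" using U(2) by blast
  have cl: "closedin (zariski N) (carrier_vec N - U)"
    using U(1) openin_closedin_eq[of "zariski N" U] by (simp add: topspace_zariski)
  obtain h where h: "polyf N h" "\<forall>z\<in>carrier_vec N - U. h (coords z) = 0" "h (coords u) \<noteq> 0"
    using closedin_separate[OF cl, of u] u Uc by blast
  define q where "q = (\<lambda>x. q0 x * h x)"
  define P where "P = (\<lambda>i x. P0 i x * h x)"
  have qp: "polyf N q" unfolding q_def using q0p h(1) by simp
  have Pp: "polyf N (P i)" if "i < m" for i unfolding P_def using P0p[OF that] h(1) by simp
  have qz: "q (coords u) \<noteq> 0" unfolding q_def using q0U[OF u] h(3) by simp
  have qU: "v \<in> U" if "v \<in> carrier_vec N" "q (coords v) \<noteq> 0" for v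
    using that h(2) unfolding q_def by auto
  have PU: "\<phi> v $ i = P i (coords v) / q (coords v)" if "v \<in> carrier_vec N" "q (coords v) \<noteq> 0" "i < m" for v i
    using P0U[OF that(3) qU[OF that(1,2)]] that(2) unfolding P_def q_def by simp
  have img: "(\<lambda>x. vec m (\<lambda>i. P i x / q x)) ` {x. q x \<noteq> 0} \<subseteq> \<phi> ` U"
  proof
    fix w assume "w \<in> (\<lambda>x. vec m (\<lambda>i. P i x / q x)) ` {x. q x \<noteq> 0}"
    then obtain x where w: "q x \<noteq> 0" "w = vec m (\<lambda>i. P i x / q x)" by auto
    have c: "vec N x \<in> carrier_vec N" by simp
    have qx: "q (coords (vec N x)) \<noteq> 0" using w(1) unfolding polyf_coords_vec[OF qp] .
    have "w = \<phi> (vec N x)"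
      unfolding w(2)
    proof (rule eq_vecI)
      have "\<phi> (vec N x) \<in> carrier_vec m" using \<phi>c qU[OF c qx] by blast
      then show d: "dim_vec (vec m (\<lambda>i. P i x / q x)) = dim_vec (\<phi> (vec N x))" by simp
      fix i assume "i < dim_vec (\<phi> (vec N x))"
      then have i: "i < m" using d by simp
      then show "vec m (\<lambda>i. P i x / q x) $ i = \<phi> (vec N x) $ i"
        unfolding PU[OF c qx i] polyf_coords_vec[OF qp] polyf_coords_vec[OF Pp[OF i]] by simp
    qed
    then show "w \<in> \<phi> ` U" using qU[OF c qx] by blast
  qed
  have ad: "alg_dim_le m d ((\<lambda>x i. P i x / q x) ` {x. q x \<noteq> 0})"
    by (rule alg_dim_le_if_image_dim_le[OF qp qz Pp order_trans[OF image_dim_mono[OF img] dim]])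
  have st: "\<sigma> g *\<^sub>v w \<in> \<phi> ` U" if g: "g \<in> carrier G" and w: "w \<in> \<phi> ` U" for g w
  proof -
    obtain v where v: "v \<in> U" "w = \<phi> v" using w by blast
    have "\<sigma> g *\<^sub>v w = \<phi> (\<rho> g *\<^sub>v v)" using equiv g v by simp
    moreover have "\<rho> g *\<^sub>v v \<in> U" using U(3) g v(1) by blast
    ultimately show ?thesis by blast
  qed
  have fU: "\<forall>g\<in>carrier G. (\<forall>w\<in>\<phi> ` U. \<sigma> g *\<^sub>v w = w) \<longrightarrow> g = \<one>\<^bsub>G\<^esub>"
    using faith acts_faithfully_iff[OF G \<sigma> _ st] \<phi>c by blast
  have f: "\<exists>v\<in>carrier_vec N. q (coords v) \<noteq> 0 \<and> \<sigma> g *\<^sub>v \<phi> v \<noteq> \<phi> v"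
    if g: "g \<in> carrier G" "g \<noteq> \<one>\<^bsub>G\<^esub>" for g
  proof (rule ccontr)
    assume n: "\<not> ?thesis"
    note s = GL_hom(1)[OF G \<sigma> g(1)]
    have "\<sigma> g *\<^sub>v \<phi> v = \<phi> v" if v: "v \<in> U" for v
    proof (rule eq_vecI)
      have c: "\<phi> v \<in> carrier_vec m" if "v \<in> U" for v using \<phi>c that by blast
      show "dim_vec (\<sigma> g *\<^sub>v \<phi> v) = dim_vec (\<phi> v)" using s c[OF v] by simp
      fix i assume "i < dim_vec (\<phi> v)"
      then have i: "i < m" using c[OF v] by simp
      have coord: "(\<sigma> g *\<^sub>v \<phi> v) $ i = (\<Sum>j<m. \<sigma> g $$ (i, j) * P0 j (coords v)) / q0 (coords v)" if "v \<in> U" for v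
        unfolding mult_mat_vec_coord[OF s c[OF that] i] sum_divide_distrib
        by (rule sum.cong) (simp_all add: P0U[OF _ that])
      have R: "polyf N (\<lambda>x. (\<Sum>j<m. \<sigma> g $$ (i, j) * P0 j x) - P0 i x)"
        by (intro polyf_diff polyf_sum polyf_mult polyf_const P0p i) simp
      \<comment> \<open>If \<open>g\<close> fixed the image of the smaller open set pointwise, this
        polynomial would vanish there, hence everywhere, and \<open>g\<close> would fix all of the
        image of \<open>U\<close>.\<close>
      have "(\<Sum>j<m. \<sigma> g $$ (i, j) * P0 j x) - P0 i x = 0" for x
      proof (rule polyf_zero_dense[OF R qp qz])
        fix x assume x: "q x \<noteq> 0"
        have cx: "vec N x \<in> carrier_vec N" by simp
        have qx: "q (coords (vec N x)) \<noteq> 0" using x unfolding polyf_coords_vec[OF qp] .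
        have xU: "vec N x \<in> U" by (rule qU[OF cx qx])
        have "\<sigma> g *\<^sub>v \<phi> (vec N x) = \<phi> (vec N x)" using n cx qx by blast
        then have "(\<Sum>j<m. \<sigma> g $$ (i, j) * P0 j (coords (vec N x))) = P0 i (coords (vec N x))"
          using coord[OF xU] P0U[OF i xU] q0U[OF xU] by simp
        then show "(\<Sum>j<m. \<sigma> g $$ (i, j) * P0 j x) - P0 i x = 0"
          using polyf_coords_vec[OF R, of x] by simp
      qed
      then show "(\<sigma> g *\<^sub>v \<phi> v) $ i = \<phi> v $ i" unfolding coord[OF v] P0U[OF i v] by simp
    qed
    then show False using fU g by blast
  qed
  have "covariant_data G N \<rho> m \<sigma> \<phi> P q d"
    unfolding covariant_data_def
  proof (intro conjI ballI allI impI)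
    show "\<exists>z. q z \<noteq> 0" using qz by blast
    show "\<phi> v \<in> carrier_vec m" if "v \<in> carrier_vec N" "q (coords v) \<noteq> 0" for v
      using \<phi>c qU[OF that] by blast
    show "\<phi> (\<rho> g *\<^sub>v v) = \<sigma> g *\<^sub>v \<phi> v" if "v \<in> carrier_vec N" "q (coords v) \<noteq> 0" "g \<in> carrier G" for v g
      using equiv that(3) qU[OF that(1,2)] by blast
  qed (rule \<rho> \<sigma> Pp qp PU f ad; assumption)+
  then show ?thesis by blast
qed

lemma compress_to_subgroup:
  fixes G :: "('g, 'r) monoid_scheme" (structure)
  assumes G: "group G" and data: "covariant_data G N \<rho> m \<sigma> \<phi> P q d" and H: "subgroup H G" "finite H"
    and \<pi>: "\<And>h. h \<in> H \<Longrightarrow> \<pi> h permutes {..<n}" "\<And>h k. h \<in> H \<Longrightarrow> k \<in> H \<Longrightarrow> \<pi> (h \<otimes>\<^bsub>G\<^esub> k) = \<pi> h \<circ> \<pi> k"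
    and \<epsilon>: "\<And>h. h \<in> H \<Longrightarrow> \<epsilon> h = 1 \<or> \<epsilon> h = (- 1 :: complex)"
      "\<And>h k. h \<in> H \<Longrightarrow> k \<in> H \<Longrightarrow> \<epsilon> (h \<otimes>\<^bsub>G\<^esub> k) = \<epsilon> h * \<epsilon> k"
    and inj: "\<And>h. h \<in> H \<Longrightarrow> \<pi> h = id \<Longrightarrow> \<epsilon> h = 1 \<Longrightarrow> h = \<one>\<^bsub>G\<^esub>"
    and n: "n \<ge> 1"
  shows "\<exists>f Q. (\<forall>i<n. polyf n (f i)) \<and> polyf n Q \<and> Q (\<lambda>i. of_nat (Suc i)) \<noteq> 0 \<and>
    (\<forall>i<n. f i (\<lambda>i. of_nat (Suc i)) = Q (\<lambda>i. of_nat (Suc i)) * of_nat (Suc i)) \<and>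
    (\<forall>h\<in>H. \<forall>i<n. \<forall>x. f (\<pi> h i) x = \<epsilon> h * f i (\<lambda>j. \<epsilon> h * x (\<pi> h j))) \<and>
    (\<forall>h\<in>H. \<forall>x. Q (\<lambda>j. \<epsilon> h * x (\<pi> h j)) = Q x) \<and>
    alg_dim_le n d ((\<lambda>x i. f i x / Q x) ` {x. Q x \<noteq> 0}) \<and>
    ((\<forall>x. q x = 1) \<longrightarrow> Q = (\<lambda>_. 1))"
proof -
  interpret group G by (rule G)
  have HG: "H \<subseteq> carrier G" using H(1) by (rule subgroup.subset)
  have \<rho>: "\<rho> \<in> hom G (GL N)" and \<sigma>: "\<sigma> \<in> hom G (GL m)" and P: "\<And>i. i < m \<Longrightarrow> polyf N (P i)" and q: "polyf N q"
    and ad: "alg_dim_le m d ((\<lambda>x i. P i x / q x) ` {x. q x \<noteq> 0})"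
    using data unfolding covariant_data_def by simp_all
  obtain z where z: "q z \<noteq> 0" using data unfolding covariant_data_def by blast
  have \<phi>: "\<phi> v \<in> carrier_vec m" "\<And>i. i < m \<Longrightarrow> \<phi> v $ i = P i (coords v) / q (coords v)"
    "\<And>g. g \<in> carrier G \<Longrightarrow> \<phi> (\<rho> g *\<^sub>v v) = \<sigma> g *\<^sub>v \<phi> v"
    if "v \<in> carrier_vec N" "q (coords v) \<noteq> 0" for v
    using data that unfolding covariant_data_def by simp_all
  have f: "\<exists>v\<in>carrier_vec N. q (coords v) \<noteq> 0 \<and> \<sigma> g *\<^sub>v \<phi> v \<noteq> \<phi> v"
    if "g \<in> carrier G" "g \<noteq> \<one>" for g using data that unfolding covariant_data_def by simp
  let ?H = "G\<lparr>carrier := H\<rparr>"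
  have "\<exists>f Q. (\<forall>i<n. polyf n (f i)) \<and> polyf n Q \<and> Q (\<lambda>i. of_nat (Suc i)) \<noteq> 0 \<and>
    (\<forall>i<n. f i (\<lambda>i. of_nat (Suc i)) = Q (\<lambda>i. of_nat (Suc i)) * of_nat (Suc i)) \<and>
    (\<forall>h\<in>carrier ?H. \<forall>i<n. \<forall>x. f (\<pi> h i) x = \<epsilon> h * f i (\<lambda>j. \<epsilon> h * x (\<pi> h j))) \<and>
    (\<forall>h\<in>carrier ?H. \<forall>x. Q (\<lambda>j. \<epsilon> h * x (\<pi> h j)) = Q x) \<and>
    alg_dim_le n d ((\<lambda>x i. f i x / Q x) ` {x. Q x \<noteq> 0}) \<and>
    ((\<forall>x. q x = 1) \<longrightarrow> Q = (\<lambda>_. 1))"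
  proof (rule versal_compression[where \<rho>=\<rho> and \<sigma>=\<sigma> and \<phi>=\<phi> and P=P and N=N and m=m and z=z])
    have c: "h \<in> carrier G" if "h \<in> carrier ?H" for h using that HG by auto
    show "group ?H" by (rule subgroup.subgroup_is_group[OF H(1) G])
    show "finite (carrier ?H)" using H(2) by simp
    show "\<rho> h \<in> carrier_mat N N" "\<sigma> h \<in> carrier_mat m m" if "h \<in> carrier ?H" for h
      by (rule GL_hom(1)[OF G \<rho> c[OF that]], rule GL_hom(1)[OF G \<sigma> c[OF that]])
    show "\<rho> (h \<otimes>\<^bsub>?H\<^esub> k) = \<rho> h * \<rho> k" if "h \<in> carrier ?H" "k \<in> carrier ?H" for h k
      using GL_hom(2)[OF G \<rho> c[OF that(1)] c[OF that(2)]] by simp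
    show "\<rho> \<one>\<^bsub>?H\<^esub> = 1\<^sub>m N" using GL_hom(3)[OF G \<rho>] by simp
    show "\<phi> (\<rho> h *\<^sub>v v) = \<sigma> h *\<^sub>v \<phi> v"
      if "h \<in> carrier ?H" "v \<in> carrier_vec N" "q (coords v) \<noteq> 0" for h v
      by (rule \<phi>(3)[OF that(2,3) c[OF that(1)]])
    show "\<exists>v\<in>carrier_vec N. q (coords v) \<noteq> 0 \<and> \<sigma> h *\<^sub>v \<phi> v \<noteq> \<phi> v"
      if "h \<in> carrier ?H" "h \<noteq> \<one>\<^bsub>?H\<^esub>" for h
      using f[OF c[OF that(1)]] that(2) by simp
    show "\<pi> h permutes {..<n}" "\<epsilon> h = 1 \<or> \<epsilon> h = - 1" if "h \<in> carrier ?H" for h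
      using \<pi>(1) \<epsilon>(1) that by simp_all
    show "\<pi> (h \<otimes>\<^bsub>?H\<^esub> k) = \<pi> h \<circ> \<pi> k" "\<epsilon> (h \<otimes>\<^bsub>?H\<^esub> k) = \<epsilon> h * \<epsilon> k"
      if "h \<in> carrier ?H" "k \<in> carrier ?H" for h k
      using \<pi>(2) \<epsilon>(2) that by simp_all
    show "h = \<one>\<^bsub>?H\<^esub>" if "h \<in> carrier ?H" "\<pi> h = id" "\<epsilon> h = 1" for h
      using inj that by simp
  qed (rule P q z \<phi>(1) \<phi>(2) n ad; assumption)+
  then show ?thesis by simp
qed

subsection \<open>Construction of covariants\<close>

text \<open>The matrix sending the unit vector number \<open>j\<close> to \<open>c\<close> times the
  unit vector number \<open>p j\<close>.\<close>

definition pmat :: "nat \<Rightarrow> complex \<Rightarrow> (nat \<Rightarrow> nat) \<Rightarrow> complex mat" where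
  "pmat n c p = mat n n (\<lambda>(i, j). if p j = i then c else 0)"

lemma pmat_carrier: "pmat n c p \<in> carrier_mat n n"
  unfolding pmat_def by simp

lemma pmat_coord:
  assumes p: "p permutes {..<n}" and v: "v \<in> carrier_vec n" and j: "j < n"
  shows "(pmat n c p *\<^sub>v v) $ p j = c * v $ j"
proof -
  have pj: "p j < n" using permutes_in_image[OF p, of j] j by simp
  have "(pmat n c p *\<^sub>v v) $ p j = (\<Sum>k<n. pmat n c p $$ (p j, k) * v $ k)"
    by (rule mult_mat_vec_coord[OF pmat_carrier v pj])
  also have "\<dots> = (\<Sum>k<n. if k = j then c * v $ k else 0)"
    unfolding pmat_def using pj permutes_inj[OF p] by (intro sum.cong) (auto dest: injD)
  also have "\<dots> = c * v $ j" using j by (simp only: sum.delta finite_lessThan lessThan_iff if_True)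
  finally show ?thesis .
qed

lemma pmat_mult:
  assumes p: "p permutes {..<n}" and r: "r permutes {..<n}"
  shows "pmat n (c * e) (p \<circ> r) = pmat n c p * pmat n e r"
proof (rule eq_matI)
  fix i j assume "i < dim_row (pmat n c p * pmat n e r)" "j < dim_col (pmat n c p * pmat n e r)"
  then have ij: "i < n" "j < n" unfolding pmat_def by simp_all
  have rj: "r j < n" using permutes_in_image[OF r, of j] ij(2) by simp
  have "(pmat n c p * pmat n e r) $$ (i, j) = (\<Sum>k<n. pmat n c p $$ (i, k) * pmat n e r $$ (k, j))"
    using ij by (simp add: pmat_def scalar_prod_def atLeast0LessThan)
  also have "\<dots> = (\<Sum>k<n. if k = r j then pmat n c p $$ (i, k) * e else 0)"
    by (rule sum.cong) (use ij in \<open>auto simp: pmat_def\<close>)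
  also have "\<dots> = pmat n c p $$ (i, r j) * e" using rj by (simp only: sum.delta finite_lessThan lessThan_iff if_True)
  also have "\<dots> = pmat n (c * e) (p \<circ> r) $$ (i, j)" using ij rj unfolding pmat_def by simp
  finally show "pmat n (c * e) (p \<circ> r) $$ (i, j) = (pmat n c p * pmat n e r) $$ (i, j)" by (rule sym)
qed (simp_all add: pmat_def)

lemma pmat_one: "pmat n 1 id = 1\<^sub>m n"
  unfolding pmat_def by (rule eq_matI) auto

lemma pd_cong_reg:
  assumes q: "polyf N q" "q x \<noteq> 0" and f: "reg N q f" and eq: "\<And>y. q y \<noteq> 0 \<Longrightarrow> g y = f y"
  shows "pd l g x = pd l f x"
proof (cases "l < N")
  case True
  show ?thesis
    by (rule hasgrad_pd[OF hasgrad_transform[OF reg_gradient(2)[OF q(1) f q(2)] q eq] True])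
next
  case False
  have "reg N q g" by (rule reg_cong[OF f]) (simp add: eq)
  then show ?thesis using reg_gradient(3)[OF q(1) _ q(2), of _ l] f False by simp
qed

text \<open>A polynomial relation on a nonempty open set holds everywhere, so omitting the zeros of
  \<open>q\<close> does not lower the dimension.\<close>

lemma alg_dim_le_dense:
  assumes q: "polyf N q" "q z \<noteq> 0" and f: "\<And>i. i < m \<Longrightarrow> polyf N (f i)"
    and ad: "alg_dim_le m d ((\<lambda>x i. f i x) ` {x. q x \<noteq> 0})"
  shows "alg_dim_le m d ((\<lambda>x i. f i x) ` UNIV)"
  unfolding alg_dim_le_def
proof (intro allI impI notI)
  fix b assume b: "\<forall>i\<le>d. polyf m (b i)" and ind: "algindep (Suc d) b ((\<lambda>x i. f i x) ` UNIV)"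
  have "algindep (Suc d) b ((\<lambda>x i. f i x) ` {x. q x \<noteq> 0})"
    unfolding algindep_def
  proof (intro allI impI)
    fix F y assume F: "polyf (Suc d) F" "\<forall>x\<in>(\<lambda>x i. f i x) ` {x. q x \<noteq> 0}. F (\<lambda>i. b i x) = 0"
    have p: "polyf N (\<lambda>x. F (\<lambda>i. b i (\<lambda>j. f j x)))"
      by (rule polyf_compose[OF F(1)], rule polyf_compose[of m]) (use b f in simp_all)
    have dense: "F (\<lambda>i. b i (\<lambda>j. f j x)) = 0" if x: "q x \<noteq> 0" for x
      by (rule bspec[OF F(2) imageI]) (simp add: x)
    have all: "F (\<lambda>i. b i (\<lambda>j. f j x)) = 0" for x
      by (rule polyf_zero_dense[OF p q dense])
    show "F y = 0"
    proof (rule algindepD[OF ind F(1)])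
      fix w assume "w \<in> (\<lambda>x i. f i x) ` UNIV"
      then obtain x where w: "w = (\<lambda>i. f i x)" by (rule imageE)
      show "F (\<lambda>i. b i w) = 0" unfolding w by (rule all)
    qed
  qed
  then show False by (rule alg_dim_leD[OF ad, rotated]) (use b in simp)
qed

lemma pmat_equivariant:
  assumes p: "p permutes {..<n}" and f: "sym_equivariant n f" and v: "v \<in> carrier_vec n"
    and cong: "\<And>i x y. i < n \<Longrightarrow> (\<And>j. j < n \<Longrightarrow> x j = y j) \<Longrightarrow> f i x = f i y"
    and c: "\<And>i. i < n \<Longrightarrow> f i (\<lambda>l. c * v $ l) = c * f i (coords v)"
  shows "vec n (\<lambda>i. f i (coords (pmat n c p *\<^sub>v v))) = pmat n c p *\<^sub>v vec n (\<lambda>i. f i (coords v))"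
proof (rule eq_vecI)
  show "dim_vec (vec n (\<lambda>i. f i (coords (pmat n c p *\<^sub>v v)))) = dim_vec (pmat n c p *\<^sub>v vec n (\<lambda>i. f i (coords v)))"
    unfolding pmat_def by simp
  fix k assume "k < dim_vec (pmat n c p *\<^sub>v vec n (\<lambda>i. f i (coords v)))"
  then have k: "k < n" unfolding pmat_def by simp
  obtain i where "k = p i" using surjD[OF permutes_surj[OF p]] by blast
  then have i: "i < n" "p i = k" using permutes_in_image[OF p, of i] k by simp_all
  have "f k (coords (pmat n c p *\<^sub>v v)) = f i (\<lambda>j. (pmat n c p *\<^sub>v v) $ p j)"
    using sym_equivariantD[OF f p i(1)] unfolding i(2) .
  also have "\<dots> = f i (\<lambda>l. c * v $ l)"
    by (rule cong[OF i(1)]) (rule pmat_coord[OF p v])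
  also have "\<dots> = c * f i (coords v)" by (rule c[OF i(1)])
  also have "\<dots> = (pmat n c p *\<^sub>v vec n (\<lambda>i. f i (coords v))) $ k"
    using pmat_coord[OF p, of "vec n (\<lambda>i. f i (coords v))" i c] i by simp
  finally show "vec n (\<lambda>i. f i (coords (pmat n c p *\<^sub>v v))) $ k = (pmat n c p *\<^sub>v vec n (\<lambda>i. f i (coords v))) $ k"
    using k by simp
qed

lemma pmat_hom:
  fixes G :: "('g, 'r) monoid_scheme" (structure)
  assumes G: "group G"
    and \<pi>: "\<And>g. g \<in> carrier G \<Longrightarrow> \<pi> g permutes {..<n}"
      "\<And>g h. g \<in> carrier G \<Longrightarrow> h \<in> carrier G \<Longrightarrow> \<pi> (g \<otimes> h) = \<pi> g \<circ> \<pi> h" "\<pi> \<one> = id"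
    and \<epsilon>: "\<And>g h. g \<in> carrier G \<Longrightarrow> h \<in> carrier G \<Longrightarrow> \<epsilon> (g \<otimes> h) = \<epsilon> g * \<epsilon> h" "\<epsilon> \<one> = 1"
  shows "(\<lambda>g. pmat n (\<epsilon> g) (\<pi> g)) \<in> hom G (GL n)"
  by (rule GL_homI[OF G]) (simp_all add: pmat_carrier \<pi> \<epsilon> pmat_mult pmat_one)

text \<open>Source and target are the same permutation module twisted by the character
  \<open>\<epsilon>\<close>. The polynomial \<open>q\<close> only marks a dense set on which the
  rank has to be bounded.\<close>

theorem covdim_le_if_equivariant:
  fixes G :: "('g, 'r) monoid_scheme" (structure)
  assumes G: "group G"
    and \<pi>: "\<And>g. g \<in> carrier G \<Longrightarrow> \<pi> g permutes {..<n}"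
      "\<And>g h. g \<in> carrier G \<Longrightarrow> h \<in> carrier G \<Longrightarrow> \<pi> (g \<otimes> h) = \<pi> g \<circ> \<pi> h" "\<pi> \<one> = id"
    and \<epsilon>: "\<And>g h. g \<in> carrier G \<Longrightarrow> h \<in> carrier G \<Longrightarrow> \<epsilon> (g \<otimes> h) = \<epsilon> g * \<epsilon> h" "\<epsilon> \<one> = 1"
    and f: "\<And>i. i < n \<Longrightarrow> polyf n (f i)" "sym_equivariant n f"
      "\<And>g i x. g \<in> carrier G \<Longrightarrow> i < n \<Longrightarrow> f i (\<lambda>l. \<epsilon> g * x l) = \<epsilon> g * f i x"
    and faith: "\<And>g. g \<in> carrier G \<Longrightarrow> g \<noteq> \<one> \<Longrightarrow> \<exists>x. \<exists>i<n. f (\<pi> g i) x \<noteq> \<epsilon> g * f i x"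
    and q: "polyf n q" "q z \<noteq> 0"
    and rk: "\<And>x. q x \<noteq> 0 \<Longrightarrow> rank_le d ((\<lambda>i l. pd l (f i) x) ` {..<n})"
  shows "covdim G \<le> enat d"
proof -
  define \<sigma> where "\<sigma> = (\<lambda>g. pmat n (\<epsilon> g) (\<pi> g))"
  define \<phi> where "\<phi> = (\<lambda>v. vec n (\<lambda>i. f i (coords v)))"
  have \<sigma>: "\<sigma> \<in> hom G (GL n)" unfolding \<sigma>_def by (rule pmat_hom[OF G \<pi> \<epsilon>])
  have fc: "f i x = f i y" if "i < n" "\<And>j. j < n \<Longrightarrow> x j = y j" for i x y
    by (rule polyf_cong[OF f(1)[OF that(1)] that(2)])
  have equiv: "\<phi> (\<sigma> g *\<^sub>v v) = \<sigma> g *\<^sub>v \<phi> v" if "g \<in> carrier G" "v \<in> carrier_vec n" for g v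
    unfolding \<phi>_def \<sigma>_def
    by (rule pmat_equivariant[OF \<pi>(1)[OF that(1)] f(2) that(2) fc f(3)[OF that(1)]])
  have \<phi>i: "\<phi> v $ i = f i (coords v)" if "i < n" for v i unfolding \<phi>_def using that by simp
  have cov: "covariant G n \<sigma> n \<sigma> \<phi>"
    unfolding covariant_def
  proof (intro conjI ballI allI impI \<sigma> equiv)
    show "\<phi> \<in> carrier_vec n \<rightarrow> carrier_vec n" unfolding \<phi>_def by simp
    show "polynomial_fun n (\<lambda>v. \<phi> v $ i)" if "i < n" for i
      unfolding \<phi>i[OF that] by (rule polynomial_fun_polyf[OF f(1)[OF that]])
  qed
  have X: "\<phi> ` carrier_vec n \<subseteq> carrier_vec n" unfolding \<phi>_def by auto
  have st: "\<sigma> g *\<^sub>v w \<in> \<phi> ` carrier_vec n" if gw: "g \<in> carrier G" "w \<in> \<phi> ` carrier_vec n" for g w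
  proof -
    obtain v where v: "v \<in> carrier_vec n" "w = \<phi> v" using gw(2) by blast
    have "\<sigma> g *\<^sub>v v \<in> carrier_vec n" using pmat_carrier v(1) unfolding \<sigma>_def by (rule mult_mat_vec_carrier)
    moreover have "\<sigma> g *\<^sub>v w = \<phi> (\<sigma> g *\<^sub>v v)" using equiv[OF gw(1) v(1)] v(2) by simp
    ultimately show ?thesis by blast
  qed
  have fa: "acts_faithfully G \<sigma> (\<phi> ` carrier_vec n)"
  proof (rule iffD2[OF acts_faithfully_iff[OF G \<sigma> X st]], assumption, assumption, intro ballI impI, rule ccontr)
    fix g assume g: "g \<in> carrier G" "\<forall>w\<in>\<phi> ` carrier_vec n. \<sigma> g *\<^sub>v w = w" "g \<noteq> \<one>"
    obtain x i where x: "i < n" "f (\<pi> g i) x \<noteq> \<epsilon> g * f i x" using faith[OF g(1,3)] by blast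
    have pi: "\<pi> g i < n" using permutes_in_image[OF \<pi>(1)[OF g(1)], of i] x(1) by simp
    have w: "\<phi> (vec n x) \<in> carrier_vec n" unfolding \<phi>_def by simp
    have "\<sigma> g *\<^sub>v \<phi> (vec n x) = \<phi> (vec n x)" using g(2) by simp
    then have "(\<sigma> g *\<^sub>v \<phi> (vec n x)) $ \<pi> g i = \<phi> (vec n x) $ \<pi> g i" by simp
    then have "\<epsilon> g * f i (coords (vec n x)) = f (\<pi> g i) (coords (vec n x))"
      unfolding \<sigma>_def pmat_coord[OF \<pi>(1)[OF g(1)] w x(1)] \<phi>i[OF x(1)] \<phi>i[OF pi] .
    then show False using x(2) unfolding polyf_coords_vec[OF f(1)[OF x(1)]] polyf_coords_vec[OF f(1)[OF pi]] by simp
  qed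
  have "alg_dim_le n d ((\<lambda>x i. f i x) ` {x. q x \<noteq> 0})"
    by (rule alg_dim_le_if_rank_le[OF q reg_polyf[OF f(1)] rk])
  from alg_dim_le_dense[OF q f(1) this] have "alg_dim_le n d ((\<lambda>x i. f i x) ` UNIV)" .
  then have "alg_dim_le n d (coords ` \<phi> ` carrier_vec n)"
  proof (rule alg_dim_le_image)
    show "polyf n (\<lambda>y. y i)" if "i < n" for i using that by simp
    fix y assume "y \<in> coords ` \<phi> ` carrier_vec n"
    then obtain v where "y = coords (\<phi> v)" by blast
    then show "\<exists>x\<in>(\<lambda>x i. f i x) ` UNIV. \<forall>i<n. y i = x i"
      using \<phi>i by (intro bexI[of _ "\<lambda>i. f i (coords v)"]) auto
  qed
  then have "image_dim n (\<phi> ` carrier_vec n) \<le> enat d" by (rule image_dim_le_if_alg_dim_le[OF X])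
  moreover have "covdim G \<le> image_dim n (\<phi> ` carrier_vec n)"
    unfolding covdim_def using cov fa by (intro Inf_lower) blast
  ultimately show ?thesis by (rule order_trans[rotated])
qed

text \<open>Invariance of the denominator makes its nonvanishing set stable and the quotients
  equivariant.\<close>

theorem edim_le_if_equivariant:
  fixes G :: "('g, 'r) monoid_scheme" (structure)
  assumes G: "group G"
    and \<pi>: "\<And>g. g \<in> carrier G \<Longrightarrow> \<pi> g permutes {..<n}"
      "\<And>g h. g \<in> carrier G \<Longrightarrow> h \<in> carrier G \<Longrightarrow> \<pi> (g \<otimes> h) = \<pi> g \<circ> \<pi> h" "\<pi> \<one> = id"
    and f: "\<And>i. i < n \<Longrightarrow> polyf n (f i)" "sym_equivariant n f"
    and q: "polyf n q" "q z \<noteq> 0" "\<And>p x. p permutes {..<n} \<Longrightarrow> q (\<lambda>j. x (p j)) = q x"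
    and faith: "\<And>g. g \<in> carrier G \<Longrightarrow> g \<noteq> \<one> \<Longrightarrow> \<exists>x. q x \<noteq> 0 \<and> (\<exists>i<n. f (\<pi> g i) x \<noteq> f i x)"
    and rk: "\<And>x. q x \<noteq> 0 \<Longrightarrow> rank_le d ((\<lambda>i l. pd l (\<lambda>x. f i x / q x) x) ` {..<n})"
  shows "edim G \<le> enat d"
proof -
  define \<sigma> where "\<sigma> = (\<lambda>g. pmat n 1 (\<pi> g))"
  define h where "h = (\<lambda>i x. f i x / q x)"
  define \<phi> where "\<phi> = (\<lambda>v. vec n (\<lambda>i. h i (coords v)))"
  define U where "U = {v \<in> carrier_vec n. q (coords v) \<noteq> 0}"
  have \<sigma>: "\<sigma> \<in> hom G (GL n)" unfolding \<sigma>_def by (rule pmat_hom[OF G \<pi>]) simp_all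
  have hs: "sym_equivariant n h"
    unfolding sym_equivariant_def h_def
    by (intro allI impI) (simp add: sym_equivariantD[OF f(2)] q(3))
  have hc: "h i x = h i y" if "i < n" "\<And>j. j < n \<Longrightarrow> x j = y j" for i x y
  proof -
    have "f i x = f i y" by (rule polyf_cong[OF f(1)[OF that(1)] that(2)])
    moreover have "q x = q y" by (rule polyf_cong[OF q(1) that(2)])
    ultimately show ?thesis unfolding h_def by simp
  qed
  have equiv: "\<phi> (\<sigma> g *\<^sub>v v) = \<sigma> g *\<^sub>v \<phi> v" if "g \<in> carrier G" "v \<in> carrier_vec n" for g v
    unfolding \<phi>_def \<sigma>_def
    by (rule pmat_equivariant[OF \<pi>(1)[OF that(1)] hs that(2) hc]) simp_all
  have \<phi>i: "\<phi> v $ i = f i (coords v) / q (coords v)" if "i < n" for v i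
    unfolding \<phi>_def h_def using that by simp
  have Ust: "\<sigma> g *\<^sub>v v \<in> U" if "g \<in> carrier G" "v \<in> U" for g v
  proof -
    have v: "v \<in> carrier_vec n" "q (coords v) \<noteq> 0" using that(2) unfolding U_def by auto
    have "\<sigma> g *\<^sub>v v \<in> carrier_vec n" using pmat_carrier v(1) unfolding \<sigma>_def by (rule mult_mat_vec_carrier)
    moreover have "q (coords (\<sigma> g *\<^sub>v v)) = q (coords v)"
    proof -
      have "q (coords (\<sigma> g *\<^sub>v v)) = q (\<lambda>j. (\<sigma> g *\<^sub>v v) $ \<pi> g j)"
        by (rule q(3)[OF \<pi>(1)[OF that(1)], symmetric])
      also have "\<dots> = q (coords v)"
        by (rule polyf_cong[OF q(1)]) (simp add: \<sigma>_def pmat_coord[OF \<pi>(1)[OF that(1)] v(1)])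
      finally show ?thesis .
    qed
    ultimately show ?thesis using v(2) unfolding U_def by simp
  qed
  have cov: "rational_covariant G n \<sigma> n \<sigma> U \<phi>"
    unfolding rational_covariant_def
  proof (intro conjI ballI allI impI \<sigma> Ust)
    have "carrier_vec n - U = {v \<in> carrier_vec n. q (coords v) = 0}" unfolding U_def by blast
    then have "closedin (zariski n) (carrier_vec n - U)" using closedin_zeros[OF q(1)] by simp
    then show "openin (zariski n) U"
      unfolding openin_zariski closedin_zariski[symmetric] U_def by blast
    have "vec n z \<in> U" unfolding U_def using q(2) polyf_coords_vec[OF q(1), of z] by simp
    then show "U \<noteq> {}" by blast
    show "\<phi> \<in> U \<rightarrow> carrier_vec n" unfolding \<phi>_def by simp
    show "\<phi> (\<sigma> g *\<^sub>v v) = \<sigma> g *\<^sub>v \<phi> v" if "g \<in> carrier G" "v \<in> U" for g v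
      using equiv[OF that(1)] that(2) unfolding U_def by simp
    show "\<exists>p r. polynomial_fun n p \<and> polynomial_fun n r \<and> (\<forall>v\<in>U. r v \<noteq> 0 \<and> \<phi> v $ i = p v / r v)" if "i < n" for i
      by (rule exI[of _ "\<lambda>v. f i (coords v)"], rule exI[of _ "\<lambda>v. q (coords v)"])
        (use polynomial_fun_polyf[OF f(1)[OF that]] polynomial_fun_polyf[OF q(1)] \<phi>i[OF that] in \<open>auto simp: U_def\<close>)
  qed
  have X: "\<phi> ` U \<subseteq> carrier_vec n" unfolding \<phi>_def by auto
  have st: "\<sigma> g *\<^sub>v w \<in> \<phi> ` U" if gw: "g \<in> carrier G" "w \<in> \<phi> ` U" for g w
  proof -
    obtain v where v: "v \<in> U" "w = \<phi> v" using gw(2) by blast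
    have "\<sigma> g *\<^sub>v w = \<phi> (\<sigma> g *\<^sub>v v)" using equiv[OF gw(1), of v] v unfolding U_def by simp
    then show ?thesis using Ust[OF gw(1) v(1)] by blast
  qed
  have fa: "acts_faithfully G \<sigma> (\<phi> ` U)"
  proof (rule iffD2[OF acts_faithfully_iff[OF G \<sigma> X st]], assumption, assumption, intro ballI impI, rule ccontr)
    fix g assume g: "g \<in> carrier G" "\<forall>w\<in>\<phi> ` U. \<sigma> g *\<^sub>v w = w" "g \<noteq> \<one>"
    obtain x i where x: "q x \<noteq> 0" "i < n" "f (\<pi> g i) x \<noteq> f i x" using faith[OF g(1,3)] by blast
    have pi: "\<pi> g i < n" using permutes_in_image[OF \<pi>(1)[OF g(1)], of i] x(2) by simp
    have w: "\<phi> (vec n x) \<in> carrier_vec n" unfolding \<phi>_def by simp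
    have "vec n x \<in> U" unfolding U_def using x(1) polyf_coords_vec[OF q(1), of x] by simp
    then have "\<sigma> g *\<^sub>v \<phi> (vec n x) = \<phi> (vec n x)" using g(2) by blast
    then have "(\<sigma> g *\<^sub>v \<phi> (vec n x)) $ \<pi> g i = \<phi> (vec n x) $ \<pi> g i" by simp
    then have "1 * (f i (coords (vec n x)) / q (coords (vec n x))) = f (\<pi> g i) (coords (vec n x)) / q (coords (vec n x))"
      unfolding \<sigma>_def pmat_coord[OF \<pi>(1)[OF g(1)] w x(2)] \<phi>i[OF x(2)] \<phi>i[OF pi] .
    then show False using x(1,3)
      unfolding polyf_coords_vec[OF f(1)[OF x(2)]] polyf_coords_vec[OF f(1)[OF pi]] polyf_coords_vec[OF q(1)] by simp
  qed
  have "alg_dim_le n d ((\<lambda>x i. f i x / q x) ` {x. q x \<noteq> 0})"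
    by (rule alg_dim_le_if_rank_le[OF q(1,2) reg_divide[OF f(1)] rk])
  then have "alg_dim_le n d (coords ` \<phi> ` U)"
  proof (rule alg_dim_le_image)
    show "polyf n (\<lambda>y. y i)" if "i < n" for i using that by simp
    fix y assume "y \<in> coords ` \<phi> ` U"
    then obtain v where "y = coords (\<phi> v)" "v \<in> U" by blast
    then show "\<exists>x\<in>(\<lambda>x i. f i x / q x) ` {x. q x \<noteq> 0}. \<forall>i<n. y i = x i"
      using \<phi>i unfolding U_def by (intro bexI[of _ "\<lambda>i. f i (coords v) / q (coords v)"]) auto
  qed
  then have "image_dim n (\<phi> ` U) \<le> enat d" by (rule image_dim_le_if_alg_dim_le[OF X])
  moreover have "edim G \<le> image_dim n (\<phi> ` U)"
    unfolding edim_def using cov fa by (intro Inf_lower) blast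
  ultimately show ?thesis by (rule order_trans[rotated])
qed

text \<open>A faithful covariant of \<open>K\<close>, restricted along \<open>h\<close>, is a
  faithful covariant of \<open>G\<close> with the same image.\<close>

lemma covdim_embed:
  assumes G: "group G" and K: "group K" and h: "h \<in> hom G K" "inj_on h (carrier G)"
  shows "covdim G \<le> covdim K"
  unfolding covdim_def
proof (rule Inf_superset_mono, rule subsetI)
  fix e assume "e \<in> {image_dim m (\<phi> ` carrier_vec n) | n \<rho> m \<sigma> \<phi>.
     covariant K n \<rho> m \<sigma> \<phi> \<and> acts_faithfully K \<sigma> (\<phi> ` carrier_vec n)}"
  then obtain n \<rho> m \<sigma> \<phi> where e: "e = image_dim m (\<phi> ` carrier_vec n)"
    and cov: "covariant K n \<rho> m \<sigma> \<phi>" and fa: "acts_faithfully K \<sigma> (\<phi> ` carrier_vec n)" by blast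
  have \<rho>: "\<rho> \<in> hom K (GL n)" and \<sigma>: "\<sigma> \<in> hom K (GL m)" and c: "\<phi> \<in> carrier_vec n \<rightarrow> carrier_vec m"
    and eq: "\<And>g v. g \<in> carrier K \<Longrightarrow> v \<in> carrier_vec n \<Longrightarrow> \<phi> (\<rho> g *\<^sub>v v) = \<sigma> g *\<^sub>v \<phi> v"
    using cov unfolding covariant_def by simp_all
  have hK: "h g \<in> carrier K" if "g \<in> carrier G" for g by (rule hom_in_carrier[OF h(1) that])
  have \<rho>': "\<rho> \<circ> h \<in> hom G (GL n)" and \<sigma>': "\<sigma> \<circ> h \<in> hom G (GL m)"
    using hom_compose[OF h(1) \<rho>] hom_compose[OF h(1) \<sigma>] .
  have cov': "covariant G n (\<rho> \<circ> h) m (\<sigma> \<circ> h) \<phi>"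
    using cov \<rho>' \<sigma>' hK unfolding covariant_def by simp
  have st: "\<sigma> g *\<^sub>v w \<in> \<phi> ` carrier_vec n" if g: "g \<in> carrier K" and w: "w \<in> \<phi> ` carrier_vec n" for g w
  proof -
    obtain v where v: "v \<in> carrier_vec n" "w = \<phi> v" using w by blast
    have "\<rho> g *\<^sub>v v \<in> carrier_vec n" using GL_hom(1)[OF K \<rho> g] v(1) by (rule mult_mat_vec_carrier)
    moreover have "\<sigma> g *\<^sub>v w = \<phi> (\<rho> g *\<^sub>v v)" using eq[OF g v(1)] v(2) by simp
    ultimately show ?thesis by blast
  qed
  have X: "\<phi> ` carrier_vec n \<subseteq> carrier_vec m" using c by blast
  have st': "(\<sigma> \<circ> h) g *\<^sub>v w \<in> \<phi> ` carrier_vec n" if "g \<in> carrier G" "w \<in> \<phi> ` carrier_vec n" for g w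
    using st[OF hK[OF that(1)] that(2)] by simp
  have "g = \<one>\<^bsub>G\<^esub>" if g: "g \<in> carrier G" "\<forall>w\<in>\<phi> ` carrier_vec n. (\<sigma> \<circ> h) g *\<^sub>v w = w" for g
  proof -
    have "h g = \<one>\<^bsub>K\<^esub>" using iffD1[OF acts_faithfully_iff[OF K \<sigma> X st] fa] g hK[OF g(1)] by simp
    also have "\<dots> = h \<one>\<^bsub>G\<^esub>" by (rule hom_one[OF h(1) G K, symmetric])
    finally show ?thesis
      using inj_onD[OF h(2) _ g(1)] monoid.one_closed[OF group.is_monoid[OF G]] by simp
  qed
  then have "acts_faithfully G (\<sigma> \<circ> h) (\<phi> ` carrier_vec n)"
    by (intro iffD2[OF acts_faithfully_iff[OF G \<sigma>' X st']]) blast+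
  then show "e \<in> {image_dim m (\<phi> ` carrier_vec n) | n \<rho> m \<sigma> \<phi>.
     covariant G n \<rho> m \<sigma> \<phi> \<and> acts_faithfully G \<sigma> (\<phi> ` carrier_vec n)}"
    using cov' e by blast
qed

subsection \<open>Renumbering\<close>

text \<open>Permutations in \<^const>\<open>sym_group\<close> act on \<open>{1..n}\<close>, coordinates are numbered from \<open>0\<close>.\<close>

definition shift_perm :: "nat \<Rightarrow> (nat \<Rightarrow> nat) \<Rightarrow> nat \<Rightarrow> nat" where
  "shift_perm n p i = (if i < n then p (Suc i) - 1 else i)"

lemma shift_perm_permutes:
  assumes "bij_betw p {1..n} {1..n}"
  shows "shift_perm n p permutes {..<n}"
proof (rule bij_imp_permutes)
  have "bij_betw Suc {..<n} {1..n}" by (rule bij_betwI[where g="\<lambda>i. i - 1"]) auto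
  moreover have "bij_betw (\<lambda>i. i - 1) {1..n} {..<n}" by (rule bij_betwI[where g=Suc]) auto
  ultimately have "bij_betw ((\<lambda>i. i - 1) \<circ> (p \<circ> Suc)) {..<n} {..<n}"
    using assms by (blast intro: bij_betw_trans)
  then show "bij_betw (shift_perm n p) {..<n} {..<n}"
    by (subst bij_betw_cong[where g="(\<lambda>i. i - 1) \<circ> (p \<circ> Suc)"]) (simp_all add: shift_perm_def)
qed (simp add: shift_perm_def)

lemma shift_perm_comp:
  assumes "bij_betw r {1..n} {1..n}"
  shows "shift_perm n (p \<circ> r) = shift_perm n p \<circ> shift_perm n r"
proof
  fix i
  show "shift_perm n (p \<circ> r) i = (shift_perm n p \<circ> shift_perm n r) i"
  proof (cases "i < n")
    case True
    then have "r (Suc i) \<in> {1..n}" using bij_betw_apply[OF assms, of "Suc i"] by simp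
    then show ?thesis using True unfolding shift_perm_def by auto
  qed (simp add: shift_perm_def)
qed

lemma shift_perm_id: "shift_perm n id = id"
  unfolding shift_perm_def by (rule ext) simp

lemma shift_perm_eq_id:
  assumes "bij_betw p {1..n} {1..n}" "shift_perm n p = id" "i \<in> {1..n}"
  shows "p i = i"
proof -
  have "p i \<in> {1..n}" using bij_betw_apply[OF assms(1,3)] .
  moreover have "shift_perm n p (i - 1) = i - 1" using assms(2) by simp
  ultimately show ?thesis using assms(3) unfolding shift_perm_def by (auto split: if_splits)
qed

lemma shift_perm_surj:
  assumes "p permutes {..<n}"
  shows "\<exists>r. r permutes {1..n} \<and> shift_perm n r = p"
proof -
  define r where "r = (\<lambda>i. if i \<in> {1..n} then Suc (p (i - 1)) else i)"
  have pn: "p i < n \<longleftrightarrow> i < n" for i using permutes_in_image[OF assms, of i] by simp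
  have "r permutes {1..n}"
  proof (rule bij_imp_permutes)
    have "bij_betw (\<lambda>i. i - 1) {1..n} {..<n}" by (rule bij_betwI[where g=Suc]) auto
    moreover have "bij_betw Suc {..<n} {1..n}" by (rule bij_betwI[where g="\<lambda>i. i - 1"]) auto
    ultimately have "bij_betw (Suc \<circ> (p \<circ> (\<lambda>i. i - 1))) {1..n} {1..n}"
      using permutes_imp_bij[OF assms] by (blast intro: bij_betw_trans)
    then show "bij_betw r {1..n} {1..n}"
      by (subst bij_betw_cong[where g="Suc \<circ> (p \<circ> (\<lambda>i. i - 1))"]) (simp_all add: r_def)
  qed (auto simp: r_def)
  moreover have "shift_perm n r = p"
  proof
    fix i show "shift_perm n r i = p i"
      using permutes_not_in[OF assms, of i] unfolding shift_perm_def r_def by simp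
  qed
  ultimately show ?thesis by blast
qed

subsection \<open>Functions odd in a single coordinate\<close>

lemma pd_coordinate_homogeneous:
  assumes "\<And>t. f (x(l := t * x l)) = t ^ e * f x" "x l = 1"
  shows "pd l f x = of_nat e * f x"
proof -
  have eq: "(\<lambda>t. f (x(l := t))) = (\<lambda>t. t ^ e * f x)"
    using assms(1) unfolding assms(2) mult_1_right by (rule ext)
  have "((\<lambda>t. t ^ e * f x) has_field_derivative of_nat e * f x) (at 1)"
    by (auto intro!: derivative_eq_intros)
  then show ?thesis by (intro pd_eqI) (simp only: eq assms(2))
qed

text \<open>Multiplying one coordinate by a scalar commutes with every weighted scaling, so such
  symmetries descend to homogeneous components.\<close>

lemma hc_scale_coordinate:
  assumes "polyf N f" "\<And>x. f (x(l := c * x l)) = \<kappa> * f x"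
  shows "hc w k f (x(l := c * x l)) = \<kappa> * hc w k f x"
proof -
  have "hc w k f (x(l := c * x l)) = hc w k (\<lambda>x. \<kappa> * f x) x"
  proof (rule hc_cong)
    fix t :: complex
    have "(\<lambda>i. t ^ w i * (x(l := c * x l)) i) = (\<lambda>i. t ^ w i * x i)(l := c * (\<lambda>i. t ^ w i * x i) l)"
      by (rule ext) simp
    then show "f (\<lambda>i. t ^ w i * (x(l := c * x l)) i) = \<kappa> * f (\<lambda>i. t ^ w i * x i)"
      using assms(2)[of "\<lambda>i. t ^ w i * x i"] by simp
  qed
  then show ?thesis unfolding hc_cmult[OF assms(1)] .
qed

text \<open>Modulo 2 such a matrix is the identity, so its determinant is odd.\<close>

lemma odd_diagonal_indep:
  fixes e :: "nat \<Rightarrow> nat \<Rightarrow> nat" and k :: nat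
  assumes e: "\<And>i l. i < k \<Longrightarrow> l < k \<Longrightarrow> odd (e i l) \<longleftrightarrow> i = l"
    and a: "\<And>i l. i < k \<Longrightarrow> l < k \<Longrightarrow> a i l = of_nat (e i l) * z i" and z: "\<And>i. i < k \<Longrightarrow> z i \<noteq> 0"
  shows "indep k a"
proof (rule gram_nonzero_indep)
  let ?b = "\<lambda>j l. if l = j then 1 else (0::complex)"
  \<comment> \<open>The determinant of the exponent matrix as an integer, so that its parity makes
    sense.\<close>
  let ?D = "\<Sum>p | p permutes {0..<k}. signof p * (\<Prod>i=0..<k. int (e i (p i)))"
  have a': "(\<Sum>l<k. a i l * ?b (p i) l) = of_int (int (e i (p i))) * z i"
    if p: "p permutes {0..<k}" and i: "i \<in> {0..<k}" for p i
  proof -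
    have pi: "p i < k" using permutes_in_image[OF p, of i] i by simp
    have "(\<Sum>l<k. a i l * ?b (p i) l) = (\<Sum>l<k. if l = p i then a i l else 0)"
      by (rule sum.cong) auto
    also have "\<dots> = a i (p i)"
      using pi by (simp only: sum.delta finite_lessThan lessThan_iff if_True)
    finally show ?thesis using a[OF _ pi] i by simp
  qed
  have "gram k k a ?b = (\<Sum>p | p permutes {0..<k}. of_int (signof p * (\<Prod>i=0..<k. int (e i (p i)))) * (\<Prod>i=0..<k. z i))"
    unfolding gram_def
  proof (rule sum.cong[OF refl])
    fix p assume "p \<in> {p. p permutes {0..<k}}"
    then have p: "p permutes {0..<k}" by simp
    have "(\<Prod>i=0..<k. \<Sum>l<k. a i l * ?b (p i) l) = (\<Prod>i=0..<k. of_int (int (e i (p i))) * z i)"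
      by (rule prod.cong[OF refl a'[OF p]])
    then show "signof p * (\<Prod>i=0..<k. \<Sum>l<k. a i l * ?b (p i) l) =
        of_int (signof p * (\<Prod>i=0..<k. int (e i (p i)))) * (\<Prod>i=0..<k. z i)"
      by (simp add: prod.distrib sign_def)
  qed
  then have gram: "gram k k a ?b = of_int ?D * (\<Prod>i=0..<k. z i)"
    by (simp only: of_int_sum sum_distrib_right)
  have fin: "finite {p. p permutes {0..<k}}" by (simp add: finite_permutations)
  have "?D = signof id * (\<Prod>i=0..<k. int (e i (id i))) +
      (\<Sum>p\<in>{p. p permutes {0..<k}} - {id}. signof p * (\<Prod>i=0..<k. int (e i (p i))))"
    by (rule sum.remove[OF fin]) (simp add: permutes_id)
  moreover have "even (\<Sum>p\<in>{p. p permutes {0..<k}} - {id}. signof p * (\<Prod>i=0..<k. int (e i (p i))))"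
  proof (rule dvd_sum)
    fix p assume "p \<in> {p. p permutes {0..<k}} - {id}"
    then have p: "p permutes {0..<k}" "p \<noteq> id" by simp_all
    obtain i where pi: "p i \<noteq> i" using p(2) by (metis eq_id_iff)
    then have i: "i \<in> {0..<k}" using permutes_not_in[OF p(1)] by blast
    then have "p i \<in> {0..<k}" using permutes_in_image[OF p(1)] by blast
    \<comment> \<open>A permutation other than the identity meets an off-diagonal entry, and these
      are even.\<close>
    then have "even (int (e i (p i)))" using e[of i "p i"] i pi by simp
    then have "even (\<Prod>i=0..<k. int (e i (p i)))" using i by (intro dvd_trans[OF _ dvd_prodI[OF _ i]]) simp_all
    then show "even (signof p * (\<Prod>i=0..<k. int (e i (p i))))" by (rule dvd_mult)
  qed
  moreover have "odd (\<Prod>i=0..<k. int (e i (id i)))"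
    using e by (auto simp: even_prod_iff)
  ultimately have "odd ?D" by (simp add: sign_id)
  then have "?D \<noteq> 0" by (rule contrapos_nn) (simp only: dvd_0_right)
  then have "of_int ?D \<noteq> (0::complex)" by (simp only: of_int_eq_0_iff not_False_eq_True)
  then show "gram k k a ?b \<noteq> 0" unfolding gram using z by (simp only: mult_eq_0_iff) simp
qed

text \<open>Such a function is a multiple of a monomial: turning coordinates from 1 to those of
  \<open>x\<close>, one at a time, multiplies the value by powers of the entries of
  \<open>x\<close>.\<close>

lemma coordinatewise_homogeneous_nonzero:
  assumes f: "polyf J f" "f x \<noteq> 0" and h: "\<And>l. l < J \<Longrightarrow> \<exists>e. \<forall>t x. f (x(l := t * x l)) = t ^ e * f x"
  shows "f (\<lambda>_. 1) \<noteq> 0"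
proof
  assume 0: "f (\<lambda>_. 1) = 0"
  have "f (\<lambda>i. if i < s then x i else 1) = 0" if "s \<le> J" for s
    using that
  proof (induction s)
    case 0
    show ?case using \<open>f (\<lambda>_. 1) = 0\<close> by simp
  next
    case (Suc s)
    let ?y = "\<lambda>i. if i < s then x i else 1"
    obtain e where e: "\<forall>t x. f (x(s := t * x s)) = t ^ e * f x" using h[of s] Suc.prems by auto
    have "(\<lambda>i. if i < Suc s then x i else 1) = ?y(s := x s * ?y s)"
      by (rule ext) (simp add: less_Suc_eq)
    moreover have "f (?y(s := x s * ?y s)) = x s ^ e * f ?y" using e by blast
    moreover have "f ?y = 0" using Suc by simp
    ultimately show ?case by simp
  qed
  from this[of J] have "f (\<lambda>i. if i < J then x i else 1) = 0" by simp
  moreover have "f x = f (\<lambda>i. if i < J then x i else 1)" by (rule polyf_cong[OF f(1)]) simp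
  ultimately show False using f(2) by simp
qed

text \<open>Coordinate by coordinate, every \<open>z j\<close> is replaced by its part of top degree
  in that coordinate. Parities and the homogeneity already reached survive, and independence of the
  new gradients implies it for the old ones. At the end all \<open>z j\<close> are monomials up to
  factors, with an exponent matrix congruent to the identity modulo 2.\<close>

lemma odd_coordinates_indep_aux:
  fixes s J :: nat
  assumes "s \<le> J" "\<And>j. j < J \<Longrightarrow> polyf J (z j)" "\<And>j. j < J \<Longrightarrow> \<exists>x. z j x \<noteq> 0"
    and "\<And>j l x. j < J \<Longrightarrow> l < J \<Longrightarrow> z j (x(l := -1 * x l)) = (if l = j then -1 else 1) * z j x"
    and "\<And>j l. j < J \<Longrightarrow> l < s \<Longrightarrow> \<exists>e. \<forall>t x. z j (x(l := t * x l)) = t ^ e * z j x"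
  shows "\<exists>x. indep J (\<lambda>j l. pd l (z j) x)"
  using assms
proof (induction s arbitrary: z rule: inc_induct)
  case base
  define e where "e j l = (SOME e. \<forall>t x. z j (x(l := t * x l)) = t ^ e * z j x)" for j l
  have e: "z j (x(l := t * x l)) = t ^ e j l * z j x" if jl: "j < J" "l < J" for j l t x
    unfolding e_def by (rule someI_ex[OF base(4)[OF jl], rule_format])
  have nz: "z j (\<lambda>_. 1) \<noteq> 0" if j: "j < J" for j
  proof -
    obtain x where "z j x \<noteq> 0" using base(2)[OF j] by (elim exE)
    then show ?thesis by (rule coordinatewise_homogeneous_nonzero[OF base(1)[OF j] _ base(4)[OF j]])
  qed
  have odd: "odd (e j l) \<longleftrightarrow> j = l" if jl: "j < J" "l < J" for j l
  proof -
    let ?o = "\<lambda>_::nat. 1::complex"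
    have "(-1) ^ e j l * z j ?o = (if l = j then -1 else 1) * z j ?o"
      unfolding e[OF jl, symmetric] by (rule base(3)[OF jl])
    then have "(-1) ^ e j l = (if l = j then -1 else (1::complex))" using nz[OF jl(1)] by simp
    then show ?thesis by (cases "even (e j l)") (auto split: if_splits)
  qed
  have "indep J (\<lambda>j l. pd l (z j) (\<lambda>_. 1))"
  proof (rule odd_diagonal_indep[where e=e and z="\<lambda>j. z j (\<lambda>_. 1)", OF odd _ nz])
    fix i l assume il: "i < J" "l < J"
    show "pd l (z i) (\<lambda>_. 1) = of_nat (e i l) * z i (\<lambda>_. 1)"
    proof (rule pd_coordinate_homogeneous[where f="z i" and x="\<lambda>_. 1"])
      show "z i ((\<lambda>_. 1)(l := t * 1)) = t ^ e i l * z i (\<lambda>_. 1)" for t by (rule e[OF il])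
    qed (rule refl)
  qed
  then show ?case by (rule exI[of _ "\<lambda>_. 1"])
next
  case (step s)
  \<comment> \<open>Only coordinate \<open>s\<close> has weight 1, so this grading is the degree in
    that coordinate.\<close>
  let ?w = "\<lambda>i. if i = s then 1 else (0::nat)"
  have "\<exists>a. (\<exists>x. hc ?w a (z j) x \<noteq> 0) \<and> (\<forall>k>a. \<forall>x. hc ?w k (z j) x = 0)" if j: "j < J" for j
  proof -
    obtain x where x: "z j x \<noteq> 0" using step.prems(2)[OF j] by (elim exE)
    have "\<exists>a. (\<exists>i<(1::nat). \<exists>x. hc ?w a (z j) x \<noteq> 0) \<and> (\<forall>k>a. \<forall>i<(1::nat). \<forall>x. hc ?w k (z j) x = 0)"
    proof (rule top_degree_exists)
      show "polyf J (z j)" by (rule step.prems(1)[OF j])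
      show "0 < (1::nat)" by simp
      show "z j x \<noteq> 0" by (rule x)
    qed
    then obtain a where a: "(\<exists>i<(1::nat). \<exists>x. hc ?w a (z j) x \<noteq> 0) \<and>
      (\<forall>k>a. \<forall>i<(1::nat). \<forall>x. hc ?w k (z j) x = 0)" by (rule exE)
    obtain i y where "hc ?w a (z j) y \<noteq> 0" using conjunct1[OF a] by (elim exE conjE)
    moreover have "hc ?w k (z j) x = 0" if "k > a" for k x
      by (rule conjunct2[OF a, rule_format, of k 0 x]) (simp_all add: that)
    ultimately show ?thesis by (intro exI[of _ a] exI[of _ y] conjI allI impI)
  qed
  note top = this
  define a where "a j = (SOME a. (\<exists>x. hc ?w a (z j) x \<noteq> 0) \<and> (\<forall>k>a. \<forall>x. hc ?w k (z j) x = 0))" for j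
  have a: "\<exists>x. hc ?w (a j) (z j) x \<noteq> 0" "\<And>k x. k > a j \<Longrightarrow> hc ?w k (z j) x = 0" if j: "j < J" for j
    unfolding a_def
    by (rule someI_ex[OF top[OF j], THEN conjunct1],
        rule someI_ex[OF top[OF j], THEN conjunct2, rule_format])
  let ?z = "\<lambda>j. hc ?w (a j) (z j)"
  have "\<exists>x. indep J (\<lambda>j l. pd l (?z j) x)"
  proof (rule step.IH)
    show "polyf J (?z j)" if "j < J" for j using step.prems(1)[OF that] by simp
    show "\<exists>x. ?z j x \<noteq> 0" if "j < J" for j using a(1)[OF that] .
    show "?z j (x(l := -1 * x l)) = (if l = j then -1 else 1) * ?z j x" if jl: "j < J" "l < J" for j l x
    proof (rule hc_scale_coordinate[where f="z j"])
      show "polyf J (z j)" by (rule step.prems(1)[OF jl(1)])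
      show "z j (x(l := -1 * x l)) = (if l = j then -1 else 1) * z j x" for x
        by (rule step.prems(3)[OF jl])
    qed
    show "\<exists>e. \<forall>t x. ?z j (x(l := t * x l)) = t ^ e * ?z j x" if jl: "j < J" "l < Suc s" for j l
    proof (cases "l = s")
      case True
      have "?z j (x(l := t * x l)) = t ^ a j * ?z j x" for t x
      proof -
        have "x(l := t * x l) = (\<lambda>i. t ^ ?w i * x i)" using True by auto
        then show ?thesis using hc_homogeneous[OF step.prems(1)[OF jl(1)], of ?w "a j" t x] by simp
      qed
      then show ?thesis by (intro exI[of _ "a j"] allI)
    next
      case False
      then have l: "l < s" using jl by simp
      obtain e where e: "\<forall>t x. z j (x(l := t * x l)) = t ^ e * z j x"
        using step.prems(4)[OF jl(1) l] by (elim exE)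
      have "?z j (x(l := t * x l)) = t ^ e * ?z j x" for t x
      proof (rule hc_scale_coordinate[where f="z j"])
        show "polyf J (z j)" by (rule step.prems(1)[OF jl(1)])
        show "z j (x(l := t * x l)) = t ^ e * z j x" for x by (rule e[rule_format])
      qed
      then show ?thesis by (intro exI[of _ e] allI)
    qed
  qed
  then obtain x where x: "indep J (\<lambda>j l. pd l (?z j) x)" by (elim exE)
  have one: "hc ?w 0 (\<lambda>_. 1) y = 1" for y by (simp add: hc_const)
  have "\<exists>x. (1::complex) \<noteq> 0 \<and> indep J (\<lambda>j l. pd l (\<lambda>x. z j x / 1) x)"
  proof (rule leading_forms_indep[where w="?w" and a=a and b=0 and N=J and ?x0.0=x and q="\<lambda>_. 1"])
    show "polyf J (z j)" if "j < J" for j using step.prems(1)[OF that] .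
    show "hc ?w k (z j) y = 0" if "j < J" "k > a j" for j k y using a(2)[OF that] .
    show "polyf J (\<lambda>_. 1)" by simp
    show "hc ?w k (\<lambda>_. 1) y = 0" if "k > 0" for k y using that by (simp add: hc_const)
    show "hc ?w 0 (\<lambda>_. 1) x \<noteq> 0" unfolding one by simp
    show "indep J (\<lambda>j l. pd l (\<lambda>x. ?z j x / hc ?w 0 (\<lambda>_. 1) x) x)"
      unfolding one div_by_1 by (rule x)
  qed
  then obtain y where "(1::complex) \<noteq> 0 \<and> indep J (\<lambda>j l. pd l (z j) y)" unfolding div_by_1 by (rule exE)
  then show ?case by (intro exI[of _ y]) (rule conjunct2)
qed

theorem odd_coordinates_indep:
  fixes J :: nat
  assumes "\<And>j. j < J \<Longrightarrow> polyf J (z j)" "\<And>j. j < J \<Longrightarrow> \<exists>x. z j x \<noteq> 0"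
    and "\<And>j l x. j < J \<Longrightarrow> l < J \<Longrightarrow> z j (x(l := -1 * x l)) = (if l = j then -1 else 1) * z j x"
  shows "\<exists>x. indep J (\<lambda>j l. pd l (z j) x)"
proof (rule odd_coordinates_indep_aux[OF le0[of J] assms])
  show "\<exists>e. \<forall>t x. z j (x(l := t * x l)) = t ^ e * z j x" if "l < 0" for j l
    using that by simp
qed

subsection \<open>The symmetric groups\<close>

lemma Inf_enat_mem: "Inf A = enat d \<Longrightarrow> enat d \<in> A"
  unfolding Inf_enat_def by (metis LeastI_ex enat.distinct(1) ex_in_conv)

lemma covdim_attained:
  assumes G: "group G" and d: "covdim G = enat d"
  shows "\<exists>N \<rho> m \<sigma> \<phi> P. covariant_data G N \<rho> m \<sigma> \<phi> P (\<lambda>_. 1) d"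
proof -
  obtain N \<rho> m \<sigma> \<phi> where "enat d = image_dim m (\<phi> ` carrier_vec N)"
      "covariant G N \<rho> m \<sigma> \<phi>" "acts_faithfully G \<sigma> (\<phi> ` carrier_vec N)"
    using Inf_enat_mem[OF d[unfolded covdim_def]] by (elim CollectE exE conjE)
  from covariant_data_polynomial[OF G this(2,3) eq_refl[OF this(1)[symmetric]]]
  obtain P where "covariant_data G N \<rho> m \<sigma> \<phi> P (\<lambda>_. 1) d" by (elim exE)
  then show ?thesis by (intro exI)
qed

lemma edim_attained:
  assumes G: "group G" and d: "edim G = enat d"
  shows "\<exists>N \<rho> m \<sigma> \<phi> P q. covariant_data G N \<rho> m \<sigma> \<phi> P q d"
proof -
  obtain N \<rho> m \<sigma> U \<phi> where "enat d = image_dim m (\<phi> ` U)"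
      "rational_covariant G N \<rho> m \<sigma> U \<phi>" "acts_faithfully G \<sigma> (\<phi> ` U)"
    using Inf_enat_mem[OF d[unfolded edim_def]] by (elim CollectE exE conjE)
  from covariant_data_rational[OF G this(2,3) eq_refl[OF this(1)[symmetric]]]
  obtain P q where "covariant_data G N \<rho> m \<sigma> \<phi> P q d" by (elim exE)
  then show ?thesis by (intro exI)
qed

lemma shift_perm_sym_group:
  assumes "p \<in> carrier (sym_group n)"
  shows "shift_perm n p permutes {..<n}"
    and "shift_perm n (r \<otimes>\<^bsub>sym_group n\<^esub> p) = shift_perm n r \<circ> shift_perm n p"
proof -
  have "bij_betw p {1..n} {1..n}"
    using assms by (intro permutes_imp_bij) (simp only: sym_group_carrier)
  then show "shift_perm n p permutes {..<n}"
      "shift_perm n (r \<otimes>\<^bsub>sym_group n\<^esub> p) = shift_perm n r \<circ> shift_perm n p"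
    unfolding sym_group_mult by (rule shift_perm_permutes, rule shift_perm_comp)
qed

lemma shift_perm_sym_group_one: "shift_perm n \<one>\<^bsub>sym_group n\<^esub> = id"
  unfolding sym_group_one by (rule shift_perm_id)

lemma shift_perm_sym_group_inj:
  assumes "p \<in> carrier (sym_group n)" "shift_perm n p = id"
  shows "p = \<one>\<^bsub>sym_group n\<^esub>"
proof -
  have p: "p permutes {1..n}" using assms(1) by (simp only: sym_group_carrier)
  have "p i = i" for i
  proof (cases "i \<in> {1..n}")
    case True
    then show ?thesis by (rule shift_perm_eq_id[OF permutes_imp_bij[OF p] assms(2)])
  next
    case False
    then show ?thesis by (rule permutes_not_in[OF p])
  qed
  then have "p = id" by (simp add: fun_eq_iff)
  then show ?thesis unfolding sym_group_one .
qed

lemma shift_perm_sym_group_moves: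
  assumes "p \<in> carrier (sym_group n)" "p \<noteq> \<one>\<^bsub>sym_group n\<^esub>"
  shows "\<exists>i<n. shift_perm n p i < n \<and> shift_perm n p i \<noteq> i"
proof -
  note p = shift_perm_sym_group(1)[OF assms(1)]
  have "shift_perm n p \<noteq> id" using assms(2) shift_perm_sym_group_inj[OF assms(1)] by (rule contrapos_nn)
  then obtain i where i: "shift_perm n p i \<noteq> i" by (auto simp: fun_eq_iff)
  then have "i < n" using permutes_not_in[OF p, of i] by auto
  moreover have "shift_perm n p i < n" using permutes_in_image[OF p, of i] \<open>i < n\<close> by simp
  ultimately show ?thesis using i by (intro exI[of _ i]) simp
qed

text \<open>The elements of sign 1 realise all permutations and give plain symmetric equivariance;
  the flag \<open>neg\<close> tells whether some element acts as -1, which gives parity.\<close>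

lemma compress_to_sym_subgroup:
  fixes G :: "('g, 'r) monoid_scheme" (structure)
  assumes G: "group G" and data: "covariant_data G N \<rho> m \<sigma> \<phi> P q d" and H: "subgroup H G" "finite H"
    and \<pi>: "\<And>h. h \<in> H \<Longrightarrow> \<pi> h permutes {..<n}" "\<And>h k. h \<in> H \<Longrightarrow> k \<in> H \<Longrightarrow> \<pi> (h \<otimes> k) = \<pi> h \<circ> \<pi> k"
    and \<epsilon>: "\<And>h. h \<in> H \<Longrightarrow> \<epsilon> h = 1 \<or> \<epsilon> h = (- 1 :: complex)"
      "\<And>h k. h \<in> H \<Longrightarrow> k \<in> H \<Longrightarrow> \<epsilon> (h \<otimes> k) = \<epsilon> h * \<epsilon> k"
    and inj: "\<And>h. h \<in> H \<Longrightarrow> \<pi> h = id \<Longrightarrow> \<epsilon> h = 1 \<Longrightarrow> h = \<one>"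
    and surj: "\<And>p. p permutes {..<n} \<Longrightarrow> \<exists>h\<in>H. \<pi> h = p \<and> \<epsilon> h = 1"
    and neg: "neg \<Longrightarrow> \<exists>h\<in>H. \<pi> h = id \<and> \<epsilon> h = -1"
    and n: "n \<ge> 1"
  shows "\<exists>f Q. (\<forall>i<n. polyf n (f i)) \<and> polyf n Q \<and> Q (\<lambda>i. of_nat (Suc i)) \<noteq> 0 \<and>
    (\<forall>i<n. f i (\<lambda>i. of_nat (Suc i)) = Q (\<lambda>i. of_nat (Suc i)) * of_nat (Suc i)) \<and>
    sym_equivariant n f \<and>
    alg_dim_le n d ((\<lambda>x i. f i x / Q x) ` {x. Q x \<noteq> 0}) \<and>
    ((\<forall>x. q x = 1) \<longrightarrow> Q = (\<lambda>_. 1)) \<and>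
    (neg \<longrightarrow> (\<forall>i<n. \<forall>x. f i (\<lambda>l. - x l) = - f i x) \<and> (\<forall>x. Q (\<lambda>l. - x l) = Q x))"
proof -
  have "\<exists>f Q. (\<forall>i<n. polyf n (f i)) \<and> polyf n Q \<and> Q (\<lambda>i. of_nat (Suc i)) \<noteq> 0 \<and>
      (\<forall>i<n. f i (\<lambda>i. of_nat (Suc i)) = Q (\<lambda>i. of_nat (Suc i)) * of_nat (Suc i)) \<and>
      (\<forall>h\<in>H. \<forall>i<n. \<forall>x. f (\<pi> h i) x = \<epsilon> h * f i (\<lambda>j. \<epsilon> h * x (\<pi> h j))) \<and>
      (\<forall>h\<in>H. \<forall>x. Q (\<lambda>j. \<epsilon> h * x (\<pi> h j)) = Q x) \<and>
      alg_dim_le n d ((\<lambda>x i. f i x / Q x) ` {x. Q x \<noteq> 0}) \<and>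
      ((\<forall>x. q x = 1) \<longrightarrow> Q = (\<lambda>_. 1))"
    by (rule compress_to_subgroup[OF G data H]) (fact \<pi> \<epsilon> inj n)+
  then obtain f Q where fQ: "\<forall>i<n. polyf n (f i)" "polyf n Q" "Q (\<lambda>i. of_nat (Suc i)) \<noteq> 0"
    "\<forall>i<n. f i (\<lambda>i. of_nat (Suc i)) = Q (\<lambda>i. of_nat (Suc i)) * of_nat (Suc i)"
    and f: "\<forall>h\<in>H. \<forall>i<n. \<forall>x. f (\<pi> h i) x = \<epsilon> h * f i (\<lambda>j. \<epsilon> h * x (\<pi> h j))"
    and Q: "\<forall>h\<in>H. \<forall>x. Q (\<lambda>j. \<epsilon> h * x (\<pi> h j)) = Q x"
    and ad: "alg_dim_le n d ((\<lambda>x i. f i x / Q x) ` {x. Q x \<noteq> 0})"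
    and one: "(\<forall>x. q x = 1) \<longrightarrow> Q = (\<lambda>_. 1)"
    by (elim exE conjE)
  have se: "sym_equivariant n f"
    unfolding sym_equivariant_def
  proof (intro allI impI)
    fix p i x assume p: "p permutes {..<n}" and i: "i < n"
    obtain h where h: "h \<in> H" "\<pi> h = p" "\<epsilon> h = 1" using surj[OF p] by (elim bexE conjE)
    show "f (p i) x = f i (\<lambda>j. x (p j))"
      using f[rule_format, OF h(1) i, of x] unfolding h(2,3) mult_1_left .
  qed
  have odd: "(\<forall>i<n. \<forall>x. f i (\<lambda>l. - x l) = - f i x) \<and> (\<forall>x. Q (\<lambda>l. - x l) = Q x)" if sign: neg
  proof (intro conjI allI impI)
    obtain h where h: "h \<in> H" "\<pi> h = id" "\<epsilon> h = -1" using neg[OF sign] by (elim bexE conjE)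
    show "f i (\<lambda>l. - x l) = - f i x" if i: "i < n" for i x
      using f[rule_format, OF h(1) i, of x] unfolding h(2,3) by simp
    show "Q (\<lambda>l. - x l) = Q x" for x
      using Q[rule_format, OF h(1), of x] unfolding h(2,3) by simp
  qed
  show ?thesis by (rule exI[of _ f], rule exI[of _ Q]) (intro conjI fQ ad one se impI odd)
qed

lemma sym_group_normal_form:
  assumes n: "n \<ge> 1" and data: "covariant_data (sym_group n) N \<rho> m \<sigma> \<phi> P q d"
  shows "\<exists>f Q. (\<forall>i<n. polyf n (f i)) \<and> polyf n Q \<and> Q (\<lambda>i. of_nat (Suc i)) \<noteq> 0 \<and>
    (\<forall>i<n. f i (\<lambda>i. of_nat (Suc i)) = Q (\<lambda>i. of_nat (Suc i)) * of_nat (Suc i)) \<and>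
    sym_equivariant n f \<and>
    alg_dim_le n d ((\<lambda>x i. f i x / Q x) ` {x. Q x \<noteq> 0}) \<and>
    ((\<forall>x. q x = 1) \<longrightarrow> Q = (\<lambda>_. 1))"
proof -
  let ?G = "sym_group n"
  note G = sym_group_is_group[of n]
  have fin: "finite (carrier ?G)" unfolding sym_group_def by (simp add: finite_permutations)
  have "\<exists>f Q. (\<forall>i<n. polyf n (f i)) \<and> polyf n Q \<and> Q (\<lambda>i. of_nat (Suc i)) \<noteq> 0 \<and>
      (\<forall>i<n. f i (\<lambda>i. of_nat (Suc i)) = Q (\<lambda>i. of_nat (Suc i)) * of_nat (Suc i)) \<and>
      sym_equivariant n f \<and>
      alg_dim_le n d ((\<lambda>x i. f i x / Q x) ` {x. Q x \<noteq> 0}) \<and>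
      ((\<forall>x. q x = 1) \<longrightarrow> Q = (\<lambda>_. 1)) \<and>
      (False \<longrightarrow> (\<forall>i<n. \<forall>x. f i (\<lambda>l. - x l) = - f i x) \<and> (\<forall>x. Q (\<lambda>l. - x l) = Q x))"
  proof (rule compress_to_sym_subgroup[where \<epsilon>="\<lambda>_. 1" and \<pi>="shift_perm n",
        OF G data group.subgroup_self[OF G] fin])
    show "\<exists>h\<in>carrier ?G. shift_perm n h = p \<and> (1::complex) = 1" if p: "p permutes {..<n}" for p
    proof -
      obtain r where "r permutes {1..n}" "shift_perm n r = p"
        using shift_perm_surj[OF p] by (elim exE conjE)
      then show ?thesis by (intro bexI[of _ r] conjI refl) (simp_all only: sym_group_carrier)
    qed
  qed (rule shift_perm_sym_group, assumption, rule shift_perm_sym_group, assumption, simp, simp,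
      rule shift_perm_sym_group_inj, assumption, assumption, simp, rule n)
  then show ?thesis by (elim exE conjE) (intro exI conjI, assumption+)
qed

text \<open>For polynomial covariants the denominator is 1. Positivity of the degree is what Euler's
  identity later requires.\<close>

lemma sym_group_homogeneous_form:
  assumes n: "n \<ge> 2" and data: "covariant_data (sym_group n) N \<rho> m \<sigma> \<phi> P (\<lambda>_. 1) d"
  shows "\<exists>F a. (\<forall>i<n. polyf n (F i)) \<and> (\<exists>i<n. \<exists>x. F i x \<noteq> 0) \<and> sym_equivariant n F \<and>
    (\<forall>x. (\<Sum>i<n. F i x) = 0) \<and> (\<forall>i<n. \<forall>t x. F i (\<lambda>l. t * x l) = t ^ a * F i x) \<and> a > 0 \<and>
    (\<forall>x. rank_le d ((\<lambda>i l. pd l (F i) x) ` {..<n}))"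
proof -
  let ?v = "\<lambda>i. complex_of_nat (Suc i)"
  have n1: "n \<ge> 1" using n by simp
  obtain f Q where f: "\<forall>i<n. polyf n (f i)" and Q: "polyf n Q" "Q ?v \<noteq> 0"
    and fv: "\<forall>i<n. f i ?v = Q ?v * of_nat (Suc i)" and se: "sym_equivariant n f"
    and ad: "alg_dim_le n d ((\<lambda>x i. f i x / Q x) ` {x. Q x \<noteq> 0})"
    and one: "(\<forall>x::nat \<Rightarrow> complex. (1::complex) = 1) \<longrightarrow> Q = (\<lambda>_. 1)"
    using sym_group_normal_form[OF n1 data] by (elim exE conjE)
  have Q1: "Q = (\<lambda>_. 1)" using one by simp
  have i01: "0 < n" "1 < n" using n by simp_all
  have ne: "f 0 ?v \<noteq> f 1 ?v" using fv[rule_format, of 0] fv[rule_format, of 1] n Q(2) by simp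
  obtain F B a b i x z where F: "\<forall>i<n. polyf n (F i)" and "polyf n B"
    and i: "i < n" "F i x \<noteq> 0" and "B z \<noteq> 0"
    and F': "sym_equivariant n F" "\<forall>x. (\<Sum>i<n. F i x) = 0"
      "\<forall>i<n. \<forall>t x. F i (\<lambda>l. t * x l) = t ^ a * F i x" and "\<forall>t x. B (\<lambda>l. t * x l) = t ^ b * B x"
    and rk: "\<forall>x. B x \<noteq> 0 \<longrightarrow> rank_le d ((\<lambda>i l. pd l (\<lambda>x. F i x / B x) x) ` {..<n})"
    and "(\<forall>i<n. \<forall>x. f i (\<lambda>l. - x l) = - f i x) \<longrightarrow> odd a"
    and "(\<forall>x. Q (\<lambda>l. - x l) = Q x) \<longrightarrow> even b"
    and B: "Q = (\<lambda>_. 1) \<longrightarrow> b = 0 \<and> B = (\<lambda>_. 1)"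
    using leading_normal_form[OF n1 f Q se i01 ne ad] by (elim exE conjE)
  have B1: "B = (\<lambda>_. 1)" using B Q1 by simp
  have rk1: "rank_le d ((\<lambda>i l. pd l (F i) x) ` {..<n})" for x
    using rk[rule_format, of x] unfolding B1 div_by_1 by simp
  \<comment> \<open>In degree 0 all components would be one and the same constant, by symmetry, and
    their zero sum would make it 0.\<close>
  have "a \<noteq> 0"
  proof
    assume a0: "a = 0"
    have c: "F i x = F i (\<lambda>_. 0)" if "i < n" for i x
      using F'(3)[rule_format, OF that, of 0 x] unfolding a0 by simp
    have eq: "F i x = F j (\<lambda>_. 0)" if ij: "i < n" "j < n" for i j x
    proof -
      have p: "Transposition.transpose i j permutes {..<n}" by (rule permutes_swap_id) (use ij in simp_all)
      have "F i (\<lambda>_. 0) = F j (\<lambda>_. 0)" using sym_equivariantD[OF F'(1) p ij(1), of "\<lambda>_. 0"] by simp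
      then show ?thesis using c[OF ij(1), of x] by simp
    qed
    have "(\<Sum>j<n. F j x) = (\<Sum>j<n. F i (\<lambda>_. 0))" by (rule sum.cong[OF refl]) (rule eq, use i(1) in simp_all)
    then have "of_nat n * F i (\<lambda>_. 0) = 0" using F'(2) by simp
    then have "F i (\<lambda>_. 0) = 0" using n by simp
    then show False using eq[OF i(1) i(1), of x] i(2) by simp
  qed
  then have "a > 0" by simp
  show ?thesis by (rule exI[of _ F], rule exI[of _ a]) (intro conjI F F' allI rk1 exI[of _ i] exI[of _ x] i \<open>a > 0\<close>)
qed

lemma sym_equivariant_nonzero:
  assumes F: "sym_equivariant n F" and nz: "i < n" "F i x \<noteq> 0" and j: "j < n"
  shows "\<exists>y. F j y \<noteq> 0"
proof -
  have p: "Transposition.transpose j i permutes {..<n}" by (rule permutes_swap_id) (use nz j in simp_all)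
  have "F i x = F j (\<lambda>l. x (Transposition.transpose j i l))"
    using sym_equivariantD[OF F p j, of x] by simp
  then show ?thesis using nz(2) by (intro exI) simp
qed

text \<open>The degree zero map \<open>F\<^sub>i\<^sup>n / \<Prod> F\<^sub>k\<close> is constant along the lines through the origin, \<open>F\<close> is not.\<close>

lemma rank_le_degree_zero:
  assumes F: "\<And>i. i < n \<Longrightarrow> polyf n (F i)" "\<And>i t x. i < n \<Longrightarrow> F i (\<lambda>l. t * x l) = t ^ a * F i x"
    and a: "a > 0" and rk: "rank_le d ((\<lambda>i l. pd l (F i) x) ` {..<n})"
    and n: "n \<ge> 1" and q: "(\<Prod>k<n. F k x) \<noteq> 0"
  shows "d > 0 \<and> rank_le (d - 1) ((\<lambda>i l. pd l (\<lambda>x. F i x ^ n / (\<Prod>k<n. F k x)) x) ` {..<n})"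
proof (rule rank_le_hyperplane[OF rk, where I="{..<n}" and b=x])
  let ?V = "(\<lambda>i l. pd l (F i) x) ` {..<n}"
  let ?q = "\<lambda>x. \<Prod>k<n. F k x"
  have qp: "polyf n ?q" by (rule polyf_prod) (simp add: F(1))
  \<comment> \<open>Gradients of polynomials in the \<open>F k\<close> stay in the span of the
    gradients of the \<open>F k\<close>; this is used for the powers and for the product.\<close>
  have span: "(\<lambda>l. pd l (\<lambda>x. H (\<lambda>k. F k x)) x) \<in> fs.span ?V" if H: "polyf n H" for H
  proof -
    have "(\<lambda>l. pd l (\<lambda>x. H (\<lambda>k. F k x)) x) = (\<lambda>l. \<Sum>k<n. pd k H (\<lambda>k. F k x) * pd l (F k) x)"
      by (rule ext, rule pd_reg_compose[where q="\<lambda>_. 1" and F=H and g=F, OF polyf_const _ H reg_polyf[OF F(1)]])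
        simp_all
    also have "\<dots> = (\<Sum>k<n. (\<lambda>l. pd k H (\<lambda>k. F k x) * pd l (F k) x))"
      by (rule ext) (simp only: sum_apply)
    also have "\<dots> \<in> fs.span ?V"
      by (intro fs.span_sum fs.span_scale fs.span_base imageI)
    finally show ?thesis .
  qed
  have pdq: "pd l (\<lambda>x. F i x ^ n / ?q x) x =
      1 / ?q x * pd l (\<lambda>x. F i x ^ n) x + (- (F i x ^ n) / (?q x)^2) * pd l ?q x" if i: "i < n" for i l
  proof -
    have *: "(u * q - p * v) / q^2 = 1 / q * u + (- p / q^2) * v" if "q \<noteq> 0" for u v p q :: complex
      using that by (simp add: diff_divide_distrib power2_eq_square)
    have "pd l (\<lambda>x. F i x ^ n / ?q x) x = (pd l (\<lambda>x. F i x ^ n) x * ?q x - F i x ^ n * pd l ?q x) / (?q x)^2"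
      by (rule pd_polyf_divide[OF polyf_power[OF F(1)[OF i]] qp q])
    then show ?thesis unfolding *[OF q] .
  qed
  show "(\<lambda>i l. pd l (\<lambda>x. F i x ^ n / ?q x) x) ` {..<n} \<subseteq> fs.span ?V"
  proof (rule image_subsetI)
    fix i assume "i \<in> {..<n}"
    then have i: "i < n" by simp
    have "(\<lambda>l. pd l (\<lambda>x. F i x ^ n / ?q x) x) = (\<lambda>l. 1 / ?q x * pd l (\<lambda>x. F i x ^ n) x) +
        (\<lambda>l. (- (F i x ^ n) / (?q x)^2) * pd l ?q x)"
      by (rule ext) (simp only: pdq[OF i] plus_fun_apply)
    also have "\<dots> \<in> fs.span ?V"
    proof (intro fs.span_add fs.span_scale)
      show "(\<lambda>l. pd l (\<lambda>x. F i x ^ n) x) \<in> fs.span ?V"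
        using span[of "\<lambda>y. y i ^ n"] i by simp
      show "(\<lambda>l. pd l ?q x) \<in> fs.span ?V"
      proof -
        have "polyf n (\<lambda>y. \<Prod>k<n. y k)" by (rule polyf_prod) simp
        then show ?thesis by (rule span[of "\<lambda>y. \<Prod>k<n. y k"])
      qed
    qed
    finally show "(\<lambda>l. pd l (\<lambda>x. F i x ^ n / ?q x) x) \<in> fs.span ?V" .
  qed
  show "(\<lambda>l. pd l (F 0) x) \<in> fs.span ?V"
    by (rule fs.span_base, rule image_eqI[of _ _ 0]) (use n in simp_all)
  \<comment> \<open>The product and each \<open>n\<close>-th power have the same degree
    \<open>a * n\<close>, so the radial derivative of their quotient cancels.\<close>
  have eq: "(\<Sum>l<n. pd l ?q x * x l) = of_nat (a * n) * ?q x"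
  proof (rule euler_identity[OF qp])
    fix t
    have "(\<Prod>k<n. F k (\<lambda>i. t * x i)) = (\<Prod>k<n. t ^ a * F k x)"
      by (rule prod.cong[OF refl], rule F(2)) simp
    then show "(\<Prod>k<n. F k (\<lambda>i. t * x i)) = t ^ (a * n) * ?q x"
      by (simp add: prod.distrib power_mult)
  qed
  have ep: "(\<Sum>l<n. pd l (\<lambda>x. F i x ^ n) x * x l) = of_nat (a * n) * F i x ^ n" if i: "i < n" for i
  proof (rule euler_identity[OF polyf_power[OF F(1)[OF i]]])
    fix t
    have "F i (\<lambda>l. t * x l) ^ n = (t ^ a * F i x) ^ n" by (rule arg_cong[OF F(2)[OF i]])
    then show "F i (\<lambda>l. t * x l) ^ n = t ^ (a * n) * F i x ^ n"
      unfolding power_mult_distrib power_mult .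
  qed
  show "(\<Sum>l<n. w l * x l) = 0" if w: "w \<in> (\<lambda>i l. pd l (\<lambda>x. F i x ^ n / ?q x) x) ` {..<n}" for w
  proof -
    obtain i where i: "i \<in> {..<n}" and w: "w = (\<lambda>l. pd l (\<lambda>x. F i x ^ n / ?q x) x)"
      using w by (elim imageE)
    have i: "i < n" using i by simp
    have *: "1 / q * (c * p) + (- p / q^2) * (c * q) = 0" if "q \<noteq> 0" for p q c :: complex
      using that by (simp add: power2_eq_square)
    have "(\<Sum>l<n. w l * x l) = 1 / ?q x * (\<Sum>l<n. pd l (\<lambda>x. F i x ^ n) x * x l) +
        (- (F i x ^ n) / (?q x)^2) * (\<Sum>l<n. pd l ?q x * x l)"
      unfolding w by (simp only: pdq[OF i] distrib_right sum.distrib sum_distrib_left mult.assoc)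
    then show ?thesis unfolding ep[OF i] eq *[OF q] .
  qed
  have "(\<Sum>l<n. pd l (F 0) x * x l) = of_nat a * F 0 x"
    by (rule euler_identity[OF F(1) F(2)]) (use n in simp_all)
  moreover have "F 0 x \<noteq> 0" using q n by simp
  ultimately show "(\<Sum>l<n. pd l (F 0) x * x l) \<noteq> 0" using a by simp
qed

text \<open>The product of all components is an invariant denominator of degree
  \<open>n * a\<close>; the exponent \<open>n\<close> in the numerators brings the total degree to
  zero while keeping equivariance. Faithfulness survives because distinct components have distinct
  \<open>n\<close>-th powers.\<close>

theorem edim_sym_group_less_covdim:
  assumes n: "n \<ge> 3"
  shows "edim (sym_group n) + 1 \<le> covdim (sym_group n)"
proof (cases "covdim (sym_group n)")
  case infinity
  then show ?thesis by simp
next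
  case (enat d)
  let ?G = "sym_group n"
  note G = sym_group_is_group[of n]
  obtain N \<rho> m \<sigma> \<phi> P where data: "covariant_data ?G N \<rho> m \<sigma> \<phi> P (\<lambda>_. 1) d"
    using covdim_attained[OF G enat] by (elim exE)
  have n2: "n \<ge> 2" "n \<ge> 1" using n by simp_all
  obtain F a i0 x0 where i0: "i0 < n" "F i0 x0 \<noteq> 0" and F: "\<forall>i<n. polyf n (F i)" "sym_equivariant n F"
      "\<forall>x. (\<Sum>i<n. F i x) = 0" "\<forall>i<n. \<forall>t x. F i (\<lambda>l. t * x l) = t ^ a * F i x" "a > 0"
      "\<forall>x. rank_le d ((\<lambda>i l. pd l (F i) x) ` {..<n})"
    using sym_group_homogeneous_form[OF n2(1) data] by (elim exE conjE)
  let ?q = "\<lambda>x. \<Prod>k<n. F k x"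
  have qp: "polyf n ?q" by (rule polyf_prod) (simp add: F(1))
  have "\<exists>z. \<forall>i\<in>{..<n}. F i z \<noteq> 0"
    
  proof (rule polyf_nonzero_common_finite)
    show "polyf n (F i)" if "i \<in> {..<n}" for i using F(1) that by simp
    show "\<exists>x. F i x \<noteq> 0" if "i \<in> {..<n}" for i
      by (rule sym_equivariant_nonzero[OF F(2) i0]) (use that in simp)
  qed simp
  then obtain z where z: "\<forall>i\<in>{..<n}. F i z \<noteq> 0" by (elim exE)
  then have qz: "?q z \<noteq> 0" by (simp add: prod_zero_iff)
  have rk: "d > 0 \<and> rank_le (d - 1) ((\<lambda>i l. pd l (\<lambda>x. F i x ^ n / ?q x) x) ` {..<n})" if "?q x \<noteq> 0" for x
    by (rule rank_le_degree_zero[OF F(1,4)[rule_format] F(5) F(6)[rule_format] n2(2) that])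
  have "edim ?G \<le> enat (d - 1)"
  proof (rule edim_le_if_equivariant[OF G, where \<pi>="shift_perm n" and f="\<lambda>i x. F i x ^ n" and q="?q" and z=z])
    show "shift_perm n g permutes {..<n}" if "g \<in> carrier ?G" for g by (rule shift_perm_sym_group(1)[OF that])
    show "shift_perm n (g \<otimes>\<^bsub>?G\<^esub> h) = shift_perm n g \<circ> shift_perm n h" if "h \<in> carrier ?G" for g h
      by (rule shift_perm_sym_group(2)[OF that])
    show "shift_perm n \<one>\<^bsub>?G\<^esub> = id" by (rule shift_perm_sym_group_one)
    show "polyf n (\<lambda>x. F i x ^ n)" if "i < n" for i using F(1) that by simp
    show "sym_equivariant n (\<lambda>i x. F i x ^ n)"
      unfolding sym_equivariant_def
    proof (intro allI impI)
      fix p i x assume p: "p permutes {..<n}" and i: "i < n"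
      show "F (p i) x ^ n = F i (\<lambda>j. x (p j)) ^ n" using sym_equivariantD[OF F(2) p i, of x] by simp
    qed
    show "polyf n ?q" "?q z \<noteq> 0" by (rule qp, rule qz)
    show "(\<Prod>k<n. F k (\<lambda>j. x (p j))) = ?q x" if p: "p permutes {..<n}" for p x
    proof -
      have "(\<Prod>k<n. F k (\<lambda>j. x (p j))) = (\<Prod>k<n. F (p k) x)"
        by (rule prod.cong[OF refl], rule sym_equivariantD[OF F(2) p, symmetric]) simp
      also have "\<dots> = ?q x" using prod.permute[OF p, of "\<lambda>k. F k x"] by (simp only: o_def)
      finally show ?thesis .
    qed
    show "\<exists>x. ?q x \<noteq> 0 \<and> (\<exists>i<n. F (shift_perm n g i) x ^ n \<noteq> F i x ^ n)"
      if g: "g \<in> carrier ?G" "g \<noteq> \<one>\<^bsub>?G\<^esub>" for g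
    proof -
      obtain i where i: "i < n" "shift_perm n g i < n" "shift_perm n g i \<noteq> i"
        using shift_perm_sym_group_moves[OF g] by (elim exE conjE)
      let ?j = "shift_perm n g i"
      have "\<exists>y. F ?j y ^ n \<noteq> F i y ^ n"
        by (rule equivariant_powers_distinct[OF n F(1)[rule_format] F(2) F(3)[rule_format] i0 i(1,2) i(3)[symmetric]])
      then obtain y where y: "F ?j y ^ n \<noteq> F i y ^ n" by (elim exE)
      have p: "polyf n (\<lambda>x. F ?j x ^ n - F i x ^ n)" using F(1) i by simp
      have "F ?j y ^ n - F i y ^ n \<noteq> 0" using y by simp
      from polyf_nonzero_common[OF p qp this qz]
      obtain x where "F ?j x ^ n - F i x ^ n \<noteq> 0" "?q x \<noteq> 0" by (elim exE conjE)
      then show ?thesis using i(1) by (intro exI[of _ x] exI[of _ i] conjI) simp_all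
    qed
    show "rank_le (d - 1) ((\<lambda>i l. pd l (\<lambda>x. F i x ^ n / ?q x) x) ` {..<n})" if "?q x \<noteq> 0" for x
      using rk[OF that] by (rule conjunct2)
  qed
  then have "edim ?G + 1 \<le> enat (d - 1) + 1" by (rule add_right_mono)
  also have "\<dots> = enat d" using rk[OF qz] by (simp add: one_enat_def)
  finally show ?thesis unfolding enat .
qed

text \<open>Clearing the denominator of the compressed map costs at most one dimension. Faithfulness
  is visible at (1, ..., n), which is sent to a nonzero multiple of itself.\<close>

theorem covdim_sym_group_le_edim:
  assumes n: "n \<ge> 1"
  shows "covdim (sym_group n) \<le> edim (sym_group n) + 1"
proof (cases "edim (sym_group n)")
  case infinity
  then show ?thesis by simp
next
  case (enat d)
  let ?G = "sym_group n" and ?v = "\<lambda>i. complex_of_nat (Suc i)"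
  note G = sym_group_is_group[of n]
  obtain N \<rho> m \<sigma> \<phi> P q where data: "covariant_data ?G N \<rho> m \<sigma> \<phi> P q d"
    using edim_attained[OF G enat] by (elim exE)
  obtain f Q where f: "\<forall>i<n. polyf n (f i)" and Q: "polyf n Q" "Q ?v \<noteq> 0"
    and fv: "\<forall>i<n. f i ?v = Q ?v * of_nat (Suc i)" and se: "sym_equivariant n f"
    and ad: "alg_dim_le n d ((\<lambda>x i. f i x / Q x) ` {x. Q x \<noteq> 0})"
    using sym_group_normal_form[OF n data] by (elim exE conjE)
  have "covdim ?G \<le> enat (Suc d)"
  proof (rule covdim_le_if_equivariant[OF G, where \<pi>="shift_perm n" and \<epsilon>="\<lambda>_. 1" and f=f and q=Q and z="?v"])
    show "shift_perm n g permutes {..<n}" if "g \<in> carrier ?G" for g by (rule shift_perm_sym_group(1)[OF that])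
    show "shift_perm n (g \<otimes>\<^bsub>?G\<^esub> h) = shift_perm n g \<circ> shift_perm n h" if "h \<in> carrier ?G" for g h
      by (rule shift_perm_sym_group(2)[OF that])
    show "shift_perm n \<one>\<^bsub>?G\<^esub> = id" by (rule shift_perm_sym_group_one)
    show "polyf n (f i)" if "i < n" for i using f that by simp
    show "\<exists>x. \<exists>i<n. f (shift_perm n g i) x \<noteq> 1 * f i x" if g: "g \<in> carrier ?G" "g \<noteq> \<one>\<^bsub>?G\<^esub>" for g
    proof -
      obtain i where i: "i < n" "shift_perm n g i < n" "shift_perm n g i \<noteq> i"
        using shift_perm_sym_group_moves[OF g] by (elim exE conjE)
      then have "f (shift_perm n g i) ?v \<noteq> 1 * f i ?v"
        using fv[rule_format, OF i(1)] fv[rule_format, OF i(2)] Q(2) by simp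
      then show ?thesis using i(1) by (intro exI[of _ ?v] exI[of _ i] conjI)
    qed
    show "rank_le (Suc d) ((\<lambda>i l. pd l (f i) x) ` {..<n})" if Qx: "Q x \<noteq> 0" for x
    proof -
      have reg: "reg n Q (\<lambda>x. f i x / Q x)" if "i < n" for i
        using f that Q(1) by (intro reg_divide) simp_all
      have rQ: "reg n Q Q" using Q(1) by (rule reg_polyf)
      have "rank_le d ((\<lambda>i l. pd l (\<lambda>x. f i x / Q x) x) ` {..<n})"
        by (rule rank_le_if_alg_dim_le[where \<phi>="\<lambda>i x. f i x / Q x", OF Q(1) _ ad Qx]) (rule reg)
      then have "rank_le (Suc d) ((\<lambda>i l. pd l (\<lambda>x. Q x * (f i x / Q x)) x) ` {..<n})"
        by (intro rank_le_mult[where \<phi>="\<lambda>i x. f i x / Q x" and h=Q, OF Q(1) Qx _ rQ]) (rule reg)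
      moreover have "(\<lambda>i l. pd l (\<lambda>x. Q x * (f i x / Q x)) x) ` {..<n} = (\<lambda>i l. pd l (f i) x) ` {..<n}"
      proof (rule image_cong[OF refl], rule ext)
        fix i l assume "i \<in> {..<n}"
        then have "polyf n (f i)" using f by simp
        then show "pd l (\<lambda>x. Q x * (f i x / Q x)) x = pd l (f i) x"
          by (intro pd_cong_reg[OF Q(1) Qx reg_polyf]) simp_all
      qed
      ultimately show ?thesis by (simp only:)
    qed
  qed (use se Q in simp_all)
  then show ?thesis unfolding enat by (simp add: one_enat_def)
qed

section \<open>Products with cyclic groups\<close>

lemma primitive_root_of_unity:
  fixes d :: nat
  assumes "d \<ge> 1"
  shows "\<exists>\<zeta>::complex. \<zeta> ^ d = 1 \<and> (\<forall>k<d. \<zeta> ^ k = 1 \<longrightarrow> k = 0)"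
proof -
  let ?z = "\<lambda>k. cis (2 * pi * real k / real d)"
  have bij: "bij_betw ?z {..<d} {z. z ^ d = 1}" by (rule bij_betw_roots_unity) (use assms in simp)
  have pow: "?z 1 ^ k = ?z k" for k unfolding DeMoivre by (simp add: mult.commute)
  have "?z 1 ^ d = 1" unfolding pow using assms by simp
  moreover have "k = 0" if "k < d" "?z 1 ^ k = 1" for k
  proof -
    have "?z k = ?z 0" using that(2) unfolding pow by simp
    then show ?thesis by (rule inj_onD[OF bij_betw_imp_inj_on[OF bij]]) (use that(1) assms in simp_all)
  qed
  ultimately show ?thesis by (intro exI[of _ "?z 1"] conjI allI impI)
qed

lemma power_mod_order:
  assumes "\<zeta> ^ d = (1::complex)"
  shows "\<zeta> ^ (k mod d) = \<zeta> ^ k"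
proof -
  have "\<zeta> ^ k = \<zeta> ^ (d * (k div d) + k mod d)" by simp
  also have "\<dots> = \<zeta> ^ (k mod d)" unfolding power_add power_mult assms by simp
  finally show ?thesis ..
qed

theorem covdim_sym_group_le_prod:
  assumes d: "d \<ge> 1"
  shows "covdim (sym_group n) \<le> covdim (sym_group n \<times>\<times> integer_mod_group d)"
proof (rule covdim_embed[where h="\<lambda>p. (p, 0)"])
  show "(\<lambda>p. (p, 0)) \<in> hom (sym_group n) (sym_group n \<times>\<times> integer_mod_group d)"
    by (rule homI) simp_all
  show "inj_on (\<lambda>p. (p, 0::int)) (carrier (sym_group n))" by (rule inj_onI) simp
qed (intro DirProd_group sym_group_is_group group_integer_mod_group)+

text \<open>The cyclic factor acts by scalars through a primitive root of unity, for which a map of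
  degree congruent to 1 modulo \<open>d\<close> is equivariant. A power of the symmetric form \<Sum>
  x_l reaches such a degree without raising the rank, since \<open>F\<close> has positive
  degree.\<close>

theorem covdim_prod_le_sym_group:
  assumes n: "n \<ge> 3" and d: "d \<ge> 1"
  shows "covdim (sym_group n \<times>\<times> integer_mod_group d) \<le> covdim (sym_group n)"
proof (cases "covdim (sym_group n)")
  case infinity
  then show ?thesis by simp
next
  case (enat e)
  let ?S = "sym_group n" and ?Z = "integer_mod_group d"
  let ?G = "?S \<times>\<times> ?Z"
  have G: "group ?G" by (intro DirProd_group sym_group_is_group group_integer_mod_group)
  obtain N \<rho> m \<sigma> \<phi> P where data: "covariant_data ?S N \<rho> m \<sigma> \<phi> P (\<lambda>_. 1) e"
    using covdim_attained[OF sym_group_is_group enat] by (elim exE)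
  have n2: "n \<ge> 2" using n by simp
  obtain F a i0 x0 where i0: "i0 < n" "F i0 x0 \<noteq> 0" and F: "\<forall>i<n. polyf n (F i)" "sym_equivariant n F"
      "\<forall>x. (\<Sum>i<n. F i x) = 0" "\<forall>i<n. \<forall>t x. F i (\<lambda>l. t * x l) = t ^ a * F i x" "a > 0"
      "\<forall>x. rank_le e ((\<lambda>i l. pd l (F i) x) ` {..<n})"
    using sym_group_homogeneous_form[OF n2 data] by (elim exE conjE)
  obtain \<zeta> :: complex where \<zeta>: "\<zeta> ^ d = 1" "\<forall>k<d. \<zeta> ^ k = 1 \<longrightarrow> k = 0"
    using primitive_root_of_unity[OF d] by (elim exE conjE)
  \<comment> \<open>The total degree becomes \<open>s + a = d * a + 1\<close>.\<close>
  define s where "s = a * (d - 1) + 1"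
  have as: "s + a = d * a + 1" using d unfolding s_def by (cases d) (simp_all add: algebra_simps)
  define h where "h x = (\<Sum>l<n. x l) ^ s" for x :: "nat \<Rightarrow> complex"
  let ?f = "\<lambda>i x. h x * F i x"
  let ?\<epsilon> = "\<lambda>g :: (nat \<Rightarrow> nat) \<times> int. \<zeta> ^ nat (snd g)"
  have hp: "polyf n h" unfolding h_def by (intro polyf_power polyf_sum polyf_var) simp
  have h0: "h (\<lambda>_. 1) \<noteq> 0" unfolding h_def using n by simp
  have carG: "fst g \<in> carrier ?S" "snd g \<ge> 0" "snd g < int d" if "g \<in> carrier ?G" for g
    using that d by (auto simp: carrier_integer_mod_group)
  have "covdim ?G \<le> enat e"
  proof (rule covdim_le_if_equivariant[OF G, where \<pi>="\<lambda>g. shift_perm n (fst g)" and \<epsilon>="?\<epsilon>"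
      and f="?f" and q="F i0" and z=x0])
    show "shift_perm n (fst g) permutes {..<n}" if "g \<in> carrier ?G" for g
      by (rule shift_perm_sym_group(1)[OF carG(1)[OF that]])
    show "shift_perm n (fst (g \<otimes>\<^bsub>?G\<^esub> k)) = shift_perm n (fst g) \<circ> shift_perm n (fst k)"
      if "k \<in> carrier ?G" for g k
      unfolding mult_DirProd' fst_conv by (rule shift_perm_sym_group(2)[OF carG(1)[OF that]])
    show "shift_perm n (fst \<one>\<^bsub>?G\<^esub>) = id"
      unfolding one_DirProd fst_conv by (rule shift_perm_sym_group_one)
    show "?\<epsilon> (g \<otimes>\<^bsub>?G\<^esub> k) = ?\<epsilon> g * ?\<epsilon> k" if "g \<in> carrier ?G" "k \<in> carrier ?G" for g k
    proof -
      have "nat ((snd g + snd k) mod int d) = (nat (snd g) + nat (snd k)) mod d"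
        using carG(2)[OF that(1)] carG(2)[OF that(2)] by (simp add: nat_mod_distrib nat_add_distrib)
      then show ?thesis
        unfolding mult_DirProd' snd_conv mult_integer_mod_group by (simp only: power_mod_order[OF \<zeta>(1)] power_add)
    qed
    show "?\<epsilon> \<one>\<^bsub>?G\<^esub> = 1" by simp
    show "polyf n (?f i)" if "i < n" for i using hp F(1) that by simp
    show "sym_equivariant n ?f"
      unfolding sym_equivariant_def
    proof (intro allI impI)
      fix p i and x :: "nat \<Rightarrow> complex" assume p: "p permutes {..<n}" and i: "i < n"
      have "(\<Sum>l<n. x (p l)) = (\<Sum>l<n. x l)"
        using sum.permute[OF p, of x] by (simp only: o_def)
      then have "h (\<lambda>j. x (p j)) = h x" unfolding h_def by simp
      moreover have "F (p i) x = F i (\<lambda>j. x (p j))" by (rule sym_equivariantD[OF F(2) p i])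
      ultimately show "h x * F (p i) x = h (\<lambda>j. x (p j)) * F i (\<lambda>j. x (p j))" by simp
    qed
    show "?f i (\<lambda>l. ?\<epsilon> g * x l) = ?\<epsilon> g * ?f i x" if "i < n" for g i x
    proof -
      let ?e = "?\<epsilon> g"
      have "?e ^ d = (\<zeta> ^ d) ^ nat (snd g)" by (simp only: power_mult[symmetric] mult.commute)
      then have "?e ^ d = 1" using \<zeta>(1) by simp
      then have e: "?e ^ (s + a) = ?e" unfolding as power_add power_mult by simp
      have "h (\<lambda>l. ?e * x l) = ?e ^ s * h x"
        unfolding h_def sum_distrib_left[symmetric] power_mult_distrib ..
      moreover have "F i (\<lambda>l. ?e * x l) = ?e ^ a * F i x" by (rule F(4)[rule_format, OF that])
      ultimately have "?f i (\<lambda>l. ?e * x l) = ?e ^ (s + a) * ?f i x" by (simp add: power_add)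
      then show ?thesis unfolding e .
    qed
    show "\<exists>x. \<exists>i<n. ?f (shift_perm n (fst g) i) x \<noteq> ?\<epsilon> g * ?f i x"
      if g: "g \<in> carrier ?G" "g \<noteq> \<one>\<^bsub>?G\<^esub>" for g
    proof -
      let ?p = "shift_perm n (fst g)"
      \<comment> \<open>A nontrivial permutation part is detected by nonproportionality, whatever
        the scalar; otherwise the scalar differs from 1 and any nonzero value detects it.\<close>
      have "\<exists>i<n. ?p i < n \<and> (\<exists>x. F (?p i) x \<noteq> ?\<epsilon> g * F i x)"
      proof (cases "fst g = \<one>\<^bsub>?S\<^esub>")
        case True
        then have "snd g \<noteq> 0" using g(2) by (auto simp: prod_eq_iff)
        then have "nat (snd g) < d" "nat (snd g) \<noteq> 0" using carG(2,3)[OF g(1)] by simp_all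
        have "?\<epsilon> g \<noteq> 1"
        proof
          assume "?\<epsilon> g = 1"
          with \<open>nat (snd g) < d\<close> have "nat (snd g) = 0" by (rule \<zeta>(2)[rule_format])
          with \<open>nat (snd g) \<noteq> 0\<close> show False by (rule notE)
        qed
        then have "F i0 x0 \<noteq> ?\<epsilon> g * F i0 x0" using i0(2) by simp
        moreover have "?p i0 = i0" unfolding True shift_perm_sym_group_one by simp
        ultimately show ?thesis using i0(1) by (intro exI[of _ i0] conjI exI[of _ x0]) simp_all
      next
        case False
        obtain i where i: "i < n" "?p i < n" "?p i \<noteq> i"
          using shift_perm_sym_group_moves[OF carG(1)[OF g(1)] False] by (elim exE conjE)
        have "\<exists>x. F (?p i) x \<noteq> ?\<epsilon> g * F i x"
          by (rule equivariant_not_proportional[OF n F(2) F(3)[rule_format] i0 i(1,2) i(3)[symmetric]])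
        then show ?thesis using i by (intro exI[of _ i] conjI)
      qed
      then obtain i y where i: "i < n" "?p i < n" and y: "F (?p i) y \<noteq> ?\<epsilon> g * F i y"
        by (elim exE conjE)
      have p: "polyf n (\<lambda>x. F (?p i) x - ?\<epsilon> g * F i x)" using F(1) i by simp
      have "F (?p i) y - ?\<epsilon> g * F i y \<noteq> 0" using y by simp
      from polyf_nonzero_common[OF p hp this h0]
      obtain x where x: "F (?p i) x - ?\<epsilon> g * F i x \<noteq> 0" "h x \<noteq> 0" by (elim exE conjE)
      have "h x * F (?p i) x - ?\<epsilon> g * (h x * F i x) = h x * (F (?p i) x - ?\<epsilon> g * F i x)"
        by (simp only: right_diff_distrib mult.left_commute)
      then have "?f (?p i) x \<noteq> ?\<epsilon> g * ?f i x" using x by (metis eq_iff_diff_eq_0 mult_eq_0_iff)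
      then show ?thesis using i(1) by (intro exI[of _ x] exI[of _ i] conjI)
    qed
    show "polyf n (F i0)" using F(1) i0(1) by simp
    show "F i0 x0 \<noteq> 0" by (rule i0(2))
    show "rank_le e ((\<lambda>i l. pd l (?f i) x) ` {..<n})" if x: "F i0 x \<noteq> 0" for x
    proof (rule rank_le_mult_homogeneous[where q="\<lambda>_. 1" and c="of_nat a" and k=i0 and N=n])
      show "reg n (\<lambda>_. 1) (F i)" if "i < n" for i using F(1) that by (intro reg_polyf) simp
      show "reg n (\<lambda>_. 1) h" by (rule reg_polyf[OF hp])
      show "(\<Sum>l<n. pd l (F i) x * x l) = of_nat a * F i x" if "i < n" for i
        by (rule euler_identity) (use F(1,4) that in blast)+
      show "rank_le e ((\<lambda>i l. pd l (F i) x) ` {..<n})" using F(6) ..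
    qed (use F(5) i0(1) x in simp_all)
  qed
  then show ?thesis unfolding enat .
qed

section \<open>The stabiliser of the last two letters, S_n \<times> S_2 in S_(n+2)\<close>

definition split_perms :: "nat \<Rightarrow> (nat \<Rightarrow> nat) set" where
  "split_perms n = {p. p permutes {1..n + 2} \<and> p ` {n + 1, n + 2} = {n + 1, n + 2}}"

text \<open>On \<open>split_perms\<close> this is the sign of the permutation induced on the last
  two letters.\<close>

definition split_sign :: "nat \<Rightarrow> (nat \<Rightarrow> nat) \<Rightarrow> complex" where
  "split_sign n p = (if p (n + 1) = n + 1 then 1 else - 1)"

lemma split_perms_cases:
  assumes "p \<in> split_perms n"
  shows "(p (n + 1) = n + 1 \<and> p (n + 2) = n + 2) \<or> (p (n + 1) = n + 2 \<and> p (n + 2) = n + 1)"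
proof -
  have "{p (n + 1), p (n + 2)} = {n + 1, n + 2}" using assms unfolding split_perms_def by simp
  then show ?thesis by (simp only: doubleton_eq_iff)
qed

lemma split_perms_bij:
  assumes "p \<in> split_perms n"
  shows "bij_betw p {1..n} {1..n}"
proof -
  have p: "p permutes {1..n + 2}" "p ` {n + 1, n + 2} = {n + 1, n + 2}"
    using assms unfolding split_perms_def by simp_all
  have split: "{1..n} = {1..n + 2} - {n + 1, n + 2}" by auto
  have "p ` {1..n} = p ` {1..n + 2} - p ` {n + 1, n + 2}"
    unfolding split by (rule image_set_diff[OF permutes_inj[OF p(1)]])
  also have "\<dots> = {1..n}" unfolding p(2) permutes_image[OF p(1)] split ..
  finally show ?thesis unfolding bij_betw_def using inj_on_subset[OF permutes_inj[OF p(1)] subset_UNIV] by simp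
qed

lemma split_perms_subgroup: "subgroup (split_perms n) (sym_group (n + 2))"
proof (rule subgroup.intro)
  show "split_perms n \<subseteq> carrier (sym_group (n + 2))"
    unfolding split_perms_def sym_group_def by auto
  show "\<one>\<^bsub>sym_group (n + 2)\<^esub> \<in> split_perms n"
    unfolding split_perms_def sym_group_one by (simp add: permutes_id)
  show "p \<otimes>\<^bsub>sym_group (n + 2)\<^esub> r \<in> split_perms n" if "p \<in> split_perms n" "r \<in> split_perms n" for p r
    using that unfolding split_perms_def sym_group_mult
    by (simp only: mem_Collect_eq permutes_compose image_comp[symmetric] simp_thms)
  show "inv\<^bsub>sym_group (n + 2)\<^esub> p \<in> split_perms n" if p: "p \<in> split_perms n" for p
  proof -
    have P: "p permutes {1..n + 2}" "p ` {n + 1, n + 2} = {n + 1, n + 2}"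
      using p unfolding split_perms_def by simp_all
    have "inv\<^bsub>sym_group (n + 2)\<^esub> p = inv' p"
      by (rule sym_group_inv_equality) (simp only: sym_group_carrier P(1))
    moreover have "inv' p ` {n + 1, n + 2} = {n + 1, n + 2}"
      using image_inv_f_f[OF permutes_inj[OF P(1)], of "{n + 1, n + 2}"] unfolding P(2) .
    ultimately show ?thesis unfolding split_perms_def using permutes_inv[OF P(1)] by simp
  qed
qed

lemma split_sign_mult:
  assumes "p \<in> split_perms n" "r \<in> split_perms n"
  shows "split_sign n (p \<circ> r) = split_sign n p * split_sign n r"
  using split_perms_cases[OF assms(1)] split_perms_cases[OF assms(2)]
  unfolding split_sign_def by auto

lemma split_perms_trivial:
  assumes "p \<in> split_perms n" "shift_perm n p = id" "split_sign n p = 1"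
  shows "p = id"
proof
  fix i
  have p: "p permutes {1..n + 2}" using assms(1) unfolding split_perms_def by simp
  have "p (n + 1) = n + 1" using assms(3) unfolding split_sign_def by (simp split: if_splits)
  then have last: "p (n + 1) = n + 1" "p (n + 2) = n + 2" using split_perms_cases[OF assms(1)] by auto
  consider "i \<in> {1..n}" | "i = n + 1" | "i = n + 2" | "i \<notin> {1..n + 2}" by fastforce
  then have "p i = i"
  proof cases
    case 1
    then show ?thesis by (rule shift_perm_eq_id[OF split_perms_bij[OF assms(1)] assms(2)])
  next
    case 4
    then show ?thesis by (rule permutes_not_in[OF p])
  qed (simp_all only: last)
  then show "p i = id i" by simp
qed

lemma split_perms_surj:
  assumes "p permutes {..<n}"
  shows "\<exists>r\<in>split_perms n. shift_perm n r = p \<and> split_sign n r = 1"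
proof -
  obtain r where r: "r permutes {1..n}" "shift_perm n r = p"
    using shift_perm_surj[OF assms] by (elim exE conjE)
  have "r (n + 1) = n + 1" "r (n + 2) = n + 2" by (rule permutes_not_in[OF r(1)], simp)+
  moreover have "r permutes {1..n + 2}" by (rule permutes_subset[OF r(1)]) simp
  ultimately show ?thesis using r(2)
    by (intro bexI[of _ r] conjI) (simp_all add: split_perms_def split_sign_def)
qed

lemma split_perms_swap:
  "\<exists>r\<in>split_perms n. shift_perm n r = id \<and> split_sign n r = - 1"
proof (intro bexI conjI)
  let ?r = "Transposition.transpose (n + 1) (n + 2)"
  have "?r permutes {1..n + 2}" by (rule permutes_swap_id) simp_all
  then show "?r \<in> split_perms n" unfolding split_perms_def by (simp add: insert_commute)
  show "shift_perm n ?r = id" unfolding shift_perm_def by (rule ext) (simp add: Transposition.transpose_def)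
  show "split_sign n ?r = - 1" unfolding split_sign_def by simp
qed

text \<open>
  The transposition of the last two letters acts by \<open>-1\<close>, so the numerator has odd and the
  denominator even degree; their quotient has nonzero degree and can be multiplied by the
  denominator without increasing the dimension.
\<close>

theorem covdim_sym_group_le_edim_add_two:
  assumes n: "n \<ge> 3"
  shows "covdim (sym_group n) \<le> edim (sym_group (n + 2))"
proof (cases "edim (sym_group (n + 2))")
  case infinity
  then show ?thesis by simp
next
  case (enat d)
  let ?G = "sym_group (n + 2)" and ?v = "\<lambda>i. complex_of_nat (Suc i)" and ?H = "split_perms n"
  note G = sym_group_is_group[of "n + 2"]
  obtain N \<rho> m \<sigma> \<phi> P q where data: "covariant_data ?G N \<rho> m \<sigma> \<phi> P q d"
    using edim_attained[OF G enat] by (elim exE)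
  have n1: "n \<ge> 1" using n by simp
  have fin: "finite ?H"
    by (rule finite_subset[OF _ finite_permutations[of "{1..n + 2}"]]) (simp_all add: split_perms_def Collect_mono)
  have "\<exists>f Q. (\<forall>i<n. polyf n (f i)) \<and> polyf n Q \<and> Q ?v \<noteq> 0 \<and>
      (\<forall>i<n. f i ?v = Q ?v * of_nat (Suc i)) \<and>
      sym_equivariant n f \<and>
      alg_dim_le n d ((\<lambda>x i. f i x / Q x) ` {x. Q x \<noteq> 0}) \<and>
      ((\<forall>x. q x = 1) \<longrightarrow> Q = (\<lambda>_. 1)) \<and>
      (True \<longrightarrow> (\<forall>i<n. \<forall>x. f i (\<lambda>l. - x l) = - f i x) \<and> (\<forall>x. Q (\<lambda>l. - x l) = Q x))"
  proof (rule compress_to_sym_subgroup[where \<epsilon>="split_sign n" and \<pi>="shift_perm n",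
        OF G data split_perms_subgroup fin])
    show "shift_perm n h permutes {..<n}" if "h \<in> ?H" for h
      by (rule shift_perm_permutes[OF split_perms_bij[OF that]])
    show "shift_perm n (h \<otimes>\<^bsub>?G\<^esub> k) = shift_perm n h \<circ> shift_perm n k" if "k \<in> ?H" for h k
      unfolding sym_group_mult by (rule shift_perm_comp[OF split_perms_bij[OF that]])
    show "split_sign n h = 1 \<or> split_sign n h = - 1" for h unfolding split_sign_def by simp
    show "split_sign n (h \<otimes>\<^bsub>?G\<^esub> k) = split_sign n h * split_sign n k" if "h \<in> ?H" "k \<in> ?H" for h k
      unfolding sym_group_mult by (rule split_sign_mult[OF that])
    show "h = \<one>\<^bsub>?G\<^esub>" if "h \<in> ?H" "shift_perm n h = id" "split_sign n h = 1" for h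
      unfolding sym_group_one by (rule split_perms_trivial[OF that])
  qed (rule split_perms_surj, assumption, rule split_perms_swap, rule n1)
  then obtain f Q where f: "\<forall>i<n. polyf n (f i)" and Q: "polyf n Q" "Q ?v \<noteq> 0"
    and fv: "\<forall>i<n. f i ?v = Q ?v * of_nat (Suc i)" and se: "sym_equivariant n f"
    and ad: "alg_dim_le n d ((\<lambda>x i. f i x / Q x) ` {x. Q x \<noteq> 0})"
    and "(\<forall>x. q x = 1) \<longrightarrow> Q = (\<lambda>_. 1)"
    and parity: "True \<longrightarrow> (\<forall>i<n. \<forall>x. f i (\<lambda>l. - x l) = - f i x) \<and> (\<forall>x. Q (\<lambda>l. - x l) = Q x)"
    by (elim exE conjE)
  have i01: "0 < n" "1 < n" using n by simp_all
  have ne: "f 0 ?v \<noteq> f 1 ?v" using fv[rule_format, of 0] fv[rule_format, of 1] n Q(2) by simp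
  obtain F B a b i0 x0 z where F: "\<forall>i<n. polyf n (F i)" and B: "polyf n B"
    and i0: "i0 < n" "F i0 x0 \<noteq> 0" and z: "B z \<noteq> 0"
    and F': "sym_equivariant n F" "\<forall>x. (\<Sum>i<n. F i x) = 0"
      "\<forall>i<n. \<forall>t x. F i (\<lambda>l. t * x l) = t ^ a * F i x" and B': "\<forall>t x. B (\<lambda>l. t * x l) = t ^ b * B x"
    and rk: "\<forall>x. B x \<noteq> 0 \<longrightarrow> rank_le d ((\<lambda>i l. pd l (\<lambda>x. F i x / B x) x) ` {..<n})"
    and a: "(\<forall>i<n. \<forall>x. f i (\<lambda>l. - x l) = - f i x) \<longrightarrow> odd a"
    and b: "(\<forall>x. Q (\<lambda>l. - x l) = Q x) \<longrightarrow> even b"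
    and "Q = (\<lambda>_. 1) \<longrightarrow> b = 0 \<and> B = (\<lambda>_. 1)"
    using leading_normal_form[OF n1 f Q se i01 ne ad] by (elim exE conjE)
  have "odd a" "even b"
    by (rule mp[OF a conjunct1[OF mp[OF parity TrueI]]], rule mp[OF b conjunct2[OF mp[OF parity TrueI]]])
  \<comment> \<open>The degree of the quotient is nonzero because its two parts have different
    parity.\<close>
  then have ab: "of_nat a - of_nat b \<noteq> (0::complex)" by auto
  have F0: "polyf n (F i0)" using F i0(1) by simp
  obtain y where y: "F i0 y \<noteq> 0" "B y \<noteq> 0"
    using polyf_nonzero_common[OF F0 B i0(2) z] by (elim exE conjE)
  \<comment> \<open>The numerator \<open>F\<close> alone serves as covariant;
    \<open>B * F i0\<close> marks the points at which the rank bound for the quotient and the Euler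
    argument both apply.\<close>
  have "covdim (sym_group n) \<le> enat d"
  proof (rule covdim_le_if_equivariant[OF sym_group_is_group, where \<pi>="shift_perm n" and \<epsilon>="\<lambda>_. 1" and f=F
        and q="\<lambda>x. B x * F i0 x" and z=y])
    show "shift_perm n g permutes {..<n}" if "g \<in> carrier (sym_group n)" for g
      by (rule shift_perm_sym_group(1)[OF that])
    show "shift_perm n (g \<otimes>\<^bsub>sym_group n\<^esub> h) = shift_perm n g \<circ> shift_perm n h"
      if "h \<in> carrier (sym_group n)" for g h
      by (rule shift_perm_sym_group(2)[OF that])
    show "shift_perm n \<one>\<^bsub>sym_group n\<^esub> = id" by (rule shift_perm_sym_group_one)
    show "polyf n (F i)" if "i < n" for i using F that by simp
    show "\<exists>x. \<exists>i<n. F (shift_perm n g i) x \<noteq> 1 * F i x"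
      if g: "g \<in> carrier (sym_group n)" "g \<noteq> \<one>\<^bsub>sym_group n\<^esub>" for g
    proof -
      obtain i where i: "i < n" "shift_perm n g i < n" "shift_perm n g i \<noteq> i"
        using shift_perm_sym_group_moves[OF g] by (elim exE conjE)
      have "\<exists>x. F (shift_perm n g i) x \<noteq> 1 * F i x"
        by (rule equivariant_not_proportional[OF n F'(1) F'(2)[rule_format] i0 i(1,2) i(3)[symmetric]])
      then obtain x where "F (shift_perm n g i) x \<noteq> 1 * F i x" by (elim exE)
      then show ?thesis using i(1) by (intro exI[of _ x] exI[of _ i] conjI)
    qed
    show "polyf n (\<lambda>x. B x * F i0 x)" using B F0 by simp
    show "B y * F i0 y \<noteq> 0" using y by simp
    show "rank_le d ((\<lambda>i l. pd l (F i) x) ` {..<n})" if Bx: "B x * F i0 x \<noteq> 0" for x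
    proof -
      have x: "B x \<noteq> 0" "F i0 x \<noteq> 0" using Bx by simp_all
      have eB: "(\<Sum>l<n. pd l B x * x l) = of_nat b * B x" by (rule euler_identity[OF B B'[rule_format]])
      have "rank_le d ((\<lambda>i l. pd l (\<lambda>x. B x * (F i x / B x)) x) ` {..<n})"
      proof (rule rank_le_mult_homogeneous[where \<phi>="\<lambda>i x. F i x / B x" and h=B and q=B
            and c="of_nat a - of_nat b" and k=i0 and N=n])
        show "polyf n B" "B x \<noteq> 0" by (rule B, rule x(1))
        show "reg n B (\<lambda>x. F i x / B x)" if "i < n" for i using F that by (intro reg_divide) simp
        show "reg n B B" by (rule reg_polyf[OF B])
        show "(\<Sum>l<n. pd l (\<lambda>x. F i x / B x) x * x l) = (of_nat a - of_nat b) * (F i x / B x)"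
          if i: "i < n" for i
        proof -
          have Fi: "polyf n (F i)" using F i by simp
          have eF: "(\<Sum>l<n. pd l (F i) x * x l) = of_nat a * F i x"
            by (rule euler_identity[OF Fi F'(3)[rule_format, OF i]])
          have 1: "(u * c - p * v) / c^2 * w = 1 / c * (u * w) - p / c^2 * (v * w)" if "c \<noteq> 0"
            for u v w p c :: complex
            using that by (simp add: diff_divide_distrib power2_eq_square left_diff_distrib)
          have 2: "1 / c * (s * p) - p / c^2 * (t * c) = (s - t) * (p / c)" if "c \<noteq> 0" for s t p c :: complex
          proof -
            have "1 / c * (s * p) = s * (p / c)" by simp
            moreover have "p / c^2 * (t * c) = t * (p / c)"
              using that by (simp add: power2_eq_square mult.commute[of p t])
            ultimately show ?thesis by (simp only: left_diff_distrib)
          qed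
          have "(\<Sum>l<n. pd l (\<lambda>x. F i x / B x) x * x l) =
              (\<Sum>l<n. (pd l (F i) x * B x - F i x * pd l B x) / (B x)^2 * x l)"
            by (simp only: pd_polyf_divide[OF Fi B x(1)])
          also have "\<dots> = 1 / B x * (\<Sum>l<n. pd l (F i) x * x l) - F i x / (B x)^2 * (\<Sum>l<n. pd l B x * x l)"
            by (simp only: 1[OF x(1)] sum_subtractf sum_distrib_left)
          also have "\<dots> = (of_nat a - of_nat b) * (F i x / B x)"
            unfolding eF eB by (rule 2[OF x(1)])
          finally show ?thesis .
        qed
        show "of_nat a - of_nat b \<noteq> (0::complex)" by (rule ab)
        show "i0 < n" by (rule i0(1))
        show "F i0 x / B x \<noteq> 0" using x by simp
        show "rank_le d ((\<lambda>i l. pd l (\<lambda>x. F i x / B x) x) ` {..<n})" by (rule rk[rule_format, OF x(1)])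
      qed
      moreover have "(\<lambda>i l. pd l (\<lambda>x. B x * (F i x / B x)) x) ` {..<n} = (\<lambda>i l. pd l (F i) x) ` {..<n}"
      proof (rule image_cong[OF refl], rule ext)
        fix i l assume "i \<in> {..<n}"
        then have "polyf n (F i)" using F by simp
        then show "pd l (\<lambda>x. B x * (F i x / B x)) x = pd l (F i) x"
          by (intro pd_cong_reg[OF B x(1) reg_polyf]) simp_all
      qed
      ultimately show ?thesis by (simp only:)
    qed
  qed (simp, simp, rule F'(1), simp)
  then show ?thesis unfolding enat .
qed

text \<open>
  Coordinates on the space of points of \<open>\<complex>\<^sup>n\<close>, \<open>k = n div 2\<close>, whose entries \<open>i\<close> and \<open>n - 1 - i\<close> have the same
  mean \<open>y k\<close> for all \<open>i\<close>. Exchanging two such entries is \<open>y i \<mapsto> - y i\<close>; reversing the order of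
  all entries and changing their sign is \<open>y k \<mapsto> - y k\<close>.
\<close>

definition mirror_point :: "nat \<Rightarrow> (nat \<Rightarrow> complex) \<Rightarrow> nat \<Rightarrow> complex" where
  "mirror_point n y i = (if i < n div 2 then y (n div 2) - y i
     else if n - 1 - i < n div 2 then y (n div 2) + y (n - 1 - i) else y (n div 2))"

text \<open>Linear forms on the target adapted to the same reflections: differences of mirrored
  components and the total sum. Each changes sign under exactly one of the sign changes of the
  coordinates.\<close>

definition mirror_form :: "nat \<Rightarrow> (nat \<Rightarrow> complex) \<Rightarrow> nat \<Rightarrow> complex" where
  "mirror_form n v j = (if j < n div 2 then v (n - 1 - j) - v j else \<Sum>i<n. v i)"

lemma mirror_point_negate:
  assumes l: "l < n div 2" and i: "i < n"
  shows "mirror_point n (y(l := -1 * y l)) i = mirror_point n y (Transposition.transpose l (n - 1 - l) i)"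
proof -
  consider "i = l" | "i = n - 1 - l" | "i \<noteq> l" "i \<noteq> n - 1 - l" by blast
  then show ?thesis
  proof cases
    case 3
    then have "n - 1 - i \<noteq> l" using i l by arith
    then show ?thesis using 3 l unfolding mirror_point_def by simp
  next
    case 1
    have "\<not> n - 1 - l < n div 2" "n - 1 - (n - 1 - l) = l" using l by arith+
    then show ?thesis using 1 l unfolding mirror_point_def by simp
  next
    case 2
    have "\<not> n - 1 - l < n div 2" "n - 1 - (n - 1 - l) = l" using l by arith+
    then show ?thesis using 2 l unfolding mirror_point_def by simp
  qed
qed

lemma mirror_point_reverse:
  assumes i: "i < n"
  shows "mirror_point n (y(n div 2 := -1 * y (n div 2))) i = - mirror_point n y (n - 1 - i)"
proof -
  have "n - 1 - (n - 1 - i) = i" "i < n div 2 \<Longrightarrow> \<not> n - 1 - i < n div 2" using i by arith+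
  then show ?thesis unfolding mirror_point_def by simp
qed

text \<open>The fixed vector (1, ..., n) lies in the subspace, since its mirrored entries all have
  mean (n + 1)/2.\<close>

lemma mirror_point_surj:
  assumes "i < n"
  shows "mirror_point n (\<lambda>j. of_nat (n + 1) / 2 - (if j < n div 2 then of_nat (Suc j) else 0)) i = of_nat (Suc i)"
proof -
  consider "i < n div 2" | "\<not> i < n div 2" "n - 1 - i < n div 2" | "\<not> i < n div 2" "\<not> n - 1 - i < n div 2" by blast
  then show ?thesis
  proof cases
    case 2
    have "Suc (n - 1 - i) + Suc i = n + 1" using assms by arith
    then have "of_nat (Suc (n - 1 - i)) = of_nat (n + 1) - (of_nat (Suc i) :: complex)"
      by (simp only: of_nat_add[symmetric] eq_diff_eq)
    then show ?thesis using 2 unfolding mirror_point_def by simp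
  next
    case 3
    then have "n + 1 = 2 * Suc i" using assms by arith
    then have "(of_nat (n + 1) :: complex) = 2 * of_nat (Suc i)" by (simp only: of_nat_mult of_nat_numeral)
    then show ?thesis using 3 unfolding mirror_point_def by simp
  qed (simp add: mirror_point_def)
qed

text \<open>For \<open>l < n div 2\<close> a transposition exchanges two mirrored components: only
  their difference changes sign. For \<open>l = n div 2\<close> the reversal composed with -1 leaves
  all differences unchanged and negates the sum.\<close>

lemma mirror_form_odd:
  assumes se: "sym_equivariant n f" and f: "\<And>i. i < n \<Longrightarrow> polyf n (f i)"
    and odd: "\<And>i x. i < n \<Longrightarrow> f i (\<lambda>l. - x l) = - f i x"
    and j: "j \<le> n div 2" and l: "l \<le> n div 2" and n: "n \<ge> 1"
  shows "mirror_form n (\<lambda>i. f i (mirror_point n (y(l := -1 * y l)))) j =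
    (if l = j then -1 else 1) * mirror_form n (\<lambda>i. f i (mirror_point n y)) j"
proof -
  define g where "g i = f i (mirror_point n y)" for i
  define g' where "g' i = f i (mirror_point n (y(l := -1 * y l)))" for i
  have "mirror_form n g' j = (if l = j then -1 else 1) * mirror_form n g j"
  proof (cases "l < n div 2")
    case True
    let ?t = "Transposition.transpose l (n - 1 - l)"
    have lt: "l \<in> {..<n}" "n - 1 - l \<in> {..<n}" using True unfolding lessThan_iff by arith+
    have p: "?t permutes {..<n}" by (rule permutes_swap_id[OF lt])
    have v: "g' i = g (?t i)" if i: "i < n" for i
    proof -
      have "g' i = f i (\<lambda>m. mirror_point n y (?t m))"
        unfolding g'_def by (rule polyf_cong[OF f[OF i]]) (rule mirror_point_negate[OF True])
      also have "\<dots> = g (?t i)" unfolding g_def by (rule sym_equivariantD[OF se p i, symmetric])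
      finally show ?thesis .
    qed
    show ?thesis
    proof (cases "j < n div 2")
      case j: True
      have jn: "j < n" "n - 1 - j < n" using j by arith+
      show ?thesis
      proof (cases "l = j")
        case True
        then show ?thesis using j unfolding mirror_form_def by (simp add: v[OF jn(1)] v[OF jn(2), simplified])
      next
        case False
        have "n - 1 - j \<noteq> l" "j \<noteq> n - 1 - l" "n - 1 - j \<noteq> n - 1 - l" using j True False by arith+
        then have "?t j = j" "?t (n - 1 - j) = n - 1 - j" using False by simp_all
        then have "g' j = g j" "g' (n - 1 - j) = g (n - 1 - j)" unfolding v[OF jn(1)] v[OF jn(2)] by simp_all
        then show ?thesis using j False unfolding mirror_form_def by simp
      qed
    next
      case j: False
      have "(\<Sum>i<n. g' i) = (\<Sum>i<n. g (?t i))"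
        by (rule sum.cong[OF refl], rule v) simp
      also have "\<dots> = (\<Sum>i<n. g i)"
        using sum.permute[OF p, of g] by (simp only: o_def)
      finally show ?thesis using j True unfolding mirror_form_def by simp
    qed
  next
    case False
    then have l: "l = n div 2" using l by simp
    let ?r = "\<lambda>i. if i < n then n - 1 - i else i"
    have bij: "bij_betw ?r {..<n} {..<n}" by (rule bij_betw_byWitness[where f'="?r"]) auto
    have p: "?r permutes {..<n}" by (rule bij_imp_permutes[OF bij]) simp
    have v: "g' i = - g (?r i)" if i: "i < n" for i
    proof -
      have "g' i = f i (\<lambda>m. - mirror_point n y (?r m))"
        unfolding g'_def l
      proof (rule polyf_cong[OF f[OF i]])
        fix m assume m: "m < n"
        then show "mirror_point n (y(n div 2 := -1 * y (n div 2))) m = - mirror_point n y (?r m)"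
          unfolding mirror_point_reverse[OF m] by simp
      qed
      also have "\<dots> = - f i (\<lambda>m. mirror_point n y (?r m))" by (rule odd[OF i])
      also have "f i (\<lambda>m. mirror_point n y (?r m)) = g (?r i)"
        unfolding g_def by (rule sym_equivariantD[OF se p i, symmetric])
      finally show ?thesis .
    qed
    show ?thesis
    proof (cases "j < n div 2")
      case j: True
      have jn: "j < n" "n - 1 - j < n" "n - 1 - (n - 1 - j) = j" using j by arith+
      have "g' j = - g (n - 1 - j)" "g' (n - 1 - j) = - g j"
        unfolding v[OF jn(1)] v[OF jn(2)] using jn by simp_all
      then show ?thesis using j l unfolding mirror_form_def by simp
    next
      case False
      then have j: "j = l" using j l by simp
      have "(\<Sum>i<n. g' i) = (\<Sum>i<n. - g (?r i))"
        by (rule sum.cong[OF refl], rule v) simp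
      also have "\<dots> = - (\<Sum>i<n. g (?r i))" by (rule sum_negf)
      also have "(\<Sum>i<n. g (?r i)) = (\<Sum>i<n. g i)"
        using sum.permute[OF p, of g] by (simp only: o_def)
      finally show ?thesis using j l unfolding mirror_form_def by simp
    qed
  qed
  then show ?thesis unfolding g_def g'_def .
qed

lemma polyf_mirror_form:
  assumes "n \<ge> 1" "j \<le> n div 2" "\<And>i. i < n \<Longrightarrow> polyf N (\<lambda>x. v x i)"
  shows "polyf N (\<lambda>x. mirror_form n (v x) j)"
proof (cases "j < n div 2")
  case True
  then have "j < n" "n - 1 - j < n" by arith+
  then show ?thesis using True assms(3) unfolding mirror_form_def by simp
next
  case False
  have "polyf N (\<lambda>x. \<Sum>i<n. v x i)" by (rule polyf_sum) (simp add: assms(3))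
  then show ?thesis using False unfolding mirror_form_def by simp
qed

text \<open>The forms of \<open>f\<close> on the subspace are each odd in exactly one of its
  \<open>n div 2 + 1\<close> coordinates, so all of them are algebraically independent, provided
  none vanishes identically.\<close>

theorem odd_equivariant_dim:
  assumes n: "n \<ge> 1" and f: "\<And>i. i < n \<Longrightarrow> polyf n (f i)" and se: "sym_equivariant n f"
    and odd: "\<And>i x. i < n \<Longrightarrow> f i (\<lambda>l. - x l) = - f i x"
    and fv: "\<And>i. i < n \<Longrightarrow> f i (\<lambda>i. of_nat (Suc i)) = of_nat (Suc i)"
    and ad: "alg_dim_le n d ((\<lambda>x i. f i x) ` UNIV)"
  shows "n div 2 + 1 \<le> d"
proof (rule ccontr)
  let ?J = "n div 2 + 1" and ?y = "\<lambda>j. complex_of_nat (n + 1) / 2 - (if j < n div 2 then of_nat (Suc j) else 0)"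
  let ?z = "\<lambda>j y. mirror_form n (\<lambda>i. f i (mirror_point n y)) j"
  assume "\<not> ?J \<le> d"
  then have dJ: "Suc d \<le> ?J" by simp
  have Lp: "polyf ?J (\<lambda>y. mirror_point n y i)" for i
    unfolding mirror_point_def by (cases "i < n div 2"; cases "n - 1 - i < n div 2") simp_all
  have zp: "polyf ?J (?z j)" if j: "j < ?J" for j
  proof (rule polyf_mirror_form[OF n])
    show "j \<le> n div 2" using j by simp
    show "polyf ?J (\<lambda>y. f i (mirror_point n y))" if i: "i < n" for i
      by (rule polyf_compose[OF f[OF i] Lp])
  qed
  \<comment> \<open>Tested at the point of the subspace that gives (1, ..., n): there
    \<open>f\<close> has distinct entries with nonzero sum.\<close>
  have z0: "\<exists>y. ?z j y \<noteq> 0" if j: "j < ?J" for j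
  proof (rule exI[of _ ?y])
    have v: "f i (mirror_point n ?y) = of_nat (Suc i)" if i: "i < n" for i
    proof -
      have "f i (mirror_point n ?y) = f i (\<lambda>i. of_nat (Suc i))"
        by (rule polyf_cong[OF f[OF i]]) (rule mirror_point_surj)
      then show ?thesis unfolding fv[OF i] .
    qed
    show "?z j ?y \<noteq> 0"
    proof (cases "j < n div 2")
      case True
      then have jn: "j < n" "n - 1 - j < n" "n - 1 - j \<noteq> j" by arith+
      from jn(3) show ?thesis
        using True unfolding mirror_form_def
        by (simp only: if_True v[OF jn(1)] v[OF jn(2)] right_minus_eq of_nat_eq_iff nat.inject not_False_eq_True)
    next
      case False
      have "(\<Sum>i<n. f i (mirror_point n ?y)) = (\<Sum>i<n. of_nat (Suc i))"
        by (rule sum.cong[OF refl], rule v) simp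
      also have "\<dots> = of_nat (\<Sum>i<n. Suc i)" by (simp only: of_nat_sum)
      finally have "(\<Sum>i<n. f i (mirror_point n ?y)) = of_nat (\<Sum>i<n. Suc i)" .
      moreover have "(\<Sum>i<n. Suc i) \<noteq> 0" using n by (auto simp: sum_eq_0_iff intro: exI[of _ 0])
      ultimately show ?thesis using False unfolding mirror_form_def by (simp only: if_False of_nat_eq_0_iff) simp
    qed
  qed
  have "\<exists>x. indep ?J (\<lambda>j l. pd l (?z j) x)"
  proof (rule odd_coordinates_indep[OF zp z0])
    show "?z j (y(l := -1 * y l)) = (if l = j then -1 else 1) * ?z j y" if "j < ?J" "l < ?J" for j l y
      by (rule mirror_form_odd[OF se f odd _ _ n]) (use that in simp_all)
  qed
  then obtain x where x: "indep ?J (\<lambda>j l. pd l (?z j) x)" by (elim exE)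
  have "algindep ?J ?z {x. (1::complex) \<noteq> 0}"
    by (rule algindep_if_gradients_indep[where q="\<lambda>_. 1" and a=x and N="?J"])
      (simp_all only: polyf_const one_neq_zero not_False_eq_True zp reg_polyf x)
  then have ind: "algindep (Suc d) ?z {x. (1::complex) \<noteq> 0}" by (rule algindep_mono_card[OF _ dJ])
  have "algindep (Suc d) (\<lambda>j v. mirror_form n v j) ((\<lambda>x i. f i x) ` UNIV)"
    unfolding algindep_def
  proof (intro allI impI)
    fix F y assume F: "polyf (Suc d) F" and 0: "\<forall>x\<in>(\<lambda>x i. f i x) ` UNIV. F (mirror_form n x) = 0"
    show "F y = 0"
    proof (rule algindepD[OF ind F])
      fix x
      show "F (\<lambda>j. ?z j x) = 0" by (rule bspec[OF 0 imageI[OF UNIV_I]])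
    qed
  qed
  then show False
    by (rule alg_dim_leD[OF ad, rotated]) (rule polyf_mirror_form[OF n], use dJ in simp_all)
qed

text \<open>Adjoining \<int>/2 does not change the covariant dimension, and its generator acting as
  -1 makes the compressed covariant odd. Starting from a polynomial covariant keeps the denominator
  1, so (1, ..., n) is fixed exactly.\<close>

theorem covdim_sym_group_ge:
  assumes n: "n \<ge> 3"
  shows "enat (n div 2 + 1) \<le> covdim (sym_group n)"
proof (cases "covdim (sym_group n)")
  case infinity
  then show ?thesis by simp
next
  case (enat d)
  let ?S = "sym_group n" and ?Z = "integer_mod_group 2" and ?v = "\<lambda>i. complex_of_nat (Suc i)"
  let ?G = "?S \<times>\<times> ?Z"
  let ?\<pi> = "\<lambda>g. shift_perm n (fst g)" and ?\<epsilon> = "\<lambda>g :: (nat \<Rightarrow> nat) \<times> int. if snd g = 0 then 1 else - 1 :: complex"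
  have G: "group ?G" by (intro DirProd_group sym_group_is_group group_integer_mod_group)
  have "covdim ?G \<le> covdim ?S" by (rule covdim_prod_le_sym_group[OF n]) simp
  moreover have "covdim ?S \<le> covdim ?G" by (rule covdim_sym_group_le_prod) simp
  ultimately have dG: "covdim ?G = enat d" unfolding enat by (rule antisym)
  obtain N \<rho> m \<sigma> \<phi> P where data: "covariant_data ?G N \<rho> m \<sigma> \<phi> P (\<lambda>_. 1) d"
    using covdim_attained[OF G dG] by (elim exE)
  have Z: "carrier ?Z = {0, 1}" by (auto simp: carrier_integer_mod_group)
  have fin: "finite (carrier ?G)"
    unfolding carrier_DirProd Z by (intro finite_cartesian_product) (simp_all add: sym_group_def finite_permutations)
  have carG: "fst g \<in> carrier ?S" "snd g = 0 \<or> snd g = 1" if "g \<in> carrier ?G" for g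
    using that unfolding carrier_DirProd Z by auto
  have n1: "n \<ge> 1" using n by simp
  have "\<exists>f Q. (\<forall>i<n. polyf n (f i)) \<and> polyf n Q \<and> Q ?v \<noteq> 0 \<and>
      (\<forall>i<n. f i ?v = Q ?v * of_nat (Suc i)) \<and>
      sym_equivariant n f \<and>
      alg_dim_le n d ((\<lambda>x i. f i x / Q x) ` {x. Q x \<noteq> 0}) \<and>
      ((\<forall>x::nat \<Rightarrow> complex. (1::complex) = 1) \<longrightarrow> Q = (\<lambda>_. 1)) \<and>
      (True \<longrightarrow> (\<forall>i<n. \<forall>x. f i (\<lambda>l. - x l) = - f i x) \<and> (\<forall>x. Q (\<lambda>l. - x l) = Q x))"
  proof (rule compress_to_sym_subgroup[where \<epsilon>="?\<epsilon>" and \<pi>="?\<pi>", OF G data group.subgroup_self[OF G] fin])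
    show "?\<pi> h permutes {..<n}" if "h \<in> carrier ?G" for h
      by (rule shift_perm_sym_group(1)[OF carG(1)[OF that]])
    show "?\<pi> (h \<otimes>\<^bsub>?G\<^esub> k) = ?\<pi> h \<circ> ?\<pi> k" if "k \<in> carrier ?G" for h k
      unfolding mult_DirProd' fst_conv by (rule shift_perm_sym_group(2)[OF carG(1)[OF that]])
    show "?\<epsilon> h = 1 \<or> ?\<epsilon> h = - 1" for h by simp
    show "?\<epsilon> (h \<otimes>\<^bsub>?G\<^esub> k) = ?\<epsilon> h * ?\<epsilon> k" if "h \<in> carrier ?G" "k \<in> carrier ?G" for h k
      using carG(2)[OF that(1)] carG(2)[OF that(2)] unfolding mult_DirProd' by auto
    show "h = \<one>\<^bsub>?G\<^esub>" if h: "h \<in> carrier ?G" "?\<pi> h = id" "?\<epsilon> h = 1" for h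
    proof -
      have "fst h = \<one>\<^bsub>?S\<^esub>" by (rule shift_perm_sym_group_inj[OF carG(1)[OF h(1)] h(2)])
      moreover have "snd h = 0" using h(3) by (simp split: if_splits)
      ultimately show ?thesis by (simp add: prod_eq_iff)
    qed
    show "\<exists>h\<in>carrier ?G. ?\<pi> h = p \<and> ?\<epsilon> h = 1" if p: "p permutes {..<n}" for p
    proof -
      obtain r where "r permutes {1..n}" "shift_perm n r = p"
        using shift_perm_surj[OF p] by (elim exE conjE)
      then show ?thesis by (intro bexI[of _ "(r, 0)"] conjI) (simp_all add: sym_group_carrier)
    qed
    show "\<exists>h\<in>carrier ?G. ?\<pi> h = id \<and> ?\<epsilon> h = - 1"
      by (intro bexI[of _ "(id, 1)"] conjI) (simp_all add: sym_group_carrier permutes_id shift_perm_id)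
  qed (rule n1)
  then obtain f Q where f: "\<forall>i<n. polyf n (f i)" and Q: "polyf n Q" "Q ?v \<noteq> 0"
    and fv: "\<forall>i<n. f i ?v = Q ?v * of_nat (Suc i)" and se: "sym_equivariant n f"
    and ad: "alg_dim_le n d ((\<lambda>x i. f i x / Q x) ` {x. Q x \<noteq> 0})"
    and one: "(\<forall>x::nat \<Rightarrow> complex. (1::complex) = 1) \<longrightarrow> Q = (\<lambda>_. 1)"
    and parity: "True \<longrightarrow> (\<forall>i<n. \<forall>x. f i (\<lambda>l. - x l) = - f i x) \<and> (\<forall>x. Q (\<lambda>l. - x l) = Q x)"
    by (elim exE conjE)
  have Q1: "Q = (\<lambda>_. 1)" using one by simp
  have UNIV1: "{x :: nat \<Rightarrow> complex. (1::complex) \<noteq> 0} = UNIV" by simp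
  have "n div 2 + 1 \<le> d"
  proof (rule odd_equivariant_dim[OF n1 _ se])
    show "polyf n (f i)" if "i < n" for i by (rule f[rule_format, OF that])
    show "f i (\<lambda>l. - x l) = - f i x" if "i < n" for i x
      by (rule conjunct1[OF mp[OF parity TrueI], rule_format, OF that])
    show "f i ?v = of_nat (Suc i)" if "i < n" for i
      using fv[rule_format, OF that] unfolding Q1 mult_1_left .
    show "alg_dim_le n d ((\<lambda>x i. f i x) ` UNIV)" using ad unfolding Q1 div_by_1 UNIV1 .
  qed
  then show ?thesis unfolding enat by simp
qed

theorem theorem7p1:
  fixes n :: nat
  assumes "n \<ge> 3"
  shows "covdim (sym_group n) = edim (sym_group n) + 1
    \<and> (\<forall>d::nat. d \<ge> 2 \<longrightarrow>
         covdim (sym_group n \<times>\<times> integer_mod_group d) = covdim (sym_group n))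
    \<and> covdim (sym_group n) \<ge> enat (n div 2 + 1)
    \<and> covdim (sym_group (n + 2)) \<ge> covdim (sym_group n) + 1"
proof (intro conjI allI impI)
  show "covdim (sym_group n) = edim (sym_group n) + 1"
    by (rule antisym[OF covdim_sym_group_le_edim edim_sym_group_less_covdim]) (use assms in simp_all)
  show "covdim (sym_group n \<times>\<times> integer_mod_group d) = covdim (sym_group n)" if "d \<ge> 2" for d
    by (rule antisym[OF covdim_prod_le_sym_group covdim_sym_group_le_prod]) (use assms that in simp_all)
  show "enat (n div 2 + 1) \<le> covdim (sym_group n)"
    by (rule covdim_sym_group_ge[OF assms])
  \<comment> \<open>Passing through the essential dimension for n + 2 letters turns the comparison
    of covariant dimensions into a strict one.\<close>
  have "covdim (sym_group n) + 1 \<le> edim (sym_group (n + 2)) + 1"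
    by (rule add_right_mono[OF covdim_sym_group_le_edim_add_two[OF assms]])
  also have "\<dots> \<le> covdim (sym_group (n + 2))"
    by (rule edim_sym_group_less_covdim) (use assms in simp)
  finally show "covdim (sym_group n) + 1 \<le> covdim (sym_group (n + 2))" .
qed

end
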